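(* Let $T$ be a $4$-connected plane triangulation, let $x,y$ be two non-adjacent vertices of $T$, and let $G=T+xy$ be the graph obtained from $T$ by adding the edge (brace) $xy$. Let $uv$ be an edge of $T$. Then $G$ has an infinitesimally rigid realisation $(G,p)$ in $\mathbb{R}^3$ with $p(u)=p(v)$.
   Context: A plane triangulation is a graph with a $2$-cell embedding in the plane in which every face has exactly three edges on its boundary. A framework in $\mathbb{R}^3$ is a pair $(G,p)$ with $p:V(G)\to\mathbb{R}^3$; its rigidity map $f_G$ sends $p$ to $(\|p(a)-p(b)\|^2)_{ab\in E(G)}$, and $(G,p)$ is infinitesimally rigid if the Jacobian of $f_G$ at $p$ has rank $3|V(G)|-6$ (for $|V(G)|\ge 4$). *)

theory Defs
  imports "HOL-Analysis.Analysis" "HOL-Library.Function_Algebras"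
begin

text \<open>A graph is given by a vertex set \<open>V\<close> and a set \<open>E\<close> of unordered pairs of vertices.\<close>

definition simple_graph :: "'a set \<Rightarrow> 'a set set \<Rightarrow> bool" where
  "simple_graph V E \<longleftrightarrow> finite V \<and> (\<forall>e\<in>E. e \<subseteq> V \<and> card e = 2)"

definition graph_connected :: "'a set \<Rightarrow> 'a set set \<Rightarrow> bool" where
  "graph_connected V E \<longleftrightarrow> (\<forall>a\<in>V. \<forall>b\<in>V. (a, b) \<in> {(s, t). {s, t} \<in> E}\<^sup>*)"

definition k_connected :: "nat \<Rightarrow> 'a set \<Rightarrow> 'a set set \<Rightarrow> bool" where
  "k_connected k V E \<longleftrightarrow> k < card V \<and>
     (\<forall>S\<subseteq>V. card S < k \<longrightarrow> graph_connected (V - S) {e \<in> E. e \<inter> S = {}})"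

text \<open>The plane is the type of complex numbers. An embedding consists of a placement \<open>\<phi>\<close> of the
  vertices and a family \<open>\<gamma>\<close> of simple arcs, one for each edge.\<close>

definition plane_embedding ::
  "'a set \<Rightarrow> 'a set set \<Rightarrow> ('a \<Rightarrow> complex) \<Rightarrow> ('a set \<Rightarrow> real \<Rightarrow> complex) \<Rightarrow> bool" where
  "plane_embedding V E \<phi> \<gamma> \<longleftrightarrow>
     inj_on \<phi> V \<and>
     (\<forall>e\<in>E. arc (\<gamma> e) \<and> {pathstart (\<gamma> e), pathfinish (\<gamma> e)} = \<phi> ` e \<and>
             path_image (\<gamma> e) \<inter> \<phi> ` V = \<phi> ` e) \<and>
     (\<forall>e\<in>E. \<forall>f\<in>E. e \<noteq> f \<longrightarrow> path_image (\<gamma> e) \<inter> path_image (\<gamma> f) = \<phi> ` (e \<inter> f))"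

definition faces ::
  "'a set \<Rightarrow> 'a set set \<Rightarrow> ('a \<Rightarrow> complex) \<Rightarrow> ('a set \<Rightarrow> real \<Rightarrow> complex) \<Rightarrow> complex set set" where
  "faces V E \<phi> \<gamma> = components (- (\<phi> ` V \<union> (\<Union>e\<in>E. path_image (\<gamma> e))))"

text \<open>The unbounded face is an open disc only after adding the point at infinity. For the unbounded
  face inside the plane this means being homeomorphic to the exterior of a closed disc.\<close>

definition two_cell :: "complex set \<Rightarrow> bool" where
  "two_cell F \<longleftrightarrow>
     (if bounded F then F homeomorphic ball (0::complex) 1
      else F homeomorphic - cball (0::complex) 1)"

definition plane_triangulation ::
  "'a set \<Rightarrow> 'a set set \<Rightarrow> ('a \<Rightarrow> complex) \<Rightarrow> ('a set \<Rightarrow> real \<Rightarrow> complex) \<Rightarrow> bool" where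
  "plane_triangulation V E \<phi> \<gamma> \<longleftrightarrow>
     simple_graph V E \<and> plane_embedding V E \<phi> \<gamma> \<and>
     (\<forall>F\<in>faces V E \<phi> \<gamma>. two_cell F \<and> card {e \<in> E. path_image (\<gamma> e) \<subseteq> frontier F} = 3)"

text \<open>The coordinate of the rigidity map at the edge \<open>e\<close>.\<close>

definition rigidity_map :: "('a \<Rightarrow> real^3) \<Rightarrow> 'a set \<Rightarrow> real" where
  "rigidity_map p e = (THE d. \<exists>a b. e = {a, b} \<and> d = (norm (p a - p b))\<^sup>2)"

lemma rigidity_map_edge: "rigidity_map p {a, b} = (norm (p a - p b))\<^sup>2"
  unfolding rigidity_map_def
  by (rule the_equality) (auto simp: doubleton_eq_iff norm_minus_commute)

definition set_coord :: "('a \<Rightarrow> real^3) \<Rightarrow> 'a \<Rightarrow> 3 \<Rightarrow> real \<Rightarrow> 'a \<Rightarrow> real^3" where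
  "set_coord p w i t = p(w := (\<chi> j. if j = i then t else p w $ j))"

text \<open>The row of the Jacobian indexed by the edge \<open>e\<close>, whose columns are indexed by vertices and
  coordinates. Columns belonging to elements outside the vertex set vanish.\<close>

definition jacobian_row :: "('a \<Rightarrow> real^3) \<Rightarrow> 'a set \<Rightarrow> 'a \<times> 3 \<Rightarrow> real" where
  "jacobian_row p e = (\<lambda>(w, i). deriv (\<lambda>t. rigidity_map (set_coord p w i t) e) (p w $ i))"

abbreviation (input) scale_fun :: "real \<Rightarrow> ('b \<Rightarrow> real) \<Rightarrow> 'b \<Rightarrow> real" where
  "scale_fun \<equiv> \<lambda>c f z. c * f z"

lemma vector_space_scale_fun: "vector_space scale_fun"
  by unfold_locales (auto simp: fun_eq_iff algebra_simps)

definition jacobian_rank :: "'a set set \<Rightarrow> ('a \<Rightarrow> real^3) \<Rightarrow> nat" where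
  "jacobian_rank E p = vector_space.dim scale_fun (jacobian_row p ` E)"

text \<open>Only meaningful for at least four vertices.\<close>

definition infinitesimally_rigid :: "'a set \<Rightarrow> 'a set set \<Rightarrow> ('a \<Rightarrow> real^3) \<Rightarrow> bool" where
  "infinitesimally_rigid V E p \<longleftrightarrow> jacobian_rank E p = 3 * card V - 6"

end

theory Submission imports Defs "HOL-Computational_Algebra.Polynomial" begin

text \<open>The face triangles of \<open>T\<close> form a set \<open>F\<close> of triples with three properties: every edge lies in exactly two
  triples, no proper nonempty part of \<open>F\<close> has empty boundary mod 2, and every edge set with even
  degrees is a boundary. The last property is the Jordan curve theorem applied to the cycles of \<open>T\<close>.
  These properties survive cutting along a nonfacial triangle and contracting an edge that lies in
  no nonfacial triangle.

  The class of braced spheres for which the induction works is wider than the 4-connected ones: all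
  common neighbours of \<open>u\<close> and \<open>v\<close> must span a face with \<open>uv\<close>, and no separation of order at most 3 may
  have \<open>u\<close>, \<open>v\<close> on one side and \<open>x\<close>, \<open>y\<close> on the other. If there is a separating triangle, one cuts along
  it, replaces the brace if its ends are separated, and glues the other part back, which is rigid by
  Gluck's theorem. If there is none, let \<open>c\<close> be an apex of one of the two faces at \<open>uv\<close>. An edge \<open>cb\<close> is
  contracted and recovered by a vertex split. An uncrossing argument for separations of order 4 with
  a smallest far side finds a \<open>b\<close> that stays in the class, unless \<open>xy\<close> joins the two apices and
  the sphere is a double pyramid, which is treated directly.

  Rigidity at one placement with coinciding \<open>u\<close> and \<open>v\<close> carries over to generic such placements, because
  along a line of placements it fails only at finitely many points.\<close>

section \<open>Infinitesimal motions and generic positions\<close>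

text \<open>A triangulated sphere with n vertices has 3n-6 edges, exactly the rank that is required.
  When \<open>u\<close> and \<open>v\<close> coincide, the row of the edge \<open>uv\<close>
  vanishes, and the brace has to make up for it: no other row may be wasted. Both conditions on the
  class come from this. If a separation of order 3 puts \<open>u\<close>, \<open>v\<close> on one
  side and the brace on the other, the first side, completed by the separating triangle, is a sphere
  with a zero row and no brace, so it flexes. A nonfacial triangle through \<open>uv\<close>
  collapses to a segment, and two pieces glued along a segment can turn about it like a door on its
  hinge. The 4-connected spheres are too small a class because contracting an edge may create
  separating triangles.

  Genericity serves only to satisfy several conditions at once. Two conditions with witnesses in the
  linear subspace \<open>p u = p v\<close> are combined on the line through these witnesses, so the
  zeros of polynomials in one variable are all that has to be controlled.\<close>

definition motion :: "'a set set \<Rightarrow> ('a \<Rightarrow> real^3) \<Rightarrow> ('a \<Rightarrow> real^3) \<Rightarrow> bool" where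
  "motion E p m \<longleftrightarrow> (\<forall>a b. {a, b} \<in> E \<longrightarrow> (p a - p b) \<bullet> (m a - m b) = 0)"

definition rigid :: "'a set \<Rightarrow> 'a set set \<Rightarrow> ('a \<Rightarrow> real^3) \<Rightarrow> bool" where
  "rigid W E p \<longleftrightarrow> (\<forall>m. motion E p m \<longrightarrow> (\<exists>t z. \<forall>w\<in>W. m w = t + cross3 z (p w)))"

definition ncol :: "('a \<Rightarrow> real^3) \<Rightarrow> 'a \<Rightarrow> 'a \<Rightarrow> 'a \<Rightarrow> bool" where
  "ncol p a b c \<longleftrightarrow> cross3 (p b - p a) (p c - p a) \<noteq> 0"

definition ncop :: "('a \<Rightarrow> real^3) \<Rightarrow> 'a \<Rightarrow> 'a \<Rightarrow> 'a \<Rightarrow> 'a \<Rightarrow> bool" where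
  "ncop p a b c d \<longleftrightarrow> (p a - p d) \<bullet> cross3 (p b - p d) (p c - p d) \<noteq> 0"

text \<open>Rigidity with the trivial motions removed: they are determined by their values at three
  noncollinear points. In this form it is the triviality of the kernel of a linear system whose
  coefficients are polynomials in the placement.\<close>

definition pinned :: "'a \<Rightarrow> 'a \<Rightarrow> 'a \<Rightarrow> 'a set \<Rightarrow> 'a set set \<Rightarrow> ('a \<Rightarrow> real^3) \<Rightarrow> bool" where
  "pinned a b c W E p \<longleftrightarrow> ncol p a b c \<and>
     (\<forall>m. motion E p m \<and> m a = 0 \<and> m b = 0 \<and> m c = 0 \<longrightarrow> (\<forall>w\<in>W. m w = 0))"

text \<open>The edges of the triangle ensure that every motion is trivial on the three pinned
  points, so that pinning them loses no motion up to trivial ones. Which triangle is pinned is left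
  open, because after cutting, gluing or splitting a different one may be at hand.\<close>

definition trig :: "'a set \<Rightarrow> 'a set set \<Rightarrow> ('a \<Rightarrow> real^3) \<Rightarrow> bool" where
  "trig W E p \<longleftrightarrow> (\<exists>a\<in>W. \<exists>b\<in>W. \<exists>c\<in>W. {a, b} \<in> E \<and> {b, c} \<in> E \<and> {a, c} \<in> E \<and> pinned a b c W E p)"

section \<open>Cross products and motions of a triangle\<close>

lemma orthogonal_to_frame:
  fixes e f w :: "real^3"
  assumes "cross3 e f \<noteq> 0" "w \<bullet> e = 0" "w \<bullet> f = 0" "w \<bullet> cross3 e f = 0"
  shows "w = 0"
proof -
  have "cross3 w (cross3 e f) = 0"
    using assms by (simp add: Lagrange)
  then have "cross3 (cross3 e f) w = cross3 (cross3 e f) 0"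
    by (metis cross_skew cross_zero_right minus_zero)
  moreover have "cross3 e f \<bullet> w = cross3 e f \<bullet> 0"
    using assms by (simp add: inner_commute)
  ultimately show ?thesis
    using cross_dot_cancel assms(1) by blast
qed

lemma orthogonal_to_basis:
  fixes a b c w :: "real^3"
  assumes "a \<bullet> cross3 b c \<noteq> 0" "w \<bullet> a = 0" "w \<bullet> b = 0" "w \<bullet> c = 0"
  shows "w = 0"
proof -
  have "cross3 w (cross3 b c) = 0"
    using assms by (simp add: Lagrange)
  then have "cross3 a (cross3 w (cross3 b c)) = 0" by simp
  then have "(a \<bullet> cross3 b c) *\<^sub>R w = 0"
    unfolding Lagrange[of a w] using assms(2) by (simp add: inner_commute)
  then show ?thesis using assms(1) by simp
qed

lemma spin_determined:
  assumes "cross3 e f \<noteq> 0" "cross3 z e = 0" "cross3 z f = 0"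
  shows "z = 0"
proof -
  have "cross3 e (cross3 z f) = 0" "cross3 z (cross3 e f) = 0"
    using assms Jacobi[of z e f] by (auto simp: cross_skew[of f z])
  then have "(e \<bullet> f) *\<^sub>R z - (e \<bullet> z) *\<^sub>R f = 0" "(z \<bullet> f) *\<^sub>R e - (z \<bullet> e) *\<^sub>R f = 0"
    by (simp_all add: Lagrange)
  then have 1: "(z \<bullet> f) *\<^sub>R e = (z \<bullet> e) *\<^sub>R f" by simp
  have "cross3 ((z \<bullet> f) *\<^sub>R e) f = 0"
    unfolding 1 by (simp add: cross_mult_left)
  then have zf: "z \<bullet> f = 0" using assms(1) by (simp add: cross_mult_left)
  have "cross3 e ((z \<bullet> e) *\<^sub>R f) = 0"
    unfolding 1[symmetric] by (simp add: cross_mult_right)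
  then have ze: "z \<bullet> e = 0" using assms(1) by (simp add: cross_mult_right)
  have "e \<noteq> 0" using assms(1) by auto
  have "cross3 e z = cross3 e 0" by (metis assms(2) cross_skew cross_zero_right minus_zero)
  moreover have "e \<bullet> z = e \<bullet> 0" using ze by (simp add: inner_commute)
  ultimately show ?thesis using cross_dot_cancel \<open>e \<noteq> 0\<close> by blast
qed

text \<open>A motion of a noncollinear triangle is trivial. Here \<open>e\<close> and
  \<open>f\<close> are the sides at one corner, \<open>\<mu>\<close> and \<open>\<nu>\<close> the
  velocities of the other two corners relative to it, and the three equations say that no side
  changes its length to first order.\<close>

lemma spin_exists:
  fixes e f \<mu> \<nu> :: "real^3"
  assumes n: "cross3 e f \<noteq> 0" and "\<mu> \<bullet> e = 0" "\<nu> \<bullet> f = 0" "\<mu> \<bullet> f + \<nu> \<bullet> e = 0"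
  shows "\<exists>z. cross3 z e = \<mu> \<and> cross3 z f = \<nu>"
proof -
  define n where "n = cross3 e f"
  define N where "N = n \<bullet> n"
  have N: "N \<noteq> 0" using n by (simp add: N_def n_def)
  have en: "e \<bullet> n = 0" "f \<bullet> n = 0" "n \<bullet> e = 0" "n \<bullet> f = 0" by (auto simp: n_def dot_cross_self)
  have x1: "cross3 n e \<bullet> f = N" unfolding N_def n_def by (metis cross_triple)
  have x2: "cross3 n f \<bullet> e = - N" unfolding N_def n_def
    by (metis cross_skew cross_triple inner_minus_left)
  have x3: "cross3 f e = - n" unfolding n_def by (rule cross_skew)
  \<comment> \<open>The coefficients are forced. In the basis \<open>e\<close>, \<open>f\<close>,
    \<open>n\<close> the components of \<open>\<mu>\<close> and \<open>\<nu>\<close> along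
    \<open>n\<close> determine those of \<open>f\<close> and \<open>e\<close>, and
    \<open>\<mu> \<bullet> f\<close> determines that of \<open>n\<close>, since
    \<open>cross3 n e \<bullet> f = N\<close>.\<close>
  define z where "z = ((\<nu> \<bullet> n) / N) *\<^sub>R e - ((\<mu> \<bullet> n) / N) *\<^sub>R f + ((\<mu> \<bullet> f) / N) *\<^sub>R n"
  have ze: "cross3 z e = ((\<mu> \<bullet> n) / N) *\<^sub>R n + ((\<mu> \<bullet> f) / N) *\<^sub>R cross3 n e"
    unfolding z_def by (simp add: cross_add_left Cross3.left_diff_distrib cross_mult_left x3)
  have zf: "cross3 z f = ((\<nu> \<bullet> n) / N) *\<^sub>R n + ((\<mu> \<bullet> f) / N) *\<^sub>R cross3 n f"
    unfolding z_def by (simp add: cross_add_left Cross3.left_diff_distrib cross_mult_left n_def)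
  have nn: "n \<bullet> n = N" by (simp add: N_def)
  have "cross3 z e - \<mu> = 0"
  proof (rule orthogonal_to_frame[OF n])
    show "(cross3 z e - \<mu>) \<bullet> e = 0"
      using en assms(2) by (simp add: ze inner_diff_left inner_add_left dot_cross_self)
    show "(cross3 z e - \<mu>) \<bullet> f = 0"
      using en N by (simp add: ze inner_diff_left inner_add_left x1)
    show "(cross3 z e - \<mu>) \<bullet> cross3 e f = 0"
      using nn N by (simp add: ze inner_diff_left inner_add_left n_def[symmetric] dot_cross_self)
  qed
  moreover have "cross3 z f - \<nu> = 0"
  proof (rule orthogonal_to_frame[OF n])
    show "(cross3 z f - \<nu>) \<bullet> f = 0"
      using en assms(3) by (simp add: zf inner_diff_left inner_add_left dot_cross_self)
    show "(cross3 z f - \<nu>) \<bullet> e = 0"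
      using en N assms(4) by (simp add: zf inner_diff_left inner_add_left x2)
    show "(cross3 z f - \<nu>) \<bullet> cross3 e f = 0"
      using nn N by (simp add: zf inner_diff_left inner_add_left n_def[symmetric] dot_cross_self)
  qed
  ultimately show ?thesis by auto
qed

lemma motion_mono: "motion E p m \<Longrightarrow> E' \<subseteq> E \<Longrightarrow> motion E' p m"
  by (auto simp: motion_def)

lemma motion_diff: "motion E p m \<Longrightarrow> motion E p m' \<Longrightarrow> motion E p (\<lambda>w. m w - m' w)"
proof -
  have "(m a - m' a) - (m b - m' b) = (m a - m b) - (m' a - m' b)" for a b by simp
  then show "motion E p m \<Longrightarrow> motion E p m' \<Longrightarrow> motion E p (\<lambda>w. m w - m' w)"
    unfolding motion_def by (metis diff_zero inner_diff_right)
qed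

lemma motion_trivial: "motion E p (\<lambda>w. t + cross3 z (p w))"
proof -
  have "(p a - p b) \<bullet> (cross3 z (p a) - cross3 z (p b)) = 0" for a b
    by (metis Cross3.right_diff_distrib dot_cross_self(2))
  then show ?thesis by (auto simp: motion_def)
qed

lemma rigid_mono: "rigid W E p \<Longrightarrow> E \<subseteq> E' \<Longrightarrow> W' \<subseteq> W \<Longrightarrow> rigid W' E' p"
  unfolding rigid_def by (metis motion_mono subsetD)

lemma trivial_vanish:
  assumes "ncol p a b c" "t + cross3 z (p a) = 0" "t + cross3 z (p b) = 0" "t + cross3 z (p c) = 0"
  shows "z = 0" "t = 0"
proof -
  have "cross3 z (p b - p a) = 0" "cross3 z (p c - p a) = 0"
    using assms(2-4) by (simp_all add: Cross3.right_diff_distrib) (metis add_left_cancel)+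
  then show "z = 0" using spin_determined assms(1) unfolding ncol_def by blast
  then show "t = 0" using assms(2) by simp
qed

lemma rigid_imp_pinned:
  assumes "rigid W E p" "ncol p a b c" "a \<in> W" "b \<in> W" "c \<in> W"
  shows "pinned a b c W E p"
  unfolding pinned_def
proof (intro conjI allI impI assms(2))
  fix m assume m: "motion E p m \<and> m a = 0 \<and> m b = 0 \<and> m c = 0"
  then obtain t z where tz: "\<forall>w\<in>W. m w = t + cross3 z (p w)"
    using assms(1) unfolding rigid_def by meson
  with m assms have "z = 0" "t = 0" using trivial_vanish[of p a b c t z] by auto
  then show "\<forall>w\<in>W. m w = 0" using tz by auto
qed

lemma triangle_trivial:
  assumes "motion E p m" "ncol p a b c" "{a, b} \<in> E" "{b, c} \<in> E" "{a, c} \<in> E"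
  obtains t z where "m a = t + cross3 z (p a)" "m b = t + cross3 z (p b)" "m c = t + cross3 z (p c)"
proof -
  define e f \<mu> \<nu> where d: "e = p b - p a" "f = p c - p a" "\<mu> = m b - m a" "\<nu> = m c - m a"
  have "(p a - p b) \<bullet> (m a - m b) = 0" "(p b - p c) \<bullet> (m b - m c) = 0" "(p a - p c) \<bullet> (m a - m c) = 0"
    using assms by (auto simp: motion_def)
  then have "\<mu> \<bullet> e = 0" "\<nu> \<bullet> f = 0" "\<mu> \<bullet> f + \<nu> \<bullet> e = 0"
    by (simp_all add: d inner_commute inner_diff_left inner_diff_right)
  then obtain z where z: "cross3 z e = \<mu>" "cross3 z f = \<nu>"
    using spin_exists[of e f \<mu> \<nu>] assms(2) by (auto simp: ncol_def d)
  show thesis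
    by (rule that[of "m a - cross3 z (p a)" z])
      (use z in \<open>auto simp: d Cross3.right_diff_distrib algebra_simps\<close>)
qed

lemma pinned_imp_rigid:
  assumes "pinned a b c W E p" "{a, b} \<in> E" "{b, c} \<in> E" "{a, c} \<in> E"
  shows "rigid W E p"
  unfolding rigid_def
proof (intro allI impI)
  fix m assume m: "motion E p m"
  obtain t z where tz: "m a = t + cross3 z (p a)" "m b = t + cross3 z (p b)" "m c = t + cross3 z (p c)"
    using triangle_trivial[OF m, of a b c] assms unfolding pinned_def by metis
  have "motion E p (\<lambda>w. m w - (t + cross3 z (p w)))"
    by (rule motion_diff[OF m motion_trivial])
  then have "\<forall>w\<in>W. m w - (t + cross3 z (p w)) = 0"
    using assms(1) tz unfolding pinned_def by auto
  then show "\<exists>t z. \<forall>w\<in>W. m w = t + cross3 z (p w)" by (metis eq_iff_diff_eq_0)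
qed

lemma trig_imp_rigid: "trig W E p \<Longrightarrow> rigid W E p"
  unfolding trig_def by (elim bexE conjE) (rule pinned_imp_rigid)

lemma rigid_imp_trig:
  assumes "rigid W E p" "ncol p a b c" "{a, b} \<in> E" "{b, c} \<in> E" "{a, c} \<in> E" "a \<in> W" "b \<in> W" "c \<in> W"
  shows "trig W E p"
proof -
  have "pinned a b c W E p" using assms by (intro rigid_imp_pinned)
  then show ?thesis unfolding trig_def using assms by blast
qed

text \<open>Relative to the rigid motion of \<open>W\<close>, the velocity of \<open>d\<close> is
  orthogonal to three linearly independent edge directions, so it vanishes.\<close>

lemma rigid_attach:
  assumes "rigid W E p" "ncop p a b c d" "{a, b, c} \<subseteq> W" "{d, a} \<in> E" "{d, b} \<in> E" "{d, c} \<in> E"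
  shows "rigid (insert d W) E p"
  unfolding rigid_def
proof (intro allI impI)
  fix m assume m: "motion E p m"
  then obtain t z where tz: "\<forall>w\<in>W. m w = t + cross3 z (p w)"
    using assms(1) unfolding rigid_def by meson
  define k where "k = (\<lambda>w. m w - (t + cross3 z (p w)))"
  have k: "motion E p k" unfolding k_def
    by (rule motion_diff[OF m motion_trivial])
  have k0: "k a = 0" "k b = 0" "k c = 0" using tz assms(3) by (auto simp: k_def)
  have "(p d - p a) \<bullet> (k d - k a) = 0" "(p d - p b) \<bullet> (k d - k b) = 0" "(p d - p c) \<bullet> (k d - k c) = 0"
    using k assms(4-6) unfolding motion_def by blast+
  then have "k d \<bullet> (p a - p d) = 0" "k d \<bullet> (p b - p d) = 0" "k d \<bullet> (p c - p d) = 0"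
    by (simp_all add: k0 inner_diff_left inner_diff_right inner_commute)
  then have "k d = 0"
    using orthogonal_to_basis[of "p a - p d" "p b - p d" "p c - p d"] assms(2) by (auto simp: ncop_def)
  then show "\<exists>t z. \<forall>w\<in>insert d W. m w = t + cross3 z (p w)"
    using tz unfolding k_def by (metis eq_iff_diff_eq_0 insertE)
qed

lemma rigid_triangle:
  assumes "ncol p a b c" "{a, b} \<in> E" "{b, c} \<in> E" "{a, c} \<in> E"
  shows "rigid {a, b, c} E p"
  unfolding rigid_def
proof (intro allI impI)
  fix m assume "motion E p m"
  from triangle_trivial[OF this assms] obtain t z where
    "m a = t + cross3 z (p a)" "m b = t + cross3 z (p b)" "m c = t + cross3 z (p c)" .
  then show "\<exists>t z. \<forall>w\<in>{a, b, c}. m w = t + cross3 z (p w)" by auto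
qed

section \<open>Linear systems with polynomial coefficients\<close>

definition trivial_kernel :: "('i \<Rightarrow> real poly) set \<Rightarrow> 'i set \<Rightarrow> real \<Rightarrow> bool" where
  "trivial_kernel K S t \<longleftrightarrow>
     (\<forall>m. (\<forall>r\<in>K. (\<Sum>i\<in>S. poly (r i) t * m i) = 0) \<longrightarrow> (\<forall>i\<in>S. m i = (0::real)))"

text \<open>Full column rank at \<open>t0\<close> means a minor that does not vanish there, and
  hence only at finitely many points. Instead of determinants, the proof eliminates one column at a
  time. Multiplying by the pivot rather than dividing by it keeps the entries polynomial; the price
  is the finite set of roots of the pivot.\<close>

lemma finite_nontrivial_kernel:
  fixes K :: "('i \<Rightarrow> real poly) set"
  assumes "finite S" "trivial_kernel K S t0"
  shows "finite {t. \<not> trivial_kernel K S t}"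
proof -
  have "\<forall>K. trivial_kernel K S t0 \<longrightarrow> finite {t. \<not> trivial_kernel K S t}"
    using assms(1)
  proof (induction S)
  case empty then show ?case by (simp add: trivial_kernel_def)
next
  case (insert j S)
  show ?case
  proof (intro allI impI)
    fix K assume K: "trivial_kernel K (insert j S) t0"
    \<comment> \<open>Otherwise the unit vector of the column \<open>j\<close> would lie in the
      kernel at \<open>t0\<close>.\<close>
    have "\<exists>r\<in>K. poly (r j) t0 \<noteq> 0"
    proof (rule ccontr)
      assume "\<not> ?thesis"
      moreover have "(\<Sum>i\<in>insert j S. poly (r i) t0 * (if i = j then 1 else 0)) = poly (r j) t0" for r
        using insert.hyps by (simp add: if_distrib[of "\<lambda>x. _ * x"] sum.delta' cong: if_cong)
      ultimately have "\<forall>r\<in>K. (\<Sum>i\<in>insert j S. poly (r i) t0 * (if i = j then 1 else 0)) = 0"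
        by simp
      then have "\<forall>i\<in>insert j S. (if i = j then 1 else 0 :: real) = 0"
        using K[unfolded trivial_kernel_def, rule_format, of "\<lambda>i. if i = j then 1 else 0"] by blast
      then show False by simp
    qed
    then obtain r where r: "r \<in> K" "poly (r j) t0 \<noteq> 0" by auto
    define K' where "K' = (\<lambda>s i. r j * s i - s j * r i) ` K"
    have *: "trivial_kernel K' S t0"
      unfolding trivial_kernel_def
    proof (intro allI impI)
      fix m :: "'i \<Rightarrow> real" assume m: "\<forall>s\<in>K'. (\<Sum>i\<in>S. poly (s i) t0 * m i) = 0"
      define R where "R = (\<Sum>i\<in>S. poly (r i) t0 * m i)"
      \<comment> \<open>The value at \<open>j\<close> is solved from the pivot row, which turns a
        kernel vector of the reduced system into one of the full system.\<close>
      define m' where "m' = m(j := - R / poly (r j) t0)"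
      have mS: "(\<Sum>i\<in>S. poly (s i) t0 * m' i) = (\<Sum>i\<in>S. poly (s i) t0 * m i)" for s :: "'i \<Rightarrow> real poly"
        by (rule sum.cong) (use insert.hyps in \<open>auto simp: m'_def\<close>)
      have "(\<Sum>i\<in>insert j S. poly (s i) t0 * m' i) = 0" if "s \<in> K" for s
      proof -
        have "(\<lambda>i. r j * s i - s j * r i) \<in> K'"
          unfolding K'_def using that by (rule imageI)
        from bspec[OF m this] have "(\<Sum>i\<in>S. poly (r j * s i - s j * r i) t0 * m i) = 0" .
        then have "poly (r j) t0 * (\<Sum>i\<in>S. poly (s i) t0 * m i) = poly (s j) t0 * R"
          by (simp add: R_def algebra_simps sum_distrib_left sum_subtractf)
        moreover have "(\<Sum>i\<in>insert j S. poly (s i) t0 * m' i) = poly (s j) t0 * m' j + (\<Sum>i\<in>S. poly (s i) t0 * m i)"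
          using insert.hyps by (simp add: mS)
        moreover have "m' j = - R / poly (r j) t0" by (simp add: m'_def)
        ultimately show ?thesis using r(2)
          by (simp add: field_simps)
      qed
      then have "\<forall>i\<in>insert j S. m' i = 0" using K unfolding trivial_kernel_def by blast
      then show "\<forall>i\<in>S. m i = 0" using insert.hyps by (auto simp: m'_def split: if_splits)
    qed
    then have fin: "finite {t. \<not> trivial_kernel K' S t}"
      using insert.IH by blast
    have "trivial_kernel K (insert j S) t" if t: "poly (r j) t \<noteq> 0" "trivial_kernel K' S t" for t
      unfolding trivial_kernel_def
    proof (intro allI impI)
      fix m :: "'i \<Rightarrow> real" assume m: "\<forall>s\<in>K. (\<Sum>i\<in>insert j S. poly (s i) t * m i) = 0"
      have "(\<Sum>i\<in>S. poly (r j * s i - s j * r i) t * m i) = 0" if "s \<in> K" for s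
      proof -
        have "poly (s j) t * m j + (\<Sum>i\<in>S. poly (s i) t * m i) = 0"
          "poly (r j) t * m j + (\<Sum>i\<in>S. poly (r i) t * m i) = 0"
          using m r(1) that insert.hyps by (auto simp: sum.insert)
        then have "poly (r j) t * (\<Sum>i\<in>S. poly (s i) t * m i) = poly (s j) t * (\<Sum>i\<in>S. poly (r i) t * m i)"
          by algebra
        then show ?thesis
          by (simp add: algebra_simps sum_distrib_left sum_subtractf)
      qed
      then have "\<forall>s\<in>K'. (\<Sum>i\<in>S. poly (s i) t * m i) = 0" unfolding K'_def by simp
      then have S0: "\<forall>i\<in>S. m i = 0" using t(2) unfolding trivial_kernel_def by blast
      have "poly (r j) t * m j + (\<Sum>i\<in>S. poly (r i) t * m i) = 0"
        using m r(1) insert.hyps by (auto simp: sum.insert)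
      then have "m j = 0" using S0 t(1) by simp
      then show "\<forall>i\<in>insert j S. m i = 0" using S0 by auto
    qed
    then have "{t. \<not> trivial_kernel K (insert j S) t} \<subseteq> {t. poly (r j) t = 0} \<union> {t. \<not> trivial_kernel K' S t}" by blast
    moreover have "finite {t. poly (r j) t = 0}" using r(2) by (intro poly_roots_finite) auto
    ultimately show "finite {t. \<not> trivial_kernel K (insert j S) t}" using fin finite_subset by blast
  qed
qed
  then show ?thesis using assms(2) by blast
qed


section \<open>Conditions that hold almost everywhere on lines of placements\<close>

definition line :: "('a \<Rightarrow> real^3) \<Rightarrow> ('a \<Rightarrow> real^3) \<Rightarrow> real \<Rightarrow> 'a \<Rightarrow> real^3" where
  "line p q t = (\<lambda>w. p w + t *\<^sub>R (q w - p w))"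

text \<open>A substitute for openness in the Zariski topology that looks at lines only: once the
  condition holds at a point, every line through this point has finitely many exceptions.\<close>

definition alg_open :: "(('a \<Rightarrow> real^3) \<Rightarrow> bool) \<Rightarrow> bool" where
  "alg_open P \<longleftrightarrow> (\<forall>p q. P q \<longrightarrow> finite {t. \<not> P (line p q t)})"

definition gen :: "'a \<Rightarrow> 'a \<Rightarrow> (('a \<Rightarrow> real^3) \<Rightarrow> bool) \<Rightarrow> bool" where
  "gen u v P \<longleftrightarrow> alg_open P \<and> (\<exists>q. q u = q v \<and> P q)"

lemma alg_open_conj:
  assumes "alg_open P" "alg_open Q" shows "alg_open (\<lambda>p. P p \<and> Q p)"
  unfolding alg_open_def
proof (intro allI impI)
  fix p q assume "P q \<and> Q q"
  then have "finite ({t. \<not> P (line p q t)} \<union> {t. \<not> Q (line p q t)})"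
    using assms by (simp add: alg_open_def)
  then show "finite {t. \<not> (P (line p q t) \<and> Q (line p q t))}"
    by (rule rev_finite_subset) auto
qed

text \<open>The line through the two witnesses stays inside the subspace \<open>q u = q v\<close>,
  and each condition fails at finitely many of its points.\<close>

lemma gen_conj:
  assumes "gen u v P" "gen u v Q" shows "gen u v (\<lambda>p. P p \<and> Q p)"
proof -
  obtain p q where pq: "p u = p v" "P p" "q u = q v" "Q q" using assms by (auto simp: gen_def)
  have f1: "finite {t. \<not> P (line q p t)}" and f2: "finite {t. \<not> Q (line p q t)}"
    using assms pq by (auto simp: gen_def alg_open_def)
  \<comment> \<open>\<open>alg_open\<close> starts from a witness at the end of the line, but the
    witness of \<open>P\<close> is at its beginning, so the line is run backwards.\<close>
  have "line p q t = line q p (1 - t)" for t by (auto simp: line_def algebra_simps)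
  then have "{t. \<not> P (line p q t)} = (\<lambda>t. 1 - t) ` {t. \<not> P (line q p t)}"
    by (auto simp: image_iff) (metis diff_diff_eq2 add_diff_cancel_left')
  then have "finite ({t. \<not> P (line p q t)} \<union> {t. \<not> Q (line p q t)})" using f1 f2 by simp
  then obtain t where "t \<notin> {t. \<not> P (line p q t)} \<union> {t. \<not> Q (line p q t)}"
    using ex_new_if_finite infinite_UNIV_char_0 by blast
  moreover have "line p q t u = line p q t v" for t using pq by (simp add: line_def)
  ultimately show ?thesis using assms alg_open_conj unfolding gen_def by blast
qed

definition polyfun :: "(('a \<Rightarrow> real^3) \<Rightarrow> real) \<Rightarrow> bool" where
  "polyfun g \<longleftrightarrow> (\<forall>p q. \<exists>P. \<forall>t. g (line p q t) = poly P t)"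

lemma line_1 [simp]: "line p q 1 = q"
  by (simp add: line_def)

lemma polyfun_coord: "polyfun (\<lambda>p. p a $ i)"
  unfolding polyfun_def
proof (intro allI)
  fix p q :: "'a \<Rightarrow> real^3"
  have "\<forall>t. line p q t a $ i = poly [:p a $ i, q a $ i - p a $ i:] t"
    by (simp add: line_def)
  then show "\<exists>P. \<forall>t. line p q t a $ i = poly P t" by blast
qed

lemma polyfun_add: "polyfun f \<Longrightarrow> polyfun g \<Longrightarrow> polyfun (\<lambda>p. f p + g p)"
proof -
  assume a: "polyfun f" "polyfun g"
  show "polyfun (\<lambda>p. f p + g p)"
    unfolding polyfun_def
  proof (intro allI)
    fix p q
    obtain P Q where "\<forall>t. f (line p q t) = poly P t" "\<forall>t. g (line p q t) = poly Q t"
      using a unfolding polyfun_def by meson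
    then have "\<forall>t. f (line p q t) + g (line p q t) = poly (P + Q) t" by simp
    then show "\<exists>P. \<forall>t. f (line p q t) + g (line p q t) = poly P t" by (rule exI)
  qed
qed

lemma polyfun_diff: "polyfun f \<Longrightarrow> polyfun g \<Longrightarrow> polyfun (\<lambda>p. f p - g p)"
proof -
  assume a: "polyfun f" "polyfun g"
  show "polyfun (\<lambda>p. f p - g p)"
    unfolding polyfun_def
  proof (intro allI)
    fix p q
    obtain P Q where "\<forall>t. f (line p q t) = poly P t" "\<forall>t. g (line p q t) = poly Q t"
      using a unfolding polyfun_def by meson
    then have "\<forall>t. f (line p q t) - g (line p q t) = poly (P - Q) t" by simp
    then show "\<exists>P. \<forall>t. f (line p q t) - g (line p q t) = poly P t" by (rule exI)
  qed
qed

lemma polyfun_mult: "polyfun f \<Longrightarrow> polyfun g \<Longrightarrow> polyfun (\<lambda>p. f p * g p)"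
proof -
  assume a: "polyfun f" "polyfun g"
  show "polyfun (\<lambda>p. f p * g p)"
    unfolding polyfun_def
  proof (intro allI)
    fix p q
    obtain P Q where "\<forall>t. f (line p q t) = poly P t" "\<forall>t. g (line p q t) = poly Q t"
      using a unfolding polyfun_def by meson
    then have "\<forall>t. f (line p q t) * g (line p q t) = poly (P * Q) t" by simp
    then show "\<exists>P. \<forall>t. f (line p q t) * g (line p q t) = poly P t" by (rule exI)
  qed
qed

lemmas polyfun_intros = polyfun_coord polyfun_add polyfun_diff polyfun_mult

lemma alg_open_polyfun:
  assumes "polyfun g" shows "alg_open (\<lambda>p. g p \<noteq> 0)"
  unfolding alg_open_def
proof (intro allI impI)
  fix p q assume q: "g q \<noteq> 0"
  obtain P where P: "\<forall>t. g (line p q t) = poly P t" using assms unfolding polyfun_def by blast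
  then have "poly P 1 \<noteq> 0" using q by (metis line_1)
  then have "P \<noteq> 0" by auto
  then show "finite {t. \<not> g (line p q t) \<noteq> 0}" using P poly_roots_finite by simp
qed

lemma alg_open_disj:
  assumes "alg_open P" "alg_open Q" shows "alg_open (\<lambda>p. P p \<or> Q p)"
  unfolding alg_open_def
proof (intro allI impI)
  fix p q assume "P q \<or> Q q"
  then have "finite {t. \<not> P (line p q t)} \<or> finite {t. \<not> Q (line p q t)}"
    using assms unfolding alg_open_def by blast
  then show "finite {t. \<not> (P (line p q t) \<or> Q (line p q t))}"
    by (elim disjE) (rule rev_finite_subset, assumption, blast)+
qed

lemma alg_open_ncop: "alg_open (\<lambda>p. ncop p a b c d)"
  unfolding ncop_def
  by (rule alg_open_polyfun)
    (simp only: inner_vec_def sum_3 cross_components vector_minus_component inner_real_def, (rule polyfun_intros)+)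

lemma alg_open_ncol: "alg_open (\<lambda>p. ncol p a b c)"
proof -
  have *: "ncol p a b c \<longleftrightarrow> cross3 (p b - p a) (p c - p a) $ 1 \<noteq> 0 \<or>
     cross3 (p b - p a) (p c - p a) $ 2 \<noteq> 0 \<or> cross3 (p b - p a) (p c - p a) $ 3 \<noteq> 0" for p
    by (auto simp: ncol_def vec_eq_iff forall_3)
  show ?thesis unfolding *
    by (intro alg_open_disj alg_open_polyfun) ((simp only: cross_components vector_minus_component, (rule polyfun_intros)+)+)
qed

lemma positions_exist:
  assumes "distinct [a, b, c, d]" "u = v \<or> \<not> {u, v} \<subseteq> {a, b, c, d}"
  shows "\<exists>q. q u = q v \<and> ncol q a b c \<and> ncop q a b c d"
proof -
  define g :: "'a \<Rightarrow> real^3" where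
    "g = (\<lambda>w. if w = a then axis 1 1 else if w = b then axis 2 1 else if w = c then axis 3 1 else 0)"
  \<comment> \<open>Unless \<open>u = v\<close>, at most one of the two is among the four points.
    The other one is moved onto it, which leaves the four standard positions intact.\<close>
  define q where "q = (if v \<in> {a, b, c, d} then g(u := g v) else g(v := g u))"
  have "q w = g w" if "w \<in> {a, b, c, d}" for w
    using that assms(2) by (auto simp: q_def)
  then have q: "q a = axis 1 1" "q b = axis 2 1" "q c = axis 3 1" "q d = 0"
    using assms(1) by (auto simp: g_def)
  have "q u = q v" by (auto simp: q_def)
  moreover have "ncop q a b c d"
    by (simp add: ncop_def q cross_basis inner_axis_axis)
  moreover have "ncol q a b c"
  proof -
    have "cross3 (axis 2 1 - axis 1 1 :: real^3) (axis 3 1 - axis 1 1) $ 1 \<noteq> 0"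
      by (simp add: cross_components axis_def)
    then show ?thesis by (auto simp: ncol_def q)
  qed
  ultimately show ?thesis by blast
qed

lemma triangle_positions_exist:
  assumes "distinct [a, b, c]" "u = v \<or> \<not> {u, v} \<subseteq> {a, b, c}"
  shows "\<exists>q. q u = q v \<and> ncol q a b c"
proof -
  define g :: "'a \<Rightarrow> real^3" where
    "g = (\<lambda>w. if w = a then axis 1 1 else if w = b then axis 2 1 else if w = c then axis 3 1 else 0)"
  define q where "q = (if v \<in> {a, b, c} then g(u := g v) else g(v := g u))"
  have "q w = g w" if "w \<in> {a, b, c}" for w
    using that assms(2) by (auto simp: q_def)
  then have q: "q a = axis 1 1" "q b = axis 2 1" "q c = axis 3 1"
    using assms(1) by (auto simp: g_def)
  have "q u = q v" by (auto simp: q_def)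
  moreover have "ncol q a b c"
  proof -
    have "cross3 (axis 2 1 - axis 1 1 :: real^3) (axis 3 1 - axis 1 1) $ 1 \<noteq> 0"
      by (simp add: cross_components axis_def)
    then show ?thesis by (auto simp: ncol_def q)
  qed
  ultimately show ?thesis by blast
qed

lemma gen_ncop:
  assumes "distinct [a, b, c, d]" "u = v \<or> \<not> {u, v} \<subseteq> {a, b, c, d}"
  shows "gen u v (\<lambda>p. ncop p a b c d)"
  unfolding gen_def using positions_exist[OF assms] alg_open_ncop[of a b c d] by auto

lemma gen_ncol:
  assumes "distinct [a, b, c]" "u = v \<or> \<not> {u, v} \<subseteq> {a, b, c}"
  shows "gen u v (\<lambda>p. ncol p a b c)"
  unfolding gen_def using triangle_positions_exist[OF assms] alg_open_ncol[of a b c] by auto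

text \<open>A triple \<open>(a, b, P)\<close> stands for the equation that the inner product of
  \<open>P\<close> with \<open>m a - m b\<close> is 0, and \<open>N\<close> holds the pinned
  vertices. The direction \<open>P\<close> is arbitrary, not a difference of positions, because the
  vertex split puts a limit direction in the place of an edge of length 0.\<close>

definition row_trivial ::
  "'a set \<Rightarrow> ('a \<times> 'a \<times> (3 \<Rightarrow> real poly)) set \<Rightarrow> 'a set \<Rightarrow> real \<Rightarrow> bool" where
  "row_trivial W K N t \<longleftrightarrow> (\<forall>m :: 'a \<Rightarrow> real^3.
     (\<forall>a b P. (a, b, P) \<in> K \<longrightarrow> (\<Sum>i\<in>UNIV. poly (P i) t * (m a $ i - m b $ i)) = 0) \<and>
     (\<forall>a\<in>N. m a = 0) \<longrightarrow> (\<forall>w\<in>W. m w = 0))"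

lemma finite_not_row_trivial:
  fixes K :: "('a \<times> 'a \<times> (3 \<Rightarrow> real poly)) set"
  assumes fin: "finite W" and K: "\<And>a b P. (a, b, P) \<in> K \<Longrightarrow> a \<in> W \<and> b \<in> W" and N: "N \<subseteq> W"
    and t0: "row_trivial W K N t0"
  shows "finite {t. \<not> row_trivial W K N t}"
proof -
  define row where "row = (\<lambda>(a :: 'a, b, P) (w, i :: 3). (if w = a then P i else 0) - (if w = b then P i else (0 :: real poly)))"
  define pin where "pin = (\<lambda>(a :: 'a, k :: 3) (w, i). if w = a \<and> i = k then 1 else (0 :: real poly))"
  define R where "R = row ` K \<union> pin ` (N \<times> UNIV)"
  have row: "(\<Sum>z\<in>W \<times> UNIV. poly (row (a, b, P) z) t * f z) = (\<Sum>i\<in>UNIV. poly (P i) t * (f (a, i) - f (b, i)))"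
    if "(a, b, P) \<in> K" for a b P t f
  proof -
    have ab: "a \<in> W" "b \<in> W" using K that by auto
    have "(\<Sum>z\<in>W \<times> UNIV. poly (row (a, b, P) z) t * f z) = (\<Sum>w\<in>W. \<Sum>i\<in>UNIV. poly (row (a, b, P) (w, i)) t * f (w, i))"
      by (simp add: sum.cartesian_product)
    also have "\<dots> = (\<Sum>i\<in>UNIV. \<Sum>w\<in>W. poly (row (a, b, P) (w, i)) t * f (w, i))"
      by (rule sum.swap)
    also have "\<dots> = (\<Sum>i\<in>UNIV. \<Sum>w\<in>W. (if w = a then poly (P i) t * f (a, i) else 0) - (if w = b then poly (P i) t * f (b, i) else 0))"
      by (intro sum.cong) (auto simp: row_def left_diff_distrib)
    also have "\<dots> = (\<Sum>i\<in>UNIV. poly (P i) t * f (a, i) - poly (P i) t * f (b, i))"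
      using ab fin by (simp add: sum_subtractf)
    finally show ?thesis by (simp add: right_diff_distrib)
  qed
  have pin: "(\<Sum>z\<in>W \<times> UNIV. poly (pin (a, k) z) t * f z) = f (a, k)" if "a \<in> N" for a k t f
  proof -
    have "(\<Sum>z\<in>W \<times> UNIV. poly (pin (a, k) z) t * f z) = (\<Sum>z\<in>W \<times> UNIV. if z = (a, k) then f z else 0)"
      by (intro sum.cong) (auto simp: pin_def split: if_splits)
    also have "\<dots> = f (a, k)" using that N fin by (subst sum.delta) auto
    finally show ?thesis .
  qed
  have R: "(\<forall>r\<in>R. (\<Sum>z\<in>W \<times> UNIV. poly (r z) t * f z) = 0) \<longleftrightarrow>
     (\<forall>a b P. (a, b, P) \<in> K \<longrightarrow> (\<Sum>i\<in>UNIV. poly (P i) t * (f (a, i) - f (b, i))) = 0) \<and> (\<forall>a\<in>N. \<forall>k. f (a, k) = 0)" for t f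
  proof -
    have R': "(\<forall>r\<in>R. Q r) \<longleftrightarrow> (\<forall>a b P. (a, b, P) \<in> K \<longrightarrow> Q (row (a, b, P))) \<and> (\<forall>a\<in>N. \<forall>k. Q (pin (a, k)))" for Q
      unfolding R_def by (auto simp del: split_paired_All)
    have "(\<forall>r\<in>R. (\<Sum>z\<in>W \<times> UNIV. poly (r z) t * f z) = 0) \<longleftrightarrow>
      (\<forall>a b P. (a, b, P) \<in> K \<longrightarrow> (\<Sum>z\<in>W \<times> UNIV. poly (row (a, b, P) z) t * f z) = 0) \<and>
      (\<forall>a\<in>N. \<forall>k. (\<Sum>z\<in>W \<times> UNIV. poly (pin (a, k) z) t * f z) = 0)"
      by (rule R')
    then show ?thesis using row pin by simp
  qed
  have *: "trivial_kernel R (W \<times> UNIV) t \<longleftrightarrow> row_trivial W K N t" for t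
  proof
    assume tk: "trivial_kernel R (W \<times> UNIV) t"
    show "row_trivial W K N t"
      unfolding row_trivial_def
    proof (intro allI impI)
      fix m :: "'a \<Rightarrow> real^3"
      assume m: "(\<forall>a b P. (a, b, P) \<in> K \<longrightarrow> (\<Sum>i\<in>UNIV. poly (P i) t * (m a $ i - m b $ i)) = 0) \<and> (\<forall>a\<in>N. m a = 0)"
      have "\<forall>r\<in>R. (\<Sum>z\<in>W \<times> UNIV. poly (r z) t * (\<lambda>(w, i). m w $ i) z) = 0"
        unfolding R using m by simp
      then have "\<forall>z\<in>W \<times> UNIV. (\<lambda>(w, i). m w $ i) z = 0"
        using tk unfolding trivial_kernel_def by blast
      then show "\<forall>w\<in>W. m w = 0" by (auto simp: vec_eq_iff)
    qed
  next
    assume rt: "row_trivial W K N t"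
    show "trivial_kernel R (W \<times> UNIV) t"
      unfolding trivial_kernel_def R
    proof (intro allI impI)
      fix f :: "'a \<times> 3 \<Rightarrow> real"
      assume f: "(\<forall>a b P. (a, b, P) \<in> K \<longrightarrow> (\<Sum>i\<in>UNIV. poly (P i) t * (f (a, i) - f (b, i))) = 0) \<and> (\<forall>a\<in>N. \<forall>k. f (a, k) = 0)"
      define m :: "'a \<Rightarrow> real^3" where "m = (\<lambda>w. \<chi> i. f (w, i))"
      have "(\<forall>a b P. (a, b, P) \<in> K \<longrightarrow> (\<Sum>i\<in>UNIV. poly (P i) t * (m a $ i - m b $ i)) = 0) \<and> (\<forall>a\<in>N. m a = 0)"
        using f by (simp add: m_def vec_eq_iff)
      then have "\<forall>w\<in>W. m w = 0" using rt unfolding row_trivial_def by blast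
      then show "\<forall>z\<in>W \<times> UNIV. f z = 0" by (auto simp: m_def vec_eq_iff)
    qed
  qed
  have "trivial_kernel R (W \<times> UNIV) t0" using t0 * by simp
  from finite_nontrivial_kernel[OF _ this] fin show ?thesis by (simp add: *)
qed

lemma alg_open_pinned:
  assumes "finite W" "E \<subseteq> Pow W" "a \<in> W" "b \<in> W" "c \<in> W"
  shows "alg_open (pinned a b c W E)"
proof -
  have "alg_open (\<lambda>p. \<forall>m. motion E p m \<and> m a = 0 \<and> m b = 0 \<and> m c = 0 \<longrightarrow> (\<forall>w\<in>W. m w = 0))"
    unfolding alg_open_def
  proof (intro allI impI)
    fix p q :: "'a \<Rightarrow> real^3"
    assume q: "\<forall>m. motion E q m \<and> m a = 0 \<and> m b = 0 \<and> m c = 0 \<longrightarrow> (\<forall>w\<in>W. m w = 0)"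
    define P where "P = (\<lambda>s r i. [: p s $ i - p r $ i, (q s $ i - p s $ i) - (q r $ i - p r $ i) :])"
    define K where "K = {(s, r, P s r) | s r. {s, r} \<in> E}"
    have P: "poly (P s r i) t = (line p q t s - line p q t r) $ i" for s r i t
      by (simp add: P_def line_def algebra_simps)
    have mo: "motion E (line p q t) m \<longleftrightarrow>
      (\<forall>s r P. (s, r, P) \<in> K \<longrightarrow> (\<Sum>i\<in>UNIV. poly (P i) t * (m s $ i - m r $ i)) = 0)" for t m
      by (auto simp: motion_def K_def P inner_vec_def)
    have rt: "row_trivial W K {a, b, c} t \<longleftrightarrow>
      (\<forall>m. motion E (line p q t) m \<and> m a = 0 \<and> m b = 0 \<and> m c = 0 \<longrightarrow> (\<forall>w\<in>W. m w = 0))" for t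
      unfolding row_trivial_def mo by simp
    have "row_trivial W K {a, b, c} 1" unfolding rt line_1 by (rule q)
    then have "finite {t. \<not> row_trivial W K {a, b, c} t}"
    proof (rule finite_not_row_trivial[rotated 3])
      show "finite W" "{a, b, c} \<subseteq> W" using assms by auto
      show "s \<in> W \<and> r \<in> W" if "(s, r, P') \<in> K" for s r P'
        using that assms(2) unfolding K_def by blast
    qed
    then show "finite {t. \<not> (\<forall>m. motion E (line p q t) m \<and> m a = 0 \<and> m b = 0 \<and> m c = 0 \<longrightarrow> (\<forall>w\<in>W. m w = 0))}"
      unfolding rt .
  qed
  then show ?thesis
    unfolding pinned_def by (rule alg_open_conj[OF alg_open_ncol[of a b c]])
qed

lemma alg_open_trig:
  assumes "finite W" "E \<subseteq> Pow W" shows "alg_open (trig W E)"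
  unfolding alg_open_def
proof (intro allI impI)
  fix p q assume "trig W E q"
  then obtain a b c where abc: "a \<in> W" "b \<in> W" "c \<in> W" "{a, b} \<in> E" "{b, c} \<in> E" "{a, c} \<in> E" "pinned a b c W E q"
    unfolding trig_def by blast
  then have "finite {t. \<not> pinned a b c W E (line p q t)}"
    using alg_open_pinned[OF assms, of a b c] unfolding alg_open_def by blast
  then show "finite {t. \<not> trig W E (line p q t)}"
    by (rule rev_finite_subset) (use abc in \<open>auto simp: trig_def\<close>)
qed

section \<open>Operations that preserve generic rigidity\<close>

definition gen_rigid :: "'a \<Rightarrow> 'a \<Rightarrow> 'a set \<Rightarrow> 'a set set \<Rightarrow> bool" where
  "gen_rigid u v W E \<longleftrightarrow> (\<exists>p. p u = p v \<and> trig W E p)"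

lemma gen_trig: "finite W \<Longrightarrow> E \<subseteq> Pow W \<Longrightarrow> gen_rigid u v W E \<Longrightarrow> gen u v (trig W E)"
  unfolding gen_def gen_rigid_def by (intro conjI alg_open_trig)

lemma gen_obtain:
  assumes "gen u v P" obtains p where "p u = p v" "P p"
  using assms unfolding gen_def by blast

lemma motion_cong:
  assumes "E \<subseteq> Pow W" "\<And>w. w \<in> W \<Longrightarrow> p w = p' w" "motion E p' m"
  shows "motion E p m"
  unfolding motion_def
proof (intro allI impI)
  fix a b assume ab: "{a, b} \<in> E"
  then have "a \<in> W" "b \<in> W" using assms(1) by blast+
  then show "(p a - p b) \<bullet> (m a - m b) = 0"
    using assms(3) ab by (simp add: assms(2) motion_def)
qed

lemma trig_cong:
  assumes E: "E \<subseteq> Pow W" and p: "\<And>w. w \<in> W \<Longrightarrow> p w = p' w" and t: "trig W E p"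
  shows "trig W E p'"
proof -
  obtain a b c where abc: "a \<in> W" "b \<in> W" "c \<in> W" "{a, b} \<in> E" "{b, c} \<in> E" "{a, c} \<in> E" "pinned a b c W E p"
    using t unfolding trig_def by blast
  have "pinned a b c W E p'"
    unfolding pinned_def
  proof (intro conjI allI impI)
    show "ncol p' a b c" using abc(7) p abc(1-3) by (simp add: pinned_def ncol_def)
    fix m assume "motion E p' m \<and> m a = 0 \<and> m b = 0 \<and> m c = 0"
    moreover from this have "motion E p m" using motion_cong[OF E, of p p' m] p by blast
    ultimately show "\<forall>w\<in>W. m w = 0" using abc(7) unfolding pinned_def by blast
  qed
  then show ?thesis using abc(1-6) unfolding trig_def by blast
qed

text \<open>\<open>gen_rigid s s\<close> imposes no coincidence at all, so plain spheres and braced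
  ones share a single notion. If \<open>u\<close> and \<open>v\<close> do not both belong to
  \<open>W\<close>, the outer one can be placed on the other without touching the framework.\<close>

lemma gen_rigid_coincide:
  assumes "gen_rigid s s W E" "E \<subseteq> Pow W" "\<not> {u, v} \<subseteq> W"
  shows "gen_rigid u v W E"
proof -
  obtain p where p: "trig W E p" using assms(1) by (auto simp: gen_rigid_def)
  define p' where "p' = (if v \<in> W then p(u := p v) else p(v := p u))"
  have "trig W E p'"
    by (rule trig_cong[OF assms(2) _ p]) (use assms(3) in \<open>auto simp: p'_def\<close>)
  moreover have "p' u = p' v" by (auto simp: p'_def)
  ultimately show ?thesis unfolding gen_rigid_def by blast
qed

text \<open>Vertex splitting: \<open>E'\<close> arises from \<open>E\<close> by merging
  \<open>b\<close> into \<open>c\<close>, and \<open>lift\<close> says that every edge of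
  \<open>E'\<close> comes from one at \<open>c\<close> or at \<open>b\<close>. The new vertex starts
  at the place of \<open>c\<close> and leaves in the direction \<open>n\<close> normal to the
  triangle \<open>cpq\<close>. At time 0 the edges to \<open>p\<close> and \<open>q\<close> make
  \<open>m c - m b\<close> orthogonal to two sides of that triangle, and the limit of the edge
  \<open>cb\<close> makes it orthogonal to \<open>n\<close>. So \<open>m b = m c\<close>, and
  \<open>m\<close> is a motion of the contracted framework. Rigidity then persists for almost all
  times.\<close>

lemma gen_rigid_split:
  assumes W: "finite W" "b \<notin> W" "b \<noteq> u" "b \<noteq> v"
    and E': "E' \<subseteq> Pow W" and E: "E \<subseteq> Pow (insert b W)"
    and r: "gen_rigid u v W E'"
    and cpq: "c \<in> W" "p \<in> W" "q \<in> W" "distinct [c, p, q]" "u = v \<or> \<not> {u, v} \<subseteq> {c, p, q}"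
    and new: "{c, b} \<in> E" "{c, p} \<in> E" "{b, p} \<in> E" "{c, q} \<in> E" "{b, q} \<in> E"
    and lift: "\<And>s r. {s, r} \<in> E' \<Longrightarrow> {s, r} \<in> E \<or> s = c \<and> {b, r} \<in> E \<or> r = c \<and> {s, b} \<in> E"
    and tri: "{i, j, k} \<subseteq> W" "distinct [i, j, k]" "u = v \<or> \<not> {u, v} \<subseteq> {i, j, k}"
      "{i, j} \<in> E" "{j, k} \<in> E" "{i, k} \<in> E"
  shows "gen_rigid u v (insert b W) E"
proof -
  obtain z where z: "z u = z v" "trig W E' z" "ncol z c p q" "ncol z i j k"
    using gen_conj[OF gen_trig[OF W(1) E' r] gen_conj[OF gen_ncol[OF cpq(4,5)] gen_ncol[OF tri(2,3)]]]
    by (rule gen_obtain) blast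
  have pin: "pinned i j k W E' z"
    using rigid_imp_pinned[OF trig_imp_rigid[OF z(2)] z(4)] tri(1) by simp
  define n where "n = cross3 (z p - z c) (z q - z c)"
  have n: "n \<noteq> 0" using z(3) by (simp add: n_def ncol_def)
  define pos where "pos = (\<lambda>t. z(b := z c + t *\<^sub>R n))"
  have bn: "b \<noteq> c" "b \<noteq> p" "b \<noteq> q" "b \<noteq> i" "b \<noteq> j" "b \<noteq> k" using W(2) cpq tri(1) by auto
  have posW: "pos t w = z w" if "w \<in> W" for t w using that W(2) by (auto simp: pos_def)
  have posb: "pos t b = z c + t *\<^sub>R n" for t by (simp add: pos_def)
  define P where "P = (\<lambda>s r i. [: (pos 0 s - pos 0 r) $ i, ((if s = b then n else 0) - (if r = b then n else 0)) $ i :])"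
  \<comment> \<open>The row of \<open>cb\<close> at time \<open>t\<close> is a multiple of
    \<open>t\<close>. Dividing it by \<open>t\<close> leaves, up to sign, the constant row
    \<open>n\<close>, which does not degenerate at time 0.\<close>
  define K where "K = {(s, r, P s r) | s r. {s, r} \<in> E \<and> {s, r} \<noteq> {c, b}} \<union> {(c, b, \<lambda>i. [: n $ i :])}"
  have P: "poly (P s r i) t = (pos t s - pos t r) $ i" for s r i t
    by (simp add: P_def pos_def algebra_simps)
  have rows: "(\<forall>s r P. (s, r, P) \<in> K \<longrightarrow> (\<Sum>i\<in>UNIV. poly (P i) t * (m s $ i - m r $ i)) = 0) \<longleftrightarrow>
      (\<forall>s r. {s, r} \<in> E \<and> {s, r} \<noteq> {c, b} \<longrightarrow> (pos t s - pos t r) \<bullet> (m s - m r) = 0) \<and> n \<bullet> (m c - m b) = 0" for t and m :: "'a \<Rightarrow> real^3"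
    by (auto simp: K_def P inner_vec_def)
  have "row_trivial (insert b W) K {i, j, k} 0"
    unfolding row_trivial_def rows
  proof (intro allI impI)
    fix m :: "'a \<Rightarrow> real^3"
    assume m: "((\<forall>s r. {s, r} \<in> E \<and> {s, r} \<noteq> {c, b} \<longrightarrow> (pos 0 s - pos 0 r) \<bullet> (m s - m r) = 0) \<and> n \<bullet> (m c - m b) = 0) \<and> (\<forall>a\<in>{i, j, k}. m a = 0)"
    have me: "(pos 0 s - pos 0 r) \<bullet> (m s - m r) = 0" if "{s, r} \<in> E" "{s, r} \<noteq> {c, b}" for s r
      using m that by blast
    have orth: "(z x - z c) \<bullet> (m c - m b) = 0" if "x = p \<or> x = q" for x
    proof -
      have x: "x \<in> W" "x \<noteq> b" "x \<noteq> c" "{c, x} \<in> E" "{b, x} \<in> E" using that cpq new bn by auto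
      have "(pos 0 c - pos 0 x) \<bullet> (m c - m x) = 0" "(pos 0 b - pos 0 x) \<bullet> (m b - m x) = 0"
        using me[of c x] me[of b x] x bn by (auto simp: doubleton_eq_iff)
      then have "(z c - z x) \<bullet> (m c - m x) = 0" "(z c - z x) \<bullet> (m b - m x) = 0"
        using x cpq(1) by (simp_all add: posW posb)
      then show ?thesis by (simp add: inner_diff_left inner_diff_right)
    qed
    have "m c - m b = 0"
      by (rule orthogonal_to_frame[of "z p - z c" "z q - z c"])
        (use orth[of p] orth[of q] n m in \<open>auto simp: inner_commute n_def[symmetric]\<close>)
    then have mb: "m b = m c" by simp
    have "motion E' z m"
      unfolding motion_def
    proof (intro allI impI)
      fix s r assume sr: "{s, r} \<in> E'"
      then have srW: "s \<in> W" "r \<in> W" using E' by blast+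
      then have sb: "s \<noteq> b" "r \<noteq> b" using W(2) by auto
      from lift[OF sr] consider "{s, r} \<in> E" | "s = c" "{b, r} \<in> E" | "r = c" "{s, b} \<in> E" by blast
      then show "(z s - z r) \<bullet> (m s - m r) = 0"
      proof cases
        case 1
        then show ?thesis using me[of s r] srW sb by (auto simp: posW doubleton_eq_iff)
      next
        case 2
        show ?thesis
        proof (cases "r = c")
          case False
          then show ?thesis using me[of b r] srW sb 2 by (auto simp: posW posb doubleton_eq_iff mb)
        qed (use 2 in simp)
      next
        case 3
        show ?thesis
        proof (cases "s = c")
          case False
          then show ?thesis using me[of s b] srW sb 3 by (auto simp: posW posb doubleton_eq_iff mb)
        qed (use 3 in simp)
      qed
    qed
    moreover have "m i = 0" "m j = 0" "m k = 0" using m by auto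
    ultimately have "\<forall>w\<in>W. m w = 0" using pin unfolding pinned_def by blast
    then show "\<forall>w\<in>insert b W. m w = 0" using mb cpq(1) by auto
  qed
  then have "finite {t. \<not> row_trivial (insert b W) K {i, j, k} t}"
  proof (rule finite_not_row_trivial[rotated 3])
    show "finite (insert b W)" "{i, j, k} \<subseteq> insert b W" using W tri(1) by auto
    show "s \<in> insert b W \<and> r \<in> insert b W" if "(s, r, P') \<in> K" for s r P'
      using that E cpq(1) unfolding K_def by blast
  qed
  \<comment> \<open>Time 0 is excluded as well: only for \<open>t \<noteq> 0\<close> does the
    constraint of the edge \<open>cb\<close> imply the row \<open>n\<close>.\<close>
  then have "finite ({t. \<not> row_trivial (insert b W) K {i, j, k} t} \<union> {0})" by simp
  then obtain t where t: "t \<notin> {t. \<not> row_trivial (insert b W) K {i, j, k} t} \<union> {0}"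
    using ex_new_if_finite infinite_UNIV_char_0 by blast
  have "pinned i j k (insert b W) E (pos t)"
    unfolding pinned_def
  proof (intro conjI allI impI)
    show "ncol (pos t) i j k" using z(4) tri(1) by (simp add: ncol_def posW)
    fix m assume m: "motion E (pos t) m \<and> m i = 0 \<and> m j = 0 \<and> m k = 0"
    have "(pos t c - pos t b) \<bullet> (m c - m b) = 0" using m new(1) unfolding motion_def by blast
    then have "n \<bullet> (m c - m b) = 0" using t cpq(1) by (simp add: posW posb)
    then show "\<forall>w\<in>insert b W. m w = 0"
      using t m unfolding row_trivial_def rows motion_def by auto
  qed
  then have "trig (insert b W) E (pos t)"
    unfolding trig_def using tri by auto
  moreover have "pos t u = pos t v" using z(1) W(3,4) by (simp add: pos_def)
  ultimately show ?thesis unfolding gen_rigid_def by blast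
qed

text \<open>Rigidity of \<open>W\<close> makes the motion trivial there; after subtracting this
  trivial motion it vanishes on \<open>W\<close>, and the common triangle pins \<open>W'\<close>.
  Constraints of \<open>F'\<close> between vertices of \<open>W\<close> then hold by themselves, so
  such edges may be virtual, that is, absent from \<open>E\<close>.\<close>

lemma gen_rigid_glue:
  assumes fin: "finite W" "finite W'" and sub: "F \<subseteq> Pow W" "F' \<subseteq> Pow W'" "F \<subseteq> E" "\<And>a b. {a, b} \<in> F' \<Longrightarrow> {a, b} \<in> E \<or> {a, b} \<subseteq> W"
    and r: "gen_rigid u v W F" "gen_rigid u v W' F'"
    and abc: "distinct [a, b, c]" "{a, b, c} \<subseteq> W" "{a, b, c} \<subseteq> W'" "u = v \<or> \<not> {u, v} \<subseteq> {a, b, c}"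
  shows "gen_rigid u v (W \<union> W') E"
proof -
  obtain p where p: "p u = p v" "trig W F p" "trig W' F' p" "ncol p a b c"
    using gen_conj[OF gen_trig[OF fin(1) sub(1) r(1)] gen_conj[OF gen_trig[OF fin(2) sub(2) r(2)] gen_ncol[OF abc(1,4)]]]
    by (rule gen_obtain) blast
  have "rigid (W \<union> W') E p"
    unfolding rigid_def
  proof (intro allI impI)
    fix m assume m: "motion E p m"
    then have "motion F p m" using sub(3) motion_mono by blast
    then obtain t z where tz: "\<forall>w\<in>W. m w = t + cross3 z (p w)"
      using trig_imp_rigid[OF p(2)] unfolding rigid_def by meson
    define k where "k = (\<lambda>w. m w - (t + cross3 z (p w)))"
    have k: "motion E p k" unfolding k_def by (rule motion_diff[OF m motion_trivial])
    have k0: "k w = 0" if "w \<in> W" for w using tz that by (simp add: k_def)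
    have "motion F' p k"
      unfolding motion_def
    proof (intro allI impI)
      fix a b assume "{a, b} \<in> F'"
      with sub(4) consider "{a, b} \<in> E" | "{a, b} \<subseteq> W" by blast
      then show "(p a - p b) \<bullet> (k a - k b) = 0"
        by cases (use k in \<open>auto simp: motion_def k0\<close>)
    qed
    moreover have "pinned a b c W' F' p"
      using rigid_imp_pinned[OF trig_imp_rigid[OF p(3)] p(4)] abc(3) by simp
    moreover have "k a = 0" "k b = 0" "k c = 0" using k0 abc(2) by auto
    ultimately have "\<forall>w\<in>W'. k w = 0" unfolding pinned_def by blast
    then show "\<exists>t z. \<forall>w\<in>W \<union> W'. m w = t + cross3 z (p w)"
      using tz unfolding k_def by (metis UnE eq_iff_diff_eq_0)
  qed
  moreover obtain a' b' c' where *: "a' \<in> W" "b' \<in> W" "c' \<in> W" "{a', b'} \<in> F" "{b', c'} \<in> F" "{a', c'} \<in> F" "pinned a' b' c' W F p"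
    using p(2) unfolding trig_def by blast
  moreover have "ncol p a' b' c'" using *(7) by (simp add: pinned_def)
  ultimately have "trig (W \<union> W') E p"
    using rigid_imp_trig[of "W \<union> W'" E p a' b' c'] sub(3) by blast
  then show ?thesis using p(1) unfolding gen_rigid_def by blast
qed

lemma gen_rigid_attach:
  assumes fin: "finite W" and F: "F \<subseteq> Pow W" "F \<subseteq> E" and r: "gen_rigid u v W F"
    and abc: "distinct [a, b, c, d]" "{a, b, c} \<subseteq> W" "u = v \<or> \<not> {u, v} \<subseteq> {a, b, c, d}"
    and e: "{d, a} \<in> E" "{d, b} \<in> E" "{d, c} \<in> E"
  shows "gen_rigid u v (insert d W) E"
proof -
  obtain p where p: "p u = p v" "trig W F p" "ncop p a b c d"
    using gen_conj[OF gen_trig[OF fin F(1) r] gen_ncop[OF abc(1,3)]] by (rule gen_obtain) blast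
  have "rigid W E p" using trig_imp_rigid[OF p(2)] F(2) rigid_mono by blast
  then have "rigid (insert d W) E p"
    using rigid_attach[OF _ p(3) abc(2) e] by blast
  moreover obtain a' b' c' where *: "a' \<in> W" "b' \<in> W" "c' \<in> W" "{a', b'} \<in> F" "{b', c'} \<in> F" "{a', c'} \<in> F" "pinned a' b' c' W F p"
    using p(2) unfolding trig_def by blast
  moreover have "ncol p a' b' c'" using *(7) by (simp add: pinned_def)
  ultimately have "trig (insert d W) E p"
    using rigid_imp_trig[of "insert d W" E p a' b' c'] F(2) by blast
  then show ?thesis using p(1) unfolding gen_rigid_def by blast
qed

lemma gen_rigid_triangle:
  assumes "distinct [a, b, c]" "{a, b} \<in> E" "{b, c} \<in> E" "{a, c} \<in> E" "u = v \<or> \<not> {u, v} \<subseteq> {a, b, c}"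
  shows "gen_rigid u v {a, b, c} E"
proof -
  obtain p where p: "p u = p v" "ncol p a b c"
    using gen_ncol[OF assms(1,5)] by (rule gen_obtain)
  have "trig {a, b, c} E p"
    by (rule rigid_imp_trig[OF rigid_triangle[OF p(2) assms(2-4)] p(2) assms(2-4)]) auto
  then show ?thesis using p(1) unfolding gen_rigid_def by blast
qed

section \<open>Rigidity and the rank of the Jacobian\<close>

text \<open>Gaussian elimination. It serves both bounds on the rank: once the unknowns are
  coordinates of vertices, once they are the coefficients of a linear relation between rows.\<close>

lemma homogeneous_solution:
  fixes K :: "('i \<Rightarrow> real) set"
  assumes "finite K" "finite S" "card K < card S"
  shows "\<exists>f. (\<exists>i\<in>S. f i \<noteq> 0) \<and> (\<forall>r\<in>K. (\<Sum>i\<in>S. r i * f i) = 0)"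
  using assms
proof (induction "card K" arbitrary: K S rule: less_induct)
  case less
  show ?case
  proof (cases "\<exists>r\<in>K. \<exists>j\<in>S. r j \<noteq> 0")
    case False
    obtain j where "j \<in> S" using less.prems by fastforce
    then show ?thesis using False by (intro exI[of _ "\<lambda>_. 1"]) auto
  next
    case True
    then obtain r j where rj: "r \<in> K" "j \<in> S" "r j \<noteq> 0" by blast
    define K' where "K' = (\<lambda>s i. s i - s j / r j * r i) ` (K - {r})"
    have K1: "card (K - {r}) < card K" using rj less.prems by (meson card_Diff1_less)
    have "card K' \<le> card (K - {r})" using less.prems by (simp add: K'_def card_image_le)
    moreover have "card (S - {j}) = card S - 1" "card (K - {r}) = card K - 1" using rj less.prems by auto
    moreover have "card K > 0" using K1 by simp
    ultimately have "card K' < card K" "card K' < card (S - {j})" using less.prems(3) by linarith+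
    then obtain f where f: "\<exists>i\<in>S - {j}. f i \<noteq> 0" "\<forall>s\<in>K'. (\<Sum>i\<in>S - {j}. s i * f i) = 0"
      using less.hyps[of K' "S - {j}"] less.prems by (auto simp: K'_def)
    define c where "c = (\<Sum>i\<in>S - {j}. r i * f i)"
    define g where "g = f(j := - c / r j)"
    have gs: "(\<Sum>i\<in>S. s i * g i) = s j * (- c / r j) + (\<Sum>i\<in>S - {j}. s i * f i)" for s
    proof -
      have "(\<Sum>i\<in>S. s i * g i) = s j * g j + (\<Sum>i\<in>S - {j}. s i * g i)"
        using rj less.prems by (simp add: sum.remove)
      also have "(\<Sum>i\<in>S - {j}. s i * g i) = (\<Sum>i\<in>S - {j}. s i * f i)"
        by (rule sum.cong) (auto simp: g_def)
      finally show ?thesis by (simp add: g_def)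
    qed
    have "(\<Sum>i\<in>S. s i * g i) = 0" if "s \<in> K" for s
    proof (cases "s = r")
      case True
      then show ?thesis using rj by (simp add: gs c_def)
    next
      case False
      then have "(\<lambda>i. s i - s j / r j * r i) \<in> K'" using that by (auto simp: K'_def)
      from bspec[OF f(2) this] have "(\<Sum>i\<in>S - {j}. (s i - s j / r j * r i) * f i) = 0" .
      moreover have "(\<Sum>i\<in>S - {j}. (s i - s j / r j * r i) * f i) = (\<Sum>i\<in>S - {j}. s i * f i) - s j / r j * c"
        by (simp add: left_diff_distrib sum_subtractf c_def sum_distrib_left mult.assoc)
      ultimately show ?thesis by (simp add: gs)
    qed
    moreover have "\<exists>i\<in>S. g i \<noteq> 0" using f(1) by (auto simp: g_def)
    ultimately show ?thesis by blast
  qed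
qed

lemma jacobian_row_edge:
  "jacobian_row p {a, b} (w, i) = 2 * ((if w = a then 1 else 0) - (if w = b then 1 else 0)) * (p a - p b) $ i"
proof -
  define c :: real where "c = (if w = a then 1 else 0) - (if w = b then 1 else 0)"
  \<comment> \<open>Moving one coordinate shifts the edge vector along one axis, so the squared
    length is quadratic in \<open>t\<close> and the entry of the Jacobian is its linear coefficient
    at the point. The sign \<open>c\<close> records whether \<open>w\<close> is the first end, the
    second end or neither.\<close>
  have d: "set_coord p w i t a - set_coord p w i t b = (p a - p b) + ((t - p w $ i) * c) *\<^sub>R axis i 1" for t
    by (auto simp: vec_eq_iff set_coord_def c_def axis_def)
  have "rigidity_map (set_coord p w i t) {a, b} =
      (p a - p b) \<bullet> (p a - p b) + 2 * ((t - p w $ i) * c) * (p a - p b) $ i + ((t - p w $ i) * c)\<^sup>2" for t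
    unfolding rigidity_map_edge d power2_norm_eq_inner
    by (simp add: inner_add_left inner_add_right inner_axis inner_commute[of "axis i 1"] inner_axis_axis power2_eq_square)
      (simp add: algebra_simps)
  then have "(\<lambda>t. rigidity_map (set_coord p w i t) {a, b}) =
      (\<lambda>t. (p a - p b) \<bullet> (p a - p b) + 2 * ((t - p w $ i) * c) * (p a - p b) $ i + ((t - p w $ i) * c)\<^sup>2)" by blast
  moreover have "((\<lambda>t. (p a - p b) \<bullet> (p a - p b) + 2 * ((t - p w $ i) * c) * (p a - p b) $ i + ((t - p w $ i) * c)\<^sup>2)
      has_field_derivative 2 * c * (p a - p b) $ i) (at (p w $ i))"
    by (auto intro!: derivative_eq_intros)
  ultimately show ?thesis unfolding jacobian_row_def c_def[symmetric] by (simp add: DERIV_imp_deriv)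
qed

lemma sum_coords:
  fixes f g :: "'a \<times> 3 \<Rightarrow> real"
  shows "(\<Sum>z\<in>V \<times> UNIV. f z * g z) = (\<Sum>w\<in>V. (\<chi> i. f (w, i)) \<bullet> (\<chi> i. g (w, i)))"
proof -
  have "(\<Sum>z\<in>V \<times> UNIV. f z * g z) = (\<Sum>w\<in>V. \<Sum>i\<in>UNIV. f (w, i) * g (w, i))"
    by (simp add: sum.cartesian_product)
  then show ?thesis by (simp add: inner_vec_def)
qed

lemma jacobian_row_inner:
  assumes "finite V" "a \<in> V" "b \<in> V"
  shows "(\<Sum>z\<in>V \<times> UNIV. jacobian_row p {a, b} z * (\<lambda>(w, i). m w $ i) z) = 2 * ((p a - p b) \<bullet> (m a - m b))"
proof -
  have "(\<chi> i. jacobian_row p {a, b} (w, i)) = (if w = a then 2 *\<^sub>R (p a - p b) else 0) - (if w = b then 2 *\<^sub>R (p a - p b) else 0)" for w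
    by (simp add: vec_eq_iff jacobian_row_edge)
  then have "(\<Sum>z\<in>V \<times> UNIV. jacobian_row p {a, b} z * (\<lambda>(w, i). m w $ i) z) =
     (\<Sum>w\<in>V. (if w = a then 2 *\<^sub>R (p a - p b) \<bullet> m w else 0) - (if w = b then 2 *\<^sub>R (p a - p b) \<bullet> m w else 0))"
    unfolding sum_coords by (intro sum.cong) (auto simp: inner_diff_left vec_lambda_eta)
  also have "\<dots> = 2 *\<^sub>R (p a - p b) \<bullet> m a - 2 *\<^sub>R (p a - p b) \<bullet> m b"
    using assms by (simp add: sum_subtractf)
  finally show ?thesis by (simp add: inner_diff_right)
qed

lemma sum_fun_apply: "(\<Sum>b\<in>B. h b) z = (\<Sum>b\<in>B. h b z)" for h :: "'b \<Rightarrow> 'c \<Rightarrow> real"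
  by (induction B rule: infinite_finite_induct) auto

text \<open>Six generators of the trivial motions: \<open>True\<close> marks the translations along
  the axes, \<open>False\<close> the rotations about them.\<close>

definition triv_row :: "('a \<Rightarrow> real^3) \<Rightarrow> bool \<times> 3 \<Rightarrow> 'a \<times> 3 \<Rightarrow> real" where
  "triv_row p = (\<lambda>(s, k) (w, i). (if s then axis k 1 else cross3 (axis k 1) (p w)) $ i)"

lemma triv_row_sum:
  "(\<Sum>s\<in>UNIV. g s * triv_row p s (w, i)) =
     ((\<chi> k. g (True, k)) + cross3 (\<chi> k. g (False, k)) (p w)) $ i"
proof -
  have "(\<Sum>s\<in>UNIV. g s * triv_row p s (w, i)) = (\<Sum>c\<in>UNIV. \<Sum>k\<in>UNIV. g (c, k) * triv_row p (c, k) (w, i))"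
    by (simp add: sum.cartesian_product UNIV_Times_UNIV)
  also have "\<dots> = (\<Sum>k\<in>UNIV. g (True, k) * triv_row p (True, k) (w, i)) + (\<Sum>k\<in>UNIV. g (False, k) * triv_row p (False, k) (w, i))"
    by (simp add: UNIV_bool)
  also have "(\<Sum>k\<in>UNIV. g (True, k) * triv_row p (True, k) (w, i)) = g (True, i)"
    by (simp add: triv_row_def axis_def if_distrib[of "\<lambda>x. _ * x"] sum.delta' cong: if_cong)
  also have "(\<Sum>k\<in>UNIV. g (False, k) * triv_row p (False, k) (w, i)) = cross3 (\<chi> k. g (False, k)) (p w) $ i"
    using exhaust_3[of i] by (auto simp: triv_row_def sum_3 cross_components axis_def)
  finally show ?thesis by simp
qed

theorem rigid_imp_infinitesimally_rigid:
  fixes V :: "'a set"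
  assumes V: "finite V" and E: "\<And>e. e \<in> E \<Longrightarrow> \<exists>a\<in>V. \<exists>b\<in>V. e = {a, b}"
    and r: "rigid V E p" and abc: "a \<in> V" "b \<in> V" "c \<in> V" "ncol p a b c"
  shows "infinitesimally_rigid V E p"
proof -
  interpret F: vector_space "\<lambda>(c::real) (f :: 'a \<times> 3 \<Rightarrow> real) z. c * f z" by (rule vector_space_scale_fun)
  define S :: "('a \<times> 3) set" where "S = V \<times> UNIV"
  have S: "finite S" "card S = 3 * card V" using V by (auto simp: S_def card_cartesian_product)
  obtain B where B: "B \<subseteq> jacobian_row p ` E" "F.independent B" "jacobian_row p ` E \<subseteq> F.span B" "card B = F.dim (jacobian_row p ` E)"
    using F.basis_exists by blast
  have "E \<subseteq> Pow V" using E by blast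
  then have finE: "finite E" using V by (meson finite_Pow_iff finite_subset)
  then have finB: "finite B" using B(1) finite_surj by blast
  have dimB: "jacobian_rank E p = card B" using B(4) by (simp add: jacobian_rank_def)
  have triv_orth: "(\<Sum>z\<in>S. x z * ((\<lambda>(w, i). (t + cross3 s (p w)) $ i) z)) = 0" if xB: "x \<in> B" for x t s
  proof -
    obtain e where "e \<in> E" "x = jacobian_row p e" using xB B(1) by blast
    moreover from this obtain a b where "a \<in> V" "b \<in> V" "e = {a, b}" using E by blast
    ultimately show ?thesis
      using jacobian_row_inner[OF V, of a b p "\<lambda>w. t + cross3 s (p w)"] motion_trivial[of E p t s]
      by (simp add: S_def motion_def)
  qed
  \<comment> \<open>If the rows and the six generators together were too few, some nonzero vector
    would be orthogonal to all of them. Orthogonality to the rows makes it a motion, rigidity makes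
    it a combination of the generators on \<open>V\<close>, and so it is orthogonal to
    itself.\<close>
  have "3 * card V \<le> card B + 6"
  proof (rule ccontr)
    assume *: "\<not> ?thesis"
    define K where "K = B \<union> triv_row p ` UNIV"
    have "card (triv_row p ` UNIV) \<le> card (UNIV :: (bool \<times> 3) set)" by (rule card_image_le) simp
    also have "\<dots> = 6" by simp
    finally have "card K \<le> card B + 6" unfolding K_def using card_Un_le[of B "triv_row p ` UNIV"] by linarith
    then have "card K < card S" using * S by simp
    moreover have "finite K" using finB by (simp add: K_def)
    ultimately obtain f where f: "\<exists>z\<in>S. f z \<noteq> 0" "\<forall>x\<in>K. (\<Sum>z\<in>S. x z * f z) = 0"
      using homogeneous_solution S(1) by blast
    have sp: "(\<Sum>z\<in>S. x z * f z) = 0" if "x \<in> F.span B" for x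
      using that
    proof (induction rule: F.span_induct)
      case base
      show ?case
        unfolding F.subspace_def
        by (auto simp: distrib_right sum.distrib mult.assoc simp flip: sum_distrib_left)
    next
      case (step x)
      then show ?case using f(2) by (auto simp: K_def)
    qed
    define m where "m = (\<lambda>w. \<chi> i. f (w, i))"
    have fm: "(\<lambda>(w, i). m w $ i) = f" by (auto simp: m_def)
    have "motion E p m"
      unfolding motion_def
    proof (intro allI impI)
      fix a b assume ab: "{a, b} \<in> E"
      then have "a \<in> V" "b \<in> V" using \<open>E \<subseteq> Pow V\<close> by blast+
      moreover have "(\<Sum>z\<in>S. jacobian_row p {a, b} z * f z) = 0" using sp B(3) ab by blast
      ultimately show "(p a - p b) \<bullet> (m a - m b) = 0"
        using jacobian_row_inner[OF V, of a b p m] unfolding fm S_def by simp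
    qed
    then obtain t s where ts: "\<forall>w\<in>V. m w = t + cross3 s (p w)" using r unfolding rigid_def by meson
    define g where "g = (\<lambda>(c, k). if c then t $ k else s $ k)"
    have "(\<Sum>z\<in>S. f z * f z) = (\<Sum>z\<in>S. \<Sum>c\<in>UNIV. g c * (triv_row p c z * f z))"
    proof (intro sum.cong refl)
      fix z assume "z \<in> S"
      then obtain w i where wi: "z = (w, i)" "w \<in> V" by (auto simp: S_def)
      have "f z = m w $ i" by (simp add: m_def wi)
      also have "\<dots> = (t + cross3 s (p w)) $ i" using ts wi(2) by simp
      also have "\<dots> = (\<Sum>c\<in>UNIV. g c * triv_row p c (w, i))"
        unfolding triv_row_sum by (simp add: g_def vec_lambda_eta)
      finally have "f z = (\<Sum>c\<in>UNIV. g c * triv_row p c z)" using wi by simp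
      then have "f z * f z = (\<Sum>c\<in>UNIV. g c * triv_row p c z) * f z" by simp
      then show "f z * f z = (\<Sum>c\<in>UNIV. g c * (triv_row p c z * f z))"
        by (simp add: sum_distrib_right mult.assoc)
    qed
    also have "\<dots> = (\<Sum>c\<in>UNIV. g c * (\<Sum>z\<in>S. triv_row p c z * f z))"
      by (subst sum.swap) (simp add: sum_distrib_left)
    also have "\<dots> = 0" using f(2) by (auto simp: K_def intro!: sum.neutral)
    finally have "\<forall>z\<in>S. f z * f z = 0" using S(1) by (simp add: sum_nonneg_eq_0_iff)
    then show False using f(1) by auto
  qed
  \<comment> \<open>If the rows of the basis and the six generators were too many, they would
    satisfy a linear relation. Its two halves are orthogonal to each other, so both vanish; the
    noncollinear triple kills the coefficients of the generators and the independence of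
    \<open>B\<close> kills the rest.\<close>
  moreover have "card B + 6 \<le> 3 * card V"
  proof (rule ccontr)
    assume *: "\<not> ?thesis"
    define J :: "(('a \<times> 3 \<Rightarrow> real) + bool \<times> 3) set" where "J = Inl ` B \<union> Inr ` UNIV"
    have "card J = card B + 6"
      unfolding J_def using finB by (subst card_Un_disjoint) (auto simp: card_image)
    define K where "K = (\<lambda>z. case_sum (\<lambda>x. x z) (\<lambda>c. triv_row p c z)) ` S"
    have "card K \<le> card S" using S(1) by (simp add: K_def card_image_le)
    then have "card K < card J" using * S(2) \<open>card J = _\<close> by simp
    moreover have "finite K" "finite J" using S(1) finB by (auto simp: K_def J_def)
    ultimately obtain g where g: "\<exists>j\<in>J. g j \<noteq> 0" "\<forall>x\<in>K. (\<Sum>j\<in>J. x j * g j) = 0"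
      using homogeneous_solution by blast
    define t s where "t = (\<chi> k. g (Inr (True, k)))" and "s = (\<chi> k. g (Inr (False, k)))"
    define h where "h = (\<lambda>(w, i). (t + cross3 s (p w)) $ i)"
    define f where "f = (\<lambda>z. \<Sum>x\<in>B. g (Inl x) * x z)"
    have fh: "f z = - h z" if "z \<in> S" for z
    proof -
      have "(\<Sum>j\<in>J. case_sum (\<lambda>x. x z) (\<lambda>c. triv_row p c z) j * g j) = 0"
        using g(2) that by (auto simp: K_def)
      moreover have "(\<Sum>j\<in>J. case_sum (\<lambda>x. x z) (\<lambda>c. triv_row p c z) j * g j) =
        (\<Sum>x\<in>B. x z * g (Inl x)) + (\<Sum>c\<in>UNIV. triv_row p c z * g (Inr c))"
        unfolding J_def using finB by (subst sum.union_disjoint) (auto simp: sum.reindex)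
      moreover have "(\<Sum>c\<in>UNIV. triv_row p c z * g (Inr c)) = h z"
        using triv_row_sum[of "\<lambda>c. g (Inr c)" p "fst z" "snd z"]
        by (simp add: mult.commute h_def t_def s_def case_prod_beta)
      ultimately show ?thesis by (simp add: f_def mult.commute)
    qed
    have "(\<Sum>z\<in>S. f z * h z) = (\<Sum>z\<in>S. \<Sum>x\<in>B. g (Inl x) * (x z * h z))"
      by (simp add: f_def sum_distrib_right mult.assoc)
    also have "\<dots> = (\<Sum>x\<in>B. g (Inl x) * (\<Sum>z\<in>S. x z * h z))"
      by (subst sum.swap) (simp add: sum_distrib_left)
    also have "\<dots> = 0" using triv_orth[of _ t s] by (intro sum.neutral) (auto simp: h_def)
    finally have "(\<Sum>z\<in>S. f z * h z) = 0" .
    moreover have "(\<Sum>z\<in>S. f z * h z) = - (\<Sum>z\<in>S. h z * h z)"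
      by (simp add: fh sum_negf[symmetric])
    ultimately have "(\<Sum>z\<in>S. h z * h z) = 0" by simp
    then have h0: "h z = 0" if "z \<in> S" for z using S(1) that by (simp add: sum_nonneg_eq_0_iff)
    have "t + cross3 s (p w) = 0" if "w \<in> V" for w
    proof (rule vec_eq_iff[THEN iffD2], rule allI)
      fix i
      show "(t + cross3 s (p w)) $ i = 0 $ i" using h0[of "(w, i)"] that by (simp add: h_def S_def)
    qed
    then have "s = 0" "t = 0" using trivial_vanish[OF abc(4)] abc by blast+
    then have gr: "g (Inr c) = 0" for c by (cases c; cases "fst c") (auto simp: t_def s_def vec_eq_iff)
    \<comment> \<open>The relation was solved on the coordinates of \<open>V\<close> only, whereas
      independence concerns functions on all coordinates.\<close>
    have out: "x z = 0" if xB: "x \<in> B" and zS: "z \<notin> S" for x z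
    proof -
      obtain e where "e \<in> E" "x = jacobian_row p e" using xB B(1) by blast
      moreover from this obtain a b where "a \<in> V" "b \<in> V" "e = {a, b}" using E by blast
      moreover obtain w i where "z = (w, i)" by fastforce
      ultimately show ?thesis using zS by (auto simp: jacobian_row_edge S_def)
    qed
    have "f z = 0" for z
    proof (cases "z \<in> S")
      case True then show ?thesis using fh h0 by simp
    next
      case False then show ?thesis unfolding f_def by (intro sum.neutral) (auto simp: out)
    qed
    then have "(\<Sum>x\<in>B. (\<lambda>z. g (Inl x) * x z)) = 0" by (auto simp: fun_eq_iff sum_fun_apply f_def)
    then have "g (Inl x) = 0" if "x \<in> B" for x
      using F.independentD[OF B(2) finB subset_refl _ that, of "\<lambda>x. g (Inl x)"] by blast
    then show False using g(1) gr by (auto simp: J_def)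
  qed
  ultimately show ?thesis unfolding infinitesimally_rigid_def dimB by simp
qed

section \<open>Triangulated spheres and boundaries mod 2\<close>

text \<open>The boundary operator of simplicial homology mod 2. Chains are sets, and addition is the
  symmetric difference.\<close>

definition bd :: "'a set set \<Rightarrow> 'a set set" where
  "bd X = {e. card e = 2 \<and> odd (card {f \<in> X. e \<subseteq> f})}"

definition edges :: "'a set set \<Rightarrow> 'a set set" where
  "edges F = {e. card e = 2 \<and> (\<exists>f\<in>F. e \<subseteq> f)}"

definition even_set :: "'a set set \<Rightarrow> bool" where
  "even_set Z \<longleftrightarrow> (\<forall>w. even (card {e \<in> Z. w \<in> e}))"

text \<open>In terms of homology mod 2, the last clause says that every 1-cycle bounds, and the one
  before it says that the only nonzero 2-cycle is \<open>F\<close>. Links of vertices are not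
  mentioned: their connectedness is derived in \<open>link_connected\<close> from the last
  clause.\<close>

definition spherical :: "'a set set \<Rightarrow> bool" where
  "spherical F \<longleftrightarrow> finite F \<and> F \<noteq> {} \<and> (\<forall>f\<in>F. card f = 3) \<and>
     (\<forall>e\<in>edges F. card {f \<in> F. e \<subseteq> f} = 2) \<and>
     (\<forall>X\<subseteq>F. bd X = {} \<longrightarrow> X = {} \<or> X = F) \<and>
     (\<forall>Z\<subseteq>edges F. even_set Z \<longrightarrow> (\<exists>X\<subseteq>F. bd X = Z))"

definition adj :: "'a set set \<Rightarrow> 'a \<Rightarrow> 'a \<Rightarrow> bool" where
  "adj F a b \<longleftrightarrow> a \<noteq> b \<and> (\<exists>f\<in>F. a \<in> f \<and> b \<in> f)"

lemma adjI: "f \<in> F \<Longrightarrow> a \<in> f \<Longrightarrow> b \<in> f \<Longrightarrow> a \<noteq> b \<Longrightarrow> adj F a b"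
  by (auto simp: adj_def)

lemma adj_commute: "adj F a b \<longleftrightarrow> adj F b a"
  by (auto simp: adj_def)

lemma adj_irrefl [simp]: "\<not> adj F a a"
  by (simp add: adj_def)

lemma adj_edges: "adj F a b \<longleftrightarrow> {a, b} \<in> edges F"
  by (cases "a = b") (auto simp: adj_def edges_def)

lemma edgesE:
  assumes "e \<in> edges F" obtains a b where "e = {a, b}" "a \<noteq> b" "adj F a b"
  using assms unfolding edges_def adj_def by (auto simp: card_2_iff)

lemma edge_at:
  assumes "e \<in> edges F" "w \<in> e" obtains a where "e = {w, a}" "a \<noteq> w" "adj F w a"
proof -
  obtain a b where "e = {a, b}" "a \<noteq> b" "adj F a b" using edgesE[OF assms(1)] by metis
  then show thesis using assms(2) that[of a] that[of b] adj_commute[of F a b] by (auto simp: insert_commute)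
qed

lemma sphericalD:
  assumes "spherical F"
  shows "finite F" "F \<noteq> {}" "\<And>f. f \<in> F \<Longrightarrow> card f = 3"
    "\<And>e. e \<in> edges F \<Longrightarrow> card {f \<in> F. e \<subseteq> f} = 2"
    "\<And>X. X \<subseteq> F \<Longrightarrow> bd X = {} \<Longrightarrow> X = {} \<or> X = F"
    "\<And>Z. Z \<subseteq> edges F \<Longrightarrow> even_set Z \<Longrightarrow> \<exists>X\<subseteq>F. bd X = Z"
  using assms unfolding spherical_def by - (elim conjE, (assumption | blast))+

lemma spherical_face: "spherical F \<Longrightarrow> f \<in> F \<Longrightarrow> card f = 3 \<and> finite f"
  using sphericalD(3)[of F f] by (metis card_ge_0_finite zero_less_numeral)

lemma spherical_finite: "spherical F \<Longrightarrow> finite F \<and> finite (\<Union>F)"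
  using sphericalD(1) spherical_face by (metis finite_Union)

lemma finite_edges: "spherical F \<Longrightarrow> finite (edges F)"
  using spherical_finite[of F] by (rule_tac finite_subset[of _ "Pow (\<Union>F)"]) (auto simp: edges_def)

lemma triple_cases:
  assumes "card f = 3" "a \<in> f" "b \<in> f" "a \<noteq> b"
  obtains c where "f = {a, b, c}" "c \<noteq> a" "c \<noteq> b"
proof -
  have "card (f - {a, b}) = 1" using assms by (simp add: card_Diff_subset)
  then obtain c where "f - {a, b} = {c}" using card_1_singletonE by blast
  then show thesis using assms by (intro that[of c]) blast+
qed

lemma card3_other: "card f = 3 \<Longrightarrow> \<exists>a\<in>f. a \<noteq> w"
proof (rule ccontr)
  assume f: "card f = 3" and "\<not> (\<exists>a\<in>f. a \<noteq> w)"
  then have "f \<subseteq> {w}" by blast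
  then show False using f card_mono[of "{w}" f] by simp
qed

lemma face_at:
  assumes "spherical F" "f \<in> F" "a \<in> f" "b \<in> f" "a \<noteq> b"
  obtains c where "f = {a, b, c}" "c \<noteq> a" "c \<noteq> b"
  using spherical_face[OF assms(1,2)] assms triple_cases by metis

lemma face_distinct:
  assumes "spherical F" "{a, b, c} \<in> F" shows "a \<noteq> b" "a \<noteq> c" "b \<noteq> c"
  using spherical_face[OF assms] by (auto simp: card_insert_if split: if_splits)

lemma face_adj:
  assumes "spherical F" "{a, b, c} \<in> F"
  shows "adj F a b" "adj F b c" "adj F a c" "adj F b a" "adj F c b" "adj F c a"
  using face_distinct[OF assms] by (auto intro!: adjI[OF assms(2)])

lemma edge_card: "spherical F \<Longrightarrow> e \<in> edges F \<Longrightarrow> card {f \<in> F. e \<subseteq> f} = 2"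
  by (rule sphericalD(4))

lemma two_faces:
  assumes "spherical F" "adj F a b"
  obtains c d where "c \<noteq> d" "{a, b, c} \<in> F" "{a, b, d} \<in> F"
    "\<And>f. f \<in> F \<Longrightarrow> a \<in> f \<Longrightarrow> b \<in> f \<Longrightarrow> f = {a, b, c} \<or> f = {a, b, d}"
proof -
  have "card {f \<in> F. {a, b} \<subseteq> f} = 2" using edge_card[OF assms(1)] assms(2) adj_edges by metis
  then obtain f g where fg: "{f \<in> F. {a, b} \<subseteq> f} = {f, g}" "f \<noteq> g" by (auto simp: card_2_iff)
  then have f: "f \<in> F" "a \<in> f" "b \<in> f" "g \<in> F" "a \<in> g" "b \<in> g" by blast+
  have ab: "a \<noteq> b" using assms(2) by (auto simp: adj_def)
  obtain c where c: "f = {a, b, c}" using face_at[OF assms(1) f(1-3) ab] by blast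
  obtain d where d: "g = {a, b, d}" using face_at[OF assms(1) f(4-6) ab] by blast
  show thesis
  proof (rule that[of c d])
    show "c \<noteq> d" using fg c d by auto
    show "{a, b, c} \<in> F" "{a, b, d} \<in> F" using f c d by auto
    show "h = {a, b, c} \<or> h = {a, b, d}" if "h \<in> F" "a \<in> h" "b \<in> h" for h
      using fg(1) that c d by blast
  qed
qed

lemma other_face:
  assumes "spherical F" "{a, b, c} \<in> F" obtains d where "d \<noteq> c" "{a, b, d} \<in> F"
proof -
  have "adj F a b" using face_adj assms by metis
  from two_faces[OF assms(1) this] obtain c' d' where *: "c' \<noteq> d'" "{a, b, c'} \<in> F" "{a, b, d'} \<in> F" by metis
  show thesis
  proof (cases "c' = c")
    case True then show ?thesis using that[of d'] * by auto
  next
    case False then show ?thesis using that[of c'] * by auto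
  qed
qed

lemma at_most_two_faces:
  assumes "spherical F" "{a, b, c} \<in> F" "{a, b, d} \<in> F" "{a, b, e} \<in> F" "c \<noteq> d" "c \<noteq> e"
  shows "d = e"
proof -
  have "adj F a b" using face_adj assms by metis
  from two_faces[OF assms(1) this] obtain c' d' where
    *: "\<And>f. f \<in> F \<Longrightarrow> a \<in> f \<Longrightarrow> b \<in> f \<Longrightarrow> f = {a, b, c'} \<or> f = {a, b, d'}" by metis
  have ne: "a \<noteq> c" "b \<noteq> c" "a \<noteq> d" "b \<noteq> d" "a \<noteq> e" "b \<noteq> e" using face_distinct assms(1-4) by metis+
  have *: "x = c' \<or> x = d'" if "{a, b, x} \<in> F" "a \<noteq> x" "b \<noteq> x" for x
  proof -
    have "{a, b, x} = {a, b, c'} \<or> {a, b, x} = {a, b, d'}" using *[OF that(1)] by blast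
    then have "x \<in> {a, b, c'} \<or> x \<in> {a, b, d'}" by blast
    then show ?thesis using that by auto
  qed
  show ?thesis using *[OF assms(2)] *[OF assms(3)] *[OF assms(4)] ne assms(5,6) by metis
qed

lemma vertex_adj:
  assumes "spherical F" "w \<in> \<Union>F" obtains a where "adj F w a"
proof -
  obtain f where f: "f \<in> F" "w \<in> f" using assms(2) by blast
  then obtain a where "a \<in> f" "a \<noteq> w"
    using card3_other[of f w] spherical_face[OF assms(1) f(1)] by blast
  then show thesis using that[of a] f by (auto simp: adj_def)
qed

lemma odd_card_ex:
  assumes "odd (card {x \<in> X. Q x})" obtains x where "x \<in> X" "Q x"
proof (rule ccontr)
  assume "\<not> thesis"
  then have e: "{x \<in> X. Q x} = {}" using that by blast
  show False using assms unfolding e by simp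
qed

lemma odd_card_double_count:
  assumes "finite A" "finite B"
  shows "odd (card {a \<in> A. odd (card {b \<in> B. R a b})}) \<longleftrightarrow> odd (card {b \<in> B. odd (card {a \<in> A. R a b})})"
proof -
  have c: "card {x \<in> C. Q x} = (\<Sum>x\<in>C. if Q x then 1 else 0)" if "finite C" for C :: "'c set" and Q
    using that by (simp add: sum.If_cases Int_def)
  have "(\<Sum>a\<in>A. card {b \<in> B. R a b}) = (\<Sum>a\<in>A. \<Sum>b\<in>B. if R a b then 1 else 0)"
    using assms by (simp add: sum.If_cases Int_def)
  also have "\<dots> = (\<Sum>b\<in>B. \<Sum>a\<in>A. if R a b then 1 else 0)" by (rule sum.swap)
  also have "\<dots> = (\<Sum>b\<in>B. card {a \<in> A. R a b})" using assms by (simp add: sum.If_cases Int_def)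
  finally show ?thesis
    using even_sum_iff[OF assms(1), of "\<lambda>a. card {b \<in> B. R a b}"]
      even_sum_iff[OF assms(2), of "\<lambda>b. card {a \<in> A. R a b}"] by simp
qed

lemma odd_card_sym_diff:
  assumes "finite X" "finite Y"
  shows "odd (card {f \<in> sym_diff X Y. Q f}) \<longleftrightarrow> odd (card {f \<in> X. Q f}) \<noteq> odd (card {f \<in> Y. Q f})"
proof -
  let ?X = "{f \<in> X. Q f}" and ?Y = "{f \<in> Y. Q f}"
  have "{f \<in> sym_diff X Y. Q f} = (?X - ?Y) \<union> (?Y - ?X)" by blast
  moreover have "card ((?X - ?Y) \<union> (?Y - ?X)) = card (?X - ?Y) + card (?Y - ?X)"
    using assms by (intro card_Un_disjoint) auto
  moreover have "card ?X = card (?X - ?Y) + card (?X \<inter> ?Y)" "card ?Y = card (?Y - ?X) + card (?X \<inter> ?Y)"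
    using assms by (auto simp: card_Diff_subset_Int Int_commute card_mono)
  ultimately show ?thesis by auto
qed

lemma even_set_sym_diff:
  assumes "finite Z" "finite Z'" "even_set Z" "even_set Z'" shows "even_set (sym_diff Z Z')"
  using assms odd_card_sym_diff[OF assms(1,2)] unfolding even_set_def by blast

lemma bd_sym_diff:
  assumes "finite X" "finite Y" shows "e \<in> bd (sym_diff X Y) \<longleftrightarrow> (e \<in> bd X) \<noteq> (e \<in> bd Y)"
  using odd_card_sym_diff[OF assms] by (auto simp: bd_def)

lemma bd_empty [simp]: "bd {} = {}"
  by (simp add: bd_def)

lemma bd_subset_edges: "bd X \<subseteq> edges X"
proof
  fix e assume "e \<in> bd X"
  then have "card e = 2" "odd (card {f \<in> X. e \<subseteq> f})" by (auto simp: bd_def)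
  moreover from this(2) obtain f where "f \<in> X" "e \<subseteq> f" by (rule odd_card_ex)
  ultimately show "e \<in> edges X" by (auto simp: edges_def)
qed

lemma edges_mono: "X \<subseteq> Y \<Longrightarrow> edges X \<subseteq> edges Y"
  by (auto simp: edges_def)

lemma card_edges_at:
  assumes "card f = 3" "w \<in> f" shows "card {e. e \<subseteq> f \<and> card e = 2 \<and> w \<in> e} = 2"
proof -
  obtain a where "a \<in> f" "a \<noteq> w"
    using card3_other[of f w] assms by blast
  then obtain b where f: "f = {w, a, b}" "b \<noteq> w" "b \<noteq> a" using triple_cases[of f w a] assms by metis
  have "{e. e \<subseteq> f \<and> card e = 2 \<and> w \<in> e} = {{w, a}, {w, b}}"
  proof (intro equalityI subsetI)
    fix e assume "e \<in> {e. e \<subseteq> f \<and> card e = 2 \<and> w \<in> e}"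
    then have e: "e \<subseteq> {w, a, b}" "card e = 2" "w \<in> e" using f by auto
    then obtain x where "e = {w, x}" "x \<noteq> w" by (auto simp: card_2_iff)
    then show "e \<in> {{w, a}, {w, b}}" using e(1) by auto
  qed (use f \<open>a \<noteq> w\<close> in auto)
  moreover have "{w, a} \<noteq> {w, b}" using f by (auto simp: doubleton_eq_iff)
  ultimately show ?thesis by simp
qed

text \<open>Every face at \<open>w\<close> has exactly two edges at \<open>w\<close>.\<close>

lemma even_card_odd_edges_at:
  assumes "finite X" "\<And>f. f \<in> X \<Longrightarrow> card f = 3"
  shows "even (card {e. card e = 2 \<and> w \<in> e \<and> odd (card {f \<in> X. e \<subseteq> f})})"
proof -
  have fin: "finite (\<Union>X)" using assms by (metis card_ge_0_finite finite_Union zero_less_numeral)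
  define A where "A = {e. e \<subseteq> \<Union>X \<and> card e = 2 \<and> w \<in> e}"
  have "finite A" by (rule finite_subset[of _ "Pow (\<Union>X)"]) (use fin in \<open>auto simp: A_def\<close>)
  have e1: "{e. card e = 2 \<and> w \<in> e \<and> odd (card {f \<in> X. e \<subseteq> f})} = {e \<in> A. odd (card {f \<in> X. e \<subseteq> f})}"
    (is "?L = ?R")
  proof (intro equalityI subsetI)
    fix e assume e: "e \<in> ?L"
    then have "odd (card {f \<in> X. e \<subseteq> f})" by blast
    then obtain f where "f \<in> X" "e \<subseteq> f" by (rule odd_card_ex)
    then show "e \<in> ?R" using e by (auto simp: A_def)
  qed (auto simp: A_def)
  have e2: "{f \<in> X. odd (card {e \<in> A. e \<subseteq> f})} = {}"
  proof -
    have "even (card {e \<in> A. e \<subseteq> f})" if "f \<in> X" for f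
    proof (cases "w \<in> f")
      case True
      have "{e \<in> A. e \<subseteq> f} = {e. e \<subseteq> f \<and> card e = 2 \<and> w \<in> e}" using that by (auto simp: A_def)
      then show ?thesis using card_edges_at[OF assms(2)[OF that] True] by simp
    next
      case False
      then have e: "{e \<in> A. e \<subseteq> f} = {}" by (auto simp: A_def)
      show ?thesis unfolding e by simp
    qed
    then show ?thesis by blast
  qed
  show ?thesis
    using odd_card_double_count[OF \<open>finite A\<close> assms(1), of "\<lambda>e f. e \<subseteq> f"] unfolding e1 e2 by simp
qed

lemma even_set_bd:
  assumes "finite X" "\<And>f. f \<in> X \<Longrightarrow> card f = 3" shows "even_set (bd X)"
  unfolding even_set_def
proof
  fix w
  have "{e \<in> bd X. w \<in> e} = {e. card e = 2 \<and> w \<in> e \<and> odd (card {f \<in> X. e \<subseteq> f})}"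
    by (auto simp: bd_def)
  then show "even (card {e \<in> bd X. w \<in> e})" using even_card_odd_edges_at[OF assms, of w] by simp
qed

text \<open>A walk read mod 2: the degrees cancel except at its ends, and repeated vertices do no
  harm.\<close>

lemma path_chain:
  assumes "spherical F" "(a, b) \<in> {(s, t). adj F s t \<and> s \<noteq> w \<and> t \<noteq> w}\<^sup>*"
  shows "\<exists>Z\<subseteq>edges F. (\<forall>e\<in>Z. w \<notin> e) \<and> (\<forall>z. odd (card {e \<in> Z. z \<in> e}) \<longleftrightarrow> (z = a) \<noteq> (z = b))"
  using assms(2)
proof (induction rule: rtrancl_induct)
  case base
  show ?case by (intro exI[of _ "{}"]) simp
next
  case (step b c)
  then obtain Z where Z: "Z \<subseteq> edges F" "\<forall>e\<in>Z. w \<notin> e" "\<And>z. odd (card {e \<in> Z. z \<in> e}) \<longleftrightarrow> (z = a) \<noteq> (z = b)"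
    by blast
  have bc: "adj F b c" "b \<noteq> w" "c \<noteq> w" using step by auto
  then have "b \<noteq> c" by (auto simp: adj_def)
  have fin: "finite Z" using Z(1) finite_edges[OF assms(1)] finite_subset by blast
  have one: "odd (card {e \<in> {{b, c}}. z \<in> e}) \<longleftrightarrow> z = b \<or> z = c" for z
  proof -
    have "{e \<in> {{b, c}}. z \<in> e} = (if z = b \<or> z = c then {{b, c}} else {})" by auto
    then show ?thesis by auto
  qed
  have 1: "sym_diff Z {{b, c}} \<subseteq> edges F" using Z(1) bc(1) adj_edges[of F b c] by blast
  have 2: "\<forall>e\<in>sym_diff Z {{b, c}}. w \<notin> e" using Z(2) bc by auto
  have 3: "odd (card {e \<in> sym_diff Z {{b, c}}. z \<in> e}) \<longleftrightarrow> (z = a) \<noteq> (z = c)" for z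
  proof -
    have "odd (card {e \<in> sym_diff Z {{b, c}}. z \<in> e}) \<longleftrightarrow> ((z = a) \<noteq> (z = b)) \<noteq> (z = b \<or> z = c)"
      unfolding odd_card_sym_diff[OF fin finite.insertI[OF finite.emptyI]] Z(3) one ..
    then show ?thesis using \<open>b \<noteq> c\<close> by argo
  qed
  show ?case by (rule exI[of _ "sym_diff Z {{b, c}}"]) (intro conjI 1 2 allI 3)
qed

lemmas spherical_minimal = sphericalD(5)

lemma bd_emptyI:
  assumes "spherical F" "X \<subseteq> F"
    and "\<And>e f g. e \<in> edges F \<Longrightarrow> f \<in> X \<Longrightarrow> g \<in> F \<Longrightarrow> e \<subseteq> f \<Longrightarrow> e \<subseteq> g \<Longrightarrow> g \<in> X"
  shows "bd X = {}"
proof (rule ccontr)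
  assume "bd X \<noteq> {}"
  then obtain e where e: "e \<in> bd X" by blast
  then have eF: "e \<in> edges F" using subsetD[OF edges_mono[OF assms(2)] subsetD[OF bd_subset_edges]] by blast
  from e have "odd (card {f \<in> X. e \<subseteq> f})" by (simp add: bd_def)
  then obtain f where "f \<in> X" "e \<subseteq> f" by (rule odd_card_ex)
  then have "{f \<in> X. e \<subseteq> f} = {f \<in> F. e \<subseteq> f}" using assms(2,3) eF by blast
  then show False using e edge_card[OF assms(1) eF] by (simp add: bd_def)
qed

text \<open>Every edge has an end other than \<open>w\<close>. So the faces that meet one component
  of the graph without \<open>w\<close> have no boundary edge, and by minimality they are all the
  faces.\<close>

lemma connected_minus_vertex:
  assumes F: "spherical F" and a: "a \<in> \<Union>F" "a \<noteq> w" and b: "b \<in> \<Union>F" "b \<noteq> w"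
  shows "(a, b) \<in> {(s, t). adj F s t \<and> s \<noteq> w \<and> t \<noteq> w}\<^sup>*"
proof -
  define R where "R = {(s, t). adj F s t \<and> s \<noteq> w \<and> t \<noteq> w}"
  define K where "K = {t. (a, t) \<in> R\<^sup>*}"
  have Kw: "t \<noteq> w" if "t \<in> K" for t
    using that a(2) unfolding K_def mem_Collect_eq by (induction rule: rtrancl_induct) (auto simp: R_def)
  have Kcl: "t \<in> K" if "s \<in> K" "adj F s t" "t \<noteq> w" for s t
    using that Kw[OF that(1)] unfolding K_def mem_Collect_eq R_def
    by (metis (mono_tags, lifting) CollectI case_prodI rtrancl.rtrancl_into_rtrancl)
  define X where "X = {f \<in> F. f \<inter> K \<noteq> {}}"
  have "bd X = {}"
  proof (rule bd_emptyI[OF F])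
    show "X \<subseteq> F" by (auto simp: X_def)
    fix e f g assume *: "e \<in> edges F" "f \<in> X" "g \<in> F" "e \<subseteq> f" "e \<subseteq> g"
    obtain k where k: "k \<in> f" "k \<in> K" "f \<in> F" using *(2) by (auto simp: X_def)
    obtain s t where st: "e = {s, t}" "s \<noteq> t" using *(1) edgesE by metis
    then obtain z where z: "z \<in> e" "z \<noteq> w" by (metis insertCI)
    have "z \<in> K"
    proof (cases "z = k")
      case False
      then have "adj F k z" using k z *(4) by (auto simp: adj_def)
      then show ?thesis using Kcl k z by blast
    qed (use k in simp)
    then show "g \<in> X" using z * by (auto simp: X_def)
  qed
  moreover have "X \<noteq> {}"
  proof -
    obtain f where "f \<in> F" "a \<in> f" using a by blast
    moreover have "a \<in> K" by (simp add: K_def)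
    ultimately show ?thesis by (auto simp: X_def)
  qed
  moreover have "X \<subseteq> F" by (auto simp: X_def)
  ultimately have "X = F" using spherical_minimal[OF F, of X] by simp
  moreover obtain g where g: "g \<in> F" "b \<in> g" using b by blast
  ultimately obtain k where k: "k \<in> g" "k \<in> K" by (auto simp: X_def)
  have "b \<in> K"
  proof (cases "b = k")
    case False
    then have "adj F k b" using k g by (auto simp: adj_def)
    then show ?thesis using Kcl k b by blast
  qed (use k in simp)
  then show ?thesis by (simp add: K_def R_def)
qed

text \<open>A splitting of the faces at \<open>w\<close> into two groups not sharing an edge at \<open>w\<close> would be
  detected by a cycle through \<open>w\<close> that uses one edge of each group: being a boundary, it meets
  every group in an even number of edges.\<close>

lemma link_connected:
  assumes F: "spherical F" and P: "P \<subseteq> {f \<in> F. w \<in> f}" "P \<noteq> {}"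
    and cl: "\<And>e f g. card e = 2 \<Longrightarrow> w \<in> e \<Longrightarrow> f \<in> P \<Longrightarrow> g \<in> F \<Longrightarrow> e \<subseteq> f \<Longrightarrow> e \<subseteq> g \<Longrightarrow> g \<in> P"
  shows "P = {f \<in> F. w \<in> f}"
proof (rule ccontr)
  assume "P \<noteq> {f \<in> F. w \<in> f}"
  then obtain g where g: "g \<in> F" "w \<in> g" "g \<notin> P" using P(1) by blast
  obtain f where f: "f \<in> P" using P(2) by blast
  have other: "\<exists>a\<in>h. a \<noteq> w" if "h \<in> F" for h
    using card3_other[of h w] spherical_face[OF F that] by blast
  obtain a where a: "a \<in> f" "a \<noteq> w" using other f P(1) by blast
  obtain b where b: "b \<in> g" "b \<noteq> w" using other g(1) by blast
  have fF: "f \<in> F" "w \<in> f" using f P(1) by auto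
  have aV: "a \<in> \<Union>F" "b \<in> \<Union>F" using a b fF g by auto
  obtain Z where Z: "Z \<subseteq> edges F" "\<forall>e\<in>Z. w \<notin> e" "\<And>z. odd (card {e \<in> Z. z \<in> e}) \<longleftrightarrow> (z = a) \<noteq> (z = b)"
    using path_chain[OF F connected_minus_vertex[OF F aV(1) a(2) aV(2) b(2)]] by blast
  have ab: "a \<noteq> b" using cl[of "{w, a}" f g] a b f fF g by auto
  have finZ: "finite Z" using Z(1) finite_edges[OF F] finite_subset by blast
  define Y where "Y = {{w, a}, {w, b}}"
  have wab: "{w, a} \<noteq> {w, b}" using ab by (auto simp: doubleton_eq_iff)
  have YE: "Y \<subseteq> edges F" using a b fF g by (auto simp: Y_def edges_def)
  have oddY: "odd (card {e \<in> Y. z \<in> e}) \<longleftrightarrow> (z = a) \<noteq> (z = b)" for z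
  proof -
    have "{e \<in> Y. z \<in> e} = (if z = w then Y else if z = a then {{w, a}} else if z = b then {{w, b}} else {})"
      using a(2) b(2) ab by (auto simp: Y_def)
    moreover have "card Y = 2" using wab by (simp add: Y_def)
    ultimately show ?thesis using a(2) b(2) ab by auto
  qed
  have finY: "finite Y" by (simp add: Y_def)
  have "even_set (sym_diff Z Y)"
    unfolding even_set_def using odd_card_sym_diff[OF finZ finY] Z(3) oddY by blast
  moreover have "sym_diff Z Y \<subseteq> edges F" using Z(1) YE by blast
  ultimately obtain X where X: "X \<subseteq> F" "bd X = sym_diff Z Y"
    using sphericalD(6)[OF F] by blast
  have bdw: "e \<in> bd X \<longleftrightarrow> e \<in> Y" if "w \<in> e" for e using X(2) Z(2) that by blast
  define Q where "Q = X \<inter> P"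
  have finX: "finite X" using X(1) spherical_finite[OF F] finite_subset by blast
  have "{e. card e = 2 \<and> w \<in> e \<and> odd (card {h \<in> Q. e \<subseteq> h})} = {{w, a}}"
  proof (intro equalityI subsetI)
    fix e assume e: "e \<in> {e. card e = 2 \<and> w \<in> e \<and> odd (card {h \<in> Q. e \<subseteq> h})}"
    then have "odd (card {h \<in> Q. e \<subseteq> h})" by blast
    then obtain h where "h \<in> Q" "e \<subseteq> h" by (rule odd_card_ex)
    then have h: "h \<in> X" "h \<in> P" "e \<subseteq> h" by (auto simp: Q_def)
    have "{k \<in> Q. e \<subseteq> k} = {k \<in> X. e \<subseteq> k}" using cl[of e h] e h X(1) by (auto simp: Q_def)
    then have "e \<in> bd X" using e by (simp add: bd_def)
    then have "e \<in> Y" using bdw e by blast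
    moreover have "e \<noteq> {w, b}" using cl[of e h g] e h g b by auto
    ultimately show "e \<in> {{w, a}}" by (auto simp: Y_def)
  next
    fix e assume "e \<in> {{w, a}}"
    then have e: "e = {w, a}" by simp
    then have "e \<in> bd X" using bdw[of e] by (simp add: Y_def)
    moreover have "{k \<in> Q. e \<subseteq> k} = {k \<in> X. e \<subseteq> k}" using cl[of e f] e f fF a X(1) by (auto simp: Q_def)
    ultimately show "e \<in> {e. card e = 2 \<and> w \<in> e \<and> odd (card {h \<in> Q. e \<subseteq> h})}"
      using e by (auto simp: bd_def)
  qed
  moreover have "finite Q" "\<And>h. h \<in> Q \<Longrightarrow> card h = 3"
    using finX X(1) spherical_face[OF F] by (auto simp: Q_def)
  ultimately show False using even_card_odd_edges_at[of Q w] by simp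
qed

section \<open>Separations of the vertex set\<close>

text \<open>The two sides overlap in the separator, and the order is the size of the overlap. In
  this form two separations can be crossed simply by forming unions and intersections of their
  sides.\<close>

definition nsep :: "'a set set \<Rightarrow> 'a set \<Rightarrow> 'a set \<Rightarrow> bool" where
  "nsep F A B \<longleftrightarrow> A \<union> B = \<Union>F \<and> A - B \<noteq> {} \<and> B - A \<noteq> {} \<and> (\<forall>a\<in>A - B. \<forall>b\<in>B - A. \<not> adj F a b)"

text \<open>For a sphere this amounts to the absence of separations of order 3; the two directions
  are \<open>flag_nsep_card\<close> and \<open>flagI_nsep\<close>.\<close>

definition flag :: "'a set set \<Rightarrow> bool" where
  "flag F \<longleftrightarrow> (\<forall>a b c. adj F a b \<and> adj F b c \<and> adj F a c \<longrightarrow> {a, b, c} \<in> F)"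

lemma flagD: "flag F \<Longrightarrow> adj F a b \<Longrightarrow> adj F b c \<Longrightarrow> adj F a c \<Longrightarrow> {a, b, c} \<in> F"
  by (simp add: flag_def)

lemma nsep_commute: "nsep F A B \<longleftrightarrow> nsep F B A"
  unfolding nsep_def by (metis adj_commute sup_commute)

lemma nsepD:
  assumes "nsep F A B"
  shows "A \<union> B = \<Union>F" "A - B \<noteq> {}" "B - A \<noteq> {}" "\<And>a b. a \<in> A \<Longrightarrow> a \<notin> B \<Longrightarrow> b \<in> B \<Longrightarrow> b \<notin> A \<Longrightarrow> \<not> adj F a b"
  using assms by (auto simp: nsep_def)

lemma adj_in: "adj F a b \<Longrightarrow> a \<in> \<Union>F \<and> b \<in> \<Union>F"
  by (auto simp: adj_def)

lemma nsep_face: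
  assumes "nsep F A B" "f \<in> F" shows "f \<subseteq> A \<or> f \<subseteq> B"
proof (rule ccontr)
  assume "\<not> ?thesis"
  then obtain a b where ab: "a \<in> f" "a \<notin> B" "b \<in> f" "b \<notin> A" by blast
  have "f \<subseteq> A \<union> B" using nsepD(1)[OF assms(1)] assms(2) by blast
  then have "a \<in> A" "b \<in> B" using ab by auto
  moreover from this have "adj F a b" using ab by (intro adjI[OF assms(2)]) auto
  ultimately show False using nsepD(4)[OF assms(1)] ab by blast
qed

lemma nsep_adj:
  assumes "nsep F A B" "adj F a b" "a \<in> A" "a \<notin> B" shows "b \<in> A"
  using nsepD(1)[OF assms(1)] nsepD(4)[OF assms(1), of a b] adj_in[OF assms(2)] assms(2-4) by auto

lemma nsep_adj':
  assumes "nsep F A B" "adj F a b" "a \<in> B" "a \<notin> A" shows "b \<in> B"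
  using nsep_adj[of F B A a b] assms nsep_commute[of F A B] by simp

lemma nsep_finite: "spherical F \<Longrightarrow> nsep F A B \<Longrightarrow> finite A \<and> finite B"
  using spherical_finite[of F] nsepD(1)[of F A B] by (metis finite_Un)

text \<open>Take the faces at \<open>s\<close> that reach strictly into \<open>A\<close>. As
  \<open>s\<close> has a neighbour strictly inside \<open>B\<close>, they are not all the faces at
  \<open>s\<close>, so by connectedness of the link their boundary has edges at \<open>s\<close>,
  and an even number of them. The other end of such an edge lies in the separator: if it were
  strictly inside \<open>A\<close>, both faces at the edge would reach into
  \<open>A\<close>.\<close>

lemma nsep_neighbours:
  assumes F: "spherical F" and n: "nsep F A B" and s: "s \<in> A" "s \<in> B"
    and a: "a \<in> A" "a \<notin> B" "adj F s a" and b: "b \<in> B" "b \<notin> A" "adj F s b"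
  obtains t1 t2 a1 a2 where "t1 \<noteq> t2" "t1 \<in> A" "t1 \<in> B" "t2 \<in> A" "t2 \<in> B" "t1 \<noteq> s" "t2 \<noteq> s"
    "{s, t1, a1} \<in> F" "{s, t2, a2} \<in> F" "a1 \<in> A" "a1 \<notin> B" "a2 \<in> A" "a2 \<notin> B"
proof -
  define P where "P = {f \<in> F. s \<in> f \<and> f \<inter> (A - B) \<noteq> {}}"
  have PF: "P \<subseteq> {f \<in> F. s \<in> f}" by (auto simp: P_def)
  define T where "T = {e. card e = 2 \<and> s \<in> e \<and> odd (card {f \<in> P. e \<subseteq> f})}"
  have "finite P" using PF spherical_finite[OF F] by (metis (no_types, lifting) finite_subset mem_Collect_eq subsetI subset_iff)
  moreover have "card f = 3" if "f \<in> P" for f using that spherical_face[OF F, of f] by (simp add: P_def)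
  ultimately have evT: "even (card T)" unfolding T_def by (intro even_card_odd_edges_at)
  have TE: "T \<subseteq> edges F"
  proof
    fix e assume "e \<in> T"
    then have "card e = 2" "odd (card {f \<in> P. e \<subseteq> f})" by (auto simp: T_def)
    moreover from this(2) obtain f where "f \<in> P" "e \<subseteq> f" by (rule odd_card_ex)
    ultimately show "e \<in> edges F" by (auto simp: edges_def P_def)
  qed
  have finT: "finite T" using TE finite_edges[OF F] finite_subset by blast
  have "T \<noteq> {}"
  proof
    assume T0: "T = {}"
    obtain h where h: "h \<in> F" "s \<in> h" "a \<in> h" using a(3) by (auto simp: adj_def)
    have "P = {f \<in> F. s \<in> f}"
    proof (rule link_connected[OF F PF])
      show "P \<noteq> {}" using h a by (auto simp: P_def)
      fix e f g assume e: "card e = 2" "s \<in> e" "f \<in> P" "g \<in> F" "e \<subseteq> f" "e \<subseteq> g"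
      have "e \<in> edges F" using e by (auto simp: edges_def P_def)
      then have c2: "card {f \<in> F. e \<subseteq> f} = 2" by (rule edge_card[OF F])
      have fin: "finite {f \<in> F. e \<subseteq> f}" using c2 by (metis card.infinite zero_neq_numeral)
      have sub: "{f \<in> P. e \<subseteq> f} \<subseteq> {f \<in> F. e \<subseteq> f}" by (auto simp: P_def)
      have "even (card {f \<in> P. e \<subseteq> f})" using T0 e(1,2) unfolding T_def by blast
      moreover have "card {f \<in> P. e \<subseteq> f} \<noteq> 0"
        using e(3,5) finite_subset[OF sub fin] by auto
      moreover have "card {f \<in> P. e \<subseteq> f} \<le> 2" using card_mono[OF fin sub] c2 by simp
      ultimately have "card {f \<in> P. e \<subseteq> f} = 2" by presburger
      then have "{f \<in> P. e \<subseteq> f} = {f \<in> F. e \<subseteq> f}" using card_subset_eq[OF fin sub] c2 by simp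
      then show "g \<in> P" using e by blast
    qed
    moreover obtain g where g: "g \<in> F" "s \<in> g" "b \<in> g" using b(3) by (auto simp: adj_def)
    ultimately have "g \<inter> (A - B) \<noteq> {}" by (auto simp: P_def)
    then show False using nsep_face[OF n g(1)] g(3) b(2) by blast
  qed
  then have "card T \<noteq> 0" using finT by simp
  then have "2 \<le> card T" using evT by presburger
  then obtain e1 e2 where e12: "e1 \<in> T" "e2 \<in> T" "e1 \<noteq> e2" by (meson card_2_iff' ex_card subset_iff)
  have key: "\<exists>t a'. e = {s, t} \<and> t \<noteq> s \<and> t \<in> A \<and> t \<in> B \<and> {s, t, a'} \<in> F \<and> a' \<in> A \<and> a' \<notin> B" if eT: "e \<in> T" for e
  proof -
    have e: "card e = 2" "s \<in> e" "odd (card {f \<in> P. e \<subseteq> f})" "e \<in> edges F" using eT TE by (auto simp: T_def)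
    obtain t where t: "e = {s, t}" "t \<noteq> s" using edge_at[OF e(4,2)] by metis
    from e(3) obtain f where f: "f \<in> P" "e \<subseteq> f" by (rule odd_card_ex)
    then obtain a' where a': "a' \<in> f" "a' \<in> A" "a' \<notin> B" "f \<in> F" by (auto simp: P_def)
    have fA: "f \<subseteq> A" using nsep_face[OF n a'(4)] a' by blast
    have tB: "t \<in> B"
    proof (rule ccontr)
      assume "t \<notin> B"
      then have "{f \<in> P. e \<subseteq> f} = {f \<in> F. e \<subseteq> f}" using t fA f by (auto simp: P_def)
      then show False using e(3) edge_card[OF F e(4)] by simp
    qed
    have "t \<noteq> a'" "s \<noteq> a'" using a' tB s by auto
    obtain c where "f = {s, t, c}" using face_at[OF F a'(4), of s t] f t by auto
    then have "f = {s, t, a'}" using a' \<open>t \<noteq> a'\<close> \<open>s \<noteq> a'\<close> by auto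
    then show ?thesis using t tB fA a' f by auto
  qed
  obtain t1 a1 where 1: "e1 = {s, t1}" "t1 \<noteq> s" "t1 \<in> A" "t1 \<in> B" "{s, t1, a1} \<in> F" "a1 \<in> A" "a1 \<notin> B"
    using key[OF e12(1)] by metis
  obtain t2 a2 where 2: "e2 = {s, t2}" "t2 \<noteq> s" "t2 \<in> A" "t2 \<in> B" "{s, t2, a2} \<in> F" "a2 \<in> A" "a2 \<notin> B"
    using key[OF e12(2)] by metis
  show thesis using that[of t1 t2 a1 a2] 1 2 e12(3) by metis
qed

lemma nsep_shrink:
  assumes n: "nsep F A B" and s: "s \<in> A" "s \<in> B" and no: "\<And>b. b \<in> B \<Longrightarrow> b \<notin> A \<Longrightarrow> \<not> adj F s b"
  shows "nsep F A (B - {s})"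
  unfolding nsep_def
proof (intro conjI ballI)
  show "A \<union> (B - {s}) = \<Union>F" using nsepD(1)[OF n] s by blast
  show "A - (B - {s}) \<noteq> {}" "B - {s} - A \<noteq> {}" using nsepD(2,3)[OF n] s by blast+
  fix a b assume "a \<in> A - (B - {s})" "b \<in> B - {s} - A"
  then show "\<not> adj F a b" using nsepD(4)[OF n, of a b] no[of b] by auto
qed

text \<open>Vertices of the separator that have no neighbour strictly on one of the sides are
  removed from that side one at a time. In the end either the separator is empty, which minimality
  of the sphere excludes, or each of its vertices has two neighbours inside it.\<close>

lemma nsep_card_ge_3:
  assumes F: "spherical F" and n: "nsep F A B" shows "3 \<le> card (A \<inter> B)"
  using n
proof (induction "card (A \<inter> B)" arbitrary: A B rule: less_induct)
  case less
  note n = less.prems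
  have fin: "finite A" "finite B" using nsep_finite[OF F n] by auto
  have n': "nsep F B A" using n nsep_commute by blast
  have red: "card (A \<inter> (B - {s})) < card (A \<inter> B)" "card (B \<inter> (A - {s})) < card (A \<inter> B)" if "s \<in> A" "s \<in> B" for s
    using that fin by (auto intro!: psubset_card_mono)
  show ?case
  proof (cases "\<exists>s\<in>A \<inter> B. (\<forall>b. b \<in> B \<and> b \<notin> A \<longrightarrow> \<not> adj F s b) \<or> (\<forall>a. a \<in> A \<and> a \<notin> B \<longrightarrow> \<not> adj F s a)")
    case True
    then obtain s where s: "s \<in> A" "s \<in> B"
      "(\<forall>b. b \<in> B \<and> b \<notin> A \<longrightarrow> \<not> adj F s b) \<or> (\<forall>a. a \<in> A \<and> a \<notin> B \<longrightarrow> \<not> adj F s a)" by blast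
    from s(3) show ?thesis
    proof
      assume "\<forall>b. b \<in> B \<and> b \<notin> A \<longrightarrow> \<not> adj F s b"
      then have "nsep F A (B - {s})" using nsep_shrink[OF n s(1,2)] by blast
      then show ?thesis using less.hyps[OF red(1)[OF s(1,2)]] red(1)[OF s(1,2)] by linarith
    next
      assume "\<forall>a. a \<in> A \<and> a \<notin> B \<longrightarrow> \<not> adj F s a"
      then have "nsep F B (A - {s})" using nsep_shrink[OF n' s(2,1)] by blast
      then show ?thesis using less.hyps[OF red(2)[OF s(1,2)]] red(2)[OF s(1,2)] by linarith
    qed
  next
    case False
    show ?thesis
    proof (cases "A \<inter> B = {}")
      case True
      define X where "X = {f \<in> F. f \<subseteq> A}"
      have "bd X = {}"
      proof (rule bd_emptyI[OF F])
        show "X \<subseteq> F" by (auto simp: X_def)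
        fix e f g assume e: "e \<in> edges F" "f \<in> X" "g \<in> F" "e \<subseteq> f" "e \<subseteq> g"
        obtain s where "s \<in> e" using e(1) by (auto simp: edges_def card_2_iff)
        then have "s \<in> A" "s \<in> g" using e by (auto simp: X_def)
        then have "\<not> g \<subseteq> B" using True by blast
        then show "g \<in> X" using nsep_face[OF n e(3)] e(3) by (simp add: X_def)
      qed
      moreover have XF: "X \<subseteq> F" by (auto simp: X_def)
      ultimately have "X = {} \<or> X = F" by (intro spherical_minimal[OF F])
      moreover obtain a where a: "a \<in> A" "a \<notin> B" using nsepD(2)[OF n] by blast
      moreover obtain b where b: "b \<in> B" "b \<notin> A" using nsepD(3)[OF n] by blast
      moreover obtain f where f: "f \<in> F" "a \<in> f" using nsepD(1)[OF n] a by blast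
      moreover obtain g where g: "g \<in> F" "b \<in> g" using nsepD(1)[OF n] b by blast
      moreover have "f \<in> X" using nsep_face[OF n f(1)] f a by (auto simp: X_def)
      moreover have "g \<notin> X" using g b by (auto simp: X_def)
      ultimately show ?thesis by blast
    next
      case ne: False
      then obtain s where s: "s \<in> A" "s \<in> B" by blast
      then obtain a b where "a \<in> A" "a \<notin> B" "adj F s a" "b \<in> B" "b \<notin> A" "adj F s b" using False by blast
      then obtain t1 t2 a1 a2 where t: "t1 \<noteq> t2" "t1 \<in> A" "t1 \<in> B" "t2 \<in> A" "t2 \<in> B" "t1 \<noteq> s" "t2 \<noteq> s"
        using nsep_neighbours[OF F n s] by metis
      then have "{s, t1, t2} \<subseteq> A \<inter> B" "card {s, t1, t2} = 3" using s by auto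
      then show ?thesis using card_mono[of "A \<inter> B" "{s, t1, t2}"] fin by simp
    qed
  qed
qed

lemma nsep_minimal_neighbour:
  assumes F: "spherical F" and n: "nsep F A B" and s: "s \<in> A" "s \<in> B"
    and min: "\<And>A' B'. nsep F A' B' \<Longrightarrow> card (A \<inter> B) \<le> card (A' \<inter> B')"
  obtains b where "b \<in> B" "b \<notin> A" "adj F s b"
proof (rule ccontr)
  assume "\<not> thesis"
  then have "nsep F A (B - {s})" using nsep_shrink[OF n s] that by blast
  moreover have "card (A \<inter> (B - {s})) < card (A \<inter> B)"
    using s nsep_finite[OF F n] by (auto intro!: psubset_card_mono)
  ultimately show False using min by (meson leD)
qed

lemma nsep3_neighbour:
  assumes F: "spherical F" and n: "nsep F A B" "card (A \<inter> B) \<le> 3" and s: "s \<in> A" "s \<in> B"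
  obtains b where "b \<in> B" "b \<notin> A" "adj F s b"
proof (rule nsep_minimal_neighbour[OF F n(1) s])
  show "card (A \<inter> B) \<le> card (A' \<inter> B')" if "nsep F A' B'" for A' B'
    using nsep_card_ge_3[OF F that] n(2) by linarith
qed (use that in blast)

text \<open>A separator of order 3 contains only two vertices besides \<open>s\<close>, and
  \<open>nsep_neighbours\<close> produces two neighbours of \<open>s\<close> there.\<close>

lemma nsep3_clique:
  assumes F: "spherical F" and n: "nsep F A B" "card (A \<inter> B) \<le> 3" and s: "s \<in> A" "s \<in> B" and r: "r \<in> A" "r \<in> B" "r \<noteq> s"
  shows "adj F s r"
proof -
  have n': "nsep F B A" "card (B \<inter> A) \<le> 3" using n nsep_commute by (auto simp: Int_commute)
  obtain b where b: "b \<in> B" "b \<notin> A" "adj F s b" using nsep3_neighbour[OF F n s] by metis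
  obtain a where a: "a \<in> A" "a \<notin> B" "adj F s a" using nsep3_neighbour[OF F n' s(2,1)] by metis
  obtain t1 t2 a1 a2 where t: "t1 \<noteq> t2" "t1 \<in> A" "t1 \<in> B" "t2 \<in> A" "t2 \<in> B" "t1 \<noteq> s" "t2 \<noteq> s"
    "{s, t1, a1} \<in> F" "{s, t2, a2} \<in> F"
    using nsep_neighbours[OF F n(1) s a b] by metis
  have fin: "finite (A \<inter> B)" using nsep_finite[OF F n(1)] by simp
  have "{s, t1, t2} \<subseteq> A \<inter> B" "card {s, t1, t2} = 3" using s t by auto
  then have "{s, t1, t2} = A \<inter> B" using n(2) card_seteq[OF fin] by metis
  then have "r = t1 \<or> r = t2" using r by blast
  then show ?thesis using t face_adj[OF F] by metis
qed

lemma nsep3_triangle: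
  assumes F: "spherical F" and n: "nsep F A B" "card (A \<inter> B) \<le> 3"
  obtains a b c where "A \<inter> B = {a, b, c}" "distinct [a, b, c]" "adj F a b" "adj F b c" "adj F a c"
proof -
  have "card (A \<inter> B) = 3" using nsep_card_ge_3[OF F n(1)] n(2) by simp
  then obtain a b c where abc: "A \<inter> B = {a, b, c}" "a \<noteq> b" "a \<noteq> c" "b \<noteq> c" by (auto simp: card_3_iff)
  then have "a \<in> A" "a \<in> B" "b \<in> A" "b \<in> B" "c \<in> A" "c \<in> B" by blast+
  then show thesis using that[of a b c] abc nsep3_clique[OF F n] by simp
qed

text \<open>Let \<open>t1\<close>, \<open>t2\<close> be the neighbours found from the side of
  \<open>A\<close>, and \<open>r1\<close> one found from the side of \<open>B\<close>. If
  \<open>t1\<close> and \<open>t2\<close> are adjacent, then \<open>s t1 t2\<close> is a face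
  because \<open>F\<close> is flag. The edge \<open>s t1\<close> now has a face towards
  \<open>A\<close> and the face \<open>s t1 t2\<close>, so no third one towards \<open>B\<close>,
  and \<open>r1\<close> differs from \<open>t1\<close>. If \<open>t1\<close> and \<open>r1\<close>
  were adjacent too, then \<open>r1 = t2\<close>, and the edge \<open>s t2\<close> would lie in
  three faces.\<close>

lemma nsep_nonadjacent_neighbours:
  assumes F: "spherical F" and fl: "flag F" and n: "nsep F A B" and s: "s \<in> A" "s \<in> B"
    and a: "a \<in> A" "a \<notin> B" "adj F s a" and b: "b \<in> B" "b \<notin> A" "adj F s b"
  obtains t1 t2 where "t1 \<in> A" "t1 \<in> B" "t2 \<in> A" "t2 \<in> B" "t1 \<noteq> t2" "adj F s t1" "adj F s t2" "\<not> adj F t1 t2"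
proof -
  have n': "nsep F B A" using n nsep_commute by blast
  obtain t1 t2 a1 a2 where t: "t1 \<noteq> t2" "t1 \<in> A" "t1 \<in> B" "t2 \<in> A" "t2 \<in> B" "t1 \<noteq> s" "t2 \<noteq> s"
    "{s, t1, a1} \<in> F" "{s, t2, a2} \<in> F" "a1 \<in> A" "a1 \<notin> B" "a2 \<in> A" "a2 \<notin> B"
    using nsep_neighbours[OF F n s a b] by metis
  obtain r1 r2 b1 b2 where r: "r1 \<noteq> r2" "r1 \<in> B" "r1 \<in> A" "r2 \<in> B" "r2 \<in> A" "r1 \<noteq> s" "r2 \<noteq> s"
    "{s, r1, b1} \<in> F" "{s, r2, b2} \<in> F" "b1 \<in> B" "b1 \<notin> A" "b2 \<in> B" "b2 \<notin> A"
    using nsep_neighbours[OF F n' s(2,1) b a] by metis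
  have ad: "adj F s t1" "adj F s t2" "adj F s r1" "adj F s r2"
    using face_adj(1)[OF F t(8)] face_adj(1)[OF F t(9)] face_adj(1)[OF F r(8)] face_adj(1)[OF F r(9)] by auto
  show thesis
  proof (cases "adj F t1 t2 \<and> adj F t1 r1")
    case False
    show ?thesis
    proof (cases "adj F t1 t2")
      case False
      then show ?thesis using that[of t1 t2] t ad by blast
    next
      case True
      have st: "{s, t1, t2} \<in> F" by (rule flagD[OF fl ad(1) True ad(2)])
      have "r1 \<noteq> t1"
      proof
        assume "r1 = t1"
        then have "{s, t1, b1} \<in> F" using r by simp
        then have "b1 = t2" using at_most_two_faces[OF F t(8), of b1 t2] st t r by auto
        then show False using r t by simp
      qed
      then show ?thesis using that[of t1 r1] t r ad True \<open>\<not> (adj F t1 t2 \<and> adj F t1 r1)\<close> by blast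
    qed
  next
    case True
    have st: "{s, t1, t2} \<in> F" by (rule flagD[OF fl ad(1) _ ad(2)]) (use True in simp)
    have sr: "{s, t1, r1} \<in> F" by (rule flagD[OF fl ad(1) _ ad(3)]) (use True in simp)
    have "r1 = t2" using at_most_two_faces[OF F t(8) sr st] t r by auto
    then have 1: "{s, t2, b1} \<in> F" "{s, t2, t1} \<in> F" using r st by (auto simp: insert_commute)
    have "b1 = t1" using at_most_two_faces[OF F t(9) 1] t r by auto
    then show ?thesis using r t by simp
  qed
qed

lemma flag_nsep_card:
  assumes F: "spherical F" and fl: "flag F" and n: "nsep F A B" shows "4 \<le> card (A \<inter> B)"
proof (rule ccontr)
  assume "\<not> ?thesis"
  then have c: "card (A \<inter> B) \<le> 3" by simp
  have n': "nsep F B A" "card (B \<inter> A) \<le> 3" using n c nsep_commute by (auto simp: Int_commute)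
  obtain s where s: "s \<in> A" "s \<in> B" using nsep_card_ge_3[OF F n] by (metis IntE card.empty equals0I not_numeral_le_zero)
  obtain b where b: "b \<in> B" "b \<notin> A" "adj F s b" using nsep3_neighbour[OF F n c s] by metis
  obtain a where a: "a \<in> A" "a \<notin> B" "adj F s a" using nsep3_neighbour[OF F n' s(2,1)] by metis
  obtain t1 t2 where "t1 \<in> A" "t1 \<in> B" "t2 \<in> A" "t2 \<in> B" "t1 \<noteq> t2" "\<not> adj F t1 t2"
    using nsep_nonadjacent_neighbours[OF F fl n s a b] by metis
  then show False using nsep3_clique[OF F n c, of t1 t2] by blast
qed

lemma nsep4_neighbour:
  assumes F: "spherical F" and fl: "flag F" and n: "nsep F A B" "card (A \<inter> B) \<le> 4" and s: "s \<in> A" "s \<in> B"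
  obtains b where "b \<in> B" "b \<notin> A" "adj F s b"
proof (rule nsep_minimal_neighbour[OF F n(1) s])
  show "card (A \<inter> B) \<le> card (A' \<inter> B')" if "nsep F A' B'" for A' B'
    using flag_nsep_card[OF F fl that] n(2) by linarith
qed (use that in blast)

lemma nsep4_nonadjacent:
  assumes F: "spherical F" and fl: "flag F" and n: "nsep F A B" "card (A \<inter> B) \<le> 4" and s: "s \<in> A" "s \<in> B"
  obtains t1 t2 where "t1 \<in> A" "t1 \<in> B" "t2 \<in> A" "t2 \<in> B" "t1 \<noteq> t2" "adj F s t1" "adj F s t2" "\<not> adj F t1 t2"
proof -
  have n': "nsep F B A" "card (B \<inter> A) \<le> 4" using n nsep_commute by (auto simp: Int_commute)
  obtain b where b: "b \<in> B" "b \<notin> A" "adj F s b" using nsep4_neighbour[OF F fl n s] by metis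
  obtain a where a: "a \<in> A" "a \<notin> B" "adj F s a" using nsep4_neighbour[OF F fl n' s(2,1)] by metis
  show thesis using nsep_nonadjacent_neighbours[OF F fl n(1) s a b] that by metis
qed

lemma triangle_even:
  assumes "distinct [a, b, c]" shows "even_set {{a, b}, {b, c}, {a, c}}"
  unfolding even_set_def
proof
  fix w
  have "{e \<in> {{a, b}, {b, c}, {a, c}}. w \<in> e} =
    (if w = a then {{a, b}, {a, c}} else if w = b then {{a, b}, {b, c}} else if w = c then {{b, c}, {a, c}} else {})"
    using assms by auto
  then show "even (card {e \<in> {{a, b}, {b, c}, {a, c}}. w \<in> e})"
    using assms by (auto simp: doubleton_eq_iff card_insert_if)
qed

lemma bd_faces:
  assumes F: "spherical F" and X: "X \<subseteq> F" and e: "e \<in> edges F" "e \<notin> bd X" and f: "f \<in> X" "e \<subseteq> f" and g: "g \<in> F" "e \<subseteq> g"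
  shows "g \<in> X"
proof -
  have c2: "card {f \<in> F. e \<subseteq> f} = 2" by (rule edge_card[OF F e(1)])
  have fin: "finite {f \<in> F. e \<subseteq> f}" using c2 by (metis card.infinite zero_neq_numeral)
  have sub: "{f \<in> X. e \<subseteq> f} \<subseteq> {f \<in> F. e \<subseteq> f}" using X by auto
  have "even (card {f \<in> X. e \<subseteq> f})" using e by (simp add: bd_def edges_def)
  moreover have "card {f \<in> X. e \<subseteq> f} \<noteq> 0" using f finite_subset[OF sub fin] by auto
  moreover have "card {f \<in> X. e \<subseteq> f} \<le> 2" using card_mono[OF fin sub] c2 by simp
  ultimately have "card {f \<in> X. e \<subseteq> f} = 2" by presburger
  then have "{f \<in> X. e \<subseteq> f} = {f \<in> F. e \<subseteq> f}" using card_subset_eq[OF fin sub] c2 by simp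
  then show ?thesis using g by blast
qed

lemma bd_both_sides:
  assumes F: "spherical F" and X: "X \<subseteq> F" and e: "e \<in> bd X"
  obtains f g where "f \<in> X" "e \<subseteq> f" "g \<in> F" "g \<notin> X" "e \<subseteq> g"
proof -
  have o: "odd (card {f \<in> X. e \<subseteq> f})" using e by (simp add: bd_def)
  then obtain f where f: "f \<in> X" "e \<subseteq> f" by (rule odd_card_ex)
  have "e \<in> edges F" using e bd_subset_edges[of X] edges_mono[OF X] by auto
  then have c2: "card {f \<in> F. e \<subseteq> f} = 2" by (rule edge_card[OF F])
  then have "{f \<in> X. e \<subseteq> f} \<noteq> {f \<in> F. e \<subseteq> f}" using o by auto
  then obtain g where "g \<in> F" "g \<notin> X" "e \<subseteq> g" using X by blast
  then show thesis using that f by blast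
qed

text \<open>The Jordan curve theorem for a triangle. Its edges bound a set \<open>X\<close> of
  faces, and the sides are the vertices of \<open>X\<close> and those of the remaining faces. A
  common vertex off the triangle would have a link that is split by \<open>X\<close> without a
  boundary edge.\<close>

lemma nonfacial_triangle_nsep:
  assumes F: "spherical F" and t: "adj F a b" "adj F b c" "adj F a c" and nf: "{a, b, c} \<notin> F"
  obtains A B where "nsep F A B" "A \<inter> B = {a, b, c}"
proof -
  have d: "a \<noteq> b" "b \<noteq> c" "a \<noteq> c" using t by (auto simp: adj_def)
  define Z where "Z = {{a, b}, {b, c}, {a, c}}"
  have "Z \<subseteq> edges F" using t adj_edges[of F a b] adj_edges[of F b c] adj_edges[of F a c] by (simp add: Z_def)
  moreover have "even_set Z" unfolding Z_def by (rule triangle_even) (use d in auto)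
  ultimately obtain X where X: "X \<subseteq> F" "bd X = Z" using sphericalD(6)[OF F] by blast
  define A B where "A = \<Union>X" and "B = \<Union>(F - X)"
  have ZAB: "z \<in> A \<and> z \<in> B" if "e \<in> Z" "z \<in> e" for e z
  proof -
    have "e \<in> bd X" using X(2) that(1) by simp
    then obtain f g where "f \<in> X" "e \<subseteq> f" "g \<in> F" "g \<notin> X" "e \<subseteq> g"
      by (rule bd_both_sides[OF F X(1)])
    then show ?thesis using that(2) unfolding A_def B_def by blast
  qed
  have sub: "{a, b, c} \<subseteq> A \<inter> B" using ZAB[of "{a, b}"] ZAB[of "{a, c}"] by (auto simp: Z_def)
  have inside: "w \<in> {a, b, c}" if w: "w \<in> A" "w \<in> B" for w
  proof (rule ccontr)
    assume nw: "w \<notin> {a, b, c}"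
    define P where "P = {f \<in> X. w \<in> f}"
    have "P = {f \<in> F. w \<in> f}"
    proof (rule link_connected[OF F])
      show "P \<subseteq> {f \<in> F. w \<in> f}" "P \<noteq> {}" using X(1) w(1) by (auto simp: P_def A_def)
      fix e f g assume e: "card e = 2" "w \<in> e" "f \<in> P" "g \<in> F" "e \<subseteq> f" "e \<subseteq> g"
      have "e \<notin> bd X" using e(2) nw X(2) by (auto simp: Z_def)
      moreover have "e \<in> edges F" using e by (auto simp: edges_def)
      ultimately have "g \<in> X" using bd_faces[OF F X(1), of e f g] e by (auto simp: P_def)
      then show "g \<in> P" using e by (auto simp: P_def)
    qed
    moreover obtain g where "g \<in> F" "g \<notin> X" "w \<in> g" using w(2) by (auto simp: B_def)
    ultimately show False by (auto simp: P_def)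
  qed
  have AB: "A \<inter> B = {a, b, c}" using sub inside by blast
  \<comment> \<open>Here the triangle has to be nonfacial: every face then has a vertex off it, so
    both sides are proper.\<close>
  have more: "\<exists>w\<in>f. w \<notin> {a, b, c}" if "f \<in> F" for f
  proof (rule ccontr)
    assume "\<not> ?thesis"
    then have "f \<subseteq> {a, b, c}" by blast
    moreover have "card f = 3" "card {a, b, c} = 3" using spherical_face[OF F that] d by auto
    ultimately have "f = {a, b, c}" by (metis card_subset_eq finite.emptyI finite_insert)
    then show False using nf that by simp
  qed
  have "{a, b} \<in> bd X" using X(2) by (simp add: Z_def)
  then obtain f g where f: "f \<in> X" and g: "g \<in> F" "g \<notin> X"
    by (rule bd_both_sides[OF F X(1)])
  have "nsep F A B"
    unfolding nsep_def
  proof (intro conjI ballI)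
    show "A \<union> B = \<Union>F" using X(1) by (auto simp: A_def B_def)
    obtain w where "w \<in> f" "w \<notin> {a, b, c}" using more X(1) f by blast
    moreover from this have "w \<in> A" using f by (auto simp: A_def)
    ultimately show "A - B \<noteq> {}" using AB by blast
    obtain w where "w \<in> g" "w \<notin> {a, b, c}" using more g by blast
    moreover from this have "w \<in> B" using g by (auto simp: B_def)
    ultimately show "B - A \<noteq> {}" using AB by blast
    fix s r assume s: "s \<in> A - B" and r: "r \<in> B - A"
    show "\<not> adj F s r"
    proof
      assume "adj F s r"
      then obtain h where "h \<in> F" "s \<in> h" "r \<in> h" by (auto simp: adj_def)
      then show False using s r by (cases "h \<in> X") (auto simp: A_def B_def)
    qed
  qed
  then show thesis using that AB by blast
qed

lemma flagI_nsep:
  assumes F: "spherical F" and no: "\<And>A B. nsep F A B \<Longrightarrow> card (A \<inter> B) \<noteq> 3"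
  shows "flag F"
  unfolding flag_def
proof (intro allI impI, elim conjE, rule ccontr)
  fix a b c assume t: "adj F a b" "adj F b c" "adj F a c" and "{a, b, c} \<notin> F"
  then obtain A B where "nsep F A B" "A \<inter> B = {a, b, c}" using nonfacial_triangle_nsep[OF F] by metis
  moreover have "card {a, b, c} = 3" using t by (auto simp: adj_def)
  ultimately show False using no by metis
qed

section \<open>Cutting and contracting\<close>

lemma bd_triangle:
  assumes "distinct [a, b, c]" shows "bd {{a, b, c}} = {{a, b}, {b, c}, {a, c}}"
proof (intro equalityI subsetI)
  fix e assume e: "e \<in> bd {{a, b, c}}"
  then have "e \<in> edges {{a, b, c}}" using bd_subset_edges by blast
  then show "e \<in> {{a, b}, {b, c}, {a, c}}" by (auto simp: edges_def card_2_iff)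
next
  fix e assume "e \<in> {{a, b}, {b, c}, {a, c}}"
  then have "card e = 2" and "{f \<in> {{a, b, c}}. e \<subseteq> f} = {{a, b, c}}" using assms by auto
  then show "e \<in> bd {{a, b, c}}" by (simp add: bd_def)
qed

lemma even_triangle_subset:
  assumes d: "distinct [a, b, c]" and Z: "even_set Z" "Z \<subseteq> {{a, b}, {b, c}, {a, c}}" "Z \<noteq> {}"
  shows "Z = {{a, b}, {b, c}, {a, c}}"
proof -
  have fin: "finite Z" using Z(2) finite_subset by blast
  have no1: "{e \<in> Z. w \<in> e} \<noteq> {x}" for w x
  proof
    assume "{e \<in> Z. w \<in> e} = {x}"
    moreover have "even (card {e \<in> Z. w \<in> e})" using Z(1) by (simp add: even_set_def)
    ultimately show False by simp
  qed
  have "{a, b} \<in> Z \<longleftrightarrow> {a, c} \<in> Z"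
    using no1[of a "{a, b}"] no1[of a "{a, c}"] Z(2) d by (auto simp: doubleton_eq_iff)
  moreover have "{a, b} \<in> Z \<longleftrightarrow> {b, c} \<in> Z"
    using no1[of b "{a, b}"] no1[of b "{b, c}"] Z(2) d by (auto simp: doubleton_eq_iff)
  ultimately show ?thesis using Z(2,3) by blast
qed

lemma bd_self:
  assumes "\<And>e. e \<in> edges F \<Longrightarrow> card {f \<in> F. e \<subseteq> f} = 2" shows "bd F = {}"
proof (rule ccontr)
  assume "bd F \<noteq> {}"
  then obtain e where "e \<in> bd F" by blast
  moreover from this have "e \<in> edges F" using bd_subset_edges by blast
  ultimately show False using assms[of e] by (simp add: bd_def)
qed

text \<open>Edges of \<open>A\<close> outside the separating triangle keep both their faces, so the
  boundary of the part \<open>X\<close> consists of edges of the triangle. It is nonempty by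
  minimality and has even degrees, so it is the whole triangle, and adding the triangle as a new
  face closes \<open>X\<close> up. If the triangle had been a face of \<open>F\<close>, removing it
  from \<open>X\<close> would leave a proper closed part.\<close>

lemma cut_spherical:
  assumes F: "spherical F" and n: "nsep F A B" "card (A \<inter> B) \<le> 3"
  defines "F' \<equiv> insert (A \<inter> B) {f \<in> F. f \<subseteq> A}"
  shows "spherical F'" "\<Union>F' = A" "\<And>s r. adj F' s r \<longleftrightarrow> adj F s r \<and> s \<in> A \<and> r \<in> A" "A \<inter> B \<notin> F"
proof -
  obtain a b c where D: "A \<inter> B = {a, b, c}" and d: "distinct [a, b, c]" and ad: "adj F a b" "adj F b c" "adj F a c"
    using nsep3_triangle[OF F n] by metis
  define T where "T = {{a, b}, {b, c}, {a, c}}"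
  define X where "X = {f \<in> F. f \<subseteq> A}"
  have XF: "X \<subseteq> F" by (auto simp: X_def)
  have finX: "finite X" using XF spherical_finite[OF F] finite_subset by blast
  have TF: "T \<subseteq> edges F" using ad adj_edges[of F a b] adj_edges[of F b c] adj_edges[of F a c] by (simp add: T_def)
  have inT: "e \<in> T" if "card e = 2" "e \<subseteq> A \<inter> B" for e
    using that unfolding D T_def by (auto simp: card_2_iff)
  have X3: "card f = 3" if "f \<in> X" for f using that spherical_face[OF F, of f] by (simp add: X_def)
  have noT: "{f \<in> X. e \<subseteq> f} = {f \<in> F. e \<subseteq> f}" if e: "e \<subseteq> A" "card e = 2" "e \<notin> T" for e
  proof -
    obtain z where z: "z \<in> e" "z \<notin> B" using inT[of e] e by blast
    have "f \<subseteq> A" if "f \<in> F" "e \<subseteq> f" for f using nsep_face[OF n(1) that(1)] that(2) z by blast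
    then show ?thesis by (auto simp: X_def)
  qed
  have bdT: "bd X \<subseteq> T"
  proof
    fix e assume e: "e \<in> bd X"
    then have eX: "e \<in> edges X" using bd_subset_edges by blast
    then have eA: "e \<subseteq> A" "card e = 2" by (auto simp: edges_def X_def)
    show "e \<in> T"
    proof (rule ccontr)
      assume "e \<notin> T"
      then have "{f \<in> X. e \<subseteq> f} = {f \<in> F. e \<subseteq> f}" using noT eA by blast
      moreover have "card {f \<in> F. e \<subseteq> f} = 2" using edge_card[OF F] eX edges_mono[OF XF] by blast
      ultimately show False using e by (simp add: bd_def)
    qed
  qed
  obtain s where s: "s \<in> A" "s \<notin> B" using nsepD(2)[OF n(1)] by blast
  obtain f where f: "f \<in> F" "s \<in> f" using s nsepD(1)[OF n(1)] by blast
  have fX: "f \<in> X" using nsep_face[OF n(1) f(1)] f s by (auto simp: X_def)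
  obtain r where r: "r \<in> B" "r \<notin> A" using nsepD(3)[OF n(1)] by blast
  obtain g where g: "g \<in> F" "r \<in> g" using r nsepD(1)[OF n(1)] by blast
  have gX: "g \<notin> X" using g r by (auto simp: X_def)
  have "X \<noteq> {}" "X \<noteq> F" using fX gX g by auto
  then have "bd X \<noteq> {}" using spherical_minimal[OF F XF] by metis
  then have bdX: "bd X = T"
    using even_triangle_subset[OF d even_set_bd[OF finX X3]] bdT unfolding T_def by blast
  show nD: "A \<inter> B \<notin> F"
  proof
    assume "A \<inter> B \<in> F"
    then have DX: "{a, b, c} \<in> X" using D by (auto simp: X_def)
    have "e \<notin> bd (sym_diff X {{a, b, c}})" for e
      using bd_sym_diff[OF finX, of "{{a, b, c}}" e] bd_triangle[OF d] bdX by (auto simp: T_def)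
    then have "bd (sym_diff X {{a, b, c}}) = {}" by blast
    moreover have "sym_diff X {{a, b, c}} = X - {{a, b, c}}" using DX by blast
    ultimately have bd0: "bd (X - {{a, b, c}}) = {}" by metis
    have sub: "X - {{a, b, c}} \<subseteq> F" using XF by blast
    have "f \<noteq> {a, b, c}" using f s D by blast
    then have "X - {{a, b, c}} \<noteq> {}" using fX by blast
    moreover have "X - {{a, b, c}} \<noteq> F" using gX g by blast
    ultimately show False using spherical_minimal[OF F sub bd0] by simp
  qed
  have F': "F' = insert {a, b, c} X" by (simp add: F'_def D X_def)
  have DX: "{a, b, c} \<notin> X" using nD D XF by auto
  have edges': "edges F' \<subseteq> edges F"
  proof
    fix e assume e: "e \<in> edges F'"
    show "e \<in> edges F"
    proof (cases "e \<subseteq> {a, b, c}")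
      case True
      then have "e \<in> T" using inT[of e] e D by (auto simp: edges_def)
      then show ?thesis using TF by blast
    next
      case False
      then show ?thesis using e by (auto simp: edges_def F' X_def)
    qed
  qed
  have edgeA: "e \<subseteq> A" if "e \<in> edges F'" for e using that D by (auto simp: edges_def F' X_def)
  have count: "card {f \<in> F'. e \<subseteq> f} = 2" if e: "e \<in> edges F'" for e
  proof -
    have eF: "e \<in> edges F" using e edges' by blast
    then have c2: "card {f \<in> F. e \<subseteq> f} = 2" by (rule edge_card[OF F])
    have fin: "finite {f \<in> F. e \<subseteq> f}" using c2 by (metis card.infinite zero_neq_numeral)
    have sub: "{f \<in> X. e \<subseteq> f} \<subseteq> {f \<in> F. e \<subseteq> f}" using XF by auto
    have e2: "card e = 2" using eF by (simp add: edges_def)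
    show ?thesis
    proof (cases "e \<in> T")
      case True
      then have "odd (card {f \<in> X. e \<subseteq> f})" using bdX by (auto simp: bd_def)
      moreover have "card {f \<in> X. e \<subseteq> f} \<le> 2" using card_mono[OF fin sub] c2 by simp
      ultimately have "card {f \<in> X. e \<subseteq> f} = 1" by presburger
      moreover have "e \<subseteq> {a, b, c}" using True by (auto simp: T_def)
      then have "{f \<in> F'. e \<subseteq> f} = insert {a, b, c} {f \<in> X. e \<subseteq> f}" by (auto simp: F')
      ultimately show ?thesis using DX finX by simp
    next
      case False
      then have "\<not> e \<subseteq> {a, b, c}" using inT[of e] e2 D by auto
      then have "{f \<in> F'. e \<subseteq> f} = {f \<in> X. e \<subseteq> f}" by (auto simp: F')
      also have "\<dots> = {f \<in> F. e \<subseteq> f}" by (rule noT[OF edgeA[OF e] e2 False])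
      finally show ?thesis using c2 by simp
    qed
  qed
  have finF': "finite F'" using finX by (simp add: F')
  have bdF': "bd F' = {}" using count by (rule bd_self)
  have noF: "X1 = {}" if "X1 \<subseteq> X" "bd X1 = {}" for X1
  proof -
    have "X1 \<subseteq> F" "X1 \<noteq> F" using that XF gX g by auto
    then show ?thesis using spherical_minimal[OF F, of X1] that(2) by metis
  qed
  show "spherical F'"
    unfolding spherical_def
  proof (intro conjI ballI allI impI)
    show "finite F'" by (rule finF')
    show "F' \<noteq> {}" by (simp add: F')
    show "card h = 3" if "h \<in> F'" for h using that X3 d by (auto simp: F')
    show "card {f \<in> F'. e \<subseteq> f} = 2" if "e \<in> edges F'" for e using that by (rule count)
    show "X1 = {} \<or> X1 = F'" if X1: "X1 \<subseteq> F'" "bd X1 = {}" for X1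
    proof (cases "{a, b, c} \<in> X1")
      case False
      then show ?thesis using noF[of X1] X1 by (auto simp: F')
    next
      case True
      have eq: "sym_diff F' X1 = F' - X1" using X1(1) by blast
      have "bd (F' - X1) = {}"
        using bd_sym_diff[OF finF' finite_subset[OF X1(1) finF']] unfolding eq bdF' X1(2) by blast
      then have "F' - X1 = {}" using noF[of "F' - X1"] True by (auto simp: F')
      then show ?thesis using X1(1) by blast
    qed
    show "\<exists>Y\<subseteq>F'. bd Y = Z" if Z: "Z \<subseteq> edges F'" "even_set Z" for Z
    proof -
      have "Z \<subseteq> edges F" using Z(1) edges' by blast
      then obtain Y where Y: "Y \<subseteq> F" "bd Y = Z" using sphericalD(6)[OF F] Z(2) by blast
      \<comment> \<open>A cycle of the piece is filled in \<open>F\<close>, and the faces outside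
        the piece are dropped. Their boundary is an even set inside the triangle, so it is empty or
        the whole triangle, and in the second case the new face compensates for it.\<close>
      define Y1 Y2 where "Y1 = Y \<inter> X" and "Y2 = Y - X"
      have finY: "finite Y" using Y(1) spherical_finite[OF F] finite_subset by blast
      then have fin: "finite Y1" "finite Y2" by (auto simp: Y1_def Y2_def)
      have "sym_diff Y1 Y2 = Y" by (auto simp: Y1_def Y2_def)
      then have xor: "e \<in> Z \<longleftrightarrow> (e \<in> bd Y1) \<noteq> (e \<in> bd Y2)" for e
        using bd_sym_diff[OF fin, of e] Y(2) by simp
      have "bd Y2 \<subseteq> T"
      proof
        fix e assume e: "e \<in> bd Y2"
        then have "e \<in> edges Y2" using bd_subset_edges by blast
        then obtain h where h: "h \<in> Y2" "e \<subseteq> h" "card e = 2" by (auto simp: edges_def)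
        have hF: "h \<in> F" "\<not> h \<subseteq> A" using h(1) Y(1) by (auto simp: Y2_def X_def)
        then have "h \<subseteq> B" using nsep_face[OF n(1)] by blast
        moreover have "e \<subseteq> A"
        proof (cases "e \<in> Z")
          case True then show ?thesis using edgeA Z(1) by blast
        next
          case False
          then have "e \<in> edges Y1" using xor e bd_subset_edges by blast
          then show ?thesis by (auto simp: edges_def Y1_def X_def)
        qed
        ultimately show "e \<in> T" using inT h by blast
      qed
      moreover have "even_set (bd Y2)"
        using fin(2) by (rule even_set_bd) (use Y(1) spherical_face[OF F] in \<open>auto simp: Y2_def\<close>)
      ultimately consider "bd Y2 = {}" | "bd Y2 = T" using even_triangle_subset[OF d, of "bd Y2"] unfolding T_def by blast
      then show ?thesis
      proof cases
        case 1
        then have "bd Y1 = Z" using xor by blast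
        then show ?thesis by (intro exI[of _ Y1]) (auto simp: Y1_def F')
      next
        case 2
        have "e \<in> bd (sym_diff Y1 {{a, b, c}}) \<longleftrightarrow> e \<in> Z" for e
          using bd_sym_diff[OF fin(1), of "{{a, b, c}}" e] bd_triangle[OF d] xor[of e] 2 by (simp add: T_def)
        then have "bd (sym_diff Y1 {{a, b, c}}) = Z" by blast
        then show ?thesis by (intro exI[of _ "sym_diff Y1 {{a, b, c}}"]) (auto simp: Y1_def F')
      qed
    qed
  qed
  show "\<Union>F' = A"
  proof
    show "\<Union>F' \<subseteq> A" using D by (auto simp: F' X_def)
    show "A \<subseteq> \<Union>F'"
    proof
      fix w assume w: "w \<in> A"
      show "w \<in> \<Union>F'"
      proof (cases "w \<in> B")
        case True then show ?thesis using w D by (auto simp: F')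
      next
        case False
        obtain h where h: "h \<in> F" "w \<in> h" using w nsepD(1)[OF n(1)] by blast
        then have "h \<in> X" using nsep_face[OF n(1) h(1)] False by (auto simp: X_def)
        then show ?thesis using h by (auto simp: F')
      qed
    qed
  qed
  show "adj F' w r \<longleftrightarrow> adj F w r \<and> w \<in> A \<and> r \<in> A" for w r
  proof
    assume "adj F' w r"
    then have "{w, r} \<in> edges F'" using adj_edges by metis
    then have "{w, r} \<in> edges F" "{w, r} \<subseteq> A" using edges' edgeA by blast+
    then show "adj F w r \<and> w \<in> A \<and> r \<in> A" using adj_edges[of F w r] by simp
  next
    assume wr: "adj F w r \<and> w \<in> A \<and> r \<in> A"
    show "adj F' w r"
    proof (cases "w \<in> B \<and> r \<in> B")
      case True
      then have "w \<in> {a, b, c}" "r \<in> {a, b, c}" using wr D by blast+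
      moreover have "w \<noteq> r" using wr by (auto simp: adj_def)
      ultimately show ?thesis unfolding F' by (intro adjI[of "{a, b, c}"]) auto
    next
      case False
      obtain h where h: "h \<in> F" "w \<in> h" "r \<in> h" using wr by (auto simp: adj_def)
      then have "h \<in> X" using nsep_face[OF n(1) h(1)] False by (auto simp: X_def)
      moreover have "w \<noteq> r" using wr by (auto simp: adj_def)
      ultimately show ?thesis using h unfolding F' by (intro adjI[of h]) auto
    qed
  qed
qed

section \<open>Contraction of an edge\<close>

definition merge :: "'a \<Rightarrow> 'a \<Rightarrow> 'a \<Rightarrow> 'a" where
  "merge c b x = (if x = b then c else x)"

definition contract :: "'a \<Rightarrow> 'a \<Rightarrow> 'a set set \<Rightarrow> 'a set set" where
  "contract c b F = (\<lambda>f. merge c b ` f) ` {f \<in> F. \<not> (b \<in> f \<and> c \<in> f)}"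

text \<open>\<open>common\<close> says that the edge \<open>cb\<close> lies on no nonfacial
  triangle. That \<open>p\<close> and \<open>q\<close> are not adjacent prevents two faces from
  becoming equal under the contraction; in a tetrahedron this would happen.\<close>

locale contractible =
  fixes F :: "'a set set" and c b p q
  assumes F: "spherical F" and cp: "{c, b, p} \<in> F" and cq: "{c, b, q} \<in> F" and pq: "p \<noteq> q" "\<not> adj F p q"
    and common: "\<And>t. adj F c t \<Longrightarrow> adj F b t \<Longrightarrow> {c, b, t} \<in> F"
begin

definition "N = {f \<in> F. \<not> (b \<in> f \<and> c \<in> f)}"
abbreviation "m \<equiv> merge c b"
abbreviation "F' \<equiv> contract c b F"

lemma F'_eq: "F' = (\<lambda>f. m ` f) ` N"
  by (simp add: contract_def N_def)

lemma cb: "c \<noteq> b" "p \<noteq> c" "p \<noteq> b" "q \<noteq> c" "q \<noteq> b"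
  using face_distinct[OF F cp] face_distinct[OF F cq] by auto

lemma common_pq: "adj F c t \<Longrightarrow> adj F b t \<Longrightarrow> t = p \<or> t = q"
  using at_most_two_faces[OF F cp common cq, of t] pq by auto

lemma NF: "N \<subseteq> F" by (auto simp: N_def)

lemma finN: "finite N" using NF spherical_finite[OF F] finite_subset by blast

lemma m_simps [simp]: "m b = c" "m c = c" "x \<noteq> b \<Longrightarrow> m x = x"
  by (auto simp: merge_def)

lemma m_neq_b: "m x \<noteq> b"
  using cb by (auto simp: merge_def)

lemma m_eq: "m x = m y \<longleftrightarrow> x = y \<or> {x, y} = {b, c}"
  by (auto simp: merge_def doubleton_eq_iff)

lemma inj_face: "f \<in> N \<Longrightarrow> inj_on m f"
  unfolding inj_on_def m_eq N_def by (auto simp: doubleton_eq_iff)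

lemma card_m_face: "f \<in> N \<Longrightarrow> card (m ` f) = 3"
  using inj_face[of f] spherical_face[OF F, of f] NF by (simp add: card_image subset_iff)

text \<open>Faces \<open>bsr\<close> and \<open>csr\<close> would make \<open>s\<close> and
  \<open>r\<close> the two common neighbours of \<open>b\<close> and \<open>c\<close>, which are
  \<open>p\<close> and \<open>q\<close> and not adjacent.\<close>

lemma no_twin: assumes f: "f \<in> N" "b \<in> f" and g: "g \<in> N" "b \<notin> g" and eq: "m ` f = m ` g" shows False
proof -
  have fF: "f \<in> F" "g \<in> F" "c \<notin> f" using f g by (auto simp: N_def)
  obtain s where s: "s \<in> f" "s \<noteq> b" using card3_other[of f b] spherical_face[OF F fF(1)] by blast
  obtain r where fe: "f = {b, s, r}" "r \<noteq> b" "r \<noteq> s" using face_at[OF F fF(1) f(2) s(1)] s(2) by metis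
  have "m ` g = g" using g(2) by (auto simp: merge_def image_iff)
  then have ge: "g = {c, s, r}" using eq fe s by auto
  have ad: "adj F b s" "adj F s r" "adj F b r" using face_adj[OF F, of b s r] fF fe by auto
  have ad': "adj F c s" "adj F c r" using face_adj[OF F, of c s r] fF ge by auto
  have "s = p \<or> s = q" "r = p \<or> r = q" using common_pq ad ad' by auto
  then show False using ad(2) fe(3) pq adj_commute[of F p q] by auto
qed

lemma inj_faces: "inj_on (\<lambda>f. m ` f) N"
proof (rule inj_onI)
  fix f g assume fg: "f \<in> N" "g \<in> N" "m ` f = m ` g"
  consider "b \<in> f" "b \<in> g" | "b \<notin> f" "b \<notin> g" | "b \<in> f" "b \<notin> g" | "b \<notin> f" "b \<in> g" by blast
  then show "f = g"
  proof cases
    case 1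
    then have "c \<notin> f" "c \<notin> g" using fg by (auto simp: N_def)
    then have "m ` f = insert c (f - {b})" "m ` g = insert c (g - {b})" "c \<notin> f - {b}" "c \<notin> g - {b}"
      using 1 by (auto simp: merge_def image_iff)
    then have "f - {b} = g - {b}" using fg(3) by (metis Diff_insert_absorb)
    then show ?thesis using 1 by blast
  next
    case 2
    then have "m ` f = f" "m ` g = g" by (auto simp: merge_def image_iff)
    then show ?thesis using fg(3) by metis
  next
    case 3 then show ?thesis using no_twin[OF fg(1) _ fg(2) _ fg(3)] by blast
  next
    case 4 then show ?thesis using no_twin[OF fg(2) _ fg(1) _ fg(3)[symmetric]] by blast
  qed
qed

text \<open>The map on mod 2 chains induced by the contraction commutes with the boundary. A face
  containing the contracted edge is killed, and its other two edges are identified.\<close>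

lemma bd_contract:
  assumes W: "W \<subseteq> F"
  shows "e' \<in> bd ((\<lambda>f. m ` f) ` (W \<inter> N)) \<longleftrightarrow> card e' = 2 \<and> odd (card {e \<in> bd W. m ` e = e'})"
proof (cases "card e' = 2")
  case False then show ?thesis by (simp add: bd_def)
next
  case True
  define A where "A = {e \<in> edges F. m ` e = e'}"
  have finA: "finite A" using finite_edges[OF F] by (simp add: A_def)
  have finW: "finite W" using W spherical_finite[OF F] finite_subset by blast
  have 1: "{e \<in> A. odd (card {f \<in> W. e \<subseteq> f})} = {e \<in> bd W. m ` e = e'}"
  proof -
    have "bd W \<subseteq> edges F" using bd_subset_edges[of W] edges_mono[OF W] by blast
    then show ?thesis by (auto simp: A_def bd_def edges_def)
  qed
  have odd_iff: "odd (card {e \<in> A. e \<subseteq> f}) \<longleftrightarrow> f \<in> N \<and> e' \<subseteq> m ` f" if f: "f \<in> W" for f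
  proof -
    have fF: "f \<in> F" using f W by blast
    show ?thesis
    proof (cases "f \<in> N")
      case fN: True
      show ?thesis
      proof (cases "e' \<subseteq> m ` f")
        case sub: True
        define e where "e = {x \<in> f. m x \<in> e'}"
        have me: "m ` e = e'" using sub by (auto simp: e_def)
        moreover have "card (m ` e) = card e"
          by (rule card_image) (use inj_face[OF fN] in \<open>auto simp: e_def inj_on_def\<close>)
        ultimately have "e \<in> A" using True fF by (auto simp: A_def edges_def e_def)
        moreover have "e2 = e" if "e2 \<subseteq> f" "m ` e2 = e'" for e2
          using that inj_face[OF fN] unfolding e_def inj_on_def by blast
        ultimately have "{e \<in> A. e \<subseteq> f} = {e}" using me by (auto simp: A_def e_def)
        then show ?thesis using fN sub by simp
      next
        case False
        then have "{e \<in> A. e \<subseteq> f} = {}" by (auto simp: A_def)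
        then show ?thesis using False by (simp only: card.empty) simp
      qed
    next
      case fN: False
      then have "c \<in> f" "b \<in> f" using fF by (auto simp: N_def)
      then obtain t where t: "f = {c, b, t}" "t \<noteq> c" "t \<noteq> b" using face_at[OF F fF, of c b] cb by metis
      have tN: "{c, t} \<noteq> {b, t}" using cb t by (auto simp: doubleton_eq_iff)
      have "{e \<in> A. e \<subseteq> f} = (if e' = {c, t} then {{c, t}, {b, t}} else {})"
      proof -
        have k1: "e = {c, t} \<and> e' = {c, t} \<or> e = {b, t} \<and> e' = {c, t}" if e: "e \<in> A" "e \<subseteq> f" for e
        proof -
          have me: "m ` e = e'" "card e = 2" using e by (auto simp: A_def edges_def)
          then obtain x y where xy: "e = {x, y}" "x \<noteq> y" by (auto simp: card_2_iff)
          then have "x \<in> {c, b, t}" "y \<in> {c, b, t}" using e t by auto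
          moreover have "m ` {b, c} = {c}" by auto
          then have "e \<noteq> {b, c}" using me True by auto
          ultimately have "e = {c, t} \<or> e = {b, t}" using xy by auto
          then show ?thesis using me(1) t by auto
        qed
        have "c \<in> f" "b \<in> f" "t \<in> f" using t(1) by auto
        then have "adj F c t" "adj F b t" using adjI[OF fF] t(2,3) by metis+
        then have ce: "{c, t} \<in> edges F" "{b, t} \<in> edges F" using adj_edges by metis+
        have mt: "m ` {c, t} = {c, t}" "m ` {b, t} = {c, t}" using t(2,3) by simp_all
        have k2: "{c, t} \<in> A \<and> {b, t} \<in> A" if "e' = {c, t}"
          unfolding A_def mem_Collect_eq that using ce mt by blast
        show ?thesis
        proof (cases "e' = {c, t}")
          case True
          have "{e \<in> A. e \<subseteq> f} = {{c, t}, {b, t}}"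
          proof (intro equalityI subsetI)
            fix e assume "e \<in> {e \<in> A. e \<subseteq> f}"
            then show "e \<in> {{c, t}, {b, t}}" using k1[of e] by blast
          next
            fix e assume "e \<in> {{c, t}, {b, t}}"
            then show "e \<in> {e \<in> A. e \<subseteq> f}" using k2[OF True] t(1) by auto
          qed
          then show ?thesis using True by simp
        next
          case False
          have "e \<notin> {e \<in> A. e \<subseteq> f}" for e using k1[of e] False by blast
          then have "{e \<in> A. e \<subseteq> f} = {}" by blast
          then show ?thesis using False by simp
        qed
      qed
      then show ?thesis using fN tN by simp
    qed
  qed
  then have 2: "{f \<in> W. odd (card {e \<in> A. e \<subseteq> f})} = {f \<in> W \<inter> N. e' \<subseteq> m ` f}" by blast
  have "{f' \<in> (\<lambda>f. m ` f) ` (W \<inter> N). e' \<subseteq> f'} = (\<lambda>f. m ` f) ` {f \<in> W \<inter> N. e' \<subseteq> m ` f}" by blast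
  moreover have "card ((\<lambda>f. m ` f) ` {f \<in> W \<inter> N. e' \<subseteq> m ` f}) = card {f \<in> W \<inter> N. e' \<subseteq> m ` f}"
    by (rule card_image[OF inj_on_subset[OF inj_faces]]) auto
  ultimately show ?thesis
    using odd_card_double_count[OF finA finW, of "\<lambda>e f. e \<subseteq> f"] True unfolding 1 2 by (simp add: bd_def)
qed


lemma adj_contract: "adj F' x y \<longleftrightarrow> x \<noteq> y \<and> (\<exists>s r. adj F s r \<and> m s = x \<and> m r = y)"
proof
  assume "adj F' x y"
  then obtain f where f: "f \<in> N" "x \<in> m ` f" "y \<in> m ` f" and xy: "x \<noteq> y" by (auto simp: adj_def F'_eq)
  then obtain s r where sr: "s \<in> f" "r \<in> f" "x = m s" "y = m r" by blast
  have "s \<noteq> r" using sr xy by auto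
  moreover have "f \<in> F" using f(1) NF by blast
  ultimately have "adj F s r" using sr by (intro adjI[of f]) auto
  then show "x \<noteq> y \<and> (\<exists>s r. adj F s r \<and> m s = x \<and> m r = y)" using sr xy by blast
next
  assume "x \<noteq> y \<and> (\<exists>s r. adj F s r \<and> m s = x \<and> m r = y)"
  then obtain s r where sr: "adj F s r" "m s = x" "m r = y" and xy: "x \<noteq> y" by blast
  have srn: "{s, r} \<noteq> {b, c}" using sr xy m_eq[of s r] by auto
  obtain z1 z2 where z: "z1 \<noteq> z2" "{s, r, z1} \<in> F" "{s, r, z2} \<in> F" using two_faces[OF F sr(1)] by metis
  have "\<exists>z. {s, r, z} \<in> N"
  proof (rule ccontr)
    assume "\<not> ?thesis"
    then have "{b, c} \<subseteq> {s, r, z1}" "{b, c} \<subseteq> {s, r, z2}" using z by (auto simp: N_def)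
    moreover have "s \<noteq> r" using sr(1) by (auto simp: adj_def)
    ultimately show False using srn z(1) cb(1) by (auto simp: doubleton_eq_iff)
  qed
  then obtain z where "{s, r, z} \<in> N" by blast
  then have "m ` {s, r, z} \<in> F'" unfolding F'_eq by (rule imageI)
  then show "adj F' x y" using sr xy by (intro adjI[of "m ` {s, r, z}"]) auto
qed

lemma vertices_contract: "\<Union>F' = \<Union>F - {b}"
proof (intro equalityI subsetI)
  fix x assume "x \<in> \<Union>F'"
  then obtain f s where f: "f \<in> N" "s \<in> f" "x = m s" by (auto simp: F'_eq)
  have "c \<in> \<Union>F" using cp by blast
  moreover have "s \<in> \<Union>F" using f NF by blast
  ultimately have "x \<in> \<Union>F" using f(3) by (auto simp: merge_def)
  then show "x \<in> \<Union>F - {b}" using f(3) m_neq_b by auto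
next
  fix x assume "x \<in> \<Union>F - {b}"
  then have x: "x \<in> \<Union>F" "x \<noteq> b" by auto
  have "\<exists>y. adj F' x y"
  proof (cases "x = c")
    case True
    have "adj F c p" using face_adj[OF F cp] by simp
    then have "adj F' x p" unfolding adj_contract using True cb by (intro conjI exI[of _ c] exI[of _ p]) auto
    then show ?thesis by blast
  next
    case False
    obtain a where a: "adj F x a" using vertex_adj[OF F x(1)] .
    have "x \<noteq> m a" using a False by (auto simp: merge_def adj_def)
    then have "adj F' x (m a)" unfolding adj_contract using a x(2) by (intro conjI exI[of _ x] exI[of _ a]) auto
    then show ?thesis by blast
  qed
  then show "x \<in> \<Union>F'" using adj_in by metis
qed

lemma faces_at_merged_edge:
  assumes t: "t \<noteq> b" "t \<noteq> c"
  shows "{f \<in> N. {c, t} \<subseteq> m ` f} = {f \<in> F. c \<in> f \<and> t \<in> f \<and> b \<notin> f} \<union> {f \<in> F. b \<in> f \<and> t \<in> f \<and> c \<notin> f}"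
    (is "?L = ?R")
proof -
  have "t \<in> m ` f \<longleftrightarrow> t \<in> f" "c \<in> m ` f \<longleftrightarrow> c \<in> f \<or> b \<in> f" for f
    using t by (auto simp: merge_def image_iff)
  then show ?thesis by (auto simp: N_def)
qed

text \<open>If \<open>y\<close> is joined to \<open>t\<close> as well, one of the two faces at
  \<open>xt\<close> is \<open>cbt\<close>, which disappears; otherwise both survive. A merged edge
  therefore has 1+1 or 2+0 faces, two in any case.\<close>

lemma card_faces_avoiding:
  assumes xt: "adj F x t" and xy: "{x, y} = {b, c}" and t: "t \<noteq> b" "t \<noteq> c"
  shows "card {f \<in> F. x \<in> f \<and> t \<in> f \<and> y \<notin> f} = (if adj F y t then 1 else 2)"
proof -
  have xyn: "x \<noteq> y" using xy cb by (auto simp: doubleton_eq_iff)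
  obtain z1 z2 where z: "z1 \<noteq> z2" "{x, t, z1} \<in> F" "{x, t, z2} \<in> F"
    "\<And>f. f \<in> F \<Longrightarrow> x \<in> f \<Longrightarrow> t \<in> f \<Longrightarrow> f = {x, t, z1} \<or> f = {x, t, z2}" using two_faces[OF F xt] by metis
  have ne: "{x, t, z1} \<noteq> {x, t, z2}"
  proof
    assume "{x, t, z1} = {x, t, z2}"
    then have "z1 \<in> {x, t, z2}" by blast
    then show False using z(1) face_distinct[OF F z(2)] by auto
  qed
  have "y \<in> {b, c}" using xy by blast
  then have yt: "y \<noteq> t" using t by auto
  show ?thesis
  proof (cases "adj F y t")
    case True
    have "adj F c t \<and> adj F b t" using True xt xy by (auto simp: doubleton_eq_iff)
    then have "{c, b, t} \<in> F" using common by blast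
    moreover have "{c, b, t} = {x, t, y}" using xy by (auto simp: doubleton_eq_iff)
    ultimately have fy: "{x, t, y} \<in> F" by simp
    then have "y = z1 \<or> y = z2" using at_most_two_faces[OF F z(2) z(3), of y] z(1) by auto
    then obtain z where zz: "z = z1 \<and> y = z2 \<or> z = z2 \<and> y = z1" by blast
    then have zF: "{x, t, z} \<in> F" "z \<noteq> y" using z(1-3) by auto
    have "{f \<in> F. x \<in> f \<and> t \<in> f \<and> y \<notin> f} = {{x, t, z}}"
    proof (intro equalityI subsetI)
      fix f assume "f \<in> {f \<in> F. x \<in> f \<and> t \<in> f \<and> y \<notin> f}"
      then show "f \<in> {{x, t, z}}" using z(4)[of f] zz by blast
    next
      fix f assume "f \<in> {{x, t, z}}"
      then show "f \<in> {f \<in> F. x \<in> f \<and> t \<in> f \<and> y \<notin> f}"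
        using zF xyn yt by auto
    qed
    then show ?thesis using True by simp
  next
    case False
    have "y \<notin> f" if "f \<in> F" "t \<in> f" for f using adjI[OF that(1) _ that(2), of y] yt False by metis
    then have "{f \<in> F. x \<in> f \<and> t \<in> f \<and> y \<notin> f} = {{x, t, z1}, {x, t, z2}}" using z by blast
    then show ?thesis using False ne by simp
  qed
qed

lemma card_contract_edge:
  assumes e: "e \<in> edges F'" shows "card {f \<in> F'. e \<subseteq> f} = 2"
proof -
  have e2: "card e = 2" using e by (simp add: edges_def)
  have "{f \<in> F'. e \<subseteq> f} = (\<lambda>f. m ` f) ` {f \<in> N. e \<subseteq> m ` f}" unfolding F'_eq by blast
  then have "card {f \<in> F'. e \<subseteq> f} = card {f \<in> N. e \<subseteq> m ` f}"
    using card_image[OF inj_on_subset[OF inj_faces]] by (metis (no_types, lifting) mem_Collect_eq subsetI)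
  also have "\<dots> = 2"
  proof (cases "c \<in> e")
    case False
    obtain f where f: "f \<in> N" "e \<subseteq> m ` f" using e by (auto simp: edges_def F'_eq)
    have be: "b \<notin> e" using f(2) m_neq_b by (metis imageE subsetD)
    have iff: "e \<subseteq> m ` g \<longleftrightarrow> e \<subseteq> g" for g
    proof -
      have "x \<in> m ` g \<longleftrightarrow> x \<in> g" if "x \<in> e" for x
        using that False be by (auto simp: merge_def image_iff)
      then show ?thesis by blast
    qed
    have "g \<in> N" if "g \<in> F" "e \<subseteq> g" for g
    proof (rule ccontr)
      assume "g \<notin> N"
      then have "e \<union> {b, c} \<subseteq> g" using that by (auto simp: N_def)
      moreover have "card (e \<union> {b, c}) = 4"
        using e2 False be cb(1) by (subst card_Un_disjoint) (auto simp: card_ge_0_finite)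
      moreover have "card g = 3" "finite g" using spherical_face[OF F that(1)] by auto
      ultimately show False using card_mono[of g "e \<union> {b, c}"] by simp
    qed
    then have eq: "{f \<in> N. e \<subseteq> m ` f} = {f \<in> F. e \<subseteq> f}" using iff NF by blast
    have "e \<in> edges F" using f e2 iff[of f] NF by (auto simp: edges_def)
    then show ?thesis unfolding eq by (rule edge_card[OF F])
  next
    case True
    obtain t where t: "e = {c, t}" "t \<noteq> c" "adj F' c t" using edge_at[OF e True] .
    have tb: "t \<noteq> b" using adj_in[OF t(3)] vertices_contract by auto
    obtain s r where sr: "adj F s r" "m s = c" "m r = t" using t(3) adj_contract by auto
    have "r = t" using sr(3) t(2) by (auto simp: merge_def split: if_splits)
    moreover have "s = c \<or> s = b" using sr(2) by (auto simp: merge_def split: if_splits)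
    ultimately have st: "adj F c t \<or> adj F b t" using sr(1) by auto
    let ?A = "{f \<in> F. c \<in> f \<and> t \<in> f \<and> b \<notin> f}" and ?B = "{f \<in> F. b \<in> f \<and> t \<in> f \<and> c \<notin> f}"
    have fin: "finite ?A" "finite ?B" using spherical_finite[OF F] by auto
    have "card {f \<in> N. e \<subseteq> m ` f} = card (?A \<union> ?B)"
      using faces_at_merged_edge[OF tb t(2)] t(1) by simp
    also have "\<dots> = card ?A + card ?B" using fin by (intro card_Un_disjoint) auto
    finally have sum: "card {f \<in> N. e \<subseteq> m ` f} = card ?A + card ?B" .
    have A0: "card ?A = 0" if "\<not> adj F c t"
    proof -
      have "?A = {}" using that adjI[of _ F c t] t(2) by blast
      then show ?thesis by (simp only: card.empty)
    qed
    have B0: "card ?B = 0" if "\<not> adj F b t"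
    proof -
      have "?B = {}" using that adjI[of _ F b t] tb by blast
      then show ?thesis by (simp only: card.empty)
    qed
    show ?thesis
    proof (cases "adj F c t")
      case ct: True
      then have "card ?A = (if adj F b t then 1 else 2)" using card_faces_avoiding[of c t b] tb t(2) by (simp add: insert_commute)
      moreover have "card ?B = (if adj F b t then 1 else 0)" using card_faces_avoiding[of b t c] tb t(2) ct B0 by simp
      ultimately show ?thesis using sum by (cases "adj F b t") simp_all
    next
      case False
      then have bt: "adj F b t" using st by simp
      have "card ?B = 2" using card_faces_avoiding[of b t c] tb t(2) bt False by simp
      then show ?thesis using sum A0 False by simp
    qed
  qed
  finally show ?thesis .
qed

end

context contractible
begin

text \<open>The lift \<open>W\<close> of a closed set need not be closed: edges \<open>ct\<close>
  and \<open>bt\<close> become equal and may cancel only after the contraction. Wherever that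
  happens \<open>t\<close> is a common neighbour, so \<open>cbt\<close> is a face, and adding these
  faces removes the pair from the boundary.\<close>

lemma contract_minimal:
  assumes X': "X' \<subseteq> F'" and bd0: "bd X' = {}" shows "X' = {} \<or> X' = F'"
proof -
  define W where "W = {f \<in> N. m ` f \<in> X'}"
  have WN: "W \<subseteq> N" by (auto simp: W_def)
  have WF: "W \<subseteq> F" using WN NF by blast
  have XW: "X' = (\<lambda>f. m ` f) ` W" using X' unfolding W_def F'_eq by blast
  have W1: "W \<inter> N = W" using WN by blast
  have finW: "finite W" using WN finN finite_subset by blast
  have ev: "even (card {e \<in> bd W. m ` e = e'})" if "card e' = 2" for e'
    using bd_contract[OF WF, of e'] bd0 that unfolding W1 XW[symmetric] by blast
  have bdE: "bd W \<subseteq> edges F" using bd_subset_edges[of W] edges_mono[OF WF] by blast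
  have ncb: "e \<notin> bd W" if "b \<in> e" "c \<in> e" for e
  proof
    assume "e \<in> bd W"
    then have "e \<in> edges W" using bd_subset_edges by blast
    then show False using that WN by (auto simp: edges_def N_def)
  qed
  have pair: "\<exists>t. t \<noteq> b \<and> t \<noteq> c \<and> (e = {c, t} \<or> e = {b, t}) \<and> {c, t} \<in> bd W \<and> {b, t} \<in> bd W" if e: "e \<in> bd W" for e
  proof -
    have eE: "e \<in> edges F" using e bdE by blast
    have e2: "card e = 2" using eE by (simp add: edges_def)
    have "inj_on m e" using ncb[of e] e by (auto simp: inj_on_def m_eq doubleton_eq_iff)
    then have "card (m ` e) = 2" using e2 by (simp add: card_image)
    then have ev': "even (card {e1 \<in> bd W. m ` e1 = m ` e})" by (rule ev)
    then have "{e1 \<in> bd W. m ` e1 = m ` e} \<noteq> {e}" by auto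
    then obtain e1 where e1: "e1 \<in> bd W" "m ` e1 = m ` e" "e1 \<noteq> e" using e by blast
    have e12: "card e1 = 2" using e1(1) bdE by (auto simp: edges_def)
    have cbe: "e \<inter> {b, c} \<noteq> {}"
    proof
      assume no: "e \<inter> {b, c} = {}"
      have me: "m ` e = e" using no by (auto simp: merge_def image_iff)
      have "e1 \<subseteq> e"
      proof
        fix x assume "x \<in> e1"
        then have "m x \<in> e" using e1(2) me by blast
        then show "x \<in> e" using no by (auto simp: merge_def split: if_splits)
      qed
      then show False using e1(3) e2 e12 by (metis card_subset_eq card.infinite zero_neq_numeral)
    qed
    then obtain x where x: "x \<in> e" "x = b \<or> x = c" by blast
    obtain t where t: "e = {x, t}" "t \<noteq> x" using edge_at[OF eE x(1)] by metis
    have tn: "t \<noteq> b" "t \<noteq> c" using ncb[of e] e x t by auto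
    have met: "m ` e = {c, t}" using t x tn by auto
    have e1E: "e1 \<in> edges F" using e1(1) bdE by blast
    have "t \<in> m ` e1" using e1(2) met by blast
    then have te1: "t \<in> e1" using tn by (auto simp: merge_def split: if_splits)
    obtain y where y: "e1 = {t, y}" "y \<noteq> t" using edge_at[OF e1E te1] by metis
    have "m ` e1 = {t, m y}" using y tn by simp
    then have "m y = c" using e1(2) met tn by (auto simp: doubleton_eq_iff)
    then have "y = c \<or> y = b" by (auto simp: merge_def split: if_splits)
    then have "{e, e1} = {{c, t}, {b, t}}" using e1(3) t x y by (auto simp: insert_commute)
    then show ?thesis using e e1(1) tn by (auto simp: doubleton_eq_iff)
  qed
  define D where "D = {{c, b, t} | t. {c, t} \<in> bd W \<and> t \<noteq> b}"
  have DF: "D \<subseteq> F"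
  proof
    fix f assume "f \<in> D"
    then obtain t where t: "f = {c, b, t}" "{c, t} \<in> bd W" "t \<noteq> b" by (auto simp: D_def)
    obtain t' where t': "t' \<noteq> b" "t' \<noteq> c" "{c, t} = {c, t'} \<or> {c, t} = {b, t'}" "{c, t'} \<in> bd W" "{b, t'} \<in> bd W"
      using pair[OF t(2)] by blast
    have "t' = t" using t'(1-3) t(3) cb(1) by (auto simp: doubleton_eq_iff)
    then have "{c, t} \<in> edges F" "{b, t} \<in> edges F" using t' bdE by auto
    then have "adj F c t" "adj F b t" using adj_edges by metis+
    then show "f \<in> F" using common t(1) by simp
  qed
  have DW: "D \<inter> W = {}" using WN by (auto simp: D_def N_def)
  have finD: "finite D" using DF spherical_finite[OF F] finite_subset by blast
  have bdD: "e \<in> bd D \<longleftrightarrow> e \<in> bd W" if e: "card e = 2" "e \<noteq> {c, b}" for e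
  proof (cases "\<exists>x t. e = {x, t} \<and> (x = b \<or> x = c) \<and> t \<noteq> b \<and> t \<noteq> c")
    case True
    then obtain x t where xt: "e = {x, t}" "x = b \<or> x = c" "t \<noteq> b" "t \<noteq> c" by blast
    have sym: "{c, t} \<in> bd W \<longleftrightarrow> {b, t} \<in> bd W"
      using pair[of "{c, t}"] pair[of "{b, t}"] xt(3,4) by (auto simp: doubleton_eq_iff)
    have "{f \<in> D. e \<subseteq> f} = (if {c, t} \<in> bd W then {{c, b, t}} else {})"
      using xt by (auto simp: D_def)
    then have "e \<in> bd D \<longleftrightarrow> {c, t} \<in> bd W" using e(1) by (auto simp: bd_def)
    then show ?thesis using xt sym by auto
  next
    case False
    have "e \<notin> bd W" using pair[of e] False by blast
    moreover have "\<not> e \<subseteq> f" if "f \<in> D" for f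
    proof
      assume ef: "e \<subseteq> f"
      obtain t where t: "f = {c, b, t}" "{c, t} \<in> bd W" "t \<noteq> b" using \<open>f \<in> D\<close> by (auto simp: D_def)
      have "card {c, t} = 2" using t(2) bdE by (auto simp: edges_def)
      then have "t \<noteq> c" by auto
      obtain x y where xy: "e = {x, y}" "x \<noteq> y" using e(1) by (auto simp: card_2_iff)
      then have "x \<in> {c, b, t}" "y \<in> {c, b, t}" using ef t by auto
      then have "e = {c, t} \<or> e = {b, t}" using xy e(2) by (auto simp: insert_commute)
      then show False using False t(3) \<open>t \<noteq> c\<close> by blast
    qed
    then have "e \<notin> bd D" using bd_subset_edges[of D] by (auto simp: edges_def)
    ultimately show ?thesis by blast
  qed
  have un: "sym_diff W D = W \<union> D" using DW by blast
  have WDF: "W \<union> D \<subseteq> F" using WF DF by blast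
  have bdWD: "e = {c, b}" if "e \<in> bd (W \<union> D)" for e
  proof (rule ccontr)
    assume "e \<noteq> {c, b}"
    moreover have "card e = 2" using that by (simp add: bd_def)
    ultimately show False using bdD[of e] bd_sym_diff[OF finW finD, of e] that un by simp
  qed
  have "even_set (bd (W \<union> D))"
    by (rule even_set_bd) (use finW finD WDF spherical_face[OF F] in auto)
  then have evc: "even (card {e \<in> bd (W \<union> D). c \<in> e})" by (simp add: even_set_def)
  \<comment> \<open>No other edge can be left in the boundary, and a single edge does not have even
    degrees.\<close>
  have "{c, b} \<notin> bd (W \<union> D)"
  proof
    assume "{c, b} \<in> bd (W \<union> D)"
    then have "{e \<in> bd (W \<union> D). c \<in> e} = {{c, b}}" using bdWD by blast
    then show False using evc by simp
  qed
  then have "bd (W \<union> D) = {}" using bdWD by blast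
  then consider "W \<union> D = {}" | "W \<union> D = F" using spherical_minimal[OF F WDF] by blast
  then show ?thesis
  proof cases
    case 1 then show ?thesis using XW by simp
  next
    case 2
    have "f \<in> W" if "f \<in> N" for f
    proof -
      have "f \<notin> D" using that by (auto simp: D_def N_def)
      then show ?thesis using 2 that NF by blast
    qed
    then have "W = N" using WN by blast
    then show ?thesis using XW by (simp add: F'_eq)
  qed
qed

text \<open>The cycle is lifted edge by edge, repaired to a cycle of \<open>F\<close>, filled there,
  and the filling is pushed forward by \<open>bd_contract\<close>.\<close>

lemma contract_cycles:
  assumes Z: "Z \<subseteq> edges F'" "even_set Z" shows "\<exists>Y\<subseteq>F'. bd Y = Z"
proof -
  have lift: "\<exists>e\<in>edges F. m ` e = e'" if e': "e' \<in> edges F'" for e'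
  proof -
    obtain x y where xy: "e' = {x, y}" "adj F' x y" using edgesE[OF e'] by metis
    then obtain s r where "adj F s r" "m s = x" "m r = y" using adj_contract by metis
    moreover from this have "{s, r} \<in> edges F" using adj_edges by metis
    ultimately show ?thesis using xy(1) by (intro bexI[of _ "{s, r}"]) auto
  qed
  define \<sigma> where "\<sigma> = (\<lambda>e'. SOME e. e \<in> edges F \<and> m ` e = e')"
  have \<sigma>: "\<sigma> e' \<in> edges F" "m ` \<sigma> e' = e'" if "e' \<in> Z" for e'
    using someI_ex[of "\<lambda>e. e \<in> edges F \<and> m ` e = e'"] lift[of e'] that Z(1) unfolding \<sigma>_def by blast+
  have inj: "inj_on \<sigma> Z" by (rule inj_onI) (metis \<sigma>(2))
  define Z0 where "Z0 = \<sigma> ` Z"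
  have Z0E: "Z0 \<subseteq> edges F" using \<sigma>(1) by (auto simp: Z0_def)
  have finZ0: "finite Z0" using Z0E finite_edges[OF F] finite_subset by blast
  have Z2: "card e' = 2" if "e' \<in> Z" for e' using that Z(1) by (auto simp: edges_def)
  have nob: "b \<notin> e'" if "e' \<in> Z" for e' using \<sigma>(2)[OF that] m_neq_b by (metis imageE)
  have cnt: "card {e \<in> Z0. Q e} = card {e' \<in> Z. Q (\<sigma> e')}" for Q
  proof -
    have "{e \<in> Z0. Q e} = \<sigma> ` {e' \<in> Z. Q (\<sigma> e')}" by (auto simp: Z0_def)
    then show ?thesis using card_image[OF inj_on_subset[OF inj]] by (metis (no_types, lifting) mem_Collect_eq subsetI)
  qed
  have mem: "w \<in> \<sigma> e' \<longleftrightarrow> w \<in> e'" if "e' \<in> Z" "w \<noteq> b" "w \<noteq> c" for w e'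
  proof -
    have "w \<in> \<sigma> e' \<longleftrightarrow> w \<in> m ` \<sigma> e'" using that(2,3) by (auto simp: merge_def image_iff)
    then show ?thesis using \<sigma>(2)[OF that(1)] by simp
  qed
  have memc: "c \<in> e' \<longleftrightarrow> b \<in> \<sigma> e' \<or> c \<in> \<sigma> e'" if "e' \<in> Z" for e'
  proof -
    have "c \<in> m ` \<sigma> e' \<longleftrightarrow> b \<in> \<sigma> e' \<or> c \<in> \<sigma> e'" by (auto simp: merge_def image_iff)
    then show ?thesis using \<sigma>(2)[OF that] by simp
  qed
  have notboth: "\<not> (b \<in> \<sigma> e' \<and> c \<in> \<sigma> e')" if "e' \<in> Z" for e'
  proof
    assume "b \<in> \<sigma> e' \<and> c \<in> \<sigma> e'"
    moreover have "card (\<sigma> e') = 2" using \<sigma>(1)[OF that] by (simp add: edges_def)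
    ultimately have "\<sigma> e' = {b, c}" using cb(1) by (auto simp: card_2_iff)
    then have "e' = {c}" using \<sigma>(2)[OF that] by simp
    then show False using Z2[OF that] by simp
  qed
  have finZ: "finite Z" using finZ0 inj by (simp add: Z0_def finite_image_iff)
  have evZ: "even (card {e' \<in> Z. w \<in> e'})" for w using Z(2) by (simp add: even_set_def)
  have "card {e' \<in> Z. c \<in> e'} = card ({e' \<in> Z. b \<in> \<sigma> e'} \<union> {e' \<in> Z. c \<in> \<sigma> e'})"
    using memc by (intro arg_cong[of _ _ card]) blast
  also have "\<dots> = card {e' \<in> Z. b \<in> \<sigma> e'} + card {e' \<in> Z. c \<in> \<sigma> e'}"
    using finZ notboth by (intro card_Un_disjoint) auto
  finally have bc: "card {e' \<in> Z. c \<in> e'} = card {e \<in> Z0. b \<in> e} + card {e \<in> Z0. c \<in> e}"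
    using cnt by simp
  have cbn: "{c, b} \<notin> Z0" using notboth by (auto simp: Z0_def)
  \<comment> \<open>The degrees of the lift at \<open>b\<close> and \<open>c\<close> add up to the
    even degree of \<open>c\<close> in \<open>Z\<close>, so they have the same parity. If both are
    odd, the edge \<open>cb\<close>, which the contraction kills, repairs both.\<close>
  define Z1 where "Z1 = (if odd (card {e \<in> Z0. c \<in> e}) then insert {c, b} Z0 else Z0)"
  have "even_set Z1"
    unfolding even_set_def
  proof
    fix w
    show "even (card {e \<in> Z1. w \<in> e})"
    proof (cases "w = b \<or> w = c")
      case False
      then have "{e \<in> Z1. w \<in> e} = {e \<in> Z0. w \<in> e}" by (auto simp: Z1_def)
      then have "card {e \<in> Z1. w \<in> e} = card {e' \<in> Z. w \<in> \<sigma> e'}" using cnt by simp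
      also have "{e' \<in> Z. w \<in> \<sigma> e'} = {e' \<in> Z. w \<in> e'}" using mem False by blast
      finally show ?thesis using evZ by simp
    next
      case True
      have bc': "odd (card {e \<in> Z0. b \<in> e}) \<longleftrightarrow> odd (card {e \<in> Z0. c \<in> e})" using bc evZ[of c] by simp
      show ?thesis
      proof (cases "odd (card {e \<in> Z0. c \<in> e})")
        case odd: True
        then have "{e \<in> Z1. w \<in> e} = insert {c, b} {e \<in> Z0. w \<in> e}" using True by (auto simp: Z1_def)
        then have "card {e \<in> Z1. w \<in> e} = Suc (card {e \<in> Z0. w \<in> e})" using cbn finZ0 by simp
        then show ?thesis using odd bc' True by auto
      next
        case False
        then have "{e \<in> Z1. w \<in> e} = {e \<in> Z0. w \<in> e}" by (auto simp: Z1_def)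
        then show ?thesis using False bc' True by auto
      qed
    qed
  qed
  moreover have "Z1 \<subseteq> edges F"
  proof -
    have "adj F c b" using face_adj[OF F cp] by simp
    then have "{c, b} \<in> edges F" using adj_edges by metis
    then show ?thesis using Z0E by (auto simp: Z1_def)
  qed
  ultimately obtain Y where Y: "Y \<subseteq> F" "bd Y = Z1" using sphericalD(6)[OF F] by blast
  have "e' \<in> bd ((\<lambda>f. m ` f) ` (Y \<inter> N)) \<longleftrightarrow> e' \<in> Z" for e'
  proof (cases "card e' = 2")
    case False
    then show ?thesis using Z2 by (auto simp: bd_def)
  next
    case True
    have "m ` {c, b} \<noteq> e'" using True by auto
    then have "{e \<in> Z1. m ` e = e'} = {e \<in> Z0. m ` e = e'}" by (auto simp: Z1_def)
    then have "card {e \<in> Z1. m ` e = e'} = card {e1 \<in> Z. m ` \<sigma> e1 = e'}" using cnt by simp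
    also have "{e1 \<in> Z. m ` \<sigma> e1 = e'} = (if e' \<in> Z then {e'} else {})" using \<sigma>(2) by auto
    finally have "odd (card {e \<in> Z1. m ` e = e'}) \<longleftrightarrow> e' \<in> Z" by simp
    then show ?thesis using bd_contract[OF Y(1), of e'] True Y(2) by simp
  qed
  then have "bd ((\<lambda>f. m ` f) ` (Y \<inter> N)) = Z" by blast
  moreover have "(\<lambda>f. m ` f) ` (Y \<inter> N) \<subseteq> F'" unfolding F'_eq by blast
  ultimately show ?thesis by blast
qed

lemma contract_spherical: "spherical F'"
  unfolding spherical_def
proof (intro conjI ballI allI impI)
  show "finite F'" using finN by (simp add: F'_eq)
  have "adj F c p" using face_adj[OF F cp] by simp
  then have "adj F' c p" unfolding adj_contract using cb by (intro conjI exI[of _ c] exI[of _ p]) auto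
  then show "F' \<noteq> {}" by (auto simp: adj_def)
  show "card f = 3" if "f \<in> F'" for f using that card_m_face by (auto simp: F'_eq)
qed (use card_contract_edge contract_minimal contract_cycles in blast)+

end

section \<open>Generic rigidity of spheres\<close>

text \<open>Every edge of the tetrahedron already has its two faces among the four triangles, so
  these are closed and by minimality they are everything.\<close>

lemma K4_spherical:
  assumes F: "spherical F" and d: "distinct [a, b, c, d]"
    and f: "{a, b, c} \<in> F" "{a, b, d} \<in> F" "{a, c, d} \<in> F" "{b, c, d} \<in> F"
  shows "\<Union>F = {a, b, c, d}"
proof -
  define X where "X = {{a, b, c}, {a, b, d}, {a, c, d}, {b, c, d}}"
  have XF: "X \<subseteq> F" using f by (simp add: X_def)
  have XV: "h \<subseteq> {a, b, c, d}" if "h \<in> X" for h using that by (auto simp: X_def)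
  have key: "\<exists>z w. z \<noteq> w \<and> {x, y, z} \<in> X \<and> {x, y, w} \<in> X" if xy: "x \<in> {a, b, c, d}" "y \<in> {a, b, c, d}" "x \<noteq> y" for x y
  proof -
    have 1: "{a, b, c} \<in> X" "{a, b, d} \<in> X" "{a, c, b} \<in> X" "{a, c, d} \<in> X" "{a, d, b} \<in> X" "{a, d, c} \<in> X"
      "{b, c, a} \<in> X" "{b, c, d} \<in> X" "{b, d, a} \<in> X" "{b, d, c} \<in> X" "{c, d, a} \<in> X" "{c, d, b} \<in> X"
      by (simp_all add: X_def insert_commute)
    have 2: "{b, a, c} \<in> X" "{b, a, d} \<in> X" "{c, a, b} \<in> X" "{c, a, d} \<in> X" "{d, a, b} \<in> X" "{d, a, c} \<in> X"
      "{c, b, a} \<in> X" "{c, b, d} \<in> X" "{d, b, a} \<in> X" "{d, b, c} \<in> X" "{d, c, a} \<in> X" "{d, c, b} \<in> X"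
      by (simp_all add: X_def insert_commute)
    consider "x = a \<and> y = b" | "x = a \<and> y = c" | "x = a \<and> y = d" | "x = b \<and> y = c" | "x = b \<and> y = d" | "x = c \<and> y = d"
      | "y = a \<and> x = b" | "y = a \<and> x = c" | "y = a \<and> x = d" | "y = b \<and> x = c" | "y = b \<and> x = d" | "y = c \<and> x = d"
      using xy by fast
    then show ?thesis
    proof cases
    qed (use 1 2 d in \<open>metis distinct_length_2_or_more\<close>)+
  qed
  have "bd X = {}"
  proof (rule bd_emptyI[OF F XF])
    fix e h g assume e: "e \<in> edges F" "h \<in> X" "g \<in> F" "e \<subseteq> h" "e \<subseteq> g"
    obtain x y where xy: "e = {x, y}" "x \<noteq> y" using edgesE[OF e(1)] by metis
    then have "x \<in> {a, b, c, d}" "y \<in> {a, b, c, d}" using XV[OF e(2)] e(4) by blast+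
    then obtain z w where zw: "z \<noteq> w" "{x, y, z} \<in> X" "{x, y, w} \<in> X" using key xy(2) by metis
    have "x \<in> g" "y \<in> g" using xy e(5) by auto
    then obtain g' where g': "g = {x, y, g'}" using face_at[OF F e(3) _ _ xy(2)] by metis
    have "g' = z \<or> w = g'"
      using at_most_two_faces[OF F, of x y z w g'] zw XF e(3) g' by blast
    then show "g \<in> X" using zw g' by auto
  qed
  moreover have "X \<noteq> {}" by (simp add: X_def)
  ultimately have "X = F" using spherical_minimal[OF F XF] by metis
  then have "\<Union>F = \<Union>X" by simp
  also have "\<dots> = {a, b, c, d}" by (auto simp: X_def)
  finally show ?thesis .
qed

lemma flag_K4:
  assumes F: "spherical F" and fl: "flag F"
    and ad: "adj F a b" "adj F a c" "adj F a d" "adj F b c" "adj F b d" "adj F c d"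
  shows "\<Union>F = {a, b, c, d}"
proof (rule K4_spherical[OF F])
  show "distinct [a, b, c, d]" using ad by (auto simp: adj_def)
  show "{a, b, c} \<in> F" using flagD[OF fl ad(1,4,2)] .
  show "{a, b, d} \<in> F" using flagD[OF fl ad(1,5,3)] .
  show "{a, c, d} \<in> F" using flagD[OF fl ad(2,6,3)] .
  show "{b, c, d} \<in> F" using flagD[OF fl ad(4,6,5)] .
qed

lemma flag_contractible:
  assumes F: "spherical F" and fl: "flag F" and f: "{c, b, p} \<in> F" "{c, b, q} \<in> F" and pq: "p \<noteq> q" "\<not> adj F p q"
  shows "contractible F c b p q"
  using flagD[OF fl face_adj(1)[OF F f(1)]] assms by unfold_locales auto

lemma edges_Pow: "edges F \<subseteq> Pow (\<Union>F)"
  by (auto simp: edges_def)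

context contractible
begin

text \<open>The vertex split for an edge of a sphere. The removed vertex \<open>b\<close> must be
  neither \<open>u\<close> nor \<open>v\<close>, since its position is chosen anew. The face
  \<open>ijk\<close> avoids \<open>b\<close> and contains at most one of \<open>u\<close>,
  \<open>v\<close> when they differ; it survives the contraction, can be noncollinear, and serves
  for pinning.\<close>

lemma rigid_contract:
  assumes r: "gen_rigid u v (\<Union>F') (insert {m x, m y} (edges F'))" and bu: "b \<noteq> u" "b \<noteq> v"
    and xy: "x \<in> \<Union>F" "y \<in> \<Union>F" "x \<noteq> y"
    and uv: "u = v \<or> \<not> {u, v} \<subseteq> {c, p, q}"
    and f: "{i, j, k} \<in> F" "b \<notin> {i, j, k}" "u = v \<or> \<not> {u, v} \<subseteq> {i, j, k}"
  shows "gen_rigid u v (\<Union>F) (insert {x, y} (edges F))"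
proof -
  have V: "\<Union>F = insert b (\<Union>F')" using vertices_contract cp by auto
  have cF: "c \<in> \<Union>F" using cp by blast
  have mV: "m z \<in> \<Union>F'" if "z \<in> \<Union>F" for z
    using that cF m_neq_b vertices_contract by (auto simp: merge_def)
  have dijk: "i \<noteq> j" "i \<noteq> k" "j \<noteq> k" using face_distinct[OF F f(1)] by auto
  have adc: "adj F c b" "adj F c p" "adj F b p" "adj F c q" "adj F b q"
    using face_adj[OF F cp] face_adj[OF F cq] by auto
  have "gen_rigid u v (insert b (\<Union>F')) (insert {x, y} (edges F))"
  proof (rule gen_rigid_split[where E' = "insert {m x, m y} (edges F')" and c = c and p = p and q = q and i = i and j = j and k = k])
    show "finite (\<Union>F')" using spherical_finite[OF contract_spherical] by simp
    show "b \<notin> \<Union>F'" using vertices_contract by simp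
    show "b \<noteq> u" "b \<noteq> v" using bu .
    show "insert {m x, m y} (edges F') \<subseteq> Pow (\<Union>F')" using edges_Pow[of F'] mV xy by simp
    show "insert {x, y} (edges F) \<subseteq> Pow (insert b (\<Union>F'))" using edges_Pow[of F] xy unfolding V[symmetric] by simp
    show "gen_rigid u v (\<Union>F') (insert {m x, m y} (edges F'))" by (rule r)
    show "c \<in> \<Union>F'" "p \<in> \<Union>F'" "q \<in> \<Union>F'" using vertices_contract cp cq cb by auto
    show "distinct [c, p, q]" using cb pq by simp
    show "u = v \<or> \<not> {u, v} \<subseteq> {c, p, q}" by (rule uv)
    show "{c, b} \<in> insert {x, y} (edges F)" "{c, p} \<in> insert {x, y} (edges F)" "{b, p} \<in> insert {x, y} (edges F)"
      "{c, q} \<in> insert {x, y} (edges F)" "{b, q} \<in> insert {x, y} (edges F)"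
      using adc adj_edges[of F] by simp_all
    show "{s, r} \<in> insert {x, y} (edges F) \<or> s = c \<and> {b, r} \<in> insert {x, y} (edges F) \<or> r = c \<and> {s, b} \<in> insert {x, y} (edges F)"
      if "{s, r} \<in> insert {m x, m y} (edges F')" for s r
    proof -
      have "\<exists>s' r'. s' \<noteq> r' \<and> {s', r'} \<in> insert {x, y} (edges F) \<and> m s' = s \<and> m r' = r"
      proof (cases "{s, r} \<in> edges F'")
        case True
        then have "adj F' s r" using adj_edges by metis
        then obtain s' r' where sr: "adj F s' r'" "m s' = s" "m r' = r" unfolding adj_contract by blast
        then have "{s', r'} \<in> edges F" "s' \<noteq> r'" using adj_edges[of F s' r'] by (auto simp: adj_def)
        then show ?thesis using sr by blast
      next
        case False
        then have "{s, r} = {m x, m y}" using that by simp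
        then have "s = m x \<and> r = m y \<or> s = m y \<and> r = m x" by (auto simp: doubleton_eq_iff)
        then show ?thesis
        proof
          assume "s = m x \<and> r = m y"
          then show ?thesis using xy(3) by (intro exI[of _ x] exI[of _ y]) simp
        next
          assume "s = m y \<and> r = m x"
          then show ?thesis using xy(3) by (intro exI[of _ y] exI[of _ x]) (simp add: insert_commute)
        qed
      qed
      then obtain s' r' where *: "s' \<noteq> r'" "{s', r'} \<in> insert {x, y} (edges F)" "m s' = s" "m r' = r" by blast
      show ?thesis
      proof (cases "s' = b")
        case True
        then have "s = c" "r = r'" using * by (auto simp: merge_def split: if_splits)
        then show ?thesis using * True by simp
      next
        case sb: False
        then have s: "s = s'" using * by (simp add: merge_def)
        show ?thesis
        proof (cases "r' = b")
          case True
          then have "r = c" using * by simp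
          then show ?thesis using * True s by simp
        next
          case False
          then have "r = r'" using * by (simp add: merge_def)
          then show ?thesis using * s by simp
        qed
      qed
    qed
    show "{i, j, k} \<subseteq> \<Union>F'" using f(1,2) vertices_contract by auto
    show "distinct [i, j, k]" using dijk by simp
    show "u = v \<or> \<not> {u, v} \<subseteq> {i, j, k}" by (rule f(3))
    show "{i, j} \<in> insert {x, y} (edges F)" "{j, k} \<in> insert {x, y} (edges F)" "{i, k} \<in> insert {x, y} (edges F)"
      using face_adj[OF F f(1)] adj_edges[of F] by simp_all
  qed
  then show ?thesis using V by simp
qed

end

lemma card_contract:
  assumes "contractible F c b p q" shows "card (\<Union>(contract c b F)) < card (\<Union>F)"
proof -
  interpret contractible F c b p q by (rule assms)
  have "b \<in> \<Union>F" using cp by blast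
  then show ?thesis using vertices_contract spherical_finite[OF F] by (simp only:) (meson card_Diff1_less)
qed

lemma gen_rigid_same: "gen_rigid s s W E \<longleftrightarrow> gen_rigid t t W E"
  by (simp add: gen_rigid_def)

text \<open>Gluck's theorem. Pieces along a separating triangle are glued. A flag sphere is a
  tetrahedron if the apices of the two faces at some edge are adjacent, and otherwise that edge is
  contracted.\<close>

theorem spherical_gen_rigid:
  assumes "spherical F" shows "gen_rigid s s (\<Union>F) (edges F)"
  using assms
proof (induction "card (\<Union>F)" arbitrary: F rule: less_induct)
  case less
  note F = less.prems
  have fin: "finite (\<Union>F)" using spherical_finite[OF F] by simp
  show ?case
  proof (cases "\<exists>A B. nsep F A B \<and> card (A \<inter> B) = 3")
    case True
    then obtain A B where n: "nsep F A B" "card (A \<inter> B) \<le> 3" by auto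
    then have n': "nsep F B A" "card (B \<inter> A) \<le> 3" using nsep_commute by (auto simp: Int_commute)
    note cA = cut_spherical[OF F n] and cB = cut_spherical[OF F n']
    define FA FB where "FA = insert (A \<inter> B) {f \<in> F. f \<subseteq> A}" and "FB = insert (B \<inter> A) {f \<in> F. f \<subseteq> B}"
    note cA = cA[folded FA_def] and cB = cB[folded FB_def]
    have AV: "A \<subset> \<Union>F" "B \<subset> \<Union>F" using nsepD(1-3)[OF n(1)] by blast+
    have "gen_rigid s s A (edges FA)"
      using less.hyps[of FA] cA(1,2) psubset_card_mono[OF fin AV(1)] by simp
    moreover have "gen_rigid s s B (edges FB)"
      using less.hyps[of FB] cB(1,2) psubset_card_mono[OF fin AV(2)] by simp
    moreover obtain a b c where abc: "A \<inter> B = {a, b, c}" "distinct [a, b, c]"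
      using nsep3_triangle[OF F n] by metis
    ultimately have "gen_rigid s s (A \<union> B) (edges F)"
    proof (intro gen_rigid_glue[where F = "edges FA" and F' = "edges FB" and a = a and b = b and c = c])
      show "finite A" "finite B" using nsep_finite[OF F n(1)] by auto
      show "edges FA \<subseteq> Pow A" "edges FB \<subseteq> Pow B" using edges_Pow[of FA] edges_Pow[of FB] cA(2) cB(2) by auto
      show "edges FA \<subseteq> edges F"
      proof
        fix e assume "e \<in> edges FA"
        then obtain x y where "e = {x, y}" "adj FA x y" using edgesE by metis
        then show "e \<in> edges F" using cA(3) adj_edges[of F x y] by simp
      qed
      show "{x, y} \<in> edges F \<or> {x, y} \<subseteq> A" if "{x, y} \<in> edges FB" for x y
        using that cB(3)[of x y] adj_edges[of FB x y] adj_edges[of F x y] by simp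
    qed auto
    then show ?thesis using nsepD(1)[OF n(1)] by simp
  next
    case False
    then have fl: "flag F" using flagI_nsep[OF F] by blast
    obtain f where f: "f \<in> F" using sphericalD(2)[OF F] by blast
    then obtain c b p where cbp: "{c, b, p} \<in> F"
      using spherical_face[OF F f] by (metis card_3_iff)
    obtain q where q: "q \<noteq> p" "{c, b, q} \<in> F" using other_face[OF F cbp] by metis
    note ad = face_adj[OF F cbp] face_adj[OF F q(2)]
    have dst: "c \<noteq> b" "c \<noteq> p" "b \<noteq> p" "c \<noteq> q" "b \<noteq> q" using face_distinct[OF F cbp] face_distinct[OF F q(2)] by auto
    show ?thesis
    proof (cases "adj F p q")
      case True
      have V: "\<Union>F = insert q {c, b, p}"
        using flag_K4[OF F fl, of c b p q] ad True by (simp add: insert_commute)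
      have e: "{c, b} \<in> edges F" "{b, p} \<in> edges F" "{c, p} \<in> edges F" "{q, c} \<in> edges F" "{q, b} \<in> edges F" "{q, p} \<in> edges F"
        using ad True adj_edges[of F] adj_commute[of F p q] by simp_all
      have "gen_rigid s s {c, b, p} {{c, b}, {b, p}, {c, p}}"
        by (rule gen_rigid_triangle) (use dst in auto)
      then have "gen_rigid s s (insert q {c, b, p}) (edges F)"
        by (rule gen_rigid_attach[rotated 3, where a = c and b = b and c = p]) (use dst q(1) e in auto)
      then show ?thesis using V by simp
    next
      case False
      then have con: "contractible F c b p q" using flag_contractible[OF F fl cbp q(2)] q(1) by simp
      interpret contractible F c b p q by (rule con)
      \<comment> \<open>The point \<open>s\<close> was arbitrary and might be \<open>b\<close>,
        which the split moves. As \<open>gen_rigid s s\<close> does not depend on \<open>s\<close>,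
        it is replaced by \<open>c\<close>.\<close>
      have "gen_rigid c c (\<Union>(contract c b F)) (edges (contract c b F))"
        using less.hyps[OF card_contract[OF con] contract_spherical] gen_rigid_same[of s _ _ c] by simp
      \<comment> \<open>\<open>rigid_contract\<close> expects a brace. The edge \<open>cp\<close>,
        which is present both before and after the contraction, plays its part.\<close>
      moreover have "{merge c b c, merge c b p} \<in> edges (contract c b F)"
      proof -
        have "adj (contract c b F) c p"
          unfolding adj_contract using ad dst by (intro conjI exI[of _ c] exI[of _ p]) auto
        then show ?thesis using adj_edges[of "contract c b F" c p] dst by simp
      qed
      ultimately have r: "gen_rigid c c (\<Union>(contract c b F)) (insert {merge c b c, merge c b p} (edges (contract c b F)))"
        by (simp only: insert_absorb)
      have "{c, p, b} \<in> F" using cbp by (simp add: insert_commute)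
      then obtain z where z: "z \<noteq> b" "{c, p, z} \<in> F" using other_face[OF F] by metis
      have "c \<in> \<Union>F" "p \<in> \<Union>F" using cbp by blast+
      then have "gen_rigid c c (\<Union>F) (insert {c, p} (edges F))"
        by (intro rigid_contract[OF r, where i = c and j = p and k = z]) (use dst z in auto)
      moreover have "{c, p} \<in> edges F" using ad adj_edges[of F c p] by simp
      ultimately have "gen_rigid c c (\<Union>F) (edges F)" by (simp only: insert_absorb)
      then show ?thesis using gen_rigid_same[of s _ _ c] by simp
    qed
  qed
qed

section \<open>Adding a brace\<close>

definition good :: "'a set set \<Rightarrow> 'a \<Rightarrow> 'a \<Rightarrow> 'a \<Rightarrow> 'a \<Rightarrow> bool" where
  "good F u v x y \<longleftrightarrow> spherical F \<and> adj F u v \<and> (\<forall>t. adj F u t \<and> adj F v t \<longrightarrow> {u, v, t} \<in> F) \<and>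
     x \<in> \<Union>F \<and> y \<in> \<Union>F \<and> x \<noteq> y \<and> \<not> adj F x y \<and>
     (\<forall>A B. nsep F A B \<and> card (A \<inter> B) \<le> 3 \<and> u \<in> A \<and> v \<in> A \<longrightarrow> \<not> (x \<in> B \<and> y \<in> B))"

definition braced_rigid :: "'a set set \<Rightarrow> 'a \<Rightarrow> 'a \<Rightarrow> 'a \<Rightarrow> 'a \<Rightarrow> bool" where
  "braced_rigid F u v x y \<longleftrightarrow> gen_rigid u v (\<Union>F) (insert {x, y} (edges F))"

lemma goodD:
  assumes "good F u v x y"
  shows "spherical F" "adj F u v" "\<And>t. adj F u t \<Longrightarrow> adj F v t \<Longrightarrow> {u, v, t} \<in> F" "x \<in> \<Union>F" "y \<in> \<Union>F" "x \<noteq> y"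
    "\<not> adj F x y" "\<And>A B. nsep F A B \<Longrightarrow> card (A \<inter> B) \<le> 3 \<Longrightarrow> u \<in> A \<Longrightarrow> v \<in> A \<Longrightarrow> x \<in> B \<Longrightarrow> y \<in> B \<Longrightarrow> False"
  using assms unfolding good_def by - (elim conjE, (assumption | blast))+

lemma good_commute: "good F u v x y \<longleftrightarrow> good F u v y x"
proof -
  have "good F u v y x" if g: "good F u v x y" for x y
    unfolding good_def
  proof (intro conjI allI impI)
    show "\<not> adj F y x" using goodD(7)[OF g] adj_commute[of F x y] by simp
    show "\<not> (y \<in> B \<and> x \<in> B)" if "nsep F A B \<and> card (A \<inter> B) \<le> 3 \<and> u \<in> A \<and> v \<in> A" for A B
      using goodD(8)[OF g, of A B] that by blast
  qed (use goodD(1-6)[OF g] in auto)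
  then show ?thesis by blast
qed

lemma braced_rigid_commute: "braced_rigid F u v x y \<longleftrightarrow> braced_rigid F u v y x"
  unfolding braced_rigid_def by (simp add: insert_commute)

section \<open>Uncrossing of separations\<close>

text \<open>The two new separators have the same union and the same intersection as the two old
  ones. Hence a lower bound on the order at one corner bounds the order at the opposite corner from
  above.\<close>

lemma nsep_uncross_card:
  assumes fin: "finite (\<Union>F)" and n: "nsep F A B" "nsep F A' B'"
  shows "card ((A \<inter> A') \<inter> (B \<union> B')) + card ((A \<union> A') \<inter> (B \<inter> B')) = card (A \<inter> B) + card (A' \<inter> B')"
proof -
  have V: "A \<union> B = A' \<union> B'" "finite (A \<union> B)" using nsepD(1)[OF n(1)] nsepD(1)[OF n(2)] fin by auto
  let ?P = "(A \<inter> A') \<inter> (B \<union> B')" and ?Q = "(A \<union> A') \<inter> (B \<inter> B')"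
  have "?P \<union> ?Q = (A \<inter> B) \<union> (A' \<inter> B')" "?P \<inter> ?Q = (A \<inter> B) \<inter> (A' \<inter> B')" using V(1) by blast+
  moreover have "finite A" "finite B" "finite A'" "finite B'" using V by (metis finite_Un)+
  ultimately show ?thesis
    using card_Un_Int[of ?P ?Q] card_Un_Int[of "A \<inter> B" "A' \<inter> B'"] by simp
qed

lemma nsep_uncross:
  assumes n: "nsep F A B" "nsep F A' B'" and ne: "(A \<inter> A') - (B \<union> B') \<noteq> {}"
  shows "nsep F (A \<inter> A') (B \<union> B')"
  unfolding nsep_def
proof (intro conjI ballI ne)
  have V: "A \<union> B = \<Union>F" "A' \<union> B' = \<Union>F" using nsepD(1)[OF n(1)] nsepD(1)[OF n(2)] by auto
  show "A \<inter> A' \<union> (B \<union> B') = \<Union>F" using V by blast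
  show "B \<union> B' - A \<inter> A' \<noteq> {}" using nsepD(3)[OF n(1)] by blast
  fix a b assume a: "a \<in> A \<inter> A' - (B \<union> B')" and b: "b \<in> B \<union> B' - A \<inter> A'"
  have "b \<notin> A \<and> b \<in> B \<or> b \<notin> A' \<and> b \<in> B'" using b V by blast
  then show "\<not> adj F a b" using nsepD(4)[OF n(1), of a b] nsepD(4)[OF n(2), of a b] a by blast
qed

lemma nsep_uncross':
  assumes n: "nsep F A B" "nsep F A' B'" and ne: "(B \<inter> B') - (A \<union> A') \<noteq> {}"
  shows "nsep F (A \<union> A') (B \<inter> B')"
  using nsep_uncross[of F B A B' A'] assms nsep_commute by metis

section \<open>Braced spheres with a separating triangle\<close>

locale cutting =
  fixes F :: "'a set set" and A B
  assumes F: "spherical F" and n: "nsep F A B" and c3: "card (A \<inter> B) \<le> 3"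
begin

abbreviation "FA \<equiv> insert (A \<inter> B) {f \<in> F. f \<subseteq> A}"
abbreviation "FB \<equiv> insert (B \<inter> A) {f \<in> F. f \<subseteq> B}"

lemma n': "nsep F B A" "card (B \<inter> A) \<le> 3" using n c3 nsep_commute by (auto simp: Int_commute)

lemmas cutA = cut_spherical[OF F n c3]
lemmas cutB = cut_spherical[OF F n']

lemma V: "A \<union> B = \<Union>F" using nsepD(1)[OF n] .

lemma fin: "finite A" "finite B" using nsep_finite[OF F n] by auto

lemma cards: "card A < card (\<Union>F)"
proof -
  have "A \<subset> \<Union>F" using nsepD(1,3)[OF n] by blast
  then show ?thesis using psubset_card_mono spherical_finite[OF F] by blast
qed

lemma edgesA: "edges FA \<subseteq> edges F" "edges FA \<subseteq> Pow A"
proof -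
  show "edges FA \<subseteq> edges F"
  proof
    fix e assume "e \<in> edges FA"
    then obtain x y where "e = {x, y}" "x \<noteq> y" "adj FA x y" by (rule edgesE)
    then show "e \<in> edges F" using cutA(3)[of x y] adj_edges[of F x y] by simp
  qed
  show "edges FA \<subseteq> Pow A" using edges_Pow[of FA] cutA(2) by simp
qed

lemma edgesB: "edges FB \<subseteq> edges F" "edges FB \<subseteq> Pow B"
proof -
  show "edges FB \<subseteq> edges F"
  proof
    fix e assume "e \<in> edges FB"
    then obtain x y where "e = {x, y}" "x \<noteq> y" "adj FB x y" by (rule edgesE)
    then show "e \<in> edges F" using cutB(3)[of x y] adj_edges[of F x y] by simp
  qed
  show "edges FB \<subseteq> Pow B" using edges_Pow[of FB] cutB(2) by simp
qed

lemma rigidB: "\<not> {u, v} \<subseteq> B \<Longrightarrow> gen_rigid u v B (edges FB)"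
  using gen_rigid_coincide[OF _ edgesB(2)] spherical_gen_rigid[OF cutB(1)] unfolding cutB(2) by blast

text \<open>\<open>B\<close> is attached to the piece along the separating triangle only. Added to
  the side that contains this triangle, it leaves the separator unchanged.\<close>

lemma lift_nsep:
  assumes n1: "nsep FA A' B'" and sub: "A \<inter> B \<subseteq> A'"
  shows "nsep F (A' \<union> B) B'" "(A' \<union> B) \<inter> B' = A' \<inter> B'"
proof -
  have V': "A' \<union> B' = A" using nsepD(1)[OF n1] cutA(2) by simp
  show "(A' \<union> B) \<inter> B' = A' \<inter> B'" using V' sub by blast
  show "nsep F (A' \<union> B) B'"
    unfolding nsep_def
  proof (intro conjI ballI)
    show "A' \<union> B \<union> B' = \<Union>F" using V V' by blast
    show "A' \<union> B - B' \<noteq> {}" using nsepD(2)[OF n1] by blast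
    show "B' - (A' \<union> B) \<noteq> {}" using nsepD(3)[OF n1] V' sub by blast
    fix a b assume a: "a \<in> A' \<union> B - B'" and b: "b \<in> B' - (A' \<union> B)"
    have bA: "b \<in> A" "b \<notin> B" "b \<in> B'" "b \<notin> A'" using b V' by auto
    show "\<not> adj F a b"
    proof (cases "a \<in> A")
      case True
      then have "a \<in> A'" "a \<notin> B'" using a V' by auto
      then have "\<not> adj FA a b" using nsepD(4)[OF n1, of a b] bA by blast
      then show ?thesis using cutA(3)[of a b] True bA by simp
    next
      case False
      then have "a \<in> B" using a V' by blast
      then show ?thesis using nsepD(4)[OF n, of b a] bA False adj_commute[of F a b] by blast
    qed
  qed
qed

lemma lift_nsep':
  assumes n1: "nsep FA A' B'" and sub: "A \<inter> B \<subseteq> B'"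
  shows "nsep F A' (B' \<union> B)" "A' \<inter> (B' \<union> B) = A' \<inter> B'"
  using lift_nsep[of B' A'] n1 sub nsep_commute[of FA A' B'] nsep_commute[of F A'] by (auto simp: Int_commute)

text \<open>The separating triangle is a face of the piece, so no separation of the piece can split
  it.\<close>

lemma side: "nsep FA A' B' \<Longrightarrow> A \<inter> B \<subseteq> A' \<or> A \<inter> B \<subseteq> B'"
  by (rule nsep_face) auto

text \<open>Otherwise the third vertex of the separating triangle would be a common neighbour of
  \<open>u\<close> and \<open>v\<close>. By the condition on common neighbours the triangle would be
  a face of \<open>F\<close>, which a separating triangle never is.\<close>

lemma edge_not_both:
  assumes ad: "adj F u v" and com: "\<And>t. adj F u t \<Longrightarrow> adj F v t \<Longrightarrow> {u, v, t} \<in> F"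
  shows "\<not> {u, v} \<subseteq> A \<inter> B"
proof
  assume uv: "{u, v} \<subseteq> A \<inter> B"
  have uvn: "u \<noteq> v" using ad by (auto simp: adj_def)
  obtain a b c where D: "A \<inter> B = {a, b, c}" "distinct [a, b, c]" using nsep3_triangle[OF F n c3] by metis
  have c3': "card (A \<inter> B) = 3" using D by simp
  obtain t where t: "A \<inter> B = {u, v, t}" "t \<noteq> u" "t \<noteq> v"
    using triple_cases[OF c3', of u v] uv uvn by auto
  have "adj F u t" "adj F v t" using nsep3_clique[OF F n c3] t by auto
  then have "{u, v, t} \<in> F" by (rule com)
  then show False using cutA(4) t(1) by simp
qed

lemma goodA:
  assumes ad: "adj F u v" and com: "\<And>t. adj F u t \<Longrightarrow> adj F v t \<Longrightarrow> {u, v, t} \<in> F" and uv: "u \<in> A" "v \<in> A"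
    and xy: "x \<in> A" "y \<in> A" "x \<noteq> y" "\<not> adj F x y"
    and sp: "\<And>A' B'. nsep FA A' B' \<Longrightarrow> card (A' \<inter> B') \<le> 3 \<Longrightarrow> u \<in> A' \<Longrightarrow> v \<in> A' \<Longrightarrow> x \<in> B' \<Longrightarrow> y \<in> B' \<Longrightarrow> False"
  shows "good FA u v x y"
  unfolding good_def
proof (intro conjI allI impI)
  show "spherical FA" by (rule cutA(1))
  show "adj FA u v" using cutA(3) ad uv by simp
  show "{u, v, t} \<in> FA" if "adj FA u t \<and> adj FA v t" for t
  proof -
    have "{u, v, t} \<in> F" "t \<in> A" using that cutA(3) com by auto
    then show ?thesis using uv by simp
  qed
  show "x \<in> \<Union>FA" "y \<in> \<Union>FA" using cutA(2) xy by simp_all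
  show "x \<noteq> y" by (rule xy(3))
  show "\<not> adj FA x y" using cutA(3) xy(4) by simp
  show "\<not> (x \<in> B' \<and> y \<in> B')" if "nsep FA A' B' \<and> card (A' \<inter> B') \<le> 3 \<and> u \<in> A' \<and> v \<in> A'" for A' B'
    using sp[of A' B'] that by blast
qed

text \<open>The piece on the side of \<open>B\<close> does not contain both \<open>u\<close> and
  \<open>v\<close>, so there the coincidence costs nothing and rigidity of an unbraced sphere
  suffices.\<close>

lemma rigid_if_braceA:
  assumes g: "good F u v x y" and uv: "u \<in> A" "v \<in> A" and xy: "x \<in> A" "y \<in> A" and r: "braced_rigid FA u v x y"
  shows "braced_rigid F u v x y"
proof -
  have nb: "\<not> {u, v} \<subseteq> A \<inter> B" using edge_not_both goodD(2,3)[OF g] by blast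
  then have nB: "\<not> {u, v} \<subseteq> B" using uv by blast
  obtain a b c where D: "A \<inter> B = {a, b, c}" "distinct [a, b, c]" using nsep3_triangle[OF F n c3] by metis
  have "gen_rigid u v (A \<union> B) (insert {x, y} (edges F))"
  proof (rule gen_rigid_glue[where F = "insert {x, y} (edges FA)" and F' = "edges FB" and a = a and b = b and c = c])
    show "finite A" "finite B" using fin by auto
    show "insert {x, y} (edges FA) \<subseteq> Pow A" "edges FB \<subseteq> Pow B" using edgesA edgesB xy by auto
    show "insert {x, y} (edges FA) \<subseteq> insert {x, y} (edges F)" using edgesA(1) by blast
    show "{s, r} \<in> insert {x, y} (edges F) \<or> {s, r} \<subseteq> A" if "{s, r} \<in> edges FB" for s r
      using edgesB(1) that by blast
    show "gen_rigid u v A (insert {x, y} (edges FA))" using r unfolding braced_rigid_def cutA(2) .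
    show "gen_rigid u v B (edges FB)" by (rule rigidB[OF nB])
    show "distinct [a, b, c]" by (rule D(2))
    show "{a, b, c} \<subseteq> A" "{a, b, c} \<subseteq> B" using D(1) by blast+
    show "u = v \<or> \<not> {u, v} \<subseteq> {a, b, c}" using nb D(1) by simp
  qed
  then show ?thesis unfolding braced_rigid_def V .
qed

lemma good_brace_in_A:
  assumes g: "good F u v x y" and uv: "u \<in> A" "v \<in> A" and xy: "x \<in> A" "y \<in> A"
  shows "good FA u v x y"
proof (rule goodA[OF goodD(2,3)[OF g] uv xy goodD(6,7)[OF g]])
  fix A' B' assume h: "nsep FA A' B'" "card (A' \<inter> B') \<le> 3" "u \<in> A'" "v \<in> A'" "x \<in> B'" "y \<in> B'"
  from side[OF h(1)] show False
  proof
    assume "A \<inter> B \<subseteq> A'"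
    from lift_nsep[OF h(1) this] show False using goodD(8)[OF g, of "A' \<union> B" B'] h by simp
  next
    assume "A \<inter> B \<subseteq> B'"
    from lift_nsep'[OF h(1) this] show False using goodD(8)[OF g, of A' "B' \<union> B"] h by simp
  qed
qed

end

text \<open>The ends of the brace are strictly separated. In the piece on the side of
  \<open>u\<close> and \<open>v\<close> the brace \<open>xy\<close> is to be replaced by one from
  \<open>x\<close> to a vertex of the separating triangle.\<close>

locale split_brace = cutting F A B for F :: "'a set set" and A B +
  fixes u v x y
  assumes g: "good F u v x y" and uv: "u \<in> A" "v \<in> A" and x: "x \<in> A" "x \<notin> B" and y: "y \<in> B" "y \<notin> A"
    and noA: "\<And>A B. nsep F A B \<Longrightarrow> card (A \<inter> B) \<le> 3 \<Longrightarrow> u \<in> A \<Longrightarrow> v \<in> A \<Longrightarrow> x \<in> A \<Longrightarrow> y \<in> A \<Longrightarrow> False"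
begin

lemma nb: "\<not> {u, v} \<subseteq> A \<inter> B" using edge_not_both goodD(2,3)[OF g] by blast

lemma uvn: "u \<noteq> v" using goodD(2)[OF g] by (auto simp: adj_def)

text \<open>The only separations that can spoil a brace from \<open>x\<close> to a vertex
  \<open>\<delta>\<close> of the triangle, provided these are not adjacent. If the triangle lay on
  the side of the brace, the original brace \<open>xy\<close> would be separated from
  \<open>uv\<close> too; and if \<open>x\<close> were in the separator, it would be adjacent to
  \<open>\<delta>\<close>, because a separator of order 3 is a clique.\<close>

definition cutoff :: "'a set \<Rightarrow> 'a set \<Rightarrow> bool" where
  "cutoff A' B' \<longleftrightarrow> nsep FA A' B' \<and> card (A' \<inter> B') \<le> 3 \<and> u \<in> A' \<and> v \<in> A' \<and> A \<inter> B \<subseteq> A' \<and> x \<in> B' \<and> x \<notin> A'"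

lemma violation_cutoff:
  assumes h: "nsep FA A' B'" "card (A' \<inter> B') \<le> 3" "u \<in> A'" "v \<in> A'" "x \<in> B'" "\<delta> \<in> B'"
    and \<delta>: "\<delta> \<in> A \<inter> B" "\<not> adj F x \<delta>"
  shows "cutoff A' B'"
proof -
  have sub: "A \<inter> B \<subseteq> A'"
  proof (rule ccontr)
    assume "\<not> ?thesis"
    then have "A \<inter> B \<subseteq> B'" using side[OF h(1)] by blast
    from lift_nsep'[OF h(1) this] show False using goodD(8)[OF g, of A' "B' \<union> B"] h y by simp
  qed
  have "x \<notin> A'"
  proof
    assume "x \<in> A'"
    moreover have "\<delta> \<in> A'" using sub \<delta>(1) by blast
    moreover have "x \<noteq> \<delta>" using x(2) \<delta>(1) by auto
    ultimately have "adj FA x \<delta>" using nsep3_clique[OF cutA(1) h(1,2)] h(5,6) by metis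
    then show False using cutA(3) \<delta>(2) by simp
  qed
  then show ?thesis using h sub by (simp add: cutoff_def)
qed

text \<open>The opposite corner has \<open>x\<close> strictly inside, so its order is at least 3,
  and this corner has order at most 3. Its near side contains the triangle and one of
  \<open>u\<close>, \<open>v\<close> off the triangle, hence at least four vertices, so it is not
  exhausted by the separator.\<close>

lemma cutoff_union:
  assumes c1: "cutoff A1 B1" and c2: "cutoff A2 B2" shows "cutoff (A1 \<inter> A2) (B1 \<union> B2)"
proof -
  have n1: "nsep FA A1 B1" "card (A1 \<inter> B1) \<le> 3" and n2: "nsep FA A2 B2" "card (A2 \<inter> B2) \<le> 3"
    using c1 c2 by (auto simp: cutoff_def)
  have finFA: "finite (\<Union>FA)" using cutA(2) fin by simp
  have "x \<in> (B1 \<inter> B2) - (A1 \<union> A2)" using c1 c2 by (simp add: cutoff_def)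
  then have "nsep FA (A1 \<union> A2) (B1 \<inter> B2)" using nsep_uncross'[OF n1(1) n2(1)] by blast
  then have "3 \<le> card ((A1 \<union> A2) \<inter> (B1 \<inter> B2))" using nsep_card_ge_3[OF cutA(1)] by blast
  then have le: "card ((A1 \<inter> A2) \<inter> (B1 \<union> B2)) \<le> 3" using nsep_uncross_card[OF finFA n1(1) n2(1)] n1(2) n2(2) by linarith
  have ne: "(A1 \<inter> A2) - (B1 \<union> B2) \<noteq> {}"
  proof
    assume "(A1 \<inter> A2) - (B1 \<union> B2) = {}"
    then have eq: "(A1 \<inter> A2) \<inter> (B1 \<union> B2) = A1 \<inter> A2" by blast
    have sub: "insert u (insert v (A \<inter> B)) \<subseteq> A1 \<inter> A2" using c1 c2 by (auto simp: cutoff_def)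
    have fin12: "finite (A1 \<inter> A2)" using nsep_finite[OF cutA(1) n1(1)] by simp
    have finAB: "finite (A \<inter> B)" using fin by simp
    have "3 \<le> card (A \<inter> B)" by (rule nsep_card_ge_3[OF F n])
    moreover have "card (A \<inter> B) < card (insert u (insert v (A \<inter> B)))"
      using nb finAB by (intro psubset_card_mono) auto
    ultimately have "4 \<le> card (A1 \<inter> A2)" using card_mono[OF fin12 sub] by linarith
    then show False using le eq by simp
  qed
  show ?thesis
    unfolding cutoff_def using nsep_uncross[OF n1(1) n2(1) ne] le c1 c2 by (auto simp: cutoff_def)
qed

text \<open>As the far sides of cutoffs are closed under union, there is a greatest one,
  \<open>B1\<close>. It does not contain the whole triangle: otherwise the triangle would be the
  separator of a cutoff, but it is a face of the piece. Any vertex of the triangle outside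
  \<open>B1\<close> can serve as \<open>\<delta>\<close>. If there is no cutoff at all, only
  adjacency to \<open>x\<close> stands in the way.\<close>

lemma good_brace_exists:
  obtains \<delta> where "\<delta> \<in> A \<inter> B" "good FA u v x \<delta>" | "\<forall>\<delta>\<in>A \<inter> B. adj F x \<delta>"
proof -
  have goodI: "good FA u v x \<delta>" if \<delta>: "\<delta> \<in> A \<inter> B" "\<not> adj F x \<delta>" and no: "\<And>A' B'. cutoff A' B' \<Longrightarrow> \<delta> \<notin> B'" for \<delta>
  proof (rule goodA[OF goodD(2,3)[OF g] uv x(1) _ _ \<delta>(2)])
    show "\<delta> \<in> A" "x \<noteq> \<delta>" using \<delta>(1) x(2) by auto
    fix A' B' assume h: "nsep FA A' B'" "card (A' \<inter> B') \<le> 3" "u \<in> A'" "v \<in> A'" "x \<in> B'" "\<delta> \<in> B'"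
    show False using no[OF violation_cutoff[OF h \<delta>]] h(6) by blast
  qed
  show thesis
  proof (cases "\<exists>A1 B1. cutoff A1 B1")
    case True
    then obtain A0 B0 where "cutoff A0 B0" by blast
    then have 1: "\<exists>A'. cutoff A' B0" by blast
    have BA: "B' \<subseteq> A" if "cutoff A' B'" for A' B'
      using that nsepD(1)[of FA A' B'] cutA(2) unfolding cutoff_def by blast
    then have 2: "\<forall>B'. (\<exists>A'. cutoff A' B') \<longrightarrow> card B' < Suc (card A)"
      using card_mono[OF fin(1)] by (metis less_Suc_eq_le)
    obtain B1 where B1: "\<exists>A'. cutoff A' B1" "\<And>B'. \<exists>A'. cutoff A' B' \<Longrightarrow> card B' \<le> card B1"
      using Lattices_Big.ex_has_greatest_nat[of "\<lambda>B'. \<exists>A'. cutoff A' B'", OF 1 2] by blast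
    obtain A1 where A1: "cutoff A1 B1" using B1(1) by blast
    have max: "B' \<subseteq> B1" if c: "cutoff A' B'" for A' B'
    proof -
      have "card (B1 \<union> B') \<le> card B1" using B1(2) cutoff_union[OF A1 c] by blast
      moreover have "finite (B1 \<union> B')" using BA[OF A1] BA[OF c] fin(1) finite_subset by blast
      ultimately have "B1 = B1 \<union> B'" by (intro card_seteq) auto
      then show ?thesis by blast
    qed
    have n1: "nsep FA A1 B1" "card (A1 \<inter> B1) \<le> 3" "A \<inter> B \<subseteq> A1" "x \<in> B1" "x \<notin> A1" using A1 by (auto simp: cutoff_def)
    have "\<not> A \<inter> B \<subseteq> B1"
    proof
      assume "A \<inter> B \<subseteq> B1"
      then have sub: "A \<inter> B \<subseteq> A1 \<inter> B1" using n1(3) by blast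
      have fin1: "finite (A1 \<inter> B1)" using nsep_finite[OF cutA(1) n1(1)] by simp
      have "3 \<le> card (A \<inter> B)" by (rule nsep_card_ge_3[OF F n])
      then have "A \<inter> B = A1 \<inter> B1" using card_seteq[OF fin1 sub] n1(2) by linarith
      moreover have "A1 \<inter> B1 \<notin> FA" by (rule cut_spherical(4)[OF cutA(1) n1(1,2)])
      ultimately show False by simp
    qed
    then obtain \<delta> where \<delta>: "\<delta> \<in> A \<inter> B" "\<delta> \<notin> B1" by blast
    have "\<not> adj FA \<delta> x" using nsepD(4)[OF n1(1)] n1(3-5) \<delta> by blast
    then have "\<not> adj F x \<delta>" using cutA(3)[of \<delta> x] x(1) \<delta>(1) adj_commute[of F x \<delta>] by simp
    moreover have "\<delta> \<notin> B'" if "cutoff A' B'" for A' B' using max[OF that] \<delta>(2) by blast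
    ultimately show ?thesis using goodI[OF \<delta>(1)] that(1)[OF \<delta>(1)] by blast
  next
    case False
    then show ?thesis using goodI that by blast
  qed
qed

text \<open>Splitting \<open>\<delta>\<close> into \<open>\<delta>\<close> and \<open>y\<close>
  transfers the end of the brace from \<open>\<delta>\<close> to \<open>y\<close>. The edges that
  the split demands between \<open>y\<close> and the triangle need not exist in \<open>F\<close>,
  but they lie inside \<open>B\<close>, where gluing accepts virtual edges.\<close>

lemma rigid_if_brace_to_cut:
  assumes \<delta>: "\<delta> \<in> A \<inter> B" and r: "braced_rigid FA u v x \<delta>"
  shows "braced_rigid F u v x y"
proof -
  have nB: "\<not> {u, v} \<subseteq> B" using nb uv by blast
  obtain a b c where D: "A \<inter> B = {a, b, c}" "distinct [a, b, c]" using nsep3_triangle[OF F n c3] by metis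
  have c3': "card (A \<inter> B) = 3" using D by simp
  have "\<exists>\<delta>'\<in>A \<inter> B. \<delta>' \<noteq> \<delta>" by (rule card3_other[OF c3'])
  then obtain d2 where d2: "d2 \<in> A \<inter> B" "d2 \<noteq> \<delta>" by blast
  obtain d3 where d3: "A \<inter> B = {\<delta>, d2, d3}" "d3 \<noteq> \<delta>" "d3 \<noteq> d2"
    using triple_cases[OF c3' \<delta> d2(1)] d2(2) by metis
  have dA: "\<delta> \<in> A" "d2 \<in> A" "d3 \<in> A" and dB: "\<delta> \<in> B" "d2 \<in> B" "d3 \<in> B" using d3(1) by blast+
  define E1 where "E1 = insert {x, y} (insert {\<delta>, y} (insert {y, d2} (insert {y, d3} (edges FA))))"
  have DF: "{\<delta>, d2, d3} \<in> FA" using d3(1) by simp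
  have tri: "{\<delta>, d2} \<in> edges FA" "{d2, d3} \<in> edges FA" "{\<delta>, d3} \<in> edges FA"
    using face_adj[OF cutA(1) DF] adj_edges[of FA] by simp_all
  have uy: "y \<noteq> u" "y \<noteq> v" using uv y by auto
  have nuv: "u = v \<or> \<not> {u, v} \<subseteq> {\<delta>, d2, d3}" using nb d3(1) by simp
  have E1P: "E1 \<subseteq> Pow (insert y A)" using edgesA(2) dA x by (auto simp: E1_def)
  have r1: "gen_rigid u v (insert y A) E1"
  proof (rule gen_rigid_split[where E' = "insert {x, \<delta>} (edges FA)" and c = \<delta> and p = d2 and q = d3 and i = \<delta> and j = d2 and k = d3])
    show "finite A" "y \<notin> A" "y \<noteq> u" "y \<noteq> v" using fin y uy by auto
    show "insert {x, \<delta>} (edges FA) \<subseteq> Pow A" using edgesA(2) x dA by auto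
    show "E1 \<subseteq> Pow (insert y A)" by (rule E1P)
    show "gen_rigid u v A (insert {x, \<delta>} (edges FA))" using r unfolding braced_rigid_def cutA(2) .
    show "\<delta> \<in> A" "d2 \<in> A" "d3 \<in> A" using dA by auto
    show "distinct [\<delta>, d2, d3]" "distinct [\<delta>, d2, d3]" using d2 d3 by auto
    show "u = v \<or> \<not> {u, v} \<subseteq> {\<delta>, d2, d3}" "u = v \<or> \<not> {u, v} \<subseteq> {\<delta>, d2, d3}" by (rule nuv)+
    show "{\<delta>, y} \<in> E1" "{\<delta>, d2} \<in> E1" "{y, d2} \<in> E1" "{\<delta>, d3} \<in> E1" "{y, d3} \<in> E1"
      "{\<delta>, d2} \<in> E1" "{d2, d3} \<in> E1" "{\<delta>, d3} \<in> E1"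
      using tri by (simp_all add: E1_def)
    show "{\<delta>, d2, d3} \<subseteq> A" using dA by simp
    show "{s, r} \<in> E1 \<or> s = \<delta> \<and> {y, r} \<in> E1 \<or> r = \<delta> \<and> {s, y} \<in> E1" if sr: "{s, r} \<in> insert {x, \<delta>} (edges FA)" for s r
    proof (cases "{s, r} \<in> edges FA")
      case True then show ?thesis by (simp add: E1_def)
    next
      case False
      then have "{s, r} = {x, \<delta>}" using sr by simp
      then have "s = x \<and> r = \<delta> \<or> s = \<delta> \<and> r = x" by (auto simp: doubleton_eq_iff)
      then show ?thesis by (auto simp: E1_def insert_commute)
    qed
  qed
  have "gen_rigid u v (B \<union> insert y A) (insert {x, y} (edges F))"
  proof (rule gen_rigid_glue[where F = "edges FB" and F' = E1 and a = \<delta> and b = d2 and c = d3])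
    show "finite B" "finite (insert y A)" using fin by auto
    show "edges FB \<subseteq> Pow B" "E1 \<subseteq> Pow (insert y A)" using edgesB E1P by auto
    show "edges FB \<subseteq> insert {x, y} (edges F)" using edgesB(1) by blast
    show "{s, r} \<in> insert {x, y} (edges F) \<or> {s, r} \<subseteq> B" if "{s, r} \<in> E1" for s r
    proof -
      have "{s, r} = {x, y} \<or> {s, r} \<in> {{\<delta>, y}, {y, d2}, {y, d3}} \<or> {s, r} \<in> edges FA"
        using that by (auto simp: E1_def)
      moreover have "e \<subseteq> B" if "e \<in> {{\<delta>, y}, {y, d2}, {y, d3}}" for e using that dB y by auto
      ultimately show ?thesis using edgesA(1) by blast
    qed
    show "gen_rigid u v B (edges FB)" by (rule rigidB[OF nB])
    show "gen_rigid u v (insert y A) E1" by (rule r1)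
    show "distinct [\<delta>, d2, d3]" using d2 d3 by auto
    show "{\<delta>, d2, d3} \<subseteq> B" "{\<delta>, d2, d3} \<subseteq> insert y A" using dA dB by auto
    show "u = v \<or> \<not> {u, v} \<subseteq> {\<delta>, d2, d3}" by (rule nuv)
  qed
  moreover have "B \<union> insert y A = \<Union>F" using V y by blast
  ultimately show ?thesis unfolding braced_rigid_def by simp
qed

text \<open>The triangles formed by \<open>x\<close> and the sides of the separating triangle are
  faces, because a separation along one of them would violate \<open>noA\<close> or the goodness of
  \<open>F\<close>. So the piece is a tetrahedron with apex \<open>x\<close>, and \<open>uv\<close>
  joins \<open>x\<close> to a vertex \<open>d1\<close> of the triangle. Instead of the degenerate
  edge \<open>x d1\<close>, the brace fixes \<open>x\<close> to the rigid other piece, together with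
  the edges to \<open>d2\<close> and \<open>d3\<close>.\<close>

lemma rigid_if_joined_to_cut:
  assumes ad: "\<forall>\<delta>\<in>A \<inter> B. adj F x \<delta>" shows "braced_rigid F u v x y"
proof -
  have nB: "\<not> {u, v} \<subseteq> B" using nb uv by blast
  obtain a b c where D: "A \<inter> B = {a, b, c}" "distinct [a, b, c]" "adj F a b" "adj F b c" "adj F a c"
    using nsep3_triangle[OF F n c3] by metis
  have abc: "a \<in> A" "b \<in> A" "c \<in> A" "a \<in> B" "b \<in> B" "c \<in> B" using D(1) by blast+
  have adA: "adj FA s r" if "adj F s r" "s \<in> A" "r \<in> A" for s r using cutA(3) that by simp
  have face: "{x, s, r} \<in> FA" if sr: "s \<in> A \<inter> B" "r \<in> A \<inter> B" "s \<noteq> r" for s r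
  proof (rule ccontr)
    assume nf: "{x, s, r} \<notin> FA"
    have "adj F s r" using nsep3_clique[OF F n c3] sr by blast
    then have 1: "adj FA x s" "adj FA s r" "adj FA x r" using ad sr x adA by auto
    obtain A1 B1 where n1: "nsep FA A1 B1" "A1 \<inter> B1 = {x, s, r}"
      using nonfacial_triangle_nsep[OF cutA(1) 1 nf] by metis
    have "x \<noteq> s" "x \<noteq> r" using x sr by auto
    then have card3: "card (A1 \<inter> B1) \<le> 3" unfolding n1(2) using sr(3) by simp
    obtain A' B' where n2: "nsep FA A' B'" "A' \<inter> B' = {x, s, r}" "u \<in> A'" "v \<in> A'"
    proof -
      have "adj FA u v" using adA goodD(2)[OF g] uv by blast
      then obtain f where f: "f \<in> FA" "u \<in> f" "v \<in> f" by (auto simp: adj_def)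
      from nsep_face[OF n1(1) f(1)] show thesis
      proof
        assume "f \<subseteq> A1" then show thesis using that[of A1 B1] n1 f by blast
      next
        assume "f \<subseteq> B1"
        moreover have "nsep FA B1 A1" "B1 \<inter> A1 = {x, s, r}" using n1 nsep_commute[of FA A1 B1] by (auto simp: Int_commute)
        ultimately show thesis using that[of B1 A1] f by blast
      qed
    qed
    have c3'': "card (A' \<inter> B') \<le> 3" using n1(2) n2(2) card3 by simp
    have xAB: "x \<in> A'" "x \<in> B'" using n2(2) by blast+
    from side[OF n2(1)] show False
    proof
      assume "A \<inter> B \<subseteq> A'"
      from lift_nsep[OF n2(1) this] show False using noA[of "A' \<union> B" B'] c3'' n2(3,4) xAB y by simp
    next
      assume "A \<inter> B \<subseteq> B'"
      from lift_nsep'[OF n2(1) this] show False using goodD(8)[OF g, of A' "B' \<union> B"] c3'' n2(3,4) xAB y by simp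
    qed
  qed
  have "\<Union>FA = {x, a, b, c}"
  proof (rule K4_spherical[OF cutA(1)])
    show "distinct [x, a, b, c]" using D(2) x abc by auto
    show "{x, a, b} \<in> FA" "{x, a, c} \<in> FA" "{x, b, c} \<in> FA" using face D(1,2) by auto
    show "{a, b, c} \<in> FA" using D(1) by simp
  qed
  then have "A = insert x (A \<inter> B)" using cutA(2) D(1) by simp
  then have A: "z = x \<or> z \<in> A \<inter> B" if "z \<in> A" for z using that by (metis insertE)
  have c3': "card (A \<inter> B) = 3" using D(1,2) by simp
  obtain d1 where d1: "d1 \<in> A \<inter> B" "{u, v} = {x, d1}"
  proof -
    have "u = x \<and> v \<in> A \<inter> B \<or> v = x \<and> u \<in> A \<inter> B" using A[OF uv(1)] A[OF uv(2)] nb uvn by blast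
    then show thesis using that[of u] that[of v] by blast
  qed
  obtain d2 where d2: "d2 \<in> A \<inter> B" "d2 \<noteq> d1" using card3_other[OF c3', of d1] by blast
  obtain d3 where d3: "A \<inter> B = {d1, d2, d3}" "d3 \<noteq> d1" "d3 \<noteq> d2"
    using triple_cases[OF c3' d1(1) d2(1)] d2(2) by metis
  have dd: "d2 \<in> A" "d2 \<in> B" "d3 \<in> A" "d3 \<in> B" "d1 \<in> A" using d3(1) by blast+
  have "gen_rigid u v (insert x B) (insert {x, y} (edges F))"
  proof (rule gen_rigid_attach[where F = "edges FB" and a = d2 and b = d3 and c = y])
    show "finite B" using fin by simp
    show "edges FB \<subseteq> Pow B" "edges FB \<subseteq> insert {x, y} (edges F)" using edgesB by auto
    show "gen_rigid u v B (edges FB)" by (rule rigidB[OF nB])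
    show "distinct [d2, d3, y, x]" using d3 dd x y by auto
    show "{d2, d3, y} \<subseteq> B" using dd y by simp
    have "d1 \<notin> {d2, d3, y, x}" using d2 d3 dd d1 x y by auto
    then show "u = v \<or> \<not> {u, v} \<subseteq> {d2, d3, y, x}" using d1(2) by auto
    have "adj F x d2" "adj F x d3" using ad d2(1) d3(1) by auto
    then show "{x, d2} \<in> insert {x, y} (edges F)" "{x, d3} \<in> insert {x, y} (edges F)"
      using adj_edges[of F x] by auto
    show "{x, y} \<in> insert {x, y} (edges F)" by simp
  qed
  moreover have "insert x B = \<Union>F"
  proof -
    have "A \<subseteq> insert x B" using A by blast
    then show ?thesis using V x(1) by blast
  qed
  ultimately show ?thesis unfolding braced_rigid_def by simp
qed

end

lemma good_separated:
  assumes g: "good F u v x y" and n: "nsep F A B" "card (A \<inter> B) \<le> 3"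
    and IH: "\<And>F' x y. card (\<Union>F') < card (\<Union>F) \<Longrightarrow> good F' u v x y \<Longrightarrow> braced_rigid F' u v x y"
  shows "braced_rigid F u v x y"
proof -
  note F = goodD(1)[OF g]
  show ?thesis
  \<comment> \<open>A separation with both \<open>uv\<close> and the brace on one side is preferred.
    If none exists, every separating triangle is crossed by the brace, and no brace can be kept
    after cutting.\<close>
  proof (cases "\<exists>A B. nsep F A B \<and> card (A \<inter> B) \<le> 3 \<and> u \<in> A \<and> v \<in> A \<and> x \<in> A \<and> y \<in> A")
    case True
    then obtain A B where n: "nsep F A B" "card (A \<inter> B) \<le> 3" and h: "u \<in> A" "v \<in> A" "x \<in> A" "y \<in> A" by blast
    interpret cutting F A B using F n by unfold_locales
    show ?thesis
      by (rule rigid_if_braceA[OF g h IH[OF _ good_brace_in_A[OF g h]]]) (use cutA(2) cards in simp)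
  next
    case False
    have split: ?thesis if n: "nsep F A B" "card (A \<inter> B) \<le> 3" and g: "good F u v x y"
      and h: "u \<in> A" "v \<in> A" "x \<in> A" "x \<notin> B" "y \<in> B" "y \<notin> A"
      and no: "\<not> (\<exists>A B. nsep F A B \<and> card (A \<inter> B) \<le> 3 \<and> u \<in> A \<and> v \<in> A \<and> x \<in> A \<and> y \<in> A)"
      and eq: "braced_rigid F u v x y \<Longrightarrow> ?thesis" for A B x y
    proof -
      interpret split_brace F A B u v x y
        using F n g h no by unfold_locales blast+
      show ?thesis
      proof (rule good_brace_exists)
        fix \<delta> assume "\<delta> \<in> A \<inter> B" "good FA u v x \<delta>"
        then show ?thesis using eq rigid_if_brace_to_cut IH[of FA x \<delta>] cutA(2) cards by simp
      next
        assume "\<forall>\<delta>\<in>A \<inter> B. adj F x \<delta>"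
        then show ?thesis using eq rigid_if_joined_to_cut by blast
      qed
    qed
    have key: ?thesis if n: "nsep F A B" "card (A \<inter> B) \<le> 3" and uv: "u \<in> A" "v \<in> A" for A B
    proof -
      have V: "A \<union> B = \<Union>F" by (rule nsepD(1)[OF n(1)])
      have "\<not> (x \<in> B \<and> y \<in> B)" using goodD(8)[OF g n uv] by blast
      moreover have "\<not> (x \<in> A \<and> y \<in> A)" using False n uv by blast
      moreover have "x \<in> A \<union> B" "y \<in> A \<union> B" using V goodD(4,5)[OF g] by auto
      ultimately consider "x \<in> A" "x \<notin> B" "y \<in> B" "y \<notin> A" | "y \<in> A" "y \<notin> B" "x \<in> B" "x \<notin> A" by blast
      then show ?thesis
      proof cases
        case 1
        show ?thesis by (rule split[OF n g uv 1 False])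
      next
        case 2
        have g': "good F u v y x" using g good_commute by metis
        have False': "\<not> (\<exists>A B. nsep F A B \<and> card (A \<inter> B) \<le> 3 \<and> u \<in> A \<and> v \<in> A \<and> y \<in> A \<and> x \<in> A)" using False by blast
        show ?thesis by (rule split[OF n g' uv 2 False']) (use braced_rigid_commute in metis)
      qed
    qed
    obtain f where f: "f \<in> F" "u \<in> f" "v \<in> f" using goodD(2)[OF g] by (auto simp: adj_def)
    from nsep_face[OF n(1) f(1)] show ?thesis
    proof
      assume "f \<subseteq> A" then show ?thesis using key[OF n] f by blast
    next
      assume "f \<subseteq> B"
      moreover have "nsep F B A" "card (B \<inter> A) \<le> 3" using n nsep_commute[of F A B] by (auto simp: Int_commute)
      ultimately show ?thesis using key[of B A] f by blast
    qed
  qed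
qed

section \<open>Flag spheres: contracting an edge at an apex\<close>

text \<open>The obstructions to contracting \<open>cb\<close>: a forbidden separation of the
  contracted sphere lifts to a separation of order at most 4 with both \<open>c\<close> and
  \<open>b\<close> in the separator.\<close>

definition bad_sep :: "'a set set \<Rightarrow> 'a \<Rightarrow> 'a \<Rightarrow> 'a \<Rightarrow> 'a \<Rightarrow> 'a \<Rightarrow> 'a \<Rightarrow> 'a set \<Rightarrow> 'a set \<Rightarrow> bool" where
  "bad_sep F u v x y c b A B \<longleftrightarrow> nsep F A B \<and> card (A \<inter> B) \<le> 4 \<and> c \<in> A \<and> c \<in> B \<and> b \<in> A \<and> b \<in> B \<and>
     u \<in> A \<and> v \<in> A \<and> x \<in> B \<and> y \<in> B"

locale flag_good =
  fixes F :: "'a set set" and u v x y c d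
  assumes g: "good F u v x y" and fl: "flag F" and uvc: "{u, v, c} \<in> F" and uvd: "{u, v, d} \<in> F" and cd: "c \<noteq> d"
begin

lemmas F = goodD(1)[OF g]

lemma noK4:
  assumes "adj F s1 s2" "adj F s1 s3" "adj F s1 s4" "adj F s2 s3" "adj F s2 s4" "adj F s3 s4" shows False
proof -
  have V: "\<Union>F = {s1, s2, s3, s4}" by (rule flag_K4[OF F fl assms])
  have "x \<in> {s1, s2, s3, s4}" "y \<in> {s1, s2, s3, s4}" using goodD(4,5)[OF g] unfolding V .
  then have "adj F x y" using assms goodD(6)[OF g] adj_commute[of F] by auto
  then show False using goodD(7)[OF g] by simp
qed

lemma ad: "adj F u v" "adj F u c" "adj F v c" "adj F u d" "adj F v d" "adj F c u" "adj F c v" "adj F d u" "adj F d v"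
  using face_adj[OF F uvc] face_adj[OF F uvd] by auto

lemma ncd: "\<not> adj F c d"
  using noK4[of u v c d] ad by auto

lemma dist: "u \<noteq> v" "c \<noteq> u" "c \<noteq> v" "d \<noteq> u" "d \<noteq> v"
  using face_distinct[OF F uvc] face_distinct[OF F uvd] by auto

text \<open>Of the conditions for the smaller sphere only the one on separations needs care. If the
  separator does not contain the merged vertex, the lifted separation has order at most 3, which a
  flag sphere excludes; if it does, the lifted separation is bad.\<close>

lemma contract_step:
  assumes b: "adj F c b" "b \<noteq> u" "b \<noteq> v"
    and mxy: "merge c b x \<noteq> merge c b y" "\<not> adj (contract c b F) (merge c b x) (merge c b y)"
    and nb: "\<And>A B. \<not> bad_sep F u v x y c b A B"
    and IH: "\<And>F' x y. card (\<Union>F') < card (\<Union>F) \<Longrightarrow> good F' u v x y \<Longrightarrow> braced_rigid F' u v x y"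
  shows "braced_rigid F u v x y"
proof -
  obtain p q where pqf: "p \<noteq> q" "{c, b, p} \<in> F" "{c, b, q} \<in> F" using two_faces[OF F b(1)] by metis
  note fa = face_adj[OF F pqf(2)] face_adj[OF F pqf(3)]
  have npq: "\<not> adj F p q" using noK4[of c b p q] fa by auto
  have con: "contractible F c b p q" by (rule flag_contractible[OF F fl pqf(2,3,1) npq])
  interpret contractible F c b p q by (rule con)
  have m_id: "m z = z" if "z \<noteq> b" for z using that by simp
  have m_inv: "s = z" if "m s = z" "z \<noteq> c" for s z using that by (auto simp: merge_def split: if_splits)
  have good': "good F' u v (m x) (m y)"
    unfolding good_def
  proof (intro conjI allI impI)
    show "spherical F'" by (rule contract_spherical)
    show "adj F' u v" unfolding adj_contract using ad(1) dist b by (intro conjI exI[of _ u] exI[of _ v]) auto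
    show "{u, v, t} \<in> F'" if t: "adj F' u t \<and> adj F' v t" for t
    proof -
      have tb: "t \<noteq> b" using adj_in[of F' u t] t vertices_contract by auto
      have "{u, v, t} \<in> F"
      proof (cases "t = c")
        case True then show ?thesis using uvc by simp
      next
        case False
        obtain s r where "adj F s r" "m s = u" "m r = t" using t adj_contract by blast
        then have 1: "adj F u t" using m_inv False dist by metis
        obtain s r where "adj F s r" "m s = v" "m r = t" using t adj_contract by blast
        then have 2: "adj F v t" using m_inv False dist by metis
        show ?thesis by (rule goodD(3)[OF g 1 2])
      qed
      then have "{u, v, t} \<in> N" using b tb by (auto simp: N_def)
      moreover have "m ` {u, v, t} = {u, v, t}" using b tb by simp
      ultimately show ?thesis unfolding F'_eq by (metis imageI)
    qed
    have "c \<in> \<Union>F" using uvc by blast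
    then show "m x \<in> \<Union>F'" "m y \<in> \<Union>F'"
      using goodD(4,5)[OF g] vertices_contract m_neq_b by (auto simp: merge_def)
    show "m x \<noteq> m y" "\<not> adj F' (m x) (m y)" using mxy by auto
    show "\<not> (m x \<in> B' \<and> m y \<in> B')" if h: "nsep F' A' B' \<and> card (A' \<inter> B') \<le> 3 \<and> u \<in> A' \<and> v \<in> A'" for A' B'
    proof
      assume xy: "m x \<in> B' \<and> m y \<in> B'"
      have n': "nsep F' A' B'" using h by blast
      have V': "A' \<union> B' = \<Union>F - {b}" using nsepD(1)[OF n'] vertices_contract by simp
      \<comment> \<open>Both ends of the contracted edge inherit the sides of the merged
        vertex.\<close>
      define A B where "A = {z \<in> \<Union>F. m z \<in> A'}" and "B = {z \<in> \<Union>F. m z \<in> B'}"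
      have inA: "z \<in> A \<and> m z = z" if "z \<in> A'" for z
      proof -
        have "z \<in> \<Union>F" "z \<noteq> b" using that V' by blast+
        then show ?thesis using that m_id by (simp add: A_def)
      qed
      have inB: "z \<in> B \<and> m z = z" if "z \<in> B'" for z
      proof -
        have "z \<in> \<Union>F" "z \<noteq> b" using that V' by blast+
        then show ?thesis using that m_id by (simp add: B_def)
      qed
      have n: "nsep F A B"
        unfolding nsep_def
      proof (intro conjI ballI)
        have "m z \<in> A' \<union> B'" if "z \<in> \<Union>F" for z
          unfolding V' using that \<open>c \<in> \<Union>F\<close> m_neq_b by (auto simp: merge_def)
        then show "A \<union> B = \<Union>F" by (auto simp: A_def B_def)
        obtain a where "a \<in> A'" "a \<notin> B'" using nsepD(2)[OF n'] by blast
        then have "a \<in> A - B" using inA[of a] by (auto simp: B_def)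
        then show "A - B \<noteq> {}" by blast
        obtain a where "a \<in> B'" "a \<notin> A'" using nsepD(3)[OF n'] by blast
        then have "a \<in> B - A" using inB[of a] by (auto simp: A_def)
        then show "B - A \<noteq> {}" by blast
        fix s r assume s: "s \<in> A - B" and r: "r \<in> B - A"
        have s': "m s \<in> A'" "m s \<notin> B'" and r': "m r \<in> B'" "m r \<notin> A'" using s r by (auto simp: A_def B_def)
        show "\<not> adj F s r"
        proof
          assume "adj F s r"
          moreover have "m s \<noteq> m r" using s' r' by auto
          ultimately have "adj F' (m s) (m r)" unfolding adj_contract by blast
          then show False using nsepD(4)[OF n' s' r'] by simp
        qed
      qed
      have finA': "finite (A' \<inter> B')" using nsep_finite[OF contract_spherical n'] by simp
      have sub: "A \<inter> B \<subseteq> insert b (A' \<inter> B')" by (auto simp: A_def B_def merge_def split: if_splits)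
      show False
      proof (cases "c \<in> A' \<inter> B'")
        case False
        have "A \<inter> B \<subseteq> A' \<inter> B'" using False by (auto simp: A_def B_def merge_def split: if_splits)
        then have "card (A \<inter> B) \<le> 3" using card_mono[OF finA'] h by (meson le_trans)
        then show False using flag_nsep_card[OF F fl n] by simp
      next
        case True
        have "card (A \<inter> B) \<le> card (insert b (A' \<inter> B'))" using sub finA' by (intro card_mono) auto
        also have "\<dots> \<le> Suc (card (A' \<inter> B'))" using finA' by (simp add: card_insert_if)
        finally have "card (A \<inter> B) \<le> 4" using h by linarith
        moreover have "c \<in> A" "c \<in> B" using True inA inB by auto
        moreover have "b \<in> \<Union>F" using pqf(2) by blast
        then have "b \<in> A" "b \<in> B" using True by (auto simp: A_def B_def)
        moreover have "u \<in> A" "v \<in> A" using inA h by auto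
        moreover have "x \<in> B" "y \<in> B" using xy goodD(4,5)[OF g] by (auto simp: B_def)
        ultimately show False using nb[of A B] n by (simp add: bad_sep_def)
      qed
    qed
  qed
  have r: "gen_rigid u v (\<Union>F') (insert {m x, m y} (edges F'))"
    using IH[OF card_contract[OF con] good'] by (simp add: braced_rigid_def)
  have uvpq: "{u, v} \<noteq> {p, q}" using npq ad(1) adj_commute[of F p q] by (auto simp: doubleton_eq_iff)
  have fc: "{c, p, b} \<in> F" "{c, q, b} \<in> F" using pqf by (simp_all add: insert_commute)
  obtain z where z: "z \<noteq> b" "{c, p, z} \<in> F" using other_face[OF F fc(1)] by metis
  obtain z' where z': "z' \<noteq> b" "{c, q, z'} \<in> F" using other_face[OF F fc(2)] by metis
  have bb: "b \<noteq> c" "b \<noteq> p" "b \<noteq> q" using face_distinct[OF F pqf(2)] face_distinct[OF F pqf(3)] by auto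
  \<comment> \<open>There are two faces at \<open>c\<close> to choose from, beyond the edges
    \<open>cp\<close> and \<open>cq\<close>. If both contained \<open>uv\<close>, then
    \<open>{u, v} = {p, q}\<close>, but \<open>p\<close> and \<open>q\<close> are not
    adjacent.\<close>
  obtain w k where wk: "{c, w, k} \<in> F" "b \<notin> {c, w, k}" "\<not> {u, v} \<subseteq> {c, w, k}"
  proof (cases "{u, v} \<subseteq> {c, p, z}")
    case False
    then show ?thesis using that[of p z] z bb by simp
  next
    case True
    then have 1: "{u, v} \<subseteq> {p, z}" using dist by blast
    have "\<not> {u, v} \<subseteq> {c, q, z'}"
    proof
      assume "{u, v} \<subseteq> {c, q, z'}"
      then have 2: "{u, v} \<subseteq> {q, z'}" using dist by blast
      have "p \<in> {u, v}" using 1 dist(1) by blast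
      moreover have "q \<in> {u, v}" using 2 dist(1) by blast
      ultimately have "{u, v} = {p, q}" using pqf(1) by blast
      then show False using uvpq by simp
    qed
    then show ?thesis using that[of q z'] z' bb by simp
  qed
  have "u = v \<or> \<not> {u, v} \<subseteq> {c, p, q}" using dist uvpq by auto
  then show ?thesis
    unfolding braced_rigid_def
    using rigid_contract[OF r _ _ goodD(4,5,6)[OF g] _ wk(1,2)] b wk(3) by blast
qed


lemma four_separator:
  assumes n: "nsep F A B" "card (A \<inter> B) \<le> 4" and s: "s1 \<in> A \<inter> B" "s2 \<in> A \<inter> B" "s3 \<in> A \<inter> B" "s4 \<in> A \<inter> B"
    "distinct [s1, s2, s3, s4]"
  shows "A \<inter> B = {s1, s2, s3, s4}"
proof -
  have fin: "finite (A \<inter> B)" using nsep_finite[OF F n(1)] by simp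
  have sub: "{s1, s2, s3, s4} \<subseteq> A \<inter> B" using s by simp
  have "card {s1, s2, s3, s4} = 4" using s(5) by simp
  then show ?thesis using card_seteq[OF fin sub] n(2) by simp
qed

lemma separator_pair:
  assumes n: "nsep F A B" "card (A \<inter> B) \<le> 4" and s: "s1 \<in> A \<inter> B" "s2 \<in> A \<inter> B" "s3 \<in> A \<inter> B" "s4 \<in> A \<inter> B"
    "distinct [s1, s2, s3, s4]"
  shows "adj F s1 s2 \<and> adj F s1 s3 \<and> \<not> adj F s2 s3 \<or> adj F s1 s2 \<and> adj F s1 s4 \<and> \<not> adj F s2 s4 \<or>
    adj F s1 s3 \<and> adj F s1 s4 \<and> \<not> adj F s3 s4"
proof -
  have S: "A \<inter> B = {s1, s2, s3, s4}" by (rule four_separator[OF n s])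
  have sAB: "s1 \<in> A" "s1 \<in> B" using s(1) by auto
  obtain t1 t2 where t: "t1 \<in> A" "t1 \<in> B" "t2 \<in> A" "t2 \<in> B" "t1 \<noteq> t2" "adj F s1 t1" "adj F s1 t2" "\<not> adj F t1 t2"
    using nsep4_nonadjacent[OF F fl n sAB] by metis
  have "t1 \<in> {s1, s2, s3, s4}" "t2 \<in> {s1, s2, s3, s4}" using t S by blast+
  moreover have "t1 \<noteq> s1" "t2 \<noteq> s1" using t by (auto simp: adj_def)
  moreover have "\<not> adj F t2 t1" using t(8) adj_commute[of F t1 t2] by simp
  ultimately show ?thesis using t(5-8) by auto
qed

text \<open>If \<open>s1\<close> were joined to all the others, the nonadjacent pairs at
  \<open>s2\<close> and at \<open>s3\<close> could not contain \<open>s1\<close>, and the two pairs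
  contradict each other. So a separator of order 4 is an induced 4-cycle.\<close>

lemma not_joined_to_separator:
  assumes n: "nsep F A B" "card (A \<inter> B) \<le> 4" and s: "s1 \<in> A \<inter> B" "s2 \<in> A \<inter> B" "s3 \<in> A \<inter> B" "s4 \<in> A \<inter> B"
    "distinct [s1, s2, s3, s4]" and a: "adj F s1 s2" "adj F s1 s3" "adj F s1 s4"
  shows False
proof -
  have a': "adj F s2 s1" "adj F s3 s1" "adj F s4 s1" using a adj_commute[of F s1] by auto
  have d: "distinct [s2, s1, s3, s4]" "distinct [s3, s1, s2, s4]" using s(5) by auto
  have "adj F s2 s3 \<and> adj F s2 s4 \<and> \<not> adj F s3 s4" using separator_pair[OF n s(2,1,3,4) d(1)] a by blast
  moreover have "adj F s3 s2 \<and> adj F s3 s4 \<and> \<not> adj F s2 s4" using separator_pair[OF n s(3,1,2,4) d(2)] a by blast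
  ultimately show False by blast
qed

text \<open>The separator would consist of \<open>u\<close>, \<open>v\<close>, \<open>c\<close> and
  \<open>b\<close> and contain the triangle \<open>uvc\<close>, but it is an induced
  4-cycle.\<close>

lemma edge_not_in_separator:
  assumes n: "nsep F A B" "card (A \<inter> B) \<le> 4" and c: "c \<in> A \<inter> B" and b: "b \<in> A \<inter> B" "adj F c b" "b \<noteq> u" "b \<noteq> v"
  shows "\<not> (u \<in> A \<inter> B \<and> v \<in> A \<inter> B)"
proof
  assume uv: "u \<in> A \<inter> B \<and> v \<in> A \<inter> B"
  have bc: "b \<noteq> c" "adj F b c" using b(2) adj_commute[of F b c] by (auto simp: adj_def)
  have d: "distinct [u, c, b, v]" "distinct [v, c, b, u]" using dist b(3,4) bc by auto
  have "adj F u b \<and> \<not> adj F b v" using separator_pair[OF n _ c b(1) _ d(1)] uv ad b(2) by blast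
  moreover have "adj F v b" using separator_pair[OF n _ c b(1) _ d(2)] uv ad b(2) by blast
  ultimately show False using adj_commute[of F b v] by simp
qed

text \<open>One of \<open>u\<close>, \<open>v\<close> is strictly inside \<open>A\<close>, and
  \<open>d\<close> is its neighbour.\<close>

lemma d_in_A:
  assumes n: "nsep F A B" "card (A \<inter> B) \<le> 4" and c: "c \<in> A \<inter> B" and b: "b \<in> A \<inter> B" "adj F c b" "b \<noteq> u" "b \<noteq> v"
    and uv: "u \<in> A" "v \<in> A"
  shows "d \<in> A"
  using edge_not_in_separator[OF n c b] nsep_adj[OF n(1), of u d] nsep_adj[OF n(1), of v d] uv ad by blast

lemma bad_sepD:
  assumes "bad_sep F u v x y c b A B"
  shows "nsep F A B" "card (A \<inter> B) \<le> 4" "c \<in> A \<inter> B" "b \<in> A \<inter> B" "u \<in> A" "v \<in> A" "x \<in> B" "y \<in> B"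
  using assms by (auto simp: bad_sep_def)

text \<open>If all neighbours of \<open>c\<close> strictly inside \<open>B\<close> are ends of the brace, then the faces at \<open>c\<close>
  that lie in \<open>B\<close> close up around \<open>c\<close>, although \<open>c\<close> has neighbours outside \<open>B\<close>.\<close>

lemma inner_neighbour:
  assumes n: "nsep F A B" "card (A \<inter> B) \<le> 4" and c: "c \<in> A \<inter> B" and xy: "x \<in> B" "y \<in> B"
  obtains b where "b \<in> B" "b \<notin> A" "adj F c b" "\<not> (adj F c x \<and> adj F c y \<and> (b = x \<or> b = y))"
proof (rule ccontr)
  note T = that
  assume "\<not> thesis"
  then have no: "adj F c x \<and> adj F c y \<and> (b = x \<or> b = y)" if "b \<in> B" "b \<notin> A" "adj F c b" for b
    using T[OF that] by blast
  have cAB: "c \<in> A" "c \<in> B" using c by auto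
  have n': "nsep F B A" "card (B \<inter> A) \<le> 4" using n nsep_commute[of F A B] by (auto simp: Int_commute)
  obtain b where b: "b \<in> B" "b \<notin> A" "adj F c b" using nsep4_neighbour[OF F fl n cAB] by metis
  obtain a where a: "a \<in> A" "a \<notin> B" "adj F c a" using nsep4_neighbour[OF F fl n' cAB(2,1)] by metis
  note no_b = no[OF b]
  have nxy: "\<not> adj F x y" "\<not> adj F y x" "x \<noteq> y" using goodD(6,7)[OF g] adj_commute[of F x y] by auto
  have thirds: "\<exists>s1 s2. s1 \<noteq> s2 \<and> {c, z, s1} \<in> F \<and> {c, z, s2} \<in> F \<and> s1 \<in> A \<inter> B \<and> s2 \<in> A \<inter> B \<and> adj F c s1 \<and> adj F c s2"
    if z: "z \<in> B" "z \<notin> A" "z = x \<or> z = y" for z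
  proof -
    have cz: "adj F c z" using no_b z(3) by blast
    obtain s1 s2 where s: "s1 \<noteq> s2" "{c, z, s1} \<in> F" "{c, z, s2} \<in> F" using two_faces[OF F cz] by metis
    have "s \<in> A \<inter> B \<and> adj F c s" if f: "{c, z, s} \<in> F" for s
    proof -
      have zs: "adj F z s" "adj F c s" "adj F s z" using face_adj[OF F f] by auto
      have sB: "s \<in> B" by (rule nsep_adj'[OF n(1) zs(1) z(1,2)])
      have "s \<noteq> x" "s \<noteq> y" using zs nxy z(3) by auto
      then have "s \<in> A" using no[OF sB _ zs(2)] by blast
      then show ?thesis using sB zs by simp
    qed
    then show ?thesis using s by metis
  qed
  have three: "False" if s: "s1 \<in> A \<inter> B" "s2 \<in> A \<inter> B" "s3 \<in> A \<inter> B" "distinct [s1, s2, s3]" "adj F c s1" "adj F c s2" "adj F c s3" for s1 s2 s3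
  proof (rule not_joined_to_separator[OF n c s(1-3) _ s(5-7)])
    show "distinct [c, s1, s2, s3]" using s(4-7) by (auto simp: adj_def)
  qed
  have inA: False if z: "z \<in> B" "z \<notin> A" "{z, z'} = {x, y}" and z': "z' \<in> A" for z z'
  proof -
    have zz: "z = x \<or> z = y" "z' = x \<or> z' = y" using z(3) by blast+
    have ne: "z \<noteq> z'" using z z' by auto
    obtain s1 s2 where s: "s1 \<noteq> s2" "{c, z, s1} \<in> F" "{c, z, s2} \<in> F" "s1 \<in> A \<inter> B" "s2 \<in> A \<inter> B" "adj F c s1" "adj F c s2"
      using thirds[OF z(1,2) zz(1)] by metis
    have "\<not> adj F z z'" using zz nxy ne by auto
    then have "s1 \<noteq> z'" "s2 \<noteq> z'" using face_adj[OF F s(2)] face_adj[OF F s(3)] by auto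
    moreover have "z' \<in> A \<inter> B" using z' zz(2) xy by auto
    moreover have "adj F c z'" using no_b zz(2) by blast
    ultimately show False using three[of s1 s2 z'] s by simp
  qed
  have bx: "b = x \<or> b = y" using no_b by blast
  have xA: "x \<notin> A" "y \<notin> A"
    using inA[of b y] inA[of b x] bx b(1,2) by (auto simp: insert_commute)
  obtain s1 s2 where s: "s1 \<noteq> s2" "{c, x, s1} \<in> F" "{c, x, s2} \<in> F" "s1 \<in> A \<inter> B" "s2 \<in> A \<inter> B" "adj F c s1" "adj F c s2"
    using thirds[OF xy(1) xA(1)] by metis
  obtain r1 r2 where r: "r1 \<noteq> r2" "{c, y, r1} \<in> F" "{c, y, r2} \<in> F" "r1 \<in> A \<inter> B" "r2 \<in> A \<inter> B" "adj F c r1" "adj F c r2"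
    using thirds[OF xy(2) xA(2)] by metis
  have rs: "r = s1 \<or> r = s2" if "r \<in> A \<inter> B" "adj F c r" for r
    using three[of s1 s2 r] s that by auto
  have r1: "r1 = s1 \<or> r1 = s2" and r2: "r2 = s1 \<or> r2 = s2" using rs r by blast+
  have ys: "{c, y, s1} \<in> F" "{c, y, s2} \<in> F" using r1 r2 r(1-3) by auto
  define P where "P = {{c, x, s1}, {c, x, s2}, {c, y, s1}, {c, y, s2}}"
  have PF: "P \<subseteq> {f \<in> F. c \<in> f}" using s ys by (auto simp: P_def)
  have PE: "P = {f \<in> F. c \<in> f}"
  proof (rule link_connected[OF F PF])
    show "P \<noteq> {}" by (simp add: P_def)
    fix e f h assume e: "card e = 2" "c \<in> e" "f \<in> P" "h \<in> F" "e \<subseteq> f" "e \<subseteq> h"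
    have eE: "e \<in> edges F" using e by (auto simp: edges_def)
    obtain w where w: "e = {c, w}" "w \<noteq> c" using edge_at[OF eE e(2)] by metis
    have wf: "w \<in> f" "w \<in> h" "c \<in> h" using w(1) e by auto
    have "w \<in> {x, y, s1, s2}" using wf(1) e(3) w(2) by (auto simp: P_def)
    then obtain z1 z2 where z: "z1 \<noteq> z2" "{c, w, z1} \<in> P" "{c, w, z2} \<in> P"
    proof -
      have "w = x \<or> w = y \<or> w = s1 \<or> w = s2" using \<open>w \<in> {x, y, s1, s2}\<close> by blast
      then consider "w = x" | "w = y" | "w = s1" | "w = s2" by blast
      then show thesis
      proof cases
        case 1 then show ?thesis using that[of s1 s2] s(1) by (simp add: P_def)
      next
        case 2 then show ?thesis using that[of s1 s2] s(1) by (simp add: P_def)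
      next
        case 3 then show ?thesis using that[of x y] nxy(3) by (simp add: P_def insert_commute)
      next
        case 4 then show ?thesis using that[of x y] nxy(3) by (simp add: P_def insert_commute)
      qed
    qed
    obtain h' where h': "h = {c, w, h'}" using face_at[OF F e(4) wf(3,2)] w(2) by metis
    have "{c, w, z1} \<in> F" "{c, w, z2} \<in> F" "{c, w, h'} \<in> F" using z PF e(4) h' by auto
    then have "h' = z1 \<or> h' = z2" using at_most_two_faces[OF F, of c w z1 z2 h'] z(1) by auto
    then show "h \<in> P" using h' z by auto
  qed
  obtain f where f: "f \<in> F" "c \<in> f" "a \<in> f" using a(3) by (auto simp: adj_def)
  then have "f \<in> P" using PE by blast
  then have "a \<in> {c, x, y, s1, s2}" using f(3) by (auto simp: P_def)
  then show False using a(2) cAB xy s by auto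
qed

text \<open>Suppose that every candidate has a bad separation, and let \<open>B\<close> be the
  smallest far side among all of them. A candidate \<open>b'\<close> strictly inside
  \<open>B\<close> has its own bad separation, with sides \<open>A'\<close> and \<open>B'\<close>,
  and the two are uncrossed: the far corner would give a bad separation for \<open>b'\<close> with a
  still smaller far side.\<close>

lemma good_neighbour_exists:
  assumes xc: "x \<noteq> c" "y \<noteq> c"
  obtains b where "adj F c b" "b \<noteq> u" "b \<noteq> v" "\<not> (adj F c x \<and> adj F c y \<and> (b = x \<or> b = y))"
    "\<And>A B. \<not> bad_sep F u v x y c b A B"
proof (rule ccontr)
  note T = that
  assume "\<not> thesis"
  then have bad: "\<exists>A B. bad_sep F u v x y c b A B"
    if "adj F c b" "b \<noteq> u" "b \<noteq> v" "\<not> (adj F c x \<and> adj F c y \<and> (b = x \<or> b = y))" for b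
    using T[OF that] by blast
  have nxy: "\<not> adj F x y" "\<not> adj F y x" "x \<noteq> y" using goodD(6,7)[OF g] adj_commute[of F x y] by auto
  \<comment> \<open>The excluded case is that \<open>b\<close> is one end of the brace and
    \<open>c\<close> is adjacent to both ends, since contracting \<open>cb\<close> would then make
    the brace an edge. If this excluded everything, a brace end off \<open>uv\<close> would form a
    tetrahedron with \<open>c\<close>, \<open>u\<close> and \<open>v\<close>.\<close>
  have cand: "\<exists>b. adj F c b \<and> b \<noteq> u \<and> b \<noteq> v \<and> \<not> (adj F c x \<and> adj F c y \<and> (b = x \<or> b = y))"
  proof (rule ccontr)
    assume no: "\<not> ?thesis"
    have in_uv: "z = u \<or> z = v" if z: "{z, z'} = {x, y}" "adj F c z" "z' \<noteq> z" for z z'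
    proof (rule ccontr)
      assume nz: "\<not> (z = u \<or> z = v)"
      have zz: "z = x \<or> z = y" "z' = x \<or> z' = y" using z(1) by blast+
      obtain t1 t2 where t: "t1 \<noteq> t2" "{c, z, t1} \<in> F" "{c, z, t2} \<in> F" using two_faces[OF F z(2)] by metis
      have "t = u \<or> t = v" if f: "{c, z, t} \<in> F" for t
      proof -
        have "adj F z t" "adj F t z" "adj F c t" using face_adj[OF F f] by auto
        moreover from this have "t \<noteq> x" "t \<noteq> y" using nxy zz by auto
        ultimately show ?thesis using no by blast
      qed
      then have "{t1, t2} = {u, v}" using t by blast
      then have "adj F z u" "adj F z v" using face_adj[OF F t(2)] face_adj[OF F t(3)] by (auto simp: doubleton_eq_iff)
      then show False using noK4[of c u v z] ad z(2) adj_commute[of F z] by simp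
    qed
    show False
    proof (cases "adj F c x \<and> adj F c y")
      case True
      then have "x = u \<or> x = v" "y = u \<or> y = v" using in_uv[of x y] in_uv[of y x] nxy by (auto simp: insert_commute)
      then show False using nxy ad(1) by auto
    next
      case False
      have "{c, u, v} \<in> F" using uvc by (simp add: insert_commute)
      then obtain t where t: "t \<noteq> v" "{c, u, t} \<in> F" using other_face[OF F] by metis
      then have "adj F c t" "t \<noteq> u" using face_adj[OF F t(2)] face_distinct[OF F t(2)] by auto
      then show False using no False t(1) by blast
    qed
  qed
  define Q where "Q = (\<lambda>(b, A, B). adj F c b \<and> b \<noteq> u \<and> b \<noteq> v \<and> bad_sep F u v x y c b A B)"
  have "\<exists>z. Q z" using cand bad by (auto simp: Q_def)
  then obtain z where z: "Q z" "\<And>z'. Q z' \<Longrightarrow> card (snd (snd z)) \<le> card (snd (snd z'))"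
    using ex_has_least_nat[of Q _ "\<lambda>z. card (snd (snd z))"] by blast
  obtain b A B where zb: "z = (b, A, B)" by (metis prod.exhaust)
  have b: "adj F c b" "b \<noteq> u" "b \<noteq> v" and bs: "bad_sep F u v x y c b A B" using z(1) by (auto simp: Q_def zb)
  have min: "card B \<le> card B'" if "adj F c b'" "b' \<noteq> u" "b' \<noteq> v" "bad_sep F u v x y c b' A' B'" for b' A' B'
    using z(2)[of "(b', A', B')"] that by (simp add: Q_def zb)
  note D = bad_sepD[OF bs]
  obtain b' where b': "b' \<in> B" "b' \<notin> A" "adj F c b'" "\<not> (adj F c x \<and> adj F c y \<and> (b' = x \<or> b' = y))"
    using inner_neighbour[OF D(1-3,7,8)] by metis
  have b'uv: "b' \<noteq> u" "b' \<noteq> v" using b'(2) D(5,6) by auto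
  obtain A' B' where bs': "bad_sep F u v x y c b' A' B'" using bad[OF b'(3) b'uv b'(4)] by blast
  note D' = bad_sepD[OF bs']
  have finV: "finite (\<Union>F)" using spherical_finite[OF F] by simp
  have finA: "finite A" "finite B" "finite A'" "finite B'" using nsep_finite[OF F D(1)] nsep_finite[OF F D'(1)] by auto
  have dA: "d \<in> A" by (rule d_in_A[OF D(1-4) b D(5,6)])
  have dA': "d \<in> A'" by (rule d_in_A[OF D'(1-4) b'(3) b'uv D'(5,6)])
  \<comment> \<open>The second apex \<open>d\<close> is what saves the degenerate case:
    \<open>u\<close>, \<open>v\<close>, \<open>c\<close> and \<open>d\<close> all lie in the near
    corner, so even without interior it has at least four vertices.\<close>
  have k1: "4 \<le> card ((A \<inter> A') \<inter> (B \<union> B'))"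
  proof (cases "(A \<inter> A') - (B \<union> B') = {}")
    case True
    then have eq: "(A \<inter> A') \<inter> (B \<union> B') = A \<inter> A'" by blast
    have "{u, v, c, d} \<subseteq> A \<inter> A'" using D D' dA dA' by auto
    moreover have "card {u, v, c, d} = 4" using dist cd by auto
    ultimately show ?thesis using card_mono[of "A \<inter> A'" "{u, v, c, d}"] finA eq by simp
  next
    case False
    show ?thesis by (rule flag_nsep_card[OF F fl nsep_uncross[OF D(1) D'(1) False]])
  qed
  then have k2: "card ((A \<union> A') \<inter> (B \<inter> B')) \<le> 4"
    using nsep_uncross_card[OF finV D(1) D'(1)] D(2) D'(2) by linarith
  show False
  proof (cases "(B \<inter> B') - (A \<union> A') = {}")
    case False
    have bs2: "bad_sep F u v x y c b' (A \<union> A') (B \<inter> B')"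
      unfolding bad_sep_def using nsep_uncross'[OF D(1) D'(1) False] k2 D D' b' by auto
    have "card B \<le> card (B \<inter> B')" by (rule min[OF b'(3) b'uv bs2])
    then have "B \<inter> B' = B" using card_seteq[OF finA(2), of "B \<inter> B'"] by blast
    \<comment> \<open>Minimality forces \<open>B\<close> into \<open>B'\<close>, so the separator of
      the far corner contains the old one and also \<open>b'\<close>. That makes five vertices, but
      its order is at most 4.\<close>
    then have "insert b' (A \<inter> B) \<subseteq> (A \<union> A') \<inter> (B \<inter> B')" using b'(1) D'(4) by blast
    then have "card (insert b' (A \<inter> B)) \<le> 4" using k2 card_mono[of "(A \<union> A') \<inter> (B \<inter> B')" "insert b' (A \<inter> B)"] finA by simp
    moreover have "card (insert b' (A \<inter> B)) = Suc (card (A \<inter> B))" using b'(2) finA by simp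
    ultimately show False using flag_nsep_card[OF F fl D(1)] by simp
  next
    case True
    \<comment> \<open>In the degenerate case \<open>B \<inter> B'\<close> has at most four vertices,
      while it contains the two faces at an edge \<open>b't\<close> with \<open>t\<close> strictly
      inside \<open>B'\<close>. The nonadjacent ends of the brace must be the two vertices opposite
      this edge, which leaves only \<open>t\<close> for \<open>c\<close>; but \<open>c\<close> lies
      in \<open>A'\<close>.\<close>
    have "(A \<union> A') \<inter> (B \<inter> B') = B \<inter> B'" using True by blast
    then have k2': "card (B \<inter> B') \<le> 4" using k2 by simp
    have b'S: "b' \<in> A'" "b' \<in> B'" using D'(4) by auto
    obtain t where t: "t \<in> B'" "t \<notin> A'" "adj F b' t" using nsep4_neighbour[OF F fl D'(1,2) b'S] by metis
    have tB: "t \<in> B" by (rule nsep_adj'[OF D(1) t(3) b'(1,2)])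
    obtain z1 z2 where z: "z1 \<noteq> z2" "{b', t, z1} \<in> F" "{b', t, z2} \<in> F" using two_faces[OF F t(3)] by metis
    note fa = face_adj[OF F z(2)] face_adj[OF F z(3)]
    have zBB: "z1 \<in> B \<inter> B'" "z2 \<in> B \<inter> B'"
      using nsep_adj'[OF D(1) _ b'(1,2)] nsep_adj'[OF D'(1) _ t(1,2)] fa by auto
    have dz: "distinct [b', t, z1, z2]" using z(1) face_distinct[OF F z(2)] face_distinct[OF F z(3)] by simp
    have sub: "{b', t, z1, z2} \<subseteq> B \<inter> B'" using b'(1) b'S tB t zBB by simp
    have "card {b', t, z1, z2} = 4" using dz by simp
    then have eq: "B \<inter> B' = {b', t, z1, z2}" using card_seteq[OF _ sub] finA k2' by simp
    have xyc: "x \<in> {b', t, z1, z2}" "y \<in> {b', t, z1, z2}" "c \<in> {b', t, z1, z2}"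
      using D(3,7,8) D'(3,7,8) unfolding eq[symmetric] by auto
    have "{x, y} = {z1, z2}" using xyc(1,2) nxy fa by auto
    then have "c \<noteq> z1" "c \<noteq> z2" using xc by (auto simp: doubleton_eq_iff)
    moreover have "c \<noteq> b'" using b'(3) by (auto simp: adj_def)
    ultimately have "c = t" using xyc(3) by simp
    then show False using t(2) D'(3) by simp
  qed
qed

lemma rigid_off_c:
  assumes xc: "x \<noteq> c" "y \<noteq> c"
    and IH: "\<And>F' x y. card (\<Union>F') < card (\<Union>F) \<Longrightarrow> good F' u v x y \<Longrightarrow> braced_rigid F' u v x y"
  shows "braced_rigid F u v x y"
proof -
  obtain b where b: "adj F c b" "b \<noteq> u" "b \<noteq> v" "\<not> (adj F c x \<and> adj F c y \<and> (b = x \<or> b = y))"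
    "\<And>A B. \<not> bad_sep F u v x y c b A B" by (rule good_neighbour_exists[OF xc]) blast
  have bc: "b \<noteq> c" using b(1) by (auto simp: adj_def)
  obtain p q where pqf: "p \<noteq> q" "{c, b, p} \<in> F" "{c, b, q} \<in> F" using two_faces[OF F b(1)] by metis
  note fa = face_adj[OF F pqf(2)] face_adj[OF F pqf(3)]
  have npq: "\<not> adj F p q" using noK4[of c b p q] fa by auto
  interpret contractible F c b p q by (rule flag_contractible[OF F fl pqf(2,3,1) npq])
  have nxy: "\<not> adj F x y" "\<not> adj F y x" "x \<noteq> y" using goodD(6,7)[OF g] adj_commute[of F x y] by auto
  have ne: "m x \<noteq> m y" using nxy(3) xc by (auto simp: merge_def)
  have "\<not> adj F' (m x) (m y)"
  proof
    assume "adj F' (m x) (m y)"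
    then obtain s r where sr: "adj F s r" "m s = m x" "m r = m y" unfolding adj_contract by blast
    have s: "s = x \<or> s = c \<and> x = b" using sr(2) xc unfolding m_eq by (auto simp: doubleton_eq_iff)
    have r: "r = y \<or> r = c \<and> y = b" using sr(3) xc unfolding m_eq by (auto simp: doubleton_eq_iff)
    from s r show False using sr(1) nxy b(1,4) adj_commute[of F c] by auto
  qed
  then show ?thesis by (rule contract_step[OF b(1-3) ne _ b(5) IH])
qed

end

text \<open>Here the edge \<open>uv\<close> is contained in the two faces \<open>uvc\<close> and \<open>uvd\<close>, and \<open>cd\<close> is the brace.\<close>

locale opposite_brace = flag_good F u v c d c d for F :: "'a set set" and u v c d
begin

text \<open>A bad separation would have \<open>c\<close>, \<open>b\<close> and \<open>d\<close> in
  its separator of order at most 4. There \<open>d\<close> needs two neighbours, but it is adjacent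
  neither to \<open>c\<close> nor to \<open>b\<close>, and only one further vertex is
  available.\<close>

lemma contract_opposite:
  assumes b: "adj F c b" "b \<noteq> u" "b \<noteq> v" "\<not> adj F b d"
    and IH: "\<And>F' x y. card (\<Union>F') < card (\<Union>F) \<Longrightarrow> good F' u v x y \<Longrightarrow> braced_rigid F' u v x y"
  shows "braced_rigid F u v c d"
proof -
  obtain p q where pqf: "p \<noteq> q" "{c, b, p} \<in> F" "{c, b, q} \<in> F" using two_faces[OF F b(1)] by metis
  note fa = face_adj[OF F pqf(2)] face_adj[OF F pqf(3)]
  have npq: "\<not> adj F p q" using noK4[of c b p q] fa by auto
  interpret contractible F c b p q by (rule flag_contractible[OF F fl pqf(2,3,1) npq])
  have bd: "b \<noteq> d" using b(1) ncd by auto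
  have bc: "b \<noteq> c" using b(1) by (auto simp: adj_def)
  have ne: "m c \<noteq> m d" using cd bd by (auto simp: merge_def)
  have na: "\<not> adj F' (m c) (m d)"
  proof
    assume "adj F' (m c) (m d)"
    then obtain s r where sr: "adj F s r" "m s = m c" "m r = m d" unfolding adj_contract by blast
    have "s = c \<or> s = b" using sr(2) unfolding m_eq by (auto simp: doubleton_eq_iff)
    moreover have "r = d" using sr(3) cd bd unfolding m_eq by (auto simp: doubleton_eq_iff)
    ultimately show False using sr(1) ncd b(4) by auto
  qed
  have nb: "\<not> bad_sep F u v c d c b A B" for A B
  proof
    assume "bad_sep F u v c d c b A B"
    note D = bad_sepD[OF this]
    have dS: "d \<in> A \<inter> B" using d_in_A[OF D(1-4) b(1-3) D(5,6)] D(8) by simp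
    then have dAB: "d \<in> A" "d \<in> B" by auto
    obtain t1 t2 where t: "t1 \<in> A" "t1 \<in> B" "t2 \<in> A" "t2 \<in> B" "t1 \<noteq> t2" "adj F d t1" "adj F d t2"
      using nsep4_nonadjacent[OF F fl D(1,2) dAB] by metis
    have nd: "\<not> adj F d c" "\<not> adj F d b" using ncd b(4) adj_commute[of F d] by auto
    have d1: "distinct [c, b, d, t1]" using t nd bc bd cd by (auto simp: adj_def)
    have "t1 \<in> A \<inter> B" using t by simp
    from four_separator[OF D(1,2) D(3,4) dS this d1] have "A \<inter> B = {c, b, d, t1}" .
    moreover have "t2 \<in> A \<inter> B" using t by simp
    ultimately have "t2 \<in> {c, b, d, t1}" by simp
    then show False using t nd by auto
  qed
  show ?thesis by (rule contract_step[OF b(1-3) ne na nb IH])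
qed

text \<open>If \<open>d\<close> is joined to all neighbours of \<open>c\<close>, then \<open>F\<close> is a double pyramid with apices \<open>c\<close> and \<open>d\<close>,
  and the brace completes every pair of consecutive vertices of the equator to a tetrahedron. The
  path on the equator that avoids \<open>uv\<close> links all these tetrahedra.\<close>

lemma double_pyramid:
  assumes all: "\<And>b. adj F c b \<Longrightarrow> adj F d b"
  shows "\<Union>F = insert c (insert d {b. adj F c b})"
proof -
  have face_d: "{d, a, b} \<in> F" if f: "{c, a, b} \<in> F" for a b
    using flagD[OF fl, of d a b] all face_adj[OF F f] by simp
  define X where "X = {f \<in> F. c \<in> f} \<union> {f. \<exists>a b. {c, a, b} \<in> F \<and> f = {d, a, b}}"
  have XF: "X \<subseteq> F" using face_d by (auto simp: X_def)
  have Xd: "{d, a, b} \<in> X" if "{c, a, b} \<in> F" for a b using that by (auto simp: X_def)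
  have "bd X = {}"
  proof (rule bd_emptyI[OF F XF])
    fix e f h assume e: "e \<in> edges F" "f \<in> X" "h \<in> F" "e \<subseteq> f" "e \<subseteq> h"
    show "h \<in> X"
    proof (cases "c \<in> h")
      case True then show ?thesis using e(3) by (simp add: X_def)
    next
      case False
      have third: "\<exists>z. h = {s, r, z}" if "s \<in> h" "r \<in> h" "s \<noteq> r" for s r
        using face_at[OF F e(3) that] by metis
      have k1: "h \<in> X" if f: "{c, a, b} \<in> F" and h: "a \<in> h" "b \<in> h" for a b
      proof -
        have d3: "a \<noteq> b" using face_distinct[OF F f] by simp
        obtain z where z: "h = {a, b, z}" using third[OF h d3] by blast
        have "{a, b, c} \<in> F" "{a, b, d} \<in> F" "{a, b, z} \<in> F" using f face_d[OF f] e(3) z by (simp_all add: insert_commute)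
        then have "z = c \<or> z = d" using at_most_two_faces[OF F, of a b c d z] cd by auto
        then have "z = d" using z False by auto
        then have "h = {d, a, b}" using z by (simp add: insert_commute)
        then show ?thesis using Xd[OF f] by simp
      qed
      have k2: "h \<in> X" if f: "{c, a, b} \<in> F" and h: "d \<in> h" "a \<in> h" for a b
      proof -
        have da: "d \<noteq> a" using face_d[OF f] face_distinct[OF F] by metis
        obtain z where z: "h = {d, a, z}" using third[OF h da] by blast
        obtain b2 where b2: "b2 \<noteq> b" "{c, a, b2} \<in> F" using other_face[OF F f] by metis
        have "{d, a, z} \<in> F" using z e(3) by simp
        then have "z = b \<or> z = b2" using at_most_two_faces[OF F face_d[OF f] face_d[OF b2(2)], of z] b2(1) by auto
        then show ?thesis using z Xd[OF f] Xd[OF b2(2)] by auto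
      qed
      obtain s r where sr: "e = {s, r}" "s \<noteq> r" using edgesE[OF e(1)] by metis
      have srh: "s \<in> h" "r \<in> h" "s \<in> f" "r \<in> f" using sr e(4,5) by auto
      have "c \<notin> {s, r}" using srh False by auto
      show ?thesis
      proof (cases "c \<in> f")
        case True
        have fF: "f \<in> F" using e(2) XF by blast
        have cs: "c \<noteq> s" using srh False by auto
        obtain w where "f = {c, s, w}" using face_at[OF F fF True srh(3) cs] by metis
        then have "f = {c, s, r}" using srh(4) sr(2) \<open>c \<notin> {s, r}\<close> by auto
        then show ?thesis using k1[of s r] fF srh by simp
      next
        case False
        then obtain a b where ab: "{c, a, b} \<in> F" "f = {d, a, b}" using e(2) by (auto simp: X_def)
        have ab': "{c, b, a} \<in> F" using ab(1) by (simp add: insert_commute)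
        have "s \<in> {d, a, b}" "r \<in> {d, a, b}" using srh ab(2) by auto
        then have "(a \<in> h \<and> b \<in> h) \<or> (d \<in> h \<and> a \<in> h) \<or> (d \<in> h \<and> b \<in> h)" using srh(1,2) sr(2) by auto
        then show ?thesis using k1[OF ab(1)] k2[OF ab(1)] k2[OF ab'] by blast
      qed
    qed
  qed
  moreover have "{u, v, c} \<in> X" using uvc by (simp add: X_def)
  ultimately have XE: "X = F" using spherical_minimal[OF F XF] by blast
  show ?thesis
  proof (intro equalityI subsetI)
    fix w assume "w \<in> \<Union>F"
    then obtain f where f: "f \<in> X" "w \<in> f" using XE by blast
    then show "w \<in> insert c (insert d {b. adj F c b})"
    proof (cases "c \<in> f")
      case True
      have "f \<in> F" using f(1) XF by blast
      then show ?thesis using True f(2) by (auto simp: adj_def)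
    next
      case False
      then obtain a b where ab: "{c, a, b} \<in> F" "f = {d, a, b}" using f(1) by (auto simp: X_def)
      then show ?thesis using f(2) face_adj[OF F ab(1)] by auto
    qed
  next
    fix w assume "w \<in> insert c (insert d {b. adj F c b})"
    moreover have "c \<in> \<Union>F" "d \<in> \<Union>F" using uvc uvd by blast+
    ultimately show "w \<in> \<Union>F" using adj_in[of F c w] by auto
  qed
qed

lemma rigid_double_pyramid:
  assumes all: "\<And>b. adj F c b \<Longrightarrow> adj F d b"
  shows "braced_rigid F u v c d"
proof -
  define E where "E = insert {c, d} (edges F)"
  define E_on where "E_on = (\<lambda>W. {e \<in> E. e \<subseteq> W})"
  define R where "R = (\<lambda>W. {c, d, v} \<subseteq> W \<and> W \<subseteq> \<Union>F \<and> gen_rigid u v W (E_on W))"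
  have inE: "{s, r} \<in> E" if "adj F s r" for s r using that adj_edges[of F s r] by (simp add: E_def)
  have finV: "finite (\<Union>F)" using spherical_finite[OF F] by simp
  have cdV: "c \<in> \<Union>F" "d \<in> \<Union>F" "v \<in> \<Union>F" using uvc uvd by blast+
  have start: "R {c, d, v}"
    unfolding R_def
  proof (intro conjI)
    show "{c, d, v} \<subseteq> \<Union>F" using cdV by simp
    show "gen_rigid u v {c, d, v} (E_on {c, d, v})"
    proof (rule gen_rigid_triangle)
      show "distinct [c, d, v]" using dist cd by auto
      show "{c, d} \<in> E_on {c, d, v}" by (simp add: E_on_def E_def)
      show "{d, v} \<in> E_on {c, d, v}" "{c, v} \<in> E_on {c, d, v}" using inE ad by (simp_all add: E_on_def)
      show "u = v \<or> \<not> {u, v} \<subseteq> {c, d, v}" using dist by auto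
    qed
  qed simp
  \<comment> \<open>The path along the equator is not constructed. A largest rigid set that starts
    from the triangle \<open>cdv\<close> absorbs it, and parity in the link of \<open>c\<close>
    shows that it has reached \<open>u\<close>.\<close>
  have "\<exists>W. R W \<and> (\<forall>W'. R W' \<longrightarrow> card W' \<le> card W)"
  proof (rule Lattices_Big.ex_has_greatest_nat[of R, OF start])
    show "\<forall>W. R W \<longrightarrow> card W < Suc (card (\<Union>F))"
      using card_mono[OF finV] by (auto simp: R_def less_Suc_eq_le)
  qed
  then obtain W where W: "R W" "\<And>W'. R W' \<Longrightarrow> card W' \<le> card W" by blast
  have WV: "W \<subseteq> \<Union>F" "c \<in> W" "d \<in> W" "v \<in> W" and gW: "gen_rigid u v W (E_on W)" using W(1) by (auto simp: R_def)
  have finW: "finite W" using WV(1) finV finite_subset by blast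
  \<comment> \<open>The new vertex is attached through its edges to \<open>c\<close>,
    \<open>d\<close> and \<open>a\<close>. Only the pair \<open>uv\<close> is excluded: its two
    positions coincide, so these four points would be coplanar.\<close>
  have extend: "b \<in> W" if a: "a \<in> W" and f: "{c, a, b} \<in> F" and ab: "{a, b} \<noteq> {u, v}" for a b
  proof (rule ccontr)
    assume bW: "b \<notin> W"
    note fa = face_adj[OF F f]
    have db: "adj F d a" "adj F d b" using all fa by auto
    have ne: "distinct [c, d, a, b]" using face_distinct[OF F f] db cd by (auto simp: adj_def)
    have "gen_rigid u v (insert b W) (E_on (insert b W))"
    proof (rule gen_rigid_attach[where F = "E_on W" and a = c and b = d and c = a])
      show "finite W" by (rule finW)
      show "E_on W \<subseteq> Pow W" "E_on W \<subseteq> E_on (insert b W)" by (auto simp: E_on_def)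
      show "gen_rigid u v W (E_on W)" by (rule gW)
      show "distinct [c, d, a, b]" by (rule ne)
      show "{c, d, a} \<subseteq> W" using WV a by simp
      show "u = v \<or> \<not> {u, v} \<subseteq> {c, d, a, b}"
      proof -
        have "\<not> {u, v} \<subseteq> {c, d, a, b}"
        proof
          assume "{u, v} \<subseteq> {c, d, a, b}"
          then have "u \<in> {a, b}" "v \<in> {a, b}" using dist by auto
          then have "{a, b} = {u, v}" using dist(1) by auto
          then show False using ab by simp
        qed
        then show ?thesis by simp
      qed
      show "{b, c} \<in> E_on (insert b W)" "{b, d} \<in> E_on (insert b W)" "{b, a} \<in> E_on (insert b W)"
        using inE fa db adj_commute[of F b d] WV a by (auto simp: E_on_def)
    qed
    moreover have "insert b W \<subseteq> \<Union>F" using WV adj_in[of F c b] fa by auto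
    ultimately have "R (insert b W)" using WV by (simp add: R_def)
    from W(2)[OF this] show False using bW finW by simp
  qed
  define P where "P = {f \<in> F. c \<in> f \<and> f \<subseteq> W}"
  \<comment> \<open>If \<open>u\<close> is missing, the faces at \<open>c\<close> inside
    \<open>W\<close> have \<open>cv\<close> as their only boundary edge at \<open>c\<close>, where
    an even number is required.\<close>
  have uW: "u \<in> W"
  proof (rule ccontr)
    assume uW: "u \<notin> W"
    have "{e. card e = 2 \<and> c \<in> e \<and> odd (card {f \<in> P. e \<subseteq> f})} = {{c, v}}"
    proof (intro equalityI subsetI)
      fix e assume "e \<in> {e. card e = 2 \<and> c \<in> e \<and> odd (card {f \<in> P. e \<subseteq> f})}"
      then have e: "card e = 2" "c \<in> e" "odd (card {f \<in> P. e \<subseteq> f})" by auto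
      obtain f where f: "f \<in> P" "e \<subseteq> f" using e(3) by (rule odd_card_ex)
      have eE: "e \<in> edges F" using e(1) f by (auto simp: edges_def P_def)
      obtain w where w: "e = {c, w}" "w \<noteq> c" using edge_at[OF eE e(2)] by metis
      have wW: "w \<in> W" using w f by (auto simp: P_def)
      have "w = v"
      proof (rule ccontr)
        assume wv: "w \<noteq> v"
        have wu: "w \<noteq> u" using wW uW by auto
        have "h \<in> P" if h: "h \<in> F" "e \<subseteq> h" for h
        proof -
          have ch: "c \<in> h" "w \<in> h" using h(2) w by auto
          obtain z where z: "h = {c, w, z}" using face_at[OF F h(1) ch] w(2) by metis
          have "z \<in> W" using extend[OF wW, of z] h(1) z wv wu by (auto simp: doubleton_eq_iff)
          then show ?thesis using h(1) z wW WV(2) by (simp add: P_def)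
        qed
        then have "{f \<in> P. e \<subseteq> f} = {f \<in> F. e \<subseteq> f}" by (auto simp: P_def)
        then show False using e(3) edge_card[OF F eE] by simp
      qed
      then show "e \<in> {{c, v}}" using w by simp
    next
      fix e assume "e \<in> {{c, v}}"
      then have e: "e = {c, v}" by simp
      have f1: "{c, v, u} \<in> F" using uvc by (simp add: insert_commute)
      obtain z where z: "z \<noteq> u" "{c, v, z} \<in> F" using other_face[OF F f1] by metis
      have zW: "z \<in> W" using extend[OF WV(4) z(2)] z(1) by (auto simp: doubleton_eq_iff)
      have "{f \<in> P. e \<subseteq> f} = {{c, v, z}}"
      proof (intro equalityI subsetI)
        fix h assume "h \<in> {f \<in> P. e \<subseteq> f}"
        then have h: "h \<in> F" "c \<in> h" "v \<in> h" "h \<subseteq> W" using e by (auto simp: P_def)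
        obtain h' where h': "h = {c, v, h'}" using face_at[OF F h(1-3)] dist by metis
        have hF: "{c, v, h'} \<in> F" using h(1) h' by simp
        have "h' \<noteq> u" using h(4) h' uW by auto
        then have "h' = z" using at_most_two_faces[OF F f1 hF z(2)] z(1) by auto
        then show "h \<in> {{c, v, z}}" using h' by simp
      next
        fix h assume "h \<in> {{c, v, z}}"
        then show "h \<in> {f \<in> P. e \<subseteq> f}" using z zW WV e by (simp add: P_def)
      qed
      then show "e \<in> {e. card e = 2 \<and> c \<in> e \<and> odd (card {f \<in> P. e \<subseteq> f})}" using e dist by simp
    qed
    moreover have "finite P" "\<And>f. f \<in> P \<Longrightarrow> card f = 3"
      using spherical_finite[OF F] spherical_face[OF F] by (auto simp: P_def)
    ultimately show False using even_card_odd_edges_at[of P c] by simp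
  qed
  \<comment> \<open>With \<open>u\<close> and \<open>v\<close> both in \<open>W\<close>, the
    excluded pair is harmless, and the faces inside \<open>W\<close> are closed under passing to the
    next face around \<open>c\<close>.\<close>
  have "P = {f \<in> F. c \<in> f}"
  proof (rule link_connected[OF F])
    show "P \<subseteq> {f \<in> F. c \<in> f}" by (auto simp: P_def)
    have "{u, v, c} \<in> P" using uvc uW WV by (simp add: P_def)
    then show "P \<noteq> {}" by blast
    fix e f h assume e: "card e = 2" "c \<in> e" "f \<in> P" "h \<in> F" "e \<subseteq> f" "e \<subseteq> h"
    have eE: "e \<in> edges F" using e by (auto simp: edges_def)
    obtain w where w: "e = {c, w}" "w \<noteq> c" using edge_at[OF eE e(2)] by metis
    have wW: "w \<in> W" using w e by (auto simp: P_def)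
    have ch: "c \<in> h" "w \<in> h" using e(6) w by auto
    obtain z where z: "h = {c, w, z}" using face_at[OF F e(4) ch] w(2) by metis
    have "z \<in> W"
    proof (cases "{w, z} = {u, v}")
      case True
      then show ?thesis using uW WV(4) by (auto simp: doubleton_eq_iff)
    next
      case False
      then show ?thesis using extend[OF wW, of z] e(4) z by simp
    qed
    then show "h \<in> P" using e(4) z wW WV by (simp add: P_def)
  qed
  then have "b \<in> W" if "adj F c b" for b using that unfolding adj_def P_def by blast
  then have sub: "insert c (insert d {b. adj F c b}) \<subseteq> W" using WV(2,3) by blast
  have WE: "W = \<Union>F"
    by (rule equalityI[OF WV(1)]) (use sub in \<open>simp only: double_pyramid[OF all]\<close>)
  have "e \<subseteq> W" if "e \<in> E" for e
  proof -
    have "e = {c, d} \<or> e \<in> edges F" using that by (simp add: E_def)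
    then show ?thesis using edges_Pow[of F] WV(2,3) unfolding WE[symmetric] by auto
  qed
  then have "E_on W = E" unfolding E_on_def by blast
  then show ?thesis using gW WE by (simp add: braced_rigid_def E_def)
qed

end

theorem good_braced_rigid:
  assumes "good F u v x y" shows "braced_rigid F u v x y"
  using assms
proof (induction "card (\<Union>F)" arbitrary: F x y rule: less_induct)
  case less
  note g = less.prems
  note F = goodD(1)[OF g]
  have IH: "\<And>F' x y. card (\<Union>F') < card (\<Union>F) \<Longrightarrow> good F' u v x y \<Longrightarrow> braced_rigid F' u v x y"
    by (rule less.hyps)
  show ?case
  proof (cases "\<exists>A B. nsep F A B \<and> card (A \<inter> B) \<le> 3")
    case True
    then obtain A B where n: "nsep F A B" "card (A \<inter> B) \<le> 3" by blast
    show ?thesis by (rule good_separated[OF g n IH])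
  next
    case False
    then have fl: "flag F" using flagI_nsep[OF F] by (metis order_refl)
    obtain c d where cd: "c \<noteq> d" "{u, v, c} \<in> F" "{u, v, d} \<in> F" using two_faces[OF F goodD(2)[OF g]] by metis
    have off: "braced_rigid F u v x y" if "c \<noteq> d" "{u, v, c} \<in> F" "{u, v, d} \<in> F" "x \<noteq> c" "y \<noteq> c" for c d
    proof -
      interpret flag_good F u v x y c d using g fl that by unfold_locales
      show ?thesis by (rule rigid_off_c[OF that(4,5) IH])
    qed
    have opp: "braced_rigid F u v c d" if g: "good F u v c d" and cd: "c \<noteq> d" "{u, v, c} \<in> F" "{u, v, d} \<in> F" for c d
    proof -
      interpret opposite_brace F u v c d using g fl cd by unfold_locales
      show ?thesis
      proof (cases "\<exists>b. adj F c b \<and> b \<noteq> u \<and> b \<noteq> v \<and> \<not> adj F b d")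
        case True
        then obtain b where "adj F c b" "b \<noteq> u" "b \<noteq> v" "\<not> adj F b d" by blast
        then show ?thesis by (rule contract_opposite[OF _ _ _ _ IH])
      next
        case False
        have "adj F d b" if "adj F c b" for b
        proof (cases "b = u \<or> b = v")
          case True then show ?thesis using ad by auto
        next
          case False': False
          then have "adj F b d" using False that by blast
          then show ?thesis using adj_commute[of F b d] by simp
        qed
        then show ?thesis by (rule rigid_double_pyramid)
      qed
    qed
    \<comment> \<open>If neither apex avoids the brace, both apices are ends of it, so it joins
      them.\<close>
    consider "x \<noteq> c \<and> y \<noteq> c" | "x \<noteq> d \<and> y \<noteq> d" | "x = c \<and> y = d" | "x = d \<and> y = c"
      using goodD(6)[OF g] cd(1) by blast
    then show ?thesis
    proof cases
      case 1 then show ?thesis using off[OF cd] by blast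
    next
      case 2 then show ?thesis using off[OF cd(1)[symmetric] cd(3,2)] by blast
    next
      case 3 then show ?thesis using opp[OF _ cd] g by blast
    next
      case 4
      then have "good F u v c d" using g good_commute by metis
      then show ?thesis using opp[OF _ cd] 4 braced_rigid_commute by metis
    qed
  qed
qed

section \<open>Faces of a plane triangulation\<close>

fun path_edges :: "'a list \<Rightarrow> 'a set set" where
  "path_edges (a # b # l) = insert {a, b} (path_edges (b # l))"
| "path_edges _ = {}"

lemma path_edges_Cons: "l \<noteq> [] \<Longrightarrow> path_edges (a # l) = insert {a, hd l} (path_edges l)"
  by (cases l) auto

lemma path_edges_subset: "e \<in> path_edges l \<Longrightarrow> e \<subseteq> set l"
  by (induction l rule: path_edges.induct) auto

lemma path_edges_append:
  "path_edges (l @ a # l') = path_edges (l @ [a]) \<union> path_edges (a # l')"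
proof (induction l)
  case Nil then show ?case by simp
next
  case (Cons b l)
  have "path_edges (b # (l @ a # l')) = insert {b, hd (l @ a # l')} (path_edges (l @ a # l'))"
    "path_edges (b # (l @ [a])) = insert {b, hd (l @ [a])} (path_edges (l @ [a]))"
    by (rule path_edges_Cons; simp)+
  moreover have "hd (l @ a # l') = hd (l @ [a])" by (cases l) auto
  ultimately show ?case using Cons.IH by simp
qed

lemma path_edges_split: "e \<in> path_edges l \<Longrightarrow> \<exists>l1 p q l2. l = l1 @ p # q # l2 \<and> e = {p, q}"
proof (induction l rule: path_edges.induct)
  case (1 a b l)
  show ?case
  proof (cases "e = {a, b}")
    case True
    then show ?thesis by (intro exI[of _ "[]"] exI[of _ a] exI[of _ b] exI[of _ l]) simp
  next
    case False
    then have "e \<in> path_edges (b # l)" using 1 by simp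
    then obtain l1 p q l2 where "b # l = l1 @ p # q # l2" "e = {p, q}" using 1 by blast
    then show ?thesis by (intro exI[of _ "a # l1"] exI[of _ p] exI[of _ q] exI[of _ l2]) simp
  qed
qed auto

lemma reach_path:
  assumes "(s, t) \<in> {(x, y). {x, y} \<in> Z}\<^sup>*"
  shows "\<exists>l. l \<noteq> [] \<and> hd l = s \<and> last l = t \<and> distinct l \<and> path_edges l \<subseteq> Z \<and> set l \<subseteq> insert s (\<Union>Z)"
  using assms
proof (induction rule: converse_rtrancl_induct)
  case base
  show ?case by (intro exI[of _ "[t]"]) simp
next
  case (step s s')
  then obtain l where l: "l \<noteq> []" "hd l = s'" "last l = t" "distinct l" "path_edges l \<subseteq> Z" "set l \<subseteq> insert s' (\<Union>Z)" by blast
  have ss: "{s, s'} \<in> Z" using step by simp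
  show ?case
  proof (cases "s \<in> set l")
    case True
    then obtain l1 l2 where l12: "l = l1 @ s # l2" by (meson split_list)
    have "path_edges (s # l2) \<subseteq> Z" using l(5) unfolding l12 path_edges_append[of l1 s l2] by blast
    moreover have "last (s # l2) = t" using l(3) l12 by simp
    moreover have "distinct (s # l2)" using l(4) l12 by simp
    moreover have "set (s # l2) \<subseteq> insert s (\<Union>Z)" using l(6) l12 ss by auto
    ultimately show ?thesis by (intro exI[of _ "s # l2"]) simp
  next
    case False
    have "path_edges (s # l) \<subseteq> Z" using path_edges_Cons[OF l(1), of s] l(2,5) ss by simp
    moreover have "set (s # l) \<subseteq> insert s (\<Union>Z)" using l(6) ss by auto
    ultimately show ?thesis using l False by (intro exI[of _ "s # l"]) simp
  qed
qed

text \<open>The first vertex of a longest path has a second edge by parity, and that edge must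
  return to the path.\<close>

lemma even_set_cycle:
  assumes Z: "finite Z" "Z \<noteq> {}" "even_set Z" "\<And>e. e \<in> Z \<Longrightarrow> card e = 2"
  obtains l where "3 \<le> length l" "distinct l" "path_edges l \<subseteq> Z" "{last l, hd l} \<in> Z"
proof -
  define Q where "Q = (\<lambda>l. 2 \<le> length l \<and> distinct l \<and> path_edges l \<subseteq> Z \<and> set l \<subseteq> \<Union>Z)"
  have finU: "finite (\<Union>Z)" using Z by (metis card_ge_0_finite finite_Union zero_less_numeral)
  obtain e where e: "e \<in> Z" using Z(2) by blast
  then obtain a b where ab: "e = {a, b}" "a \<noteq> b" using Z(4) by (meson card_2_iff)
  have "Q [a, b]" using e ab by (auto simp: Q_def)
  moreover have "\<forall>l. Q l \<longrightarrow> length l < Suc (card (\<Union>Z))"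
    using card_mono[OF finU] by (metis Q_def distinct_card less_Suc_eq_le)
  ultimately obtain l where l: "Q l" "\<And>l'. Q l' \<Longrightarrow> length l' \<le> length l"
    using Lattices_Big.ex_has_greatest_nat[of Q _ length] by blast
  obtain a b r where abr: "l = a # b # r"
    using l(1) unfolding Q_def by (metis One_nat_def Suc_1 Suc_le_length_iff)
  have dl: "distinct (a # b # r)" "path_edges (a # b # r) \<subseteq> Z" "set (a # b # r) \<subseteq> \<Union>Z" using l(1) by (auto simp: Q_def abr)
  have abZ: "{a, b} \<in> Z" using dl(2) by simp
  have "even (card {e \<in> Z. a \<in> e})" using Z(3) by (simp add: even_set_def)
  then have ev: "{e \<in> Z. a \<in> e} \<noteq> {{a, b}}" by (metis One_nat_def card.empty card.insert empty_iff finite.emptyI odd_one)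
  have "\<exists>f. f \<in> Z \<and> a \<in> f \<and> f \<noteq> {a, b}"
  proof (rule ccontr)
    assume no: "\<nexists>f. f \<in> Z \<and> a \<in> f \<and> f \<noteq> {a, b}"
    have "{e \<in> Z. a \<in> e} = {{a, b}}"
    proof (intro equalityI subsetI)
      fix e assume "e \<in> {e \<in> Z. a \<in> e}"
      then have "e = {a, b}" using no by fast
      then show "e \<in> {{a, b}}" by simp
    next
      fix e assume "e \<in> {{a, b}}"
      then show "e \<in> {e \<in> Z. a \<in> e}" using abZ by simp
    qed
    then show False using ev by contradiction
  qed
  then obtain f where f: "f \<in> Z" "a \<in> f" "f \<noteq> {a, b}" by (elim exE conjE)
  obtain w where w: "f = {a, w}" "w \<noteq> a" using Z(4)[OF f(1)] f(2) by (auto simp: card_2_iff)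
  have wb: "w \<noteq> b" using w f(3) by auto
  have "w \<in> set r"
  proof (rule ccontr)
    assume "w \<notin> set r"
    then have "Q (w # l)" using dl w f(1) wb unfolding Q_def abr by (auto simp: insert_commute)
    from l(2)[OF this] show False by simp
  qed
  then obtain r1 r2 where r: "r = r1 @ w # r2" by (meson split_list)
  have eq: "a # b # r = (a # b # r1) @ w # r2" using r by simp
  have "path_edges ((a # b # r1) @ [w]) \<subseteq> Z"
    using dl(2) unfolding eq path_edges_append[of "a # b # r1" w r2] by blast
  moreover have "distinct ((a # b # r1) @ [w])" using dl(1) r by auto
  moreover have "{last ((a # b # r1) @ [w]), hd ((a # b # r1) @ [w])} \<in> Z" using f w by (simp add: insert_commute)
  ultimately show thesis by (intro that[of "(a # b # r1) @ [w]"]) auto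
qed

definition cycle_edges :: "'a list \<Rightarrow> 'a set set" where
  "cycle_edges l = insert {last l, hd l} (path_edges l)"

text \<open>The sides of an edge are studied by opening the cycle at it, so the edge is made the
  closing one.\<close>

lemma cycle_rotate:
  assumes l: "distinct l" "3 \<le> length l" and e: "e \<in> cycle_edges l"
  obtains l' where "distinct l'" "3 \<le> length l'" "cycle_edges l' = cycle_edges l" "e = {last l', hd l'}"
proof (cases "e = {last l, hd l}")
  case True
  then show ?thesis using that[of l] l by simp
next
  case False
  then have "e \<in> path_edges l" using e by (simp add: cycle_edges_def)
  then obtain l1 p q l2 where l12: "l = l1 @ p # q # l2" "e = {p, q}" using path_edges_split by metis
  define l' where "l' = (q # l2) @ (l1 @ [p])"
  have lp: "path_edges l = path_edges (l1 @ [p]) \<union> insert {p, q} (path_edges (q # l2))"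
    unfolding l12(1) path_edges_append[of l1 p "q # l2"] by simp
  have h: "hd l = hd (l1 @ [p])" "last l = last (q # l2)" unfolding l12(1) by (cases l1; simp)+
  have pe: "path_edges l' = path_edges (q # l2) \<union> insert {last (q # l2), hd (l1 @ [p])} (path_edges (l1 @ [p]))"
  proof -
    obtain z s where zs: "l1 @ [p] = z # s" by (cases l1) auto
    obtain s' z' where zs': "q # l2 = s' @ [z']" by (metis append_butlast_last_id list.discI)
    have "path_edges l' = path_edges (s' @ z' # z # s)" by (simp add: l'_def zs zs')
    also have "\<dots> = path_edges (s' @ [z']) \<union> insert {z', z} (path_edges (z # s))"
      unfolding path_edges_append[of s' z' "z # s"] by simp
    finally show ?thesis using zs zs' by simp
  qed
  have "cycle_edges l' = cycle_edges l"
    unfolding cycle_edges_def pe lp h by (auto simp: l'_def insert_commute)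
  moreover have "distinct l'" "3 \<le> length l'" using l unfolding l12(1) l'_def by auto
  moreover have "e = {last l', hd l'}" using l12(2) by (simp add: l'_def)
  ultimately show ?thesis using that by blast
qed

section \<open>Plane drawings and the two sides of an edge\<close>

lemma endless_arc:
  assumes "arc c"
  shows "path_image c - {pathstart c, pathfinish c} \<noteq> {}"
    "path_image c \<subseteq> closure (path_image c - {pathstart c, pathfinish c})"
    "connected (path_image c - {pathstart c, pathfinish c})"
proof -
  have inj: "inj_on c {0..1}" and cont: "continuous_on {0..1} c" using assms by (auto simp: arc_def path_def)
  have sub: "c ` {0<..<1} \<subseteq> path_image c - {pathstart c, pathfinish c}"
  proof
    fix z assume "z \<in> c ` {0<..<1}"
    then obtain t where t: "z = c t" "0 < t" "t < 1" by auto
    then have "c t \<noteq> c 0" "c t \<noteq> c 1" using inj_onD[OF inj, of t 0] inj_onD[OF inj, of t 1] by auto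
    then show "z \<in> path_image c - {pathstart c, pathfinish c}"
      using t by (auto simp: path_image_def pathstart_def pathfinish_def)
  qed
  have "c (1/2) \<in> c ` {0<..<1::real}" by (rule imageI) simp
  then show "path_image c - {pathstart c, pathfinish c} \<noteq> {}" using sub by blast
  have "path_image c = c ` closure {0<..<1}" by (simp add: path_image_def)
  also have "\<dots> \<subseteq> closure (c ` {0<..<1})" by (rule continuous_image_closure_subset[OF cont]) simp
  finally show "path_image c \<subseteq> closure (path_image c - {pathstart c, pathfinish c})"
    using closure_mono[OF sub] by blast
  show "connected (path_image c - {pathstart c, pathfinish c})"
    by (rule connected_simple_path_endless[OF arc_imp_simple_path[OF assms]])
qed

locale embedding =
  fixes V :: "'a set" and E :: "'a set set" and \<phi> :: "'a \<Rightarrow> complex" and \<gamma> :: "'a set \<Rightarrow> real \<Rightarrow> complex"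
  assumes sg: "simple_graph V E" and pe: "plane_embedding V E \<phi> \<gamma>"
begin

definition "P e = path_image (\<gamma> e)"
definition "open_edge e = P e - \<phi> ` e"
definition "\<Gamma> = \<phi> ` V \<union> (\<Union>e\<in>E. P e)"
definition "Faces = components (- \<Gamma>)"

lemma Faces_eq: "faces V E \<phi> \<gamma> = Faces"
  by (simp add: faces_def Faces_def \<Gamma>_def P_def)

lemma finV: "finite V" and edge: "e \<in> E \<Longrightarrow> e \<subseteq> V \<and> card e = 2"
  using sg by (auto simp: simple_graph_def)

lemma finE: "finite E"
  using finV edge by (metis Pow_iff finite_Pow_iff finite_subset subsetI)

lemma inj: "inj_on \<phi> V"
  using pe by (simp add: plane_embedding_def)

lemma arc_edge: "e \<in> E \<Longrightarrow> arc (\<gamma> e)"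
  and ends: "e \<in> E \<Longrightarrow> {pathstart (\<gamma> e), pathfinish (\<gamma> e)} = \<phi> ` e"
  and edge_vertices: "e \<in> E \<Longrightarrow> P e \<inter> \<phi> ` V = \<phi> ` e"
  and edge_edge: "e \<in> E \<Longrightarrow> f \<in> E \<Longrightarrow> e \<noteq> f \<Longrightarrow> P e \<inter> P f = \<phi> ` (e \<inter> f)"
  using pe by (auto simp: plane_embedding_def P_def)

lemma compact_P: "e \<in> E \<Longrightarrow> compact (P e)"
  using arc_edge compact_arc_image unfolding P_def by blast

lemma compact_\<Gamma>: "compact \<Gamma>"
proof -
  have "compact (\<phi> ` V)" using finV by (intro finite_imp_compact) simp
  moreover have "compact (\<Union>e\<in>E. P e)" using finE compact_P by (rule compact_UN)
  ultimately show ?thesis unfolding \<Gamma>_def by (rule compact_Un)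
qed

lemma open_edge_facts:
  assumes "e \<in> E"
  shows "open_edge e \<noteq> {}" "P e \<subseteq> closure (open_edge e)" "connected (open_edge e)" "open_edge e \<subseteq> P e"
  using endless_arc[OF arc_edge[OF assms]] ends[OF assms] by (auto simp: open_edge_def P_def)

lemma face_facts:
  assumes "f \<in> Faces"
  shows "f \<noteq> {}" "open f" "connected f" "f \<inter> \<Gamma> = {}"
  using assms compact_imp_closed[OF compact_\<Gamma>] in_components_nonempty in_components_connected in_components_subset
    open_components[of "- \<Gamma>"] unfolding Faces_def by blast+

lemma oriented_arc:
  assumes "{a, b} \<in> E" obtains g where "arc g" "pathstart g = \<phi> a" "pathfinish g = \<phi> b" "path_image g = P {a, b}"
proof -
  let ?c = "\<gamma> {a, b}"
  have "{pathstart ?c, pathfinish ?c} = {\<phi> a, \<phi> b}" using ends[OF assms] by simp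
  then consider "pathstart ?c = \<phi> a" "pathfinish ?c = \<phi> b" | "pathstart ?c = \<phi> b" "pathfinish ?c = \<phi> a"
    by (auto simp: doubleton_eq_iff)
  then show thesis
  proof cases
    case 1 then show ?thesis using that[of ?c] arc_edge[OF assms] by (simp add: P_def)
  next
    case 2 then show ?thesis using that[of "reversepath ?c"] arc_edge[OF assms] by (simp add: P_def arc_reversepath)
  qed
qed

lemma path_arc:
  assumes "distinct (a # b # l)" "path_edges (a # b # l) \<subseteq> E"
  shows "\<exists>g. arc g \<and> pathstart g = \<phi> a \<and> pathfinish g = \<phi> (last (b # l)) \<and> path_image g = (\<Union>e\<in>path_edges (a # b # l). P e)"
  using assms
proof (induction l arbitrary: a b)
  case Nil
  then have "{a, b} \<in> E" by simp
  then obtain g where "arc g" "pathstart g = \<phi> a" "pathfinish g = \<phi> b" "path_image g = P {a, b}" by (rule oriented_arc)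
  then show ?case by auto
next
  case (Cons c l)
  have "distinct (b # c # l)" "path_edges (b # c # l) \<subseteq> E" using Cons.prems by auto
  then obtain g where g: "arc g" "pathstart g = \<phi> b" "pathfinish g = \<phi> (last (c # l))" "path_image g = (\<Union>e\<in>path_edges (b # c # l). P e)"
    using Cons.IH by blast
  have abE: "{a, b} \<in> E" using Cons.prems by simp
  then obtain h where h: "arc h" "pathstart h = \<phi> a" "pathfinish h = \<phi> b" "path_image h = P {a, b}" by (rule oriented_arc)
  have "path_image h \<inter> path_image g \<subseteq> {pathstart g}"
  proof
    fix z assume z: "z \<in> path_image h \<inter> path_image g"
    then obtain f where f: "f \<in> path_edges (b # c # l)" "z \<in> P f" using g(4) by auto
    have fs: "f \<subseteq> set (b # c # l)" using path_edges_subset[OF f(1)] .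
    then have af: "a \<notin> f" using Cons.prems(1) by auto
    have "f \<in> E" using f(1) Cons.prems(2) by auto
    moreover have "{a, b} \<noteq> f" using af by auto
    ultimately have "P {a, b} \<inter> P f = \<phi> ` ({a, b} \<inter> f)" using edge_edge abE by blast
    then have "z \<in> \<phi> ` ({a, b} \<inter> f)" using z h(4) f(2) by blast
    then show "z \<in> {pathstart g}" using af g(2) by auto
  qed
  then have "arc (h +++ g)" using h g by (intro arc_join) auto
  moreover have "path_image (h +++ g) = P {a, b} \<union> (\<Union>e\<in>path_edges (b # c # l). P e)"
    using h g by (simp add: path_image_join)
  ultimately show ?case using h g by (intro exI[of _ "h +++ g"]) auto
qed

text \<open>Besides the closed curve, the rest of the cycle without the closing edge is recorded:
  its connectedness is the hypothesis for Janiszewski's theorem in \<open>two_sides\<close>.\<close>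

lemma cycle_curve:
  assumes l: "3 \<le> length l" "distinct l" "cycle_edges l \<subseteq> E"
  obtains g where "simple_path g" "pathfinish g = pathstart g" "path_image g = (\<Union>e\<in>cycle_edges l. P e)"
    "connected (\<Union>e\<in>path_edges l. P e)" "\<phi> ` {last l, hd l} \<subseteq> (\<Union>e\<in>path_edges l. P e)" "{last l, hd l} \<notin> path_edges l"
proof -
  obtain a b c r where abc: "l = a # b # c # r"
    using l(1) by (metis One_nat_def Suc_1 Suc_le_length_iff numeral_3_eq_3)
  have d: "distinct (a # b # c # r)" using l(2) abc by simp
  have pE: "path_edges (a # b # c # r) \<subseteq> E" using l(3) abc by (simp add: cycle_edges_def)
  define z where "z = last l"
  have z: "z = last (c # r)" "z \<in> set (c # r)" by (auto simp: z_def abc)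
  have za: "{z, a} \<in> E" using l(3) by (simp add: cycle_edges_def z_def abc)
  obtain h where h: "arc h" "pathstart h = \<phi> a" "pathfinish h = \<phi> (last (b # c # r))" "path_image h = (\<Union>e\<in>path_edges (a # b # c # r). P e)"
    using path_arc[OF d pE] by blast
  have hz: "pathfinish h = \<phi> z" using h(3) z by simp
  obtain k where k: "arc k" "pathstart k = \<phi> z" "pathfinish k = \<phi> a" "path_image k = P {z, a}"
    by (rule oriented_arc[OF za])
  have nin: "{z, a} \<notin> path_edges (a # b # c # r)"
  proof
    assume "{z, a} \<in> path_edges (a # b # c # r)"
    then consider "{z, a} = {a, b}" | "{z, a} \<in> path_edges (b # c # r)" by auto
    then show False
    proof cases
      case 1
      then have "z = b" using d z by (auto simp: doubleton_eq_iff)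
      then show False using z d by auto
    next
      case 2
      then have "a \<in> set (b # c # r)" using path_edges_subset by fastforce
      then show False using d by auto
    qed
  qed
  have "path_image h \<inter> path_image k \<subseteq> {pathstart h, pathstart k}"
  proof
    fix w assume w: "w \<in> path_image h \<inter> path_image k"
    then obtain f where f: "f \<in> path_edges (a # b # c # r)" "w \<in> P f" using h(4) by blast
    have "f \<in> E" "{z, a} \<noteq> f" using f(1) pE nin by auto
    then have "P {z, a} \<inter> P f = \<phi> ` ({z, a} \<inter> f)" using edge_edge za by blast
    then have "w \<in> \<phi> ` ({z, a} \<inter> f)" using w k(4) f(2) by blast
    then show "w \<in> {pathstart h, pathstart k}" using h(2) k(2) by auto
  qed
  then have "simple_path (h +++ k)" using h hz k by (intro simple_path_join_loop) auto
  moreover have "pathfinish (h +++ k) = pathstart (h +++ k)" using h k by simp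
  moreover have "path_image (h +++ k) = (\<Union>e\<in>cycle_edges l. P e)"
    using h hz k by (simp add: path_image_join cycle_edges_def abc z_def Un_commute)
  moreover have "connected (\<Union>e\<in>path_edges l. P e)"
    using h(1,4) abc by (metis connected_path_image arc_imp_path)
  moreover have "\<phi> ` {last l, hd l} \<subseteq> (\<Union>e\<in>path_edges l. P e)"
  proof -
    have "\<phi> a \<in> path_image h" "\<phi> z \<in> path_image h" using h(2) hz pathstart_in_path_image pathfinish_in_path_image by metis+
    moreover have "hd l = a" "path_edges l = path_edges (a # b # c # r)" using abc by simp_all
    ultimately show ?thesis using h(4) by (simp add: z_def[symmetric])
  qed
  ultimately show thesis using that nin by (simp add: z_def abc)
qed

end

text \<open>\<open>\<Gamma>'\<close> is the drawing without one edge, and \<open>W\<close> is the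
  component of its complement that contains this open edge \<open>A\<close>. Points of
  \<open>W\<close> on the same side of \<open>J\<close> are separated neither by
  \<open>\<Gamma>'\<close> nor by \<open>J\<close>, so by Janiszewski's theorem not by their union.
  Thus \<open>J\<close> cuts \<open>W\<close> into exactly two faces, and both reach
  \<open>A\<close> because every point of \<open>J\<close> is a limit of its inside and of its
  outside.\<close>

lemma two_sides:
  fixes \<Gamma>' :: "complex set"
  assumes S: "compact \<Gamma>'" and g: "simple_path g" "pathfinish g = pathstart g" and J: "J = path_image g"
    and con: "connected (\<Gamma>' \<inter> J)" and A: "A = J - \<Gamma>'" "A \<noteq> {}" "connected A"
    and G: "\<Gamma> = \<Gamma>' \<union> J"
  obtains W f1 f2 where "open W" "connected W" "W = f1 \<union> f2 \<union> A" "f1 \<in> components (- \<Gamma>)" "f2 \<in> components (- \<Gamma>)"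
    "f1 \<subseteq> inside J" "f2 \<subseteq> outside J" "A \<subseteq> closure f1" "A \<subseteq> closure f2"
proof -
  have io: "connected (inside J)" "connected (outside J)" "inside J \<inter> outside J = {}" "inside J \<union> outside J = - J"
    "frontier (inside J) = J" "frontier (outside J) = J"
    using Jordan_inside_outside[OF g] J by auto
  have clJ: "closed J" using J g(1) by (simp add: closed_simple_path_image)
  obtain q where q: "q \<in> A" using A by blast
  define W where "W = connected_component_set (- \<Gamma>') q"
  have oW: "open W" unfolding W_def using compact_imp_closed[OF S] by (intro open_connected_component) auto
  have cW: "connected W" by (simp add: W_def)
  have AW: "A \<subseteq> W" unfolding W_def using q A by (intro connected_component_maximal) auto
  have Wsub: "W \<subseteq> - \<Gamma>'" unfolding W_def by (rule connected_component_subset)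
  have WJ: "W \<inter> J = A" using A(1) AW Wsub by blast
  have half: "W \<inter> H \<in> components (- \<Gamma>) \<and> A \<subseteq> closure (W \<inter> H)"
    if H: "connected H" "H \<subseteq> - J" "frontier H = J" and same: "\<And>a b. connected_component (- J) a b \<Longrightarrow> a \<in> H \<Longrightarrow> b \<in> H" for H
  proof -
    have "A \<subseteq> W \<inter> closure H" using AW H(3) A(1) by (auto simp: frontier_def)
    also have "\<dots> \<subseteq> closure (W \<inter> H)" by (rule open_Int_closure_subset[OF oW])
    finally have cl: "A \<subseteq> closure (W \<inter> H)" .
    then have "W \<inter> H \<noteq> {}" using q by auto
    then obtain a where a: "a \<in> W" "a \<in> H" by blast
    have "W \<inter> H = connected_component_set (- \<Gamma>) a"
    proof (intro equalityI subsetI)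
      fix b assume b: "b \<in> W \<inter> H"
      have "connected_component (- \<Gamma>') a b" using cW Wsub a b unfolding connected_component_def by blast
      moreover have "connected_component (- J) a b" using H a b unfolding connected_component_def by blast
      ultimately show "b \<in> connected_component_set (- \<Gamma>) a" using Janiszewski[OF S clJ con] G by simp
    next
      fix b assume "b \<in> connected_component_set (- \<Gamma>) a"
      then have b: "connected_component (- \<Gamma>) a b" by simp
      then have "connected_component (- \<Gamma>') a b" "connected_component (- J) a b"
        using connected_component_of_subset[of "- \<Gamma>"] G by blast+
      then have "b \<in> H" "connected_component_set (- \<Gamma>') a = connected_component_set (- \<Gamma>') b"
        using same a connected_component_eq by fastforce+
      moreover have "connected_component_set (- \<Gamma>') a = W"
        using a(1) unfolding W_def by (metis connected_component_eq)
      moreover have "b \<in> - \<Gamma>'" using b connected_component_in[OF b] G by blast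
      ultimately show "b \<in> W \<inter> H" by (metis IntI connected_component_refl_eq mem_Collect_eq)
    qed
    moreover have "a \<in> - \<Gamma>" using a Wsub H(2) G by blast
    ultimately show ?thesis using cl by (metis componentsI)
  qed
  have sub: "inside J \<subseteq> - J" "outside J \<subseteq> - J" using io(4) by blast+
  have 1: "W \<inter> inside J \<in> components (- \<Gamma>) \<and> A \<subseteq> closure (W \<inter> inside J)"
    by (rule half[OF io(1) sub(1) io(5) inside_same_component])
  have 2: "W \<inter> outside J \<in> components (- \<Gamma>) \<and> A \<subseteq> closure (W \<inter> outside J)"
    by (rule half[OF io(2) sub(2) io(6) outside_same_component])
  have "W = W \<inter> inside J \<union> W \<inter> outside J \<union> A" using WJ io(4) by blast
  then show thesis using that[of W "W \<inter> inside J" "W \<inter> outside J"] oW cW 1 2 by blast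
qed

lemma three_triangle:
  assumes c: "card e1 = 2" "card e2 = 2" "card e3 = 2" and d: "e1 \<noteq> e2" "e1 \<noteq> e3" "e2 \<noteq> e3"
    and s: "e1 \<subseteq> e2 \<union> e3" "e2 \<subseteq> e1 \<union> e3" "e3 \<subseteq> e1 \<union> e2"
  obtains a b c where "a \<noteq> b" "b \<noteq> c" "a \<noteq> c" "{e1, e2, e3} = {{a, b}, {b, c}, {a, c}}"
proof -
  obtain p q where e1: "e1 = {p, q}" "p \<noteq> q" using c(1) by (auto simp: card_2_iff)
  have "\<exists>a b. e1 = {a, b} \<and> a \<noteq> b \<and> a \<in> e2"
  proof (cases "p \<in> e2")
    case True then show ?thesis using e1 by blast
  next
    case False
    have "q \<in> e2"
    proof (rule ccontr)
      assume "q \<notin> e2"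
      then have "e1 \<subseteq> e3" using s(1) e1 False by auto
      then have "e1 = e3" using c by (metis card_subset_eq card.infinite zero_neq_numeral)
      then show False using d by simp
    qed
    then show ?thesis using e1 by (metis insert_commute)
  qed
  then obtain a b where ab: "e1 = {a, b}" "a \<noteq> b" "a \<in> e2" by blast
  obtain c' where c': "e2 = {a, c'}" "a \<noteq> c'" using c(2) ab(3) by (auto simp: card_2_iff)
  have bc: "b \<noteq> c'" using d(1) ab c' by auto
  have "b \<in> e3" "c' \<in> e3" using s ab c' bc by auto
  then have "e3 = {b, c'}" using c(3) bc by (auto simp: card_2_iff)
  then show thesis using that[of a b c'] ab c' bc by (auto simp: insert_commute)
qed

context embedding
begin

definition "bE f = {e \<in> E. P e \<subseteq> frontier f}"

lemma open_edge_sub_\<Gamma>: "e \<in> E \<Longrightarrow> open_edge e \<subseteq> \<Gamma>"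
  by (auto simp: open_edge_def \<Gamma>_def)

lemma open_edge_vertex: "e \<in> E \<Longrightarrow> open_edge e \<inter> \<phi> ` V = {}"
  using edge_vertices unfolding open_edge_def by blast

lemma open_edge_disjoint: "e \<in> E \<Longrightarrow> f \<in> E \<Longrightarrow> e \<noteq> f \<Longrightarrow> open_edge e \<inter> P f = {}"
  using edge_edge[of e f] unfolding open_edge_def by blast

lemma \<Gamma>_split: "\<Gamma> = \<phi> ` V \<union> (\<Union>e\<in>E. open_edge e)"
  using edge unfolding \<Gamma>_def open_edge_def by blast

lemma Faces_Un: "\<Union>Faces = - \<Gamma>"
  unfolding Faces_def by (rule Union_components)

lemma face_eq: "f \<in> Faces \<Longrightarrow> g \<in> Faces \<Longrightarrow> z \<in> f \<Longrightarrow> z \<in> g \<Longrightarrow> f = g"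
  unfolding Faces_def using components_eq by blast

lemma frontier_face: "f \<in> Faces \<Longrightarrow> frontier f \<subseteq> \<Gamma>"
  unfolding Faces_def using compact_imp_closed[OF compact_\<Gamma>] frontier_of_components_closed_complement by blast

text \<open>The drawing without \<open>e\<close> meets the curve in the rest of the cycle, so
  \<open>two_sides\<close> applies. The set \<open>W\<close> is an open neighbourhood of the whole
  open edge made of that edge and two faces, so no other face can come near any of its
  points.\<close>

lemma edge_sides:
  assumes l: "3 \<le> length l" "distinct l" "cycle_edges l \<subseteq> E" and e: "e = {last l, hd l}"
    and J: "J = (\<Union>e\<in>cycle_edges l. P e)"
  obtains W f1 f2 where "open W" "connected W" "W = f1 \<union> f2 \<union> open_edge e" "f1 \<in> Faces" "f2 \<in> Faces"
    "f1 \<subseteq> inside J" "f2 \<subseteq> outside J" "f1 \<noteq> f2"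
    "\<And>f. f \<in> Faces \<Longrightarrow> e \<in> bE f \<longleftrightarrow> f = f1 \<or> f = f2"
    "\<And>f. f \<in> Faces \<Longrightarrow> frontier f \<inter> open_edge e \<noteq> {} \<Longrightarrow> e \<in> bE f"
proof -
  obtain g where g: "simple_path g" "pathfinish g = pathstart g" "path_image g = (\<Union>e\<in>cycle_edges l. P e)"
    "connected (\<Union>e\<in>path_edges l. P e)" "\<phi> ` {last l, hd l} \<subseteq> (\<Union>e\<in>path_edges l. P e)" "{last l, hd l} \<notin> path_edges l"
    by (rule cycle_curve[OF l])
  define R where "R = (\<Union>e\<in>path_edges l. P e)"
  define \<Gamma>' where "\<Gamma>' = \<phi> ` V \<union> (\<Union>f\<in>E - {e}. P f)"
  have ce: "cycle_edges l = insert e (path_edges l)" by (simp add: cycle_edges_def e)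
  have eE: "e \<in> E" and pE: "path_edges l \<subseteq> E - {e}" using l(3) g(6) by (auto simp: ce e)
  have JR: "J = R \<union> P e" unfolding J R_def ce by blast
  have "compact (\<phi> ` V)" using finV by (intro finite_imp_compact) simp
  moreover have "compact (\<Union>f\<in>E - {e}. P f)" using finE compact_P by (intro compact_UN) auto
  ultimately have comp: "compact \<Gamma>'" unfolding \<Gamma>'_def by (rule compact_Un)
  have R\<Gamma>: "R \<subseteq> \<Gamma>'" unfolding R_def \<Gamma>'_def using pE by blast
  have PE\<Gamma>: "P e \<inter> \<Gamma>' \<subseteq> \<phi> ` e"
  proof
    fix z assume z: "z \<in> P e \<inter> \<Gamma>'"
    show "z \<in> \<phi> ` e"
    proof (cases "z \<in> \<phi> ` V")
      case True then show ?thesis using z edge_vertices[OF eE] by blast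
    next
      case False
      then obtain f where f: "f \<in> E" "f \<noteq> e" "z \<in> P f" using z unfolding \<Gamma>'_def by blast
      then show ?thesis using z edge_edge[of e f] eE by blast
    qed
  qed
  have \<phi>R: "\<phi> ` e \<subseteq> R" using g(5) unfolding R_def e .
  have int: "\<Gamma>' \<inter> J = R" using JR R\<Gamma> PE\<Gamma> \<phi>R by blast
  have oe: "open_edge e = J - \<Gamma>'" using JR R\<Gamma> PE\<Gamma> \<phi>R unfolding open_edge_def by blast
  have un: "\<Gamma> = \<Gamma>' \<union> J" using eE JR R\<Gamma> unfolding \<Gamma>_def \<Gamma>'_def by blast
  have c1: "connected (\<Gamma>' \<inter> J)" using g(4) int R_def by simp
  obtain W f1 f2 where W: "open W" "connected W" "W = f1 \<union> f2 \<union> open_edge e" "f1 \<in> components (- \<Gamma>)" "f2 \<in> components (- \<Gamma>)"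
    "f1 \<subseteq> inside J" "f2 \<subseteq> outside J" "open_edge e \<subseteq> closure f1" "open_edge e \<subseteq> closure f2"
    by (rule two_sides[OF comp g(1,2) J[folded g(3)] c1 oe open_edge_facts(1)[OF eE] open_edge_facts(3)[OF eE] un])
  have F: "f1 \<in> Faces" "f2 \<in> Faces" using W unfolding Faces_def by auto
  have "inside J \<inter> outside J = {}" by (rule inside_Int_outside)
  then have ne: "f1 \<noteq> f2" using W(6,7) face_facts(1)[OF F(1)] by blast
  have bd: "e \<in> bE f" if f: "f \<in> Faces" "open_edge e \<subseteq> closure f" for f
  proof -
    have "open_edge e \<inter> f = {}" using open_edge_sub_\<Gamma>[OF eE] face_facts(4)[OF f(1)] by blast
    then have "open_edge e \<subseteq> frontier f" using f(2) face_facts(2)[OF f(1)] by (auto simp: frontier_def interior_open)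
    then have "closure (open_edge e) \<subseteq> frontier f" by (rule closure_minimal) simp
    then show ?thesis using open_edge_facts(2)[OF eE] eE unfolding bE_def by blast
  qed
  have near: "f = f1 \<or> f = f2" if f: "f \<in> Faces" "frontier f \<inter> open_edge e \<noteq> {}" for f
  proof -
    have "W \<inter> closure f \<noteq> {}" using f(2) W(3) unfolding frontier_def by blast
    then have "W \<inter> f \<noteq> {}" using open_Int_closure_eq_empty[OF W(1)] by blast
    then obtain z where z: "z \<in> W" "z \<in> f" by blast
    have "z \<notin> open_edge e" using z(2) face_facts(4)[OF f(1)] open_edge_sub_\<Gamma>[OF eE] by blast
    then have "z \<in> f1 \<or> z \<in> f2" using z(1) W(3) by blast
    then show ?thesis using face_eq[OF f(1) F(1) z(2)] face_eq[OF f(1) F(2) z(2)] by blast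
  qed
  have meets: "frontier f \<inter> open_edge e \<noteq> {}" if "e \<in> bE f" for f
    using that open_edge_facts(1,4)[OF eE] unfolding bE_def by blast
  have b12: "e \<in> bE f1" "e \<in> bE f2" using bd F W(8,9) by blast+
  show thesis
  proof (rule that[OF W(1-3) F W(6,7) ne])
    fix f assume f: "f \<in> Faces"
    show "e \<in> bE f \<longleftrightarrow> f = f1 \<or> f = f2" using near[OF f] meets b12 by blast
    show "frontier f \<inter> open_edge e \<noteq> {} \<Longrightarrow> e \<in> bE f" using near[OF f] b12 by blast
  qed
qed

text \<open>An arc does not separate the plane, and compact sets that do not separate it may be
  united if they meet in a connected set. Two edges meet in at most one vertex, and the third edge
  has an end off both of them, so it meets their union in at most one point.\<close>

lemma three_edges_connected:
  assumes E: "e1 \<in> E" "e2 \<in> E" "e3 \<in> E" and d: "e1 \<noteq> e2" "e1 \<noteq> e3" "e2 \<noteq> e3" and n: "\<not> e3 \<subseteq> e1 \<union> e2"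
  shows "connected (- (P e1 \<union> P e2 \<union> P e3))"
proof -
  have one: "connected (- P e)" if "e \<in> E" for e
    unfolding P_def by (rule connected_arc_complement[OF arc_edge[OF that]]) simp
  have small: "connected (\<phi> ` A)" if "A \<subseteq> {w}" for A w
  proof -
    have "A = {} \<or> A = {w}" using that by blast
    then show ?thesis by auto
  qed
  have c2: "card e1 = 2" "card e2 = 2" "card e3 = 2" using edge E by auto
  have "\<exists>w. e1 \<inter> e2 \<subseteq> {w}" using c2 d(1) by (auto simp: card_2_iff)
  then obtain w where w: "e1 \<inter> e2 \<subseteq> {w}" ..
  have i: "P e1 \<inter> P e2 = \<phi> ` (e1 \<inter> e2)" "P e1 \<inter> P e3 = \<phi> ` (e1 \<inter> e3)" "P e2 \<inter> P e3 = \<phi> ` (e2 \<inter> e3)"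
    using edge_edge E d by auto
  have "connected (- (P e1 \<union> P e2))"
    by (rule Janiszewski_connected[OF compact_P[OF E(1)] compact_imp_closed[OF compact_P[OF E(2)]] _ one[OF E(1)] one[OF E(2)]])
      (simp only: i(1) small[OF w])
  moreover obtain w' where w': "(e1 \<union> e2) \<inter> e3 \<subseteq> {w'}"
  proof -
    obtain r s where rs: "e3 = {r, s}" using c2(3) by (auto simp: card_2_iff)
    then have "r \<notin> e1 \<union> e2 \<or> s \<notin> e1 \<union> e2" using n by blast
    then show thesis using that[of r] that[of s] rs by blast
  qed
  moreover have "(P e1 \<union> P e2) \<inter> P e3 = \<phi> ` ((e1 \<union> e2) \<inter> e3)" using i by blast
  ultimately show ?thesis
    using Janiszewski_connected[OF compact_Un[OF compact_P[OF E(1)] compact_P[OF E(2)]] compact_imp_closed[OF compact_P[OF E(3)]] _ _ one[OF E(3)]]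
      small[OF w'] by metis
qed

end

section \<open>The face triangles as an abstract sphere\<close>

locale triangulated = embedding +
  assumes conn: "k_connected 4 V E" and three: "\<And>f. f \<in> Faces \<Longrightarrow> card (bE f) = 3"
begin

lemma neighbour_outside:
  assumes a: "a \<in> V" "a \<notin> S" and S: "S \<subseteq> V" "card S < 4"
  obtains t where "{a, t} \<in> E" "t \<notin> S" "t \<noteq> a"
proof -
  have "card (insert a S) \<le> 4" using S(2) by (metis Suc_leI card_insert_le_m1 card_insert_if finite_subset[OF S(1) finV] a(2) )
  also have "4 < card V" using conn by (simp add: k_connected_def)
  finally have "\<not> V \<subseteq> insert a S" using card_mono[of "insert a S" V] finite_subset[OF S(1) finV] by auto
  then obtain w where w: "w \<in> V" "w \<noteq> a" "w \<notin> S" by blast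
  have "graph_connected (V - S) {e \<in> E. e \<inter> S = {}}" using conn S unfolding k_connected_def by blast
  then have "(a, w) \<in> {(s, t). {s, t} \<in> {e \<in> E. e \<inter> S = {}}}\<^sup>*"
    using a w unfolding graph_connected_def by blast
  then obtain t where t: "{a, t} \<in> E" "{a, t} \<inter> S = {}"
    using w(2) by (cases rule: converse_rtranclE) auto
  then have "card {a, t} = 2" using edge by blast
  then have "t \<noteq> a" by auto
  then show thesis using that t by blast
qed

text \<open>Without \<open>b\<close> the graph is still connected, so a path leads from another
  neighbour of \<open>b\<close> back to \<open>a\<close>.\<close>

lemma edge_on_cycle:
  assumes "e \<in> E"
  obtains l where "3 \<le> length l" "distinct l" "cycle_edges l \<subseteq> E" "e = {last l, hd l}"
proof -
  obtain a b where ab: "e = {a, b}" "a \<noteq> b" "a \<in> V" "b \<in> V" using edge[OF assms] by (auto simp: card_2_iff)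
  obtain b2 where b2: "{b, b2} \<in> E" "b2 \<notin> {a}" "b2 \<noteq> b"
    by (rule neighbour_outside[of b "{a}"]) (use ab in auto)
  have "b2 \<in> V" using edge[OF b2(1)] by simp
  moreover have "graph_connected (V - {b}) {e \<in> E. e \<inter> {b} = {}}" using conn[unfolded k_connected_def, THEN conjunct2, rule_format, of "{b}"] ab(4) by simp
  ultimately have r: "(b2, a) \<in> {(s, t). {s, t} \<in> {e \<in> E. e \<inter> {b} = {}}}\<^sup>*"
    using ab b2(3) unfolding graph_connected_def by blast
  then obtain l where l: "l \<noteq> []" "hd l = b2" "last l = a" "distinct l" "path_edges l \<subseteq> {e \<in> E. e \<inter> {b} = {}}"
      "set l \<subseteq> insert b2 (\<Union>{e \<in> E. e \<inter> {b} = {}})"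
    using reach_path[OF r] by (elim exE conjE)
  have bl: "b \<notin> set l" using l(6) b2(3) by auto
  have "2 \<le> length l"
  proof (rule ccontr)
    assume "\<not> 2 \<le> length l"
    then have "l = [hd l]" using l(1) by (cases l) (auto simp: not_less_eq_eq)
    then have "hd l = last l" by (metis last.simps)
    then show False using l(2,3) b2(2) by simp
  qed
  moreover have "cycle_edges (b # l) \<subseteq> E"
    using path_edges_Cons[OF l(1), of b] l(1,2,3,5) b2(1) ab(1) assms by (auto simp: cycle_edges_def insert_commute)
  ultimately show thesis using that[of "b # l"] l bl ab(1) by auto
qed

lemma edge_faces:
  assumes "e \<in> E"
  obtains W f1 f2 where "open W" "connected W" "W = f1 \<union> f2 \<union> open_edge e" "f1 \<in> Faces" "f2 \<in> Faces" "f1 \<noteq> f2"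
    "\<And>f. f \<in> Faces \<Longrightarrow> e \<in> bE f \<longleftrightarrow> f = f1 \<or> f = f2"
    "\<And>f. f \<in> Faces \<Longrightarrow> frontier f \<inter> open_edge e \<noteq> {} \<Longrightarrow> e \<in> bE f"
proof -
  obtain l where l: "3 \<le> length l" "distinct l" "cycle_edges l \<subseteq> E" "e = {last l, hd l}"
    by (rule edge_on_cycle[OF assms])
  show thesis by (rule edge_sides[OF l refl]) (rule that)
qed

lemma frontier_bE:
  assumes "f \<in> Faces" shows "frontier f \<subseteq> \<phi> ` V \<union> (\<Union>e\<in>bE f. P e)"
proof
  fix z assume z: "z \<in> frontier f"
  then have "z \<in> \<phi> ` V \<union> (\<Union>e\<in>E. open_edge e)" using frontier_face[OF assms] \<Gamma>_split by blast
  then show "z \<in> \<phi> ` V \<union> (\<Union>e\<in>bE f. P e)"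
  proof
    assume "z \<in> (\<Union>e\<in>E. open_edge e)"
    then obtain e where e: "e \<in> E" "z \<in> open_edge e" by blast
    have "e \<in> bE f"
    proof (rule edge_faces[OF e(1)])
      fix W f1 f2 assume "\<And>f. f \<in> Faces \<Longrightarrow> frontier f \<inter> open_edge e \<noteq> {} \<Longrightarrow> e \<in> bE f"
      then show "e \<in> bE f" using assms z e(2) by blast
    qed
    then show ?thesis using open_edge_facts(4)[OF e(1)] e(2) by blast
  qed simp
qed

text \<open>The other ends of the edges of \<open>B\<close> at \<open>a\<close> are at most three
  vertices, and 4-connectivity gives \<open>a\<close> a neighbour outside them.\<close>

lemma another_edge:
  assumes B: "B \<subseteq> E" "finite B" "card B \<le> 3"
  shows "\<exists>e. e \<in> E \<and> e \<notin> B"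
proof -
  have "V \<noteq> {}" using conn unfolding k_connected_def by force
  then obtain a where a: "a \<in> V" by blast
  define S where "S = (\<Union>e\<in>B. if a \<in> e then e - {a} else {})"
  have "card S \<le> (\<Sum>e\<in>B. card (if a \<in> e then e - {a} else {}))" unfolding S_def using B(2) by (rule card_UN_le)
  also have "\<dots> \<le> (\<Sum>e\<in>B. 1)" using edge B(1) by (intro sum_mono) (auto simp: card_Diff_singleton_if)
  finally have c: "card S < 4" using B(3) by simp
  have "S \<subseteq> V" "a \<notin> S" using edge B(1) unfolding S_def by (auto split: if_splits)
  then obtain t where t: "{a, t} \<in> E" "t \<notin> S" "t \<noteq> a" by (rule_tac neighbour_outside[OF a _ _ c])
  have "{a, t} \<notin> B"
  proof
    assume "{a, t} \<in> B"
    moreover have "t \<in> (if a \<in> {a, t} then {a, t} - {a} else {})" using t(3) by simp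
    ultimately have "t \<in> S" unfolding S_def by (rule UN_I)
    then show False using t(2) by contradiction
  qed
  then show ?thesis using t(1) by blast
qed

lemma finite_bE: "finite (bE f)" and bE_subset: "bE f \<subseteq> E"
  using finE by (auto simp: bE_def)

text \<open>Otherwise the face would fill the connected complement of its three boundary edges, and
  there would be no room for a fourth edge.\<close>

lemma bE_covered:
  assumes f: "f \<in> Faces" and b: "bE f = {e1, e2, e3}" and d: "e1 \<noteq> e2" "e1 \<noteq> e3" "e2 \<noteq> e3"
  shows "e3 \<subseteq> e1 \<union> e2"
proof (rule ccontr)
  assume n: "\<not> e3 \<subseteq> e1 \<union> e2"
  define K where "K = P e1 \<union> P e2 \<union> P e3"
  have E: "e1 \<in> E" "e2 \<in> E" "e3 \<in> E" using b bE_subset by blast+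
  have "connected (- K)" unfolding K_def by (rule three_edges_connected[OF E d n])
  moreover have "open (- K)" unfolding K_def using compact_imp_closed compact_P E by (intro open_Compl closed_Un) blast+
  ultimately have con: "connected (- K - \<phi> ` V)" using finV by (intro connected_open_delete_finite) auto
  have fr: "frontier f \<subseteq> \<phi> ` V \<union> K" using frontier_bE[OF f] unfolding b K_def by (simp add: Un_assoc)
  have "P e \<subseteq> \<Gamma>" if "e \<in> E" for e using that unfolding \<Gamma>_def by blast
  then have "K \<subseteq> \<Gamma>" using E unfolding K_def by simp
  moreover have "\<phi> ` V \<subseteq> \<Gamma>" unfolding \<Gamma>_def by blast
  ultimately have fsub: "f \<subseteq> - K - \<phi> ` V" using face_facts(4)[OF f] by blast
  have "- K - \<phi> ` V - f = {}"
  proof (rule ccontr)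
    assume "- K - \<phi> ` V - f \<noteq> {}"
    moreover have "(- K - \<phi> ` V) \<inter> f \<noteq> {}" using fsub face_facts(1)[OF f] by blast
    ultimately have "(- K - \<phi> ` V) \<inter> frontier f \<noteq> {}" using connected_Int_frontier[OF con] by blast
    then show False using fr by blast
  qed
  then have \<Gamma>K: "\<Gamma> \<subseteq> K \<union> \<phi> ` V" using face_facts(4)[OF f] by blast
  obtain e where e: "e \<in> E" "e \<notin> bE f" using another_edge[OF bE_subset finite_bE] three[OF f] by (metis order_refl)
  obtain z where z: "z \<in> open_edge e" using open_edge_facts(1)[OF e(1)] by blast
  have "z \<in> K \<union> \<phi> ` V" using z \<Gamma>K open_edge_sub_\<Gamma>[OF e(1)] by blast
  then have "z \<in> K" using z open_edge_vertex[OF e(1)] by blast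
  then obtain e' where "e' \<in> bE f" "z \<in> P e'" unfolding K_def b by blast
  moreover have "e' \<noteq> e" using calculation e(2) by blast
  ultimately show False using open_edge_disjoint[OF e(1), of e'] bE_subset z by blast
qed

definition "tri f = \<Union>(bE f)"

text \<open>\<open>bE_covered\<close>, applied to three orders of the boundary edges, shows that
  each edge is covered by the other two. Three distinct edges with this property form a
  triangle.\<close>

lemma face_triangle:
  assumes f: "f \<in> Faces"
  obtains a b c where "a \<noteq> b" "b \<noteq> c" "a \<noteq> c" "bE f = {{a, b}, {b, c}, {a, c}}" "tri f = {a, b, c}"
proof -
  obtain e1 e2 e3 where e: "bE f = {e1, e2, e3}" and d: "e1 \<noteq> e2" "e1 \<noteq> e3" "e2 \<noteq> e3"
    using three[OF f] unfolding card_3_iff by blast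
  have "e1 \<in> E" "e2 \<in> E" "e3 \<in> E" using e bE_subset by blast+
  then have c: "card e1 = 2" "card e2 = 2" "card e3 = 2" using edge by blast+
  have "bE f = {e2, e3, e1}" "bE f = {e1, e3, e2}" using e by blast+
  then have s: "e1 \<subseteq> e2 \<union> e3" "e2 \<subseteq> e1 \<union> e3" "e3 \<subseteq> e1 \<union> e2"
    using bE_covered[OF f] e d by metis+
  obtain a b c where abc: "a \<noteq> b" "b \<noteq> c" "a \<noteq> c" "{e1, e2, e3} = {{a, b}, {b, c}, {a, c}}"
    by (rule three_triangle[OF c d s])
  have bE: "bE f = {{a, b}, {b, c}, {a, c}}" using abc(4) e by simp
  then have "tri f = {a, b, c}" unfolding tri_def bE by auto
  then show thesis by (rule that[OF abc(1-3) bE])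
qed

lemma sub_tri:
  assumes f: "f \<in> Faces" and e: "card e = 2" shows "e \<subseteq> tri f \<longleftrightarrow> e \<in> bE f"
proof -
  obtain a b c where abc: "a \<noteq> b" "b \<noteq> c" "a \<noteq> c" "bE f = {{a, b}, {b, c}, {a, c}}" "tri f = {a, b, c}"
    by (rule face_triangle[OF f])
  obtain p q where pq: "e = {p, q}" "p \<noteq> q" using e by (auto simp: card_2_iff)
  show ?thesis unfolding abc(4,5) pq(1) using abc(1-3) pq(2) by (auto simp: doubleton_eq_iff)
qed

text \<open>If both the faces in \<open>X\<close> and the remaining faces are enlarged by their open
  boundary edges, they become disjoint open sets that cover the plane minus the vertices. This set
  is connected, because only finitely many points have been removed.\<close>

lemma faces_connected:
  assumes X: "X \<subseteq> Faces" "X \<noteq> {}" and cl: "\<And>e f g. f \<in> X \<Longrightarrow> g \<in> Faces \<Longrightarrow> e \<in> bE f \<Longrightarrow> e \<in> bE g \<Longrightarrow> g \<in> X"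
  shows "X = Faces"
proof (rule ccontr)
  assume "X \<noteq> Faces"
  define side where "side Y = \<Union>Y \<union> (\<Union>e\<in>{e \<in> E. \<exists>f\<in>Y. e \<in> bE f}. open_edge e)" for Y
  have op: "open (side Y)" if Y: "Y \<subseteq> Faces" "\<And>e f g. f \<in> Y \<Longrightarrow> g \<in> Faces \<Longrightarrow> e \<in> bE f \<Longrightarrow> e \<in> bE g \<Longrightarrow> g \<in> Y" for Y
  proof (subst open_subopen, rule ballI)
    fix z assume "z \<in> side Y"
    then consider (face) f where "f \<in> Y" "z \<in> f" | (edge) e f where "e \<in> E" "f \<in> Y" "e \<in> bE f" "z \<in> open_edge e"
      unfolding side_def by blast
    then have "\<exists>W. open W \<and> z \<in> W \<and> W \<subseteq> side Y"
    proof cases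
      case face
      then have "open f" using face_facts(2) Y(1) by blast
      moreover have "f \<subseteq> side Y" using face unfolding side_def by blast
      ultimately show ?thesis using face by blast
    next
      case edge
      show ?thesis
      proof (rule edge_faces[OF edge(1)])
        fix W f1 f2
        assume W: "open W" "W = f1 \<union> f2 \<union> open_edge e" "f1 \<in> Faces" "f2 \<in> Faces"
          and iff: "\<And>f. f \<in> Faces \<Longrightarrow> e \<in> bE f \<longleftrightarrow> f = f1 \<or> f = f2"
        have "f1 \<in> Y" using Y(2)[OF edge(2) W(3) edge(3)] iff[OF W(3)] by simp
        moreover have "f2 \<in> Y" using Y(2)[OF edge(2) W(4) edge(3)] iff[OF W(4)] by simp
        ultimately have "W \<subseteq> side Y" using W(2) edge(1-3) unfolding side_def by blast
        then show ?thesis using W(1,2) edge(4) by blast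
      qed
    qed
    then show "\<exists>T. open T \<and> z \<in> T \<and> T \<subseteq> side Y" .
  qed
  have o1: "open (side X)" using X(1) cl by (rule op)
  have o2: "open (side (Faces - X))"
  proof (rule op)
    fix e f g assume "f \<in> Faces - X" "g \<in> Faces" "e \<in> bE f" "e \<in> bE g"
    then show "g \<in> Faces - X" using cl[of g f e] by blast
  qed blast
  have f1: "f \<inter> open_edge e = {}" if "f \<in> Faces" "e \<in> E" for f e
    using face_facts(4)[OF that(1)] open_edge_sub_\<Gamma>[OF that(2)] by blast
  have f2: "open_edge e \<inter> open_edge e' = {}" if "e \<in> E" "e' \<in> E" "e \<noteq> e'" for e e'
    using open_edge_disjoint[OF that] open_edge_facts(4)[OF that(2)] by blast
  have disj: "side X \<inter> side (Faces - X) = {}"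
  proof (rule ccontr)
    assume "side X \<inter> side (Faces - X) \<noteq> {}"
    then obtain z where z: "z \<in> side X" "z \<in> side (Faces - X)" by blast
    consider (face) f where "f \<in> X" "z \<in> f" | (edge) e f where "e \<in> E" "f \<in> X" "e \<in> bE f" "z \<in> open_edge e"
      using z(1) unfolding side_def by blast
    then show False
    proof cases
      case face
      have fF: "f \<in> Faces" using face X by blast
      consider g where "g \<in> Faces" "g \<notin> X" "z \<in> g" | e where "e \<in> E" "z \<in> open_edge e"
        using z(2) unfolding side_def by blast
      then show False
      proof cases
        case 1 then show ?thesis using face_eq[OF fF 1(1) face(2) 1(3)] face by blast
      next
        case 2 then show ?thesis using f1[OF fF 2(1)] face by blast
      qed
    next
      case edge
      consider g where "g \<in> Faces" "g \<notin> X" "z \<in> g" | e' g where "e' \<in> E" "g \<in> Faces" "g \<notin> X" "e' \<in> bE g" "z \<in> open_edge e'"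
        using z(2) unfolding side_def by blast
      then show False
      proof cases
        case 1 then show ?thesis using f1[OF 1(1) edge(1)] edge(4) by blast
      next
        case 2
        then have "e' = e" using f2[OF edge(1) 2(1)] edge(4) by blast
        then show ?thesis using cl[OF edge(2) 2(2) edge(3)] 2 by blast
      qed
    qed
  qed
  have cover: "- (\<phi> ` V) \<subseteq> side X \<union> side (Faces - X)"
  proof
    fix z assume z: "z \<in> - (\<phi> ` V)"
    show "z \<in> side X \<union> side (Faces - X)"
    proof (cases "z \<in> \<Gamma>")
      case True
      then obtain e where e: "e \<in> E" "z \<in> open_edge e" using z \<Gamma>_split by blast
      obtain g where g: "g \<in> Faces" "e \<in> bE g"
      proof (rule edge_faces[OF e(1)])
        fix W f1 f2 assume "f1 \<in> Faces" "\<And>f. f \<in> Faces \<Longrightarrow> e \<in> bE f \<longleftrightarrow> f = f1 \<or> f = f2"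
        then show thesis using that[of f1] by simp
      qed
      then show ?thesis using e unfolding side_def by blast
    next
      case False
      then obtain g where "g \<in> Faces" "z \<in> g" using Faces_Un by blast
      then show ?thesis unfolding side_def by blast
    qed
  qed
  have "connected (- (\<phi> ` V))"
    using connected_open_delete_finite[of "UNIV :: complex set" "\<phi> ` V"] finV by (simp add: Compl_eq_Diff_UNIV connected_UNIV)
  moreover have meet: "side Y \<inter> - (\<phi> ` V) \<noteq> {}" if Y: "Y \<subseteq> Faces" "Y \<noteq> {}" for Y
  proof -
    obtain f where f: "f \<in> Y" using Y(2) by blast
    then obtain z where "z \<in> f" using face_facts(1) Y(1) by blast
    moreover have "z \<notin> \<phi> ` V" using calculation face_facts(4)[of f] f Y(1) unfolding \<Gamma>_def by blast
    ultimately show ?thesis using f unfolding side_def by blast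
  qed
  moreover have "Faces - X \<noteq> {}" using X(1) \<open>X \<noteq> Faces\<close> by blast
  ultimately show False
    using connectedD[of "- (\<phi> ` V)" "side X" "side (Faces - X)"] o1 o2 cover disj meet[OF X] meet[of "Faces - X"] by blast
qed

end

context triangulated
begin

text \<open>Two faces with the same three boundary edges would be closed under adjacency and hence
  be all the faces, leaving none for a fourth edge.\<close>

lemma tri_inj: "inj_on tri Faces"
proof (rule inj_onI, rule ccontr)
  fix f g assume fg: "f \<in> Faces" "g \<in> Faces" "tri f = tri g" "f \<noteq> g"
  have "e \<in> bE f \<longleftrightarrow> e \<in> bE g" for e
  proof (cases "e \<in> E")
    case True
    then have "card e = 2" using edge by blast
    then show ?thesis using sub_tri[OF fg(1)] sub_tri[OF fg(2)] fg(3) by simp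
  next
    case False then show ?thesis using bE_subset by blast
  qed
  then have eq: "bE f = bE g" by blast
  have F: "{f, g} = Faces"
  proof (rule faces_connected)
    fix e f' h assume h: "f' \<in> {f, g}" "h \<in> Faces" "e \<in> bE f'" "e \<in> bE h"
    then have e: "e \<in> bE f" "e \<in> bE g" "e \<in> E" using eq bE_subset by auto
    show "h \<in> {f, g}"
    proof (rule edge_faces[OF e(3)])
      fix W f1 f2 assume "\<And>f. f \<in> Faces \<Longrightarrow> e \<in> bE f \<longleftrightarrow> f = f1 \<or> f = f2"
      then show ?thesis using e(1,2) h(2,4) fg by (metis insert_iff)
    qed
  qed (use fg in auto)
  obtain e where e: "e \<in> E" "e \<notin> bE f"
    using another_edge[OF bE_subset finite_bE] three[OF fg(1)] by (metis order_refl)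
  obtain h where h: "h \<in> Faces" "e \<in> bE h"
  proof (rule edge_faces[OF e(1)])
    fix W f1 f2 assume "f1 \<in> Faces" "\<And>f. f \<in> Faces \<Longrightarrow> e \<in> bE f \<longleftrightarrow> f = f1 \<or> f = f2"
    then show thesis using that[of f1] by simp
  qed
  have "h = f \<or> h = g" using h(1) unfolding F[symmetric] by simp
  then show False using h(2) e(2) eq by metis
qed

lemma tri_subset: "f \<in> Faces \<Longrightarrow> tri f \<subseteq> V"
proof
  fix w assume "w \<in> tri f"
  then obtain e where e: "e \<in> bE f" "w \<in> e" unfolding tri_def by blast
  have "e \<in> E" using e(1) bE_subset by (rule rev_subsetD)
  then have "e \<subseteq> V" by (rule edge[THEN conjunct1])
  then show "w \<in> V" using e(2) by (rule subsetD)
qed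

lemma finite_tri: "finite (tri ` Faces)"
  using tri_subset finV by (intro finite_subset[of "tri ` Faces" "Pow V"]) auto

lemma edges_tri: "edges (tri ` Faces) = E"
proof (intro equalityI subsetI)
  fix e assume "e \<in> edges (tri ` Faces)"
  then obtain f where f: "f \<in> Faces" "card e = 2" "e \<subseteq> tri f" unfolding edges_def by blast
  then show "e \<in> E" using sub_tri[OF f(1,2)] bE_subset by blast
next
  fix e assume e: "e \<in> E"
  obtain h where h: "h \<in> Faces" "e \<in> bE h"
  proof (rule edge_faces[OF e])
    fix W f1 f2 assume "f1 \<in> Faces" "\<And>f. f \<in> Faces \<Longrightarrow> e \<in> bE f \<longleftrightarrow> f = f1 \<or> f = f2"
    then show thesis using that[of f1] by simp
  qed
  have "card e = 2" using edge[OF e] by blast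
  then show "e \<in> edges (tri ` Faces)" using sub_tri[OF h(1)] h unfolding edges_def by blast
qed

lemma Union_tri: "\<Union>(tri ` Faces) = V"
proof (intro equalityI subsetI)
  fix w assume "w \<in> V"
  then obtain t where "{w, t} \<in> E" by (rule_tac neighbour_outside[of w "{}"]) auto
  then have "{w, t} \<in> edges (tri ` Faces)" using edges_tri by simp
  then show "w \<in> \<Union>(tri ` Faces)" unfolding edges_def by blast
qed (use tri_subset in blast)

lemma bd_tri:
  assumes Y: "Y \<subseteq> Faces" and e: "e \<in> E" "f1 \<in> Faces" "f2 \<in> Faces" "f1 \<noteq> f2"
    and iff: "\<And>f. f \<in> Faces \<Longrightarrow> e \<in> bE f \<longleftrightarrow> f = f1 \<or> f = f2"
  shows "e \<in> bd (tri ` Y) \<longleftrightarrow> (f1 \<in> Y) \<noteq> (f2 \<in> Y)"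
proof -
  have c2: "card e = 2" using edge[OF e(1)] by blast
  have "{t \<in> tri ` Y. e \<subseteq> t} = tri ` (Y \<inter> {f1, f2})"
  proof (intro equalityI subsetI)
    fix t assume "t \<in> {t \<in> tri ` Y. e \<subseteq> t}"
    then obtain f where f: "f \<in> Y" "t = tri f" "e \<subseteq> tri f" by blast
    then have "f = f1 \<or> f = f2" using sub_tri[OF _ c2, of f] iff[of f] Y by blast
    then show "t \<in> tri ` (Y \<inter> {f1, f2})" using f by blast
  next
    fix t assume "t \<in> tri ` (Y \<inter> {f1, f2})"
    then obtain f where f: "f \<in> Y" "t = tri f" "f = f1 \<or> f = f2" by blast
    then have "e \<subseteq> tri f" using sub_tri[OF _ c2, of f] iff[of f] Y by blast
    then show "t \<in> {t \<in> tri ` Y. e \<subseteq> t}" using f by blast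
  qed
  moreover have "inj_on tri (Y \<inter> {f1, f2})" using tri_inj Y by (rule_tac inj_on_subset) auto
  ultimately have "card {t \<in> tri ` Y. e \<subseteq> t} = card (Y \<inter> {f1, f2})" by (simp add: card_image)
  moreover have "odd (card (Y \<inter> {f1, f2})) \<longleftrightarrow> (f1 \<in> Y) \<noteq> (f2 \<in> Y)"
    using e(4) by (cases "f1 \<in> Y"; cases "f2 \<in> Y") auto
  ultimately show ?thesis unfolding bd_def using c2 by simp
qed

lemma two_triangles:
  assumes e: "e \<in> E" shows "card {t \<in> tri ` Faces. e \<subseteq> t} = 2"
proof (rule edge_faces[OF e])
  fix W f1 f2 assume f: "f1 \<in> Faces" "f2 \<in> Faces" "f1 \<noteq> f2" "\<And>f. f \<in> Faces \<Longrightarrow> e \<in> bE f \<longleftrightarrow> f = f1 \<or> f = f2"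
  have c2: "card e = 2" using edge[OF e] by blast
  have "{t \<in> tri ` Faces. e \<subseteq> t} = {tri f1, tri f2}"
  proof (intro equalityI subsetI)
    fix t assume "t \<in> {t \<in> tri ` Faces. e \<subseteq> t}"
    then obtain f where "f \<in> Faces" "t = tri f" "e \<subseteq> tri f" by blast
    then show "t \<in> {tri f1, tri f2}" using sub_tri[OF _ c2, of f] f(4)[of f] by blast
  next
    fix t assume "t \<in> {tri f1, tri f2}"
    then show "t \<in> {t \<in> tri ` Faces. e \<subseteq> t}" using f sub_tri[OF f(1) c2] sub_tri[OF f(2) c2] by blast
  qed
  moreover have "tri f1 \<noteq> tri f2" using tri_inj f(1-3) by (meson inj_onD)
  ultimately show ?thesis by simp
qed

lemma bd_subset_E: "X \<subseteq> tri ` Faces \<Longrightarrow> bd X \<subseteq> E"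
proof
  fix e assume X: "X \<subseteq> tri ` Faces" and e: "e \<in> bd X"
  then have "odd (card {f \<in> X. e \<subseteq> f})" "card e = 2" unfolding bd_def by blast+
  moreover from this(1) have "{f \<in> X. e \<subseteq> f} \<noteq> {}" by (metis card.empty even_zero)
  ultimately show "e \<in> E" using X edges_tri unfolding edges_def by blast
qed

lemma bd_empty_cases:
  assumes X: "X \<subseteq> tri ` Faces" and b: "bd X = {}" shows "X = {} \<or> X = tri ` Faces"
proof -
  obtain Y where Y: "Y \<subseteq> Faces" "X = tri ` Y" using X by (meson subset_imageE)
  have "Y = Faces" if "Y \<noteq> {}"
  proof (rule faces_connected[OF Y(1) that])
    fix e f g assume fg: "f \<in> Y" "g \<in> Faces" "e \<in> bE f" "e \<in> bE g"
    have e: "e \<in> E" using fg(3) bE_subset by blast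
    show "g \<in> Y"
    proof (rule edge_faces[OF e])
      fix W f1 f2 assume h: "f1 \<in> Faces" "f2 \<in> Faces" "f1 \<noteq> f2" "\<And>f. f \<in> Faces \<Longrightarrow> e \<in> bE f \<longleftrightarrow> f = f1 \<or> f = f2"
      have "(f1 \<in> Y) = (f2 \<in> Y)" using bd_tri[OF Y(1) e h] b Y(2) by simp
      moreover have "f = f1 \<or> f = f2" "g = f1 \<or> g = f2" using h(4) fg Y(1) by blast+
      ultimately show ?thesis using fg(1) by blast
    qed
  qed
  then show ?thesis using Y(2) by blast
qed

text \<open>The filling consists of the faces inside the Jordan curve. Opened at any of its edges,
  the cycle has one face inside and one outside there. At an edge off the cycle, the connected set
  \<open>W\<close> made of the open edge and its two faces misses the curve and stays on one
  side.\<close>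

lemma cycle_boundary:
  assumes l: "3 \<le> length l" "distinct l" "cycle_edges l \<subseteq> E"
  shows "\<exists>X\<subseteq>tri ` Faces. bd X = cycle_edges l"
proof -
  define J where "J = (\<Union>e\<in>cycle_edges l. P e)"
  define Y where "Y = {f \<in> Faces. f \<subseteq> inside J}"
  have YF: "Y \<subseteq> Faces" by (auto simp: Y_def)
  have iff: "e \<in> bd (tri ` Y) \<longleftrightarrow> e \<in> cycle_edges l" if e: "e \<in> E" for e
  proof (cases "e \<in> cycle_edges l")
    case True
    obtain l' where l': "distinct l'" "3 \<le> length l'" "cycle_edges l' = cycle_edges l" "e = {last l', hd l'}"
      by (rule cycle_rotate[OF l(2,1) True])
    have l'E: "cycle_edges l' \<subseteq> E" using l' l(3) by simp
    have J': "J = (\<Union>e\<in>cycle_edges l'. P e)" using l'(3) J_def by simp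
    show ?thesis
    proof (rule edge_sides[OF l'(2,1) l'E l'(4) J'])
      fix W f1 f2
      assume f: "f1 \<in> Faces" "f2 \<in> Faces" "f1 \<noteq> f2" "\<And>f. f \<in> Faces \<Longrightarrow> e \<in> bE f \<longleftrightarrow> f = f1 \<or> f = f2"
        and io: "f1 \<subseteq> inside J" "f2 \<subseteq> outside J"
      have "inside J \<inter> outside J = {}" by (rule inside_Int_outside)
      then have "\<not> f2 \<subseteq> inside J" using io(2) face_facts(1)[OF f(2)] by blast
      then show ?thesis using bd_tri[OF YF e f] True f(1) io(1) unfolding Y_def by simp
    qed
  next
    case False
    show ?thesis
    proof (rule edge_faces[OF e])
      fix W f1 f2
      assume W: "connected W" "W = f1 \<union> f2 \<union> open_edge e"
        and f: "f1 \<in> Faces" "f2 \<in> Faces" "f1 \<noteq> f2" "\<And>f. f \<in> Faces \<Longrightarrow> e \<in> bE f \<longleftrightarrow> f = f1 \<or> f = f2"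
      have "J \<subseteq> \<Gamma>" using l(3) unfolding J_def \<Gamma>_def by blast
      then have "f1 \<inter> J = {}" "f2 \<inter> J = {}" using face_facts(4)[OF f(1)] face_facts(4)[OF f(2)] by blast+
      moreover have "open_edge e \<inter> J = {}"
      proof (rule ccontr)
        assume "open_edge e \<inter> J \<noteq> {}"
        then obtain e' where e': "e' \<in> cycle_edges l" "open_edge e \<inter> P e' \<noteq> {}" unfolding J_def by blast
        then have "e' \<in> E" "e \<noteq> e'" using l(3) False by auto
        then show False using open_edge_disjoint[OF e] e'(2) by blast
      qed
      ultimately have WJ: "W \<inter> J = {}" using W(2) by blast
      have "W \<subseteq> inside J \<or> W \<inter> inside J = {}"
      proof (rule ccontr)
        assume n: "\<not> (W \<subseteq> inside J \<or> W \<inter> inside J = {})"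
        then obtain z where "z \<in> W" "z \<notin> inside J" by blast
        then have "z \<in> outside J" using WJ inside_Un_outside[of J] by blast
        then have "outside J \<inter> W \<noteq> {}" "inside J \<inter> W \<noteq> {}" using \<open>z \<in> W\<close> n by blast+
        then have "J \<inter> W \<noteq> {}" using inside_outside_intersect_connected[OF W(1)] by blast
        then show False using WJ by blast
      qed
      then have "f1 \<subseteq> inside J \<longleftrightarrow> f2 \<subseteq> inside J"
        using W(2) face_facts(1)[OF f(1)] face_facts(1)[OF f(2)] by blast
      then show ?thesis using bd_tri[OF YF e f] False f(1,2) unfolding Y_def by simp
    qed
  qed
  have YT: "tri ` Y \<subseteq> tri ` Faces" using YF by (rule image_mono)
  have "bd (tri ` Y) = cycle_edges l"
  proof (intro equalityI subsetI)
    fix e assume e: "e \<in> bd (tri ` Y)"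
    then have "e \<in> E" using bd_subset_E[OF YT] by (rule_tac subsetD)
    then show "e \<in> cycle_edges l" using iff e by simp
  next
    fix e assume e: "e \<in> cycle_edges l"
    then have "e \<in> E" using l(3) by (rule_tac subsetD)
    then show "e \<in> bd (tri ` Y)" using iff e by simp
  qed
  then show ?thesis using YT by (intro exI[of _ "tri ` Y"] conjI)
qed

lemma even_set_bd_ex:
  assumes "Z \<subseteq> E" "even_set Z" shows "\<exists>X\<subseteq>tri ` Faces. bd X = Z"
  using assms
proof (induction "card Z" arbitrary: Z rule: less_induct)
  case less
  have finZ: "finite Z" using less.prems(1) finE finite_subset by blast
  show ?case
  proof (cases "Z = {}")
    case True then show ?thesis by (intro exI[of _ "{}"]) simp
  next
    case False
    have "card e = 2" if "e \<in> Z" for e using edge that less.prems(1) by blast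
    then obtain l where l: "3 \<le> length l" "distinct l" "path_edges l \<subseteq> Z" "{last l, hd l} \<in> Z"
      using even_set_cycle[OF finZ False less.prems(2)] by metis
    have C: "cycle_edges l \<subseteq> Z" "cycle_edges l \<noteq> {}" using l(3,4) by (auto simp: cycle_edges_def)
    have finC: "finite (cycle_edges l)" using C(1) finZ finite_subset by blast
    obtain X where X: "X \<subseteq> tri ` Faces" "bd X = cycle_edges l" using cycle_boundary[OF l(1,2)] C(1) less.prems(1) by blast
    have "finite X" using X(1) finite_tri finite_subset by blast
    have c3: "card t = 3" if t: "t \<in> X" for t
    proof -
      obtain f where f: "f \<in> Faces" "t = tri f" using t X(1) by blast
      show ?thesis using f(2) by (rule_tac face_triangle[OF f(1)]) simp
    qed
    \<comment> \<open>The even degrees of the cycle are read off from the fact that it is a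
      boundary, without counting along the list.\<close>
    then have "even_set (cycle_edges l)" using even_set_bd[OF \<open>finite X\<close>] X(2) by simp
    then have "even_set (sym_diff Z (cycle_edges l))" using even_set_sym_diff[OF finZ finC less.prems(2)] by blast
    moreover have eq: "sym_diff Z (cycle_edges l) = Z - cycle_edges l" using C(1) by blast
    ultimately have ev: "even_set (Z - cycle_edges l)" by simp
    have less': "card (Z - cycle_edges l) < card Z" using C finZ by (intro psubset_card_mono) auto
    have ZE: "Z - cycle_edges l \<subseteq> E" using less.prems(1) by blast
    obtain X' where X': "X' \<subseteq> tri ` Faces" "bd X' = Z - cycle_edges l"
      using less.hyps[OF less' ZE ev] by (elim exE conjE)
    have "finite X'" using X'(1) finite_tri finite_subset by blast
    have "e \<in> bd (sym_diff X X') \<longleftrightarrow> e \<in> Z" for e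
      using bd_sym_diff[OF \<open>finite X\<close> \<open>finite X'\<close>, of e] C(1) unfolding X(2) X'(2) by fast
    then have b: "bd (sym_diff X X') = Z" by (intro set_eqI)
    have "sym_diff X X' \<subseteq> tri ` Faces" using X(1) X'(1) by (intro Un_least) fast+
    then show ?thesis using b by (intro exI[of _ "sym_diff X X'"] conjI)
  qed
qed

lemma spherical_tri: "spherical (tri ` Faces)"
proof -
  have "\<Union>(tri ` Faces) \<noteq> {}" using Union_tri conn unfolding k_connected_def by force
  then have "tri ` Faces \<noteq> {}" by blast
  moreover have "card t = 3" if t: "t \<in> tri ` Faces" for t
  proof -
    obtain f where f: "f \<in> Faces" "t = tri f" using t by blast
    show ?thesis using f(2) by (rule_tac face_triangle[OF f(1)]) simp
  qed
  ultimately show ?thesis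
    unfolding spherical_def edges_tri using finite_tri two_triangles bd_empty_cases even_set_bd_ex by simp
qed

lemma no_small_nsep:
  assumes n: "nsep (tri ` Faces) A B" shows "4 \<le> card (A \<inter> B)"
proof (rule ccontr)
  assume c: "\<not> 4 \<le> card (A \<inter> B)"
  have un: "A \<union> B = V" and na: "\<And>a b. a \<in> A - B \<Longrightarrow> b \<in> B - A \<Longrightarrow> \<not> adj (tri ` Faces) a b"
    using n Union_tri unfolding nsep_def by auto
  obtain a b where ab: "a \<in> A - B" "b \<in> B - A" using n unfolding nsep_def by blast
  have "graph_connected (V - A \<inter> B) {e \<in> E. e \<inter> (A \<inter> B) = {}}"
    by (rule conn[unfolded k_connected_def, THEN conjunct2, rule_format]) (use un c in auto)
  then have "(a, b) \<in> {(s, t). {s, t} \<in> {e \<in> E. e \<inter> (A \<inter> B) = {}}}\<^sup>*"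
    using ab un unfolding graph_connected_def by blast
  then have "b \<in> A - B"
  proof (induction rule: rtrancl_induct)
    case base show ?case by (rule ab(1))
  next
    case (step s t)
    then have st: "{s, t} \<in> E" "t \<notin> A \<inter> B" by auto
    then have "t \<in> V" "adj (tri ` Faces) s t" using edge[OF st(1)] adj_edges[of "tri ` Faces" s t] edges_tri by auto
    then show ?case using na[OF step.IH, of t] st(2) un by blast
  qed
  then show False using ab(2) by blast
qed

text \<open>A nonfacial triangle at \<open>uv\<close> would give a separation of order 3. As
  4-connectivity allows none, the condition on common neighbours holds, and the one on separations
  holds vacuously.\<close>

lemma good_tri:
  assumes "x \<in> V" "y \<in> V" "x \<noteq> y" "{x, y} \<notin> E" "{u, v} \<in> E"
  shows "good (tri ` Faces) u v x y"
proof -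
  have adjE: "adj (tri ` Faces) a b \<longleftrightarrow> {a, b} \<in> E" for a b
    using adj_edges[of "tri ` Faces" a b] edges_tri by simp
  have uv: "adj (tri ` Faces) u v" using adjE assms(5) by simp
  have "{u, v, t} \<in> tri ` Faces" if t: "adj (tri ` Faces) u t" "adj (tri ` Faces) v t" for t
  proof (rule ccontr)
    assume n: "{u, v, t} \<notin> tri ` Faces"
    obtain A B where AB: "nsep (tri ` Faces) A B" "A \<inter> B = {u, v, t}"
      by (rule nonfacial_triangle_nsep[OF spherical_tri uv t(2,1) n])
    have "4 \<le> card {u, v, t}" using no_small_nsep[OF AB(1)] AB(2) by simp
    moreover have "card {u, v, t} \<le> 3" using card_length[of "[u, v, t]"] by simp
    ultimately show False by simp
  qed
  moreover have "\<not> (nsep (tri ` Faces) A B \<and> card (A \<inter> B) \<le> 3 \<and> P)" for A B P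
    using no_small_nsep[of A B] by force
  ultimately show ?thesis
    unfolding good_def Union_tri adjE using spherical_tri assms uv adjE by blast
qed

end

theorem theorem4p1:
  fixes V :: "'a set" and E :: "'a set set"
    and \<phi> :: "'a \<Rightarrow> complex" and \<gamma> :: "'a set \<Rightarrow> real \<Rightarrow> complex"
    and x y u v :: 'a
  assumes "plane_triangulation V E \<phi> \<gamma>"
    and "k_connected 4 V E"
    and "x \<in> V" and "y \<in> V" and "x \<noteq> y" and "{x, y} \<notin> E"
    and "{u, v} \<in> E"
  shows "\<exists>p :: 'a \<Rightarrow> real^3. infinitesimally_rigid V (insert {x, y} E) p \<and> p u = p v"
proof -
  interpret embedding V E \<phi> \<gamma>
    using assms(1) by unfold_locales (simp_all add: plane_triangulation_def)
  have three: "card (bE f) = 3" if "f \<in> Faces" for f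
    using assms(1) that unfolding plane_triangulation_def Faces_eq bE_def P_def by blast
  interpret triangulated V E \<phi> \<gamma>
    using assms(2) three by unfold_locales
  have "braced_rigid (tri ` Faces) u v x y"
    by (rule good_braced_rigid[OF good_tri[OF assms(3-7)]])
  then obtain p where p: "p u = p v" "trig V (insert {x, y} E) p"
    unfolding braced_rigid_def gen_rigid_def edges_tri Union_tri by blast
  from p(2) obtain a b c where abc: "a \<in> V" "b \<in> V" "c \<in> V" "pinned a b c V (insert {x, y} E) p"
    unfolding trig_def by blast
  have nc: "ncol p a b c" using abc(4) by (simp add: pinned_def)
  have rig: "rigid V (insert {x, y} E) p" using p(2) by (rule trig_imp_rigid)
  have ed: "\<exists>a\<in>V. \<exists>b\<in>V. e = {a, b}" if "e \<in> insert {x, y} E" for e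
  proof (cases "e = {x, y}")
    case True then show ?thesis using assms(3,4) by blast
  next
    case False
    then have "e \<subseteq> V" "card e = 2" using that edge by auto
    then show ?thesis by (auto simp: card_2_iff)
  qed
  have "infinitesimally_rigid V (insert {x, y} E) p"
    by (rule rigid_imp_infinitesimally_rigid[OF finV ed rig abc(1-3) nc])
  then show ?thesis using p(1) by blast
qed

end
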